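(* Let $G$ be a locally compact group, let $\mu\in M(G)$ and let $1\le p<\infty$. Consider the following conditions on the convolution operator $\lambda_p(\mu)$: (a) $\lambda_p(\mu)$ is mean ergodic; (b) $\lambda_p(\mu)$ is power bounded; (c) $\|\mu\|\le 1$. Then: (1) If $G$ is Abelian and $p=2$, then (a) and (b) are equivalent. (2) If $G$ is amenable and $\mu$ is positive, then (a), (b) and (c) are equivalent, for any $1<p<\infty$. (3) If $G$ is compact, $\mu$ is positive and $p=1$, then (a), (b) and (c) are equivalent.
   Context: For a locally compact group $G$, $m_G$ is a left Haar measure, $L^p(G)=L^p(G,m_G)$, and $M(G)=C_0(G)^*$ is the Banach space of bounded regular (complex) measures on $G$ with total variation norm $\|\cdot\|$. For $\mu\in M(G)$ and $1\le p\le\infty$, the convolution operator $\lambda_p(\mu)\colon L^p(G)\to L^p(G)$ is $(\lambda_p(\mu)f)(s)=(\mu*f)(s)=\int f(x^{-1}s)\,d\mu(x)$. For a bounded linear operator $T$ on a Banach space $X$, its Cesàro means are $T_{[n]}=\frac1n\sum_{k=1}^n T^k$. $T$ is mean ergodic if $(T_{[n]})_n$ converges in the strong operator topology to some bounded operator $P$ on $X$; $T$ is power bounded if $\sup_n\|T^n\|<\infty$. *)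

theory Defs
  imports "HOL-Analysis.Analysis"
begin

text \<open>
  A locally compact group is a type of class \<open>{topological_group_add, t2_space}\<close> whose topology is
  locally compact. The class \<open>group_add\<close> does not assume commutativity; in this additive notation
  \<open>x\<^sup>-\<^sup>1 s\<close> is written \<open>- x + s\<close>.
\<close>

definition outer_regular_at :: "('a::topological_space set \<Rightarrow> ennreal) \<Rightarrow> 'a set \<Rightarrow> bool" where
  "outer_regular_at \<nu> A \<longleftrightarrow> \<nu> A = (INF U\<in>{U. open U \<and> A \<subseteq> U}. \<nu> U)"

definition inner_regular_at :: "('a::topological_space set \<Rightarrow> ennreal) \<Rightarrow> 'a set \<Rightarrow> bool" where
  "inner_regular_at \<nu> A \<longleftrightarrow> \<nu> A = (SUP K\<in>{K. compact K \<and> K \<subseteq> A}. \<nu> K)"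


subsection \<open>Haar measure\<close>

text \<open>
  The group need not be \<open>\<sigma>\<close>-compact, so inner regularity is only required on open sets.
\<close>

definition radon_measure :: "'a::topological_space measure \<Rightarrow> bool" where
  "radon_measure m \<longleftrightarrow>
     sets m = sets borel \<and>
     (\<forall>K. compact K \<longrightarrow> emeasure m K < \<infinity>) \<and>
     (\<forall>A\<in>sets borel. outer_regular_at (emeasure m) A) \<and>
     (\<forall>U. open U \<longrightarrow> inner_regular_at (emeasure m) U)"

definition left_haar_measure :: "'a::topological_group_add measure \<Rightarrow> bool" where
  "left_haar_measure m \<longleftrightarrow>
     radon_measure m \<and> emeasure m UNIV \<noteq> 0 \<and>
     (\<forall>x. \<forall>A\<in>sets borel. emeasure m ((\<lambda>y. x + y) ` A) = emeasure m A)"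


subsection \<open>Bounded regular complex measures\<close>

text \<open>
  A complex measure is a set function of which only the values on Borel sets matter.
\<close>

definition total_variation :: "('a::topological_space set \<Rightarrow> complex) \<Rightarrow> 'a set \<Rightarrow> ennreal" where
  "total_variation \<mu> A =
     (SUP P\<in>{P. finite P \<and> P \<subseteq> sets borel \<and> partition_on A P}. \<Sum>E\<in>P. ennreal (norm (\<mu> E)))"

definition regular_complex_measure :: "('a::topological_space set \<Rightarrow> complex) \<Rightarrow> bool" where
  "regular_complex_measure \<mu> \<longleftrightarrow>
     (\<forall>A :: nat \<Rightarrow> 'a set. range A \<subseteq> sets borel \<longrightarrow> disjoint_family A \<longrightarrow>
        (\<lambda>i. \<mu> (A i)) sums \<mu> (\<Union>i. A i)) \<and>
     (\<forall>A\<in>sets borel. outer_regular_at (total_variation \<mu>) A \<and>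
                     inner_regular_at (total_variation \<mu>) A)"

abbreviation measure_norm :: "('a::topological_space set \<Rightarrow> complex) \<Rightarrow> ennreal" where
  "measure_norm \<mu> \<equiv> total_variation \<mu> UNIV"

definition positive_complex_measure :: "('a::topological_space set \<Rightarrow> complex) \<Rightarrow> bool" where
  "positive_complex_measure \<mu> \<longleftrightarrow> (\<forall>A\<in>sets borel. \<mu> A \<in> \<real>\<^sub>\<ge>\<^sub>0)"

text \<open>
  The positive part \<open>\<sigma>\<^sup>+\<close> of a signed measure \<open>\<sigma>\<close>; the negative part is \<open>(- \<sigma>)\<^sup>+\<close>. Truncation of
  negative values by \<open>ennreal\<close> is harmless since \<open>B = {}\<close> contributes \<open>0\<close> to the supremum.
\<close>

definition positive_part :: "('a::topological_space set \<Rightarrow> real) \<Rightarrow> 'a measure" where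
  "positive_part \<sigma> =
     measure_of UNIV (sets borel) (\<lambda>A. SUP B\<in>{B \<in> sets borel. B \<subseteq> A}. ennreal (\<sigma> B))"

definition complex_measure_integral ::
  "('a::topological_space set \<Rightarrow> complex) \<Rightarrow> ('a \<Rightarrow> complex) \<Rightarrow> complex" where
  "complex_measure_integral \<mu> f =
     (LINT x|positive_part (\<lambda>A. Re (\<mu> A)). f x) - (LINT x|positive_part (\<lambda>A. - Re (\<mu> A)). f x)
     + \<i> * ((LINT x|positive_part (\<lambda>A. Im (\<mu> A)). f x) - (LINT x|positive_part (\<lambda>A. - Im (\<mu> A)). f x))"


subsection \<open>Operators on \<open>L\<^sup>p\<close>\<close>

text \<open>
  Elements of \<open>L\<^sup>p\<close> are given by representatives, and equality in \<open>L\<^sup>p\<close> is equality almost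
  everywhere; \<open>Lp_norm\<close> is thus a seminorm on representatives.
\<close>

definition Lp :: "'a measure \<Rightarrow> real \<Rightarrow> ('a \<Rightarrow> complex) set" where
  "Lp m p = {f \<in> borel_measurable m. integrable m (\<lambda>x. norm (f x) powr p)}"

definition Lp_norm :: "'a measure \<Rightarrow> real \<Rightarrow> ('a \<Rightarrow> complex) \<Rightarrow> real" where
  "Lp_norm m p f = (LINT x|m. norm (f x) powr p) powr (1 / p)"

definition Lp_op_norm ::
  "'a measure \<Rightarrow> real \<Rightarrow> (('a \<Rightarrow> complex) \<Rightarrow> ('a \<Rightarrow> complex)) \<Rightarrow> ennreal" where
  "Lp_op_norm m p T = (SUP f\<in>{f \<in> Lp m p. Lp_norm m p f \<le> 1}. ennreal (Lp_norm m p (T f)))"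

definition bounded_Lp_operator ::
  "'a measure \<Rightarrow> real \<Rightarrow> (('a \<Rightarrow> complex) \<Rightarrow> ('a \<Rightarrow> complex)) \<Rightarrow> bool" where
  "bounded_Lp_operator m p T \<longleftrightarrow>
     (\<forall>f\<in>Lp m p. T f \<in> Lp m p) \<and>
     (\<forall>f\<in>Lp m p. \<forall>g\<in>Lp m p. (AE x in m. f x = g x) \<longrightarrow> (AE x in m. T f x = T g x)) \<and>
     (\<forall>f\<in>Lp m p. \<forall>g\<in>Lp m p. AE x in m. T (\<lambda>y. f y + g y) x = T f x + T g x) \<and>
     (\<forall>c. \<forall>f\<in>Lp m p. AE x in m. T (\<lambda>y. c * f y) x = c * T f x) \<and>
     Lp_op_norm m p T < \<infinity>"

definition cesaro_mean ::
  "(('a \<Rightarrow> complex) \<Rightarrow> ('a \<Rightarrow> complex)) \<Rightarrow> nat \<Rightarrow> ('a \<Rightarrow> complex) \<Rightarrow> ('a \<Rightarrow> complex)" where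
  "cesaro_mean T n f = (\<lambda>x. (1 / of_nat n) * (\<Sum>k=1..n. (T ^^ k) f x))"

definition mean_ergodic ::
  "'a measure \<Rightarrow> real \<Rightarrow> (('a \<Rightarrow> complex) \<Rightarrow> ('a \<Rightarrow> complex)) \<Rightarrow> bool" where
  "mean_ergodic m p T \<longleftrightarrow>
     (\<exists>P. bounded_Lp_operator m p P \<and>
          (\<forall>f\<in>Lp m p. (\<lambda>n. Lp_norm m p (\<lambda>x. cesaro_mean T n f x - P f x)) \<longlonglongrightarrow> 0))"

definition power_bounded ::
  "'a measure \<Rightarrow> real \<Rightarrow> (('a \<Rightarrow> complex) \<Rightarrow> ('a \<Rightarrow> complex)) \<Rightarrow> bool" where
  "power_bounded m p T \<longleftrightarrow> (SUP n. Lp_op_norm m p (T ^^ n)) < \<infinity>"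

text \<open>
  The formula for \<open>\<mu> * f\<close> does not involve \<open>p\<close>; the operator on \<open>L\<^sup>p\<close> is this map acting on \<open>Lp m p\<close>.
  For \<open>f\<close> in \<open>L\<^sup>p\<close> the integral exists for almost every \<open>s\<close>.
\<close>

definition convolution_operator ::
  "('a::topological_group_add set \<Rightarrow> complex) \<Rightarrow> ('a \<Rightarrow> complex) \<Rightarrow> ('a \<Rightarrow> complex)" where
  "convolution_operator \<mu> f = (\<lambda>s. complex_measure_integral \<mu> (\<lambda>x. f (- x + s)))"


subsection \<open>Amenability\<close>

text \<open>
  For groups that are not \<open>\<sigma>\<close>-compact, \<open>L\<^sup>\<infinity>\<close> (the dual of \<open>L\<^sup>1\<close>) is taken modulo locally null sets.
  Each class has a Borel representative.
\<close>

definition locally_AE :: "'a::topological_space measure \<Rightarrow> ('a \<Rightarrow> bool) \<Rightarrow> bool" where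
  "locally_AE m Q \<longleftrightarrow> (\<forall>K. compact K \<longrightarrow> (AE x in m. x \<in> K \<longrightarrow> Q x))"

definition Linfty :: "'a::topological_space measure \<Rightarrow> ('a \<Rightarrow> complex) set" where
  "Linfty m = {f \<in> borel_measurable m. \<exists>C. locally_AE m (\<lambda>x. norm (f x) \<le> C)}"

text \<open>
  A mean is a linear functional \<open>M\<close> on \<open>L\<^sup>\<infinity>\<close> with \<open>\<parallel>M\<parallel> = M 1 = 1\<close>. The norm bound, applied to
  differences with \<open>C = 0\<close>, makes \<open>M\<close> well defined on classes.
\<close>

definition is_mean :: "'a::topological_space measure \<Rightarrow> (('a \<Rightarrow> complex) \<Rightarrow> complex) \<Rightarrow> bool" where
  "is_mean m M \<longleftrightarrow>
     (\<forall>f\<in>Linfty m. \<forall>g\<in>Linfty m. M (\<lambda>x. f x + g x) = M f + M g) \<and>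
     (\<forall>c. \<forall>f\<in>Linfty m. M (\<lambda>x. c * f x) = c * M f) \<and>
     (\<forall>f\<in>Linfty m. \<forall>C. locally_AE m (\<lambda>x. norm (f x) \<le> C) \<longrightarrow> norm (M f) \<le> C) \<and>
     M (\<lambda>x. 1) = 1"

text \<open>
  Amenability does not depend on the choice of the left Haar measure \<open>m\<close>.
\<close>

definition amenable :: "'a::topological_group_add measure \<Rightarrow> bool" where
  "amenable m \<longleftrightarrow>
     (\<exists>M. is_mean m M \<and> (\<forall>x. \<forall>f\<in>Linfty m. M (\<lambda>s. f (- x + s)) = M f))"

end

theory Submission
  imports Defs
begin

text \<open>
  Each of (a) and (b) implies \<open>\<parallel>T\<^sup>n f\<parallel> = o(n)\<close> for every \<open>f\<close>, and contractions are power bounded and mean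
  ergodic (for \<open>p > 1\<close> by uniform convexity, for \<open>p = 1\<close> by density of \<open>L\<^sup>2\<close>). So in each case it suffices
  to show that sublinear growth of the orbits forces \<open>T\<close> to be a contraction.

  If \<open>G\<close> is Abelian, \<open>T\<close> is a limit of linear combinations of translations, so it is normal and
  \<open>\<parallel>T f\<parallel>\<^sup>2 \<le> \<parallel>T\<^sup>2 f\<parallel> \<parallel>f\<parallel>\<close>; hence an orbit that grows at all grows exponentially. If \<open>G\<close> is compact, apply \<open>T\<close> to
  the constant function \<open>1\<close>.

  If \<open>G\<close> is amenable and \<open>\<mu>(G) > 1\<close>, let \<open>\<tau>\<close> be the normalized restriction of \<open>\<mu>\<close> to a compact set of mass
  \<open>c > 1\<close>. It is enough to find almost \<open>\<tau>\<close>-invariant positive functions, and by uniform convexity these exist if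
  \<open>B = K S K'\<close>, the symmetrization \<open>S\<close> of \<open>\<tau>\<close> smoothed by a kernel \<open>K\<close> of compact support, has
  no spectral gap. A gap would give a positive \<open>f\<close> with \<open>B f \<le> \<rho> f\<close>, \<open>\<rho> < 1\<close>; smoothing yields a Harnack
  inequality for \<open>f\<close>. On the open subgroup generated by the support, \<open>\<xi> y\<close>, the mean of
  \<open>s \<mapsto> ln (f (y + s) / f s)\<close>, is then a homomorphism to the reals. By symmetry the mean of \<open>\<xi>\<close> with respect to \<open>B\<close> vanishes,
  so Jensen's inequality gives \<open>\<rho> \<ge> 1\<close>, a contradiction.
\<close>

text \<open>Growth is known only orbit by orbit, so a failure of
  \<open>emeasure \<nu> UNIV \<le> 1\<close> must be turned into one function with a fast orbit.
  Functions that are almost invariant for n steps depend on n; being nonnegative, they can be added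
  with weights r^n without cancellation, and c > 1 leaves room for r < 1 < r c.

  The mean supplied by amenability is only finitely additive and acts on bounded functions.
  Logarithms are therefore taken on an open subgroup, where f is strictly positive and ratios of its
  translates are bounded; smoothing makes these ratios continuous. The integrals in B are never
  interchanged with the mean: they are bounded below by finite sums of translates, with errors that
  vanish in the limit.

  One third of S is the identity. It bounds K K' by 3 B, which turns superharmonicity into a Harnack
  inequality, and together with \<tau> it forms the midpoint to which uniform convexity applies.

  The group may be neither second countable nor \<sigma>-compact, so countable partitions and
  Fubini-type bounds are derived from regularity of the measures.\<close>

section \<open>Convexity of powers and its pointwise consequences\<close>

text \<open>The derivative of the power is increasing, so the mean value theorem puts the graph
  above each tangent. The strict version is the eventual source of uniform convexity.\<close>

lemma powr_above_tangent:
  fixes a x p :: real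
  assumes "1 \<le> p" "0 < a" "0 \<le> x"
  shows "a powr p + p * a powr (p - 1) * (x - a) \<le> x powr p"
    and "1 < p \<Longrightarrow> x \<noteq> a \<Longrightarrow> a powr p + p * a powr (p - 1) * (x - a) < x powr p"
proof -
  have ap: "a powr p = a * a powr (p - 1)"
    using assms by (simp add: powr_diff)
  have der: "((\<lambda>z. z powr p) has_real_derivative p * z powr (p - 1)) (at z)" if "0 < z" for z
    using that by (auto intro!: derivative_eq_intros simp: powr_diff)
  have "a powr p + p * a powr (p - 1) * (x - a) \<le> x powr p \<and>
     (1 < p \<longrightarrow> x \<noteq> a \<longrightarrow> a powr p + p * a powr (p - 1) * (x - a) < x powr p)"
  \<comment> \<open>The power is differentiated only at positive points; at x = 0 the two claims
    reduce to \<open>1 \<le> p\<close> and \<open>1 < p\<close>.\<close>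
  proof (cases "x = 0")
    case True
    then show ?thesis using assms
      by (simp add: ap algebra_simps)
  next
    case False
    then have x: "0 < x" using assms by simp
    consider "x = a" | "a < x" | "x < a" by linarith
    then show ?thesis
    proof cases
      case 2
      then obtain z where z: "a < z" "z < x" "x powr p - a powr p = (x - a) * (p * z powr (p - 1))"
        using MVT2[of a x "\<lambda>z. z powr p" "\<lambda>z. p * z powr (p - 1)"] der assms by force
      have le: "a powr (p - 1) \<le> z powr (p - 1)"
        using z assms by (intro powr_mono2) auto
      have lt: "a powr (p - 1) < z powr (p - 1)" if "1 < p"
        using z assms that by (intro powr_less_mono2) auto
      have "(x - a) * (p * a powr (p - 1)) \<le> (x - a) * (p * z powr (p - 1))"
        using 2 le assms by (intro mult_left_mono) auto
      moreover have "(x - a) * (p * a powr (p - 1)) < (x - a) * (p * z powr (p - 1))" if "1 < p"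
        using 2 lt that assms by (intro mult_strict_left_mono) auto
      ultimately show ?thesis using z(3) by (auto simp: algebra_simps)
    next
      case 3
      then obtain z where z: "x < z" "z < a" "a powr p - x powr p = (a - x) * (p * z powr (p - 1))"
        using MVT2[of x a "\<lambda>z. z powr p" "\<lambda>z. p * z powr (p - 1)"] der x by force
      have le: "z powr (p - 1) \<le> a powr (p - 1)"
        using z x assms by (intro powr_mono2) auto
      have lt: "z powr (p - 1) < a powr (p - 1)" if "1 < p"
        using z x assms that by (intro powr_less_mono2) auto
      have "(a - x) * (p * z powr (p - 1)) \<le> (a - x) * (p * a powr (p - 1))"
        using 3 le assms by (intro mult_left_mono) auto
      moreover have "(a - x) * (p * z powr (p - 1)) < (a - x) * (p * a powr (p - 1))" if "1 < p"
        using 3 lt that assms by (intro mult_strict_left_mono) auto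
      ultimately show ?thesis using z(3) by (auto simp: algebra_simps)
    qed simp
  qed
  then show "a powr p + p * a powr (p - 1) * (x - a) \<le> x powr p"
    and "1 < p \<Longrightarrow> x \<noteq> a \<Longrightarrow> a powr p + p * a powr (p - 1) * (x - a) < x powr p" by auto
qed

text \<open>The tangent inequalities at the combination itself are averaged, and the linear terms
  cancel. A combination equal to 0 offers no positive point for a tangent and is split off.\<close>

lemma powr_convex_combination:
  fixes a b l p :: real
  assumes "1 \<le> p" "0 \<le> a" "0 \<le> b" "0 \<le> l" "l \<le> 1"
  shows "(l * a + (1 - l) * b) powr p \<le> l * a powr p + (1 - l) * b powr p"
proof (cases "l * a + (1 - l) * b = 0")
  case True
  then show ?thesis using assms by simp
next
  case False
  define c where "c = l * a + (1 - l) * b"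
  have c: "0 < c" using False assms unfolding c_def
    by (smt (verit) mult_nonneg_nonneg)
  have "l * (c powr p + p * c powr (p - 1) * (a - c)) + (1 - l) * (c powr p + p * c powr (p - 1) * (b - c))
      \<le> l * a powr p + (1 - l) * b powr p"
    using assms c by (intro add_mono mult_left_mono powr_above_tangent(1)) auto
  moreover have "l * (c powr p + p * c powr (p - 1) * (a - c)) + (1 - l) * (c powr p + p * c powr (p - 1) * (b - c))
     = c powr p + p * c powr (p - 1) * (l * a + (1 - l) * b - c)"
    by (simp add: algebra_simps)
  ultimately show ?thesis unfolding c_def by simp
qed

lemma powr_midpoint_strict:
  fixes a b p :: real
  assumes "1 < p" "0 \<le> a" "0 \<le> b" "a \<noteq> b"
  shows "((a + b) / 2) powr p < (a powr p + b powr p) / 2"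
proof -
  define c where "c = (a + b) / 2"
  have c: "0 < c" "a \<noteq> c" "b \<noteq> c" using assms unfolding c_def by auto
  have "c powr p + p * c powr (p - 1) * (a - c) < a powr p"
       "c powr p + p * c powr (p - 1) * (b - c) < b powr p"
    using assms c by (auto intro!: powr_above_tangent(2))
  then have "2 * c powr p + p * c powr (p - 1) * (a + b - 2 * c) < a powr p + b powr p"
    by (simp add: algebra_simps)
  moreover have "a + b - 2 * c = 0" by (simp add: c_def)
  ultimately have "2 * c powr p < a powr p + b powr p" by simp
  then show ?thesis unfolding c_def by simp
qed

text \<open>Strictness has two sources: for different moduli it is strict convexity of the power,
  for equal moduli it is the strict triangle inequality in the complex plane.\<close>

lemma norm_midpoint_powr_strict:
  fixes a b :: complex
  assumes "1 < p" "a \<noteq> b"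
  shows "norm ((a + b) / 2) powr p < (norm a powr p + norm b powr p) / 2"
proof (cases "norm a = norm b")
  case False
  have "norm ((a + b) / 2) \<le> (norm a + norm b) / 2"
    using norm_triangle_ineq[of a b] by (simp add: norm_divide)
  then have "norm ((a + b) / 2) powr p \<le> ((norm a + norm b) / 2) powr p"
    using assms by (intro powr_mono2) auto
  also have "\<dots> < (norm a powr p + norm b powr p) / 2"
    using assms False by (intro powr_midpoint_strict) auto
  finally show ?thesis .
next
  case True
  have "norm (a + b) \<noteq> norm a + norm b"
  proof
    assume "norm (a + b) = norm a + norm b"
    then have "norm a *\<^sub>R b = norm b *\<^sub>R a" by (simp add: norm_triangle_eq)
    then show False using True assms by (cases "norm a = 0") auto
  qed
  then have "norm (a + b) < norm a + norm b"
    using norm_triangle_ineq[of a b] by simp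
  then have "norm ((a + b) / 2) < norm a" using True by (simp add: norm_divide)
  then have "norm ((a + b) / 2) powr p < norm a powr p"
    using assms by (intro powr_less_mono2) auto
  then show ?thesis using True by simp
qed

text \<open>Convexity applied to a + b = l (a / l) + (1 - l) (b / (1 - l)). The weight l stays free;
  Minkowski's inequality optimizes it.\<close>

lemma norm_add_powr_le:
  fixes a b :: "'b::real_normed_vector"
  assumes "1 \<le> p" "0 < l" "l < 1"
  shows "norm (a + b) powr p \<le> l powr (1 - p) * norm a powr p + (1 - l) powr (1 - p) * norm b powr p"
proof -
  have "norm (a + b) powr p \<le> (l * (norm a / l) + (1 - l) * (norm b / (1 - l))) powr p"
    using norm_triangle_ineq[of a b] assms by (intro powr_mono2) auto
  also have "\<dots> \<le> l * (norm a / l) powr p + (1 - l) * (norm b / (1 - l)) powr p"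
    using assms by (intro powr_convex_combination) auto
  also have "\<dots> = l powr (1 - p) * norm a powr p + (1 - l) powr (1 - p) * norm b powr p"
    using assms by (simp add: powr_divide powr_diff)
  finally show ?thesis .
qed

lemma norm_midpoint_powr_le:
  fixes a b :: complex
  assumes "1 \<le> p"
  shows "norm ((a + b) / 2) powr p \<le> (norm a powr p + norm b powr p) / 2"
proof -
  have "norm ((a + b) / 2) powr p \<le> (1/2 * norm a + (1 - 1/2) * norm b) powr p"
    using norm_triangle_ineq[of a b] assms by (intro powr_mono2) (auto simp: norm_divide)
  also have "\<dots> \<le> 1/2 * norm a powr p + (1 - 1/2) * norm b powr p"
    using assms by (intro powr_convex_combination) auto
  finally show ?thesis by simp
qed

text \<open>Uniform convexity of \<open>L\<^sup>p\<close> is reduced to a pointwise inequality, which follows by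
  homogeneity from compactness of the unit sphere of \<open>\<complex>\<^sup>2\<close>.\<close>

lemma complex_uniform_convexity:
  assumes "1 < p" "0 < e"
  shows "\<exists>C\<ge>0. \<forall>a b :: complex. norm (a - b) powr p \<le>
     e * (norm a powr p + norm b powr p) + C * ((norm a powr p + norm b powr p) / 2 - norm ((a + b) / 2) powr p)"
proof -
  define S where "S = {z :: complex \<times> complex. norm (fst z) powr p + norm (snd z) powr p = 1 \<and> e \<le> norm (fst z - snd z) powr p}"
  define \<phi> where "\<phi> = (\<lambda>z :: complex \<times> complex. (norm (fst z) powr p + norm (snd z) powr p) / 2 - norm ((fst z + snd z) / 2) powr p)"
  have p: "0 < p" using assms by simp
  have cont: "continuous_on UNIV (\<lambda>z :: complex \<times> complex. norm (f z) powr p)"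
    if "continuous_on UNIV f" for f :: "complex \<times> complex \<Rightarrow> complex"
    using that p by (intro continuous_on_powr' continuous_intros) auto
  have c\<phi>: "continuous_on S \<phi>" unfolding \<phi>_def
    by (rule continuous_on_subset[OF _ subset_UNIV], intro continuous_on_diff continuous_on_add
        continuous_on_divide cont continuous_on_const continuous_on_fst continuous_on_snd continuous_on_id) auto
  have "closed S" unfolding S_def
    by (intro closed_Collect_conj closed_Collect_eq closed_Collect_le continuous_on_diff continuous_on_add
        cont continuous_on_const continuous_on_fst continuous_on_snd continuous_on_id)
  moreover have "bounded S"
  proof (rule boundedI[where B = 2])
    fix z assume "z \<in> S"
    then have s: "norm (fst z) powr p + norm (snd z) powr p = 1" by (auto simp: S_def)
    have "norm (fst z) powr p \<le> 1" "norm (snd z) powr p \<le> 1"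
      using s powr_ge_zero[of "norm (fst z)" p] powr_ge_zero[of "norm (snd z)" p] by linarith+
    have 1: "y \<le> 1" if "y powr p \<le> 1" for y :: real
    proof (rule ccontr)
      assume "\<not> y \<le> 1"
      then have "1 < y powr p" using p by (simp add: gr_one_powr)
      then show False using that by simp
    qed
    have "norm (fst z) \<le> 1" "norm (snd z) \<le> 1"
      using 1 \<open>norm (fst z) powr p \<le> 1\<close> \<open>norm (snd z) powr p \<le> 1\<close> by auto
    then show "norm z \<le> 2" using norm_Pair_le[of "fst z" "snd z"] by simp
  qed
  ultimately have S: "compact S" by (simp add: compact_eq_bounded_closed)
  have pos: "0 < \<phi> z" if "z \<in> S" for z
  proof -
    have "fst z \<noteq> snd z" using that assms by (auto simp: S_def)
    then show ?thesis using norm_midpoint_powr_strict[OF assms(1)] by (simp add: \<phi>_def)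
  qed
  \<comment> \<open>For large e the set S is empty, and any positive d serves.\<close>
  obtain d where d: "0 < d" "\<And>z. z \<in> S \<Longrightarrow> d \<le> \<phi> z"
  proof (cases "S = {}")
    case True then show ?thesis using that[of 1] by simp
  next
    case False
    then obtain z0 where "z0 \<in> S" "\<forall>z\<in>S. \<phi> z0 \<le> \<phi> z"
      using continuous_attains_inf[OF S _ c\<phi>] by blast
    then show ?thesis using that[of "\<phi> z0"] pos by auto
  qed
  \<comment> \<open>A pair that scales into S has left side at most 2^p r^p and convexity defect at
    least d r^p, so this C suffices. For the other pairs the term with e already covers the left
    side.\<close>
  define C where "C = 2 powr p / d"
  have "norm (a - b) powr p \<le> e * (norm a powr p + norm b powr p)
     + C * ((norm a powr p + norm b powr p) / 2 - norm ((a + b) / 2) powr p)" for a b :: complex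
  proof -
    define r where "r = (norm a powr p + norm b powr p) powr (1/p)"
    have rp: "r powr p = norm a powr p + norm b powr p" unfolding r_def
      using p by (simp add: powr_powr)
    show ?thesis
    proof (cases "r = 0")
      case True
      then have "norm a powr p + norm b powr p = 0" using rp by simp
      then have "norm a powr p = 0" "norm b powr p = 0"
        using powr_ge_zero[of "norm a" p] powr_ge_zero[of "norm b" p] by linarith+
      then show ?thesis by simp
    next
      case False
      then have r: "0 < r" unfolding r_def by (simp add: order_less_le)
      have mid: "norm (a + b) powr p / 2 powr p \<le> r powr p / 2"
        using norm_midpoint_powr_le[of p a b] assms by (simp add: rp norm_divide powr_divide)
      define z where "z = (a / of_real r, b / of_real r)"
      have z: "norm (fst z) powr p = norm a powr p / r powr p" "norm (snd z) powr p = norm b powr p / r powr p"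
        "norm (fst z - snd z) powr p = norm (a - b) powr p / r powr p"
        "norm ((fst z + snd z) / 2) powr p = norm ((a + b) / 2) powr p / r powr p"
        using r by (simp_all add: z_def norm_divide powr_divide powr_mult diff_divide_distrib[symmetric]
            add_divide_distrib[symmetric] mult.commute)
      have rp0: "0 < r powr p" using r by simp
      have s1: "norm (fst z) powr p + norm (snd z) powr p = 1"
        using rp rp0 by (simp add: z add_divide_distrib[symmetric])
      show ?thesis
      proof (cases "norm (a - b) powr p \<le> e * r powr p")
        case True
        then show ?thesis using mid d unfolding C_def rp[symmetric]
          by (simp add: norm_divide powr_divide add_increasing2)
      next
        case False
        then have "e \<le> norm (fst z - snd z) powr p" using rp0 unfolding z(3) by (simp add: pos_le_divide_eq)
        then have "z \<in> S" using s1 by (simp add: S_def)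
        then have "d \<le> \<phi> z" by (rule d)
        then have *: "d * r powr p \<le> r powr p / 2 - norm ((a + b) / 2) powr p"
          using s1 rp0 unfolding \<phi>_def s1 z by (simp add: field_simps)
        have "norm (a - b) powr p \<le> (2 * (1/2 * norm a + (1-1/2) * norm b)) powr p"
          using norm_triangle_ineq4[of a b] p by (intro powr_mono2) auto
        also have "\<dots> = 2 powr p * (1/2 * norm a + (1-1/2) * norm b) powr p"
          by (rule powr_mult)
        also have "\<dots> \<le> 2 powr p * (1/2 * norm a powr p + (1 - 1/2) * norm b powr p)"
          using assms by (intro mult_left_mono powr_convex_combination) auto
        also have "\<dots> \<le> 2 powr p * r powr p" using rp0 unfolding rp[symmetric] by (simp add: rp)
        also have "\<dots> = C * (d * r powr p)" using d by (simp add: C_def)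
        also have "\<dots> \<le> C * (r powr p / 2 - norm ((a + b) / 2) powr p)"
          using * d by (intro mult_left_mono) (auto simp: C_def)
        finally show ?thesis using assms rp0 unfolding rp[symmetric] by (simp add: add_increasing)
      qed
    qed
  qed
  moreover have "0 \<le> C" using d by (simp add: C_def)
  ultimately show ?thesis by blast
qed

subsection \<open>The seminorm on \<open>L\<^sup>p\<close>\<close>

lemma Lp_norm_nonneg [simp]: "0 \<le> Lp_norm m p f"
  by (simp add: Lp_norm_def)

lemma Lp_norm_powr:
  assumes "0 < p"
  shows "Lp_norm m p f powr p = (LINT x|m. norm (f x) powr p)"
  using assms by (simp add: Lp_norm_def powr_powr)

lemma Lp_norm_leI:
  assumes "0 < p" "0 \<le> r" "(LINT x|m. norm (f x) powr p) \<le> r powr p"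
  shows "Lp_norm m p f \<le> r"
proof -
  have "Lp_norm m p f \<le> (r powr p) powr (1 / p)"
    unfolding Lp_norm_def using assms by (intro powr_mono2) auto
  then show ?thesis using assms by (simp add: powr_powr)
qed

lemma Lp_measurable: "f \<in> Lp m p \<Longrightarrow> f \<in> borel_measurable m"
  and Lp_integrable: "f \<in> Lp m p \<Longrightarrow> integrable m (\<lambda>x. norm (f x) powr p)"
  by (auto simp: Lp_def)

lemma nn_integral_Lp:
  assumes "0 < p" "f \<in> Lp m p"
  shows "(\<integral>\<^sup>+x. ennreal (norm (f x) powr p) \<partial>m) = ennreal (Lp_norm m p f powr p)"
  using assms by (subst nn_integral_eq_integral) (auto simp: Lp_norm_powr Lp_integrable)

text \<open>The bound is phrased with the extended integral because the Bochner integral of a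
  non-integrable function is 0, so a bound on it would not yield membership in
  \<open>Lp\<close>.\<close>

lemma Lp_boundI:
  assumes "0 < p" "f \<in> borel_measurable m" "0 \<le> r"
    and "(\<integral>\<^sup>+x. ennreal (norm (f x) powr p) \<partial>m) \<le> ennreal (r powr p)"
  shows "f \<in> Lp m p" "Lp_norm m p f \<le> r"
proof -
  have m: "(\<lambda>x. norm (f x) powr p) \<in> borel_measurable m" using assms(2) by measurable
  have "integrable m (\<lambda>x. norm (f x) powr p)"
    using assms m by (intro integrableI_nonneg) (auto simp: le_less_trans)
  then show L: "f \<in> Lp m p" using assms by (simp add: Lp_def)
  have "ennreal (Lp_norm m p f powr p) \<le> ennreal (r powr p)"
    using assms nn_integral_Lp[OF assms(1) L] by simp
  then show "Lp_norm m p f \<le> r"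
    using assms by (intro Lp_norm_leI) (auto simp: Lp_norm_powr)
qed

lemma Lp_norm_dominated:
  assumes "0 < p" "g \<in> Lp m p" "f \<in> borel_measurable m" "AE x in m. norm (f x) \<le> norm (g x)"
  shows "f \<in> Lp m p" "Lp_norm m p f \<le> Lp_norm m p g"
proof -
  have "(\<integral>\<^sup>+x. ennreal (norm (f x) powr p) \<partial>m) \<le> (\<integral>\<^sup>+x. ennreal (norm (g x) powr p) \<partial>m)"
    using assms(4) by (intro nn_integral_mono_AE) (auto elim!: eventually_mono intro!: powr_mono2 simp: assms(1) less_imp_le)
  then have *: "(\<integral>\<^sup>+x. ennreal (norm (f x) powr p) \<partial>m) \<le> ennreal (Lp_norm m p g powr p)"
    using nn_integral_Lp[OF assms(1,2)] by simp
  show "f \<in> Lp m p" "Lp_norm m p f \<le> Lp_norm m p g"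
    using Lp_boundI[OF assms(1,3) _ *] by auto
qed

lemma Lp_norm_cong_AE:
  assumes "f \<in> borel_measurable m" "g \<in> borel_measurable m" "AE x in m. f x = g x"
  shows "Lp_norm m p f = Lp_norm m p g"
  unfolding Lp_norm_def using assms
  by (intro arg_cong2[where f = "(powr)"] integral_cong_AE) (auto elim!: eventually_mono)

lemma Lp_cong_AE:
  assumes "0 < p" "f \<in> Lp m p" "g \<in> borel_measurable m" "AE x in m. f x = g x"
  shows "g \<in> Lp m p"
  using assms by (intro Lp_norm_dominated(1)[OF assms(1,2)]) (auto elim!: eventually_mono)

lemma Lp_zero: "(\<lambda>x. 0) \<in> Lp m p" by (simp add: Lp_def)

lemma Lp_norm_zero [simp]: "Lp_norm m p (\<lambda>x. 0) = 0" by (simp add: Lp_norm_def)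

lemma Lp_cmult: "f \<in> Lp m p \<Longrightarrow> (\<lambda>x. c * f x) \<in> Lp m p"
  by (auto simp: Lp_def norm_mult powr_mult)

lemma Lp_norm_cmult: "0 < p \<Longrightarrow> Lp_norm m p (\<lambda>x. c * f x) = norm c * Lp_norm m p f"
  by (simp add: Lp_norm_def norm_mult powr_mult powr_powr)

lemma Lp_norm_minus [simp]: "Lp_norm m p (\<lambda>x. - f x) = Lp_norm m p f"
  by (simp add: Lp_norm_def)

lemma Lp_uminus: "f \<in> Lp m p \<Longrightarrow> (\<lambda>x. - f x) \<in> Lp m p"
  using Lp_cmult[of f m p "-1"] by simp

lemma Lp_norm_eq_0:
  assumes "0 < p" "f \<in> Lp m p"
  shows "Lp_norm m p f = 0 \<longleftrightarrow> (AE x in m. f x = 0)"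
proof -
  have "Lp_norm m p f = 0 \<longleftrightarrow> (LINT x|m. norm (f x) powr p) = 0"
    using assms by (simp add: Lp_norm_def)
  also have "\<dots> \<longleftrightarrow> (AE x in m. norm (f x) powr p = 0)"
    using assms by (intro integral_nonneg_eq_0_iff_AE) (auto simp: Lp_integrable)
  finally show ?thesis using assms by simp
qed

text \<open>Minkowski's inequality: the pointwise estimate with weight l is integrated and l is then
  chosen according to the two norms. If one norm is 0, that function vanishes almost everywhere and
  no weight strictly between 0 and 1 is optimal, so these cases are separate.\<close>

lemma
  assumes p: "1 \<le> p" and f: "f \<in> Lp m p" and g: "g \<in> Lp m p"
  shows Lp_add: "(\<lambda>x. f x + g x) \<in> Lp m p"
    and Lp_norm_triangle: "Lp_norm m p (\<lambda>x. f x + g x) \<le> Lp_norm m p f + Lp_norm m p g"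
proof -
  have p0: "0 < p" using p by simp
  note [measurable] = Lp_measurable[OF f] Lp_measurable[OF g]
  have bd: "(LINT x|m. norm (f x + g x) powr p) \<le> l powr (1 - p) * (LINT x|m. norm (f x) powr p) + (1 - l) powr (1 - p) * (LINT x|m. norm (g x) powr p)
    \<and> integrable m (\<lambda>x. norm (f x + g x) powr p)" if "0 < l" "l < 1" for l
  proof -
    have i: "integrable m (\<lambda>x. l powr (1 - p) * norm (f x) powr p + (1 - l) powr (1 - p) * norm (g x) powr p)"
      using f g by (simp add: Lp_integrable)
    have j: "integrable m (\<lambda>x. norm (f x + g x) powr p)"
      using norm_add_powr_le[OF p that] by (intro Bochner_Integration.integrable_bound[OF i]) auto
    have "(LINT x|m. norm (f x + g x) powr p) \<le> (LINT x|m. l powr (1 - p) * norm (f x) powr p + (1 - l) powr (1 - p) * norm (g x) powr p)"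
      using norm_add_powr_le[OF p that] by (intro integral_mono i j) auto
    then show ?thesis using j f g by (simp add: Lp_integrable)
  qed
  have "integrable m (\<lambda>x. norm (f x + g x) powr p)" using bd[of "1/2"] by simp
  then show L: "(\<lambda>x. f x + g x) \<in> Lp m p" by (simp add: Lp_def)
  define A where "A = Lp_norm m p f"
  define B where "B = Lp_norm m p g"
  consider "A = 0" | "B = 0" | "0 < A" "0 < B"
    unfolding A_def B_def by (metis Lp_norm_nonneg order_less_le)
  then show "Lp_norm m p (\<lambda>x. f x + g x) \<le> Lp_norm m p f + Lp_norm m p g"
  proof cases
    case 1
    then have "AE x in m. f x = 0" using Lp_norm_eq_0[OF p0 f] A_def by simp
    then have "Lp_norm m p (\<lambda>x. f x + g x) = Lp_norm m p g"
      by (intro Lp_norm_cong_AE) (auto elim!: eventually_mono)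
    then show ?thesis by simp
  next
    case 2
    then have "AE x in m. g x = 0" using Lp_norm_eq_0[OF p0 g] B_def by simp
    then have "Lp_norm m p (\<lambda>x. f x + g x) = Lp_norm m p f"
      by (intro Lp_norm_cong_AE) (auto elim!: eventually_mono)
    then show ?thesis by simp
  next
    case 3
    \<comment> \<open>The minimizer of l^(1-p) A^p + (1-l)^(1-p) B^p, whose minimum is (A +
      B)^p.\<close>
    define l where "l = A / (A + B)"
    have l: "0 < l" "l < 1" "1 - l = B / (A + B)" using 3 by (auto simp: l_def field_simps)
    have "(LINT x|m. norm (f x + g x) powr p) \<le> l powr (1 - p) * A powr p + (1 - l) powr (1 - p) * B powr p"
      using bd[OF l(1,2)] p0 by (simp add: A_def B_def Lp_norm_powr)
    also have "\<dots> = (A + B) powr p"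
    proof -
      have "l powr (1 - p) * A powr p = A * (A + B) powr (p - 1)"
      proof -
        have "A powr (1 - p) * A powr p = A" using 3 by (simp add: powr_add[symmetric])
        moreover have "(A + B) powr (p - 1) = 1 / (A + B) powr (1 - p)"
          using powr_minus_divide[of "A + B" "1 - p"] by simp
        ultimately show ?thesis using 3 unfolding l_def by (simp add: powr_divide)
      qed
      moreover have "(1 - l) powr (1 - p) * B powr p = B * (A + B) powr (p - 1)"
      proof -
        have "B powr (1 - p) * B powr p = B" using 3 by (simp add: powr_add[symmetric])
        moreover have "(A + B) powr (p - 1) = 1 / (A + B) powr (1 - p)"
          using powr_minus_divide[of "A + B" "1 - p"] by simp
        ultimately show ?thesis using 3 unfolding l(3) by (simp add: powr_divide)
      qed
      ultimately have "l powr (1 - p) * A powr p + (1 - l) powr (1 - p) * B powr p = (A + B) * (A + B) powr (p - 1)"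
        by (simp add: distrib_right)
      then show ?thesis using 3 by (simp add: powr_diff)
    qed
    finally show ?thesis
      using 3 p0 unfolding A_def B_def by (intro Lp_norm_leI) auto
  qed
qed

lemma Lp_diff: "1 \<le> p \<Longrightarrow> f \<in> Lp m p \<Longrightarrow> g \<in> Lp m p \<Longrightarrow> (\<lambda>x. f x - g x) \<in> Lp m p"
  using Lp_add[of p f m "\<lambda>x. - g x"] Lp_uminus[of g m p] by simp

lemma Lp_norm_triangle_diff:
  "1 \<le> p \<Longrightarrow> f \<in> Lp m p \<Longrightarrow> g \<in> Lp m p \<Longrightarrow> Lp_norm m p (\<lambda>x. f x - g x) \<le> Lp_norm m p f + Lp_norm m p g"
  using Lp_norm_triangle[of p f m "\<lambda>x. - g x"] Lp_uminus[of g m p] by simp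

lemma Lp_norm_diff_commute: "Lp_norm m p (\<lambda>x. f x - g x) = Lp_norm m p (\<lambda>x. g x - f x)"
  by (simp add: Lp_norm_def norm_minus_commute)

lemma Lp_norm_diff_triangle:
  assumes "1 \<le> p" "f \<in> Lp m p" "g \<in> Lp m p" "h \<in> Lp m p"
  shows "Lp_norm m p (\<lambda>x. f x - h x) \<le> Lp_norm m p (\<lambda>x. f x - g x) + Lp_norm m p (\<lambda>x. g x - h x)"
  using Lp_norm_triangle[OF assms(1) Lp_diff[OF assms(1-3)] Lp_diff[OF assms(1,3,4)]] by simp

lemma Lp_norm_diff_ineq:
  assumes "1 \<le> p" "f \<in> Lp m p" "g \<in> Lp m p"
  shows "Lp_norm m p f \<le> Lp_norm m p g + Lp_norm m p (\<lambda>x. f x - g x)"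
  using Lp_norm_triangle[OF assms(1,3) Lp_diff[OF assms]] by simp

lemma
  assumes "1 \<le> p" "\<And>i. i \<in> I \<Longrightarrow> f i \<in> Lp m p"
  shows Lp_sum: "(\<lambda>x. \<Sum>i\<in>I. f i x) \<in> Lp m p"
    and Lp_norm_sum: "Lp_norm m p (\<lambda>x. \<Sum>i\<in>I. f i x) \<le> (\<Sum>i\<in>I. Lp_norm m p (f i))"
proof -
  have "(\<lambda>x. \<Sum>i\<in>I. f i x) \<in> Lp m p \<and> Lp_norm m p (\<lambda>x. \<Sum>i\<in>I. f i x) \<le> (\<Sum>i\<in>I. Lp_norm m p (f i))"
    using assms(2)
  proof (induction I rule: infinite_finite_induct)
    case (insert i I)
    then have "(\<lambda>x. f i x + (\<Sum>i\<in>I. f i x)) \<in> Lp m p"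
      "Lp_norm m p (\<lambda>x. f i x + (\<Sum>i\<in>I. f i x)) \<le> Lp_norm m p (f i) + Lp_norm m p (\<lambda>x. \<Sum>i\<in>I. f i x)"
      by (auto intro!: Lp_add Lp_norm_triangle simp: assms(1))
    then show ?case using insert by fastforce
  qed (simp_all add: Lp_zero)
  then show "(\<lambda>x. \<Sum>i\<in>I. f i x) \<in> Lp m p"
    "Lp_norm m p (\<lambda>x. \<Sum>i\<in>I. f i x) \<le> (\<Sum>i\<in>I. Lp_norm m p (f i))" by auto
qed

text \<open>The pointwise inequality is integrated: the first term is small because the norms are at
  most D + 1, the second is a multiple of (D + d)^p - (D - d)^p. The level D with slack d is the
  form suited to an infimum that need not be attained, and D = 0 is included.\<close>

lemma Lp_uniform_convexity:
  assumes "1 < p" "0 < e" "0 \<le> D"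
  shows "\<exists>d>0. \<forall>f\<in>Lp m p. \<forall>g\<in>Lp m p. Lp_norm m p f \<le> D + d \<longrightarrow> Lp_norm m p g \<le> D + d \<longrightarrow>
     D - d \<le> Lp_norm m p (\<lambda>x. (f x + g x) / 2) \<longrightarrow> Lp_norm m p (\<lambda>x. f x - g x) \<le> e"
proof -
  have p: "0 < p" "1 \<le> p" using assms by auto
  \<comment> \<open>With norms at most D + 1 the first term of the pointwise inequality contributes
    e' * 2 (D + 1)^p, which is half of e^p.\<close>
  define e' where "e' = e powr p / (4 * (D + 1) powr p)"
  have D1: "0 < (D + 1) powr p" using assms by simp
  have e': "0 < e'" using assms D1 by (simp add: e'_def)
  obtain C where C: "0 \<le> C" "\<And>a b :: complex. norm (a - b) powr p \<le>
     e' * (norm a powr p + norm b powr p) + C * ((norm a powr p + norm b powr p) / 2 - norm ((a + b) / 2) powr p)"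
    using complex_uniform_convexity[OF assms(1) e'] by blast
  have ev: "\<forall>\<^sub>F d in at_right 0. 0 \<le> D + d"
    using eventually_at_right_less[of 0] by eventually_elim (use assms in auto)
  \<comment> \<open>The maximum with 0 keeps the base of the power nonnegative when d exceeds
    D.\<close>
  have "((\<lambda>d. C * ((D + d) powr p - (max 0 (D - d)) powr p)) \<longlongrightarrow> C * ((D + 0) powr p - (max 0 (D - 0)) powr p)) (at_right 0)"
    using p assms by (intro tendsto_mult tendsto_const tendsto_diff tendsto_add tendsto_max tendsto_ident_at tendsto_powr' disjI2 conjI ev) auto
  then have "((\<lambda>d. C * ((D + d) powr p - (max 0 (D - d)) powr p)) \<longlongrightarrow> 0) (at_right 0)"
    using assms by (simp add: max_def)
  then have "\<forall>\<^sub>F d in at_right 0. C * ((D + d) powr p - (max 0 (D - d)) powr p) < e powr p / 2"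
    using assms by (intro order_tendstoD(2)) auto
  moreover have "\<forall>\<^sub>F d in at_right (0::real). d < 1"
    by (auto intro!: eventually_at_rightI[of _ 1])
  ultimately have "\<forall>\<^sub>F d in at_right 0. C * ((D + d) powr p - (max 0 (D - d)) powr p) < e powr p / 2 \<and> d < 1 \<and> 0 < d"
    by (intro eventually_conj eventually_at_right_less) 
  then obtain d where d: "C * ((D + d) powr p - (max 0 (D - d)) powr p) < e powr p / 2" "d < 1" "0 < d"
    using eventually_happens[of _ "at_right (0::real)"] trivial_limit_at_right_real by blast
  have "Lp_norm m p (\<lambda>x. f x - g x) \<le> e"
    if f: "f \<in> Lp m p" and g: "g \<in> Lp m p" and nf: "Lp_norm m p f \<le> D + d" and ng: "Lp_norm m p g \<le> D + d"
      and mid: "D - d \<le> Lp_norm m p (\<lambda>x. (f x + g x) / 2)" for f g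
  proof -
    let ?F = "LINT x|m. norm (f x) powr p" and ?G = "LINT x|m. norm (g x) powr p"
    have h: "(\<lambda>x. (f x + g x) / 2) \<in> Lp m p"
      using Lp_cmult[OF Lp_add[OF p(2) f g], of "1/2"] by simp
    note i = Lp_integrable[OF f] Lp_integrable[OF g] Lp_integrable[OF h] Lp_integrable[OF Lp_diff[OF p(2) f g]]
    have "(LINT x|m. norm (f x - g x) powr p) \<le> (LINT x|m. e' * (norm (f x) powr p + norm (g x) powr p) +
         C * ((norm (f x) powr p + norm (g x) powr p) / 2 - norm ((f x + g x) / 2) powr p))"
      using i C by (intro integral_mono Bochner_Integration.integrable_add integrable_mult_right Bochner_Integration.integrable_diff integrable_divide) auto
    also have "\<dots> = e' * (?F + ?G) + C * ((?F + ?G) / 2 - (LINT x|m. norm ((f x + g x) / 2) powr p))"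
      using i by simp
    also have "\<dots> \<le> e' * (2 * (D + 1) powr p) + C * ((D + d) powr p - (max 0 (D - d)) powr p)"
    proof -
      have a: "Lp_norm m p f powr p \<le> (D + d) powr p" "Lp_norm m p g powr p \<le> (D + d) powr p"
        "(max 0 (D - d)) powr p \<le> Lp_norm m p (\<lambda>x. (f x + g x) / 2) powr p"
        using nf ng mid p by (auto intro!: powr_mono2)
      have b: "(D + d) powr p \<le> (D + 1) powr p"
        using d p assms by (intro powr_mono2) auto
      have "?F + ?G \<le> 2 * (D + 1) powr p"
        "(?F + ?G) / 2 - (LINT x|m. norm ((f x + g x) / 2) powr p) \<le> (D + d) powr p - (max 0 (D - d)) powr p"
      proof -
        define X Y where "X = (D + d) powr p" and "Y = (max 0 (D - d)) powr p"
        define F G H where "F = ?F" and "G = ?G" and "H = (LINT x|m. norm ((f x + g x) / 2) powr p)"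
        have *: "F \<le> X" "G \<le> X" "Y \<le> H" "X \<le> (D + 1) powr p"
          using a b unfolding Lp_norm_powr[OF p(1)] X_def Y_def F_def G_def H_def by auto
        show "?F + ?G \<le> 2 * (D + 1) powr p"
          using * unfolding F_def G_def by linarith
        show "(?F + ?G) / 2 - (LINT x|m. norm ((f x + g x) / 2) powr p) \<le> (D + d) powr p - (max 0 (D - d)) powr p"
        proof -
          have "(F + G) / 2 \<le> X" using *(1,2) by simp
          then have "(F + G) / 2 - H \<le> X - Y" using *(3) by (rule diff_mono)
          then show ?thesis unfolding X_def Y_def F_def G_def H_def .
        qed
      qed
      then show ?thesis using e' C(1) by (intro add_mono mult_left_mono) auto
    qed
    also have "\<dots> \<le> e powr p / 2 + e powr p / 2"
      using d D1 by (intro add_mono) (auto simp: e'_def)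
    finally show ?thesis using p assms by (intro Lp_norm_leI) auto
  qed
  then show ?thesis using d by blast
qed

text \<open>Riesz-Fischer. Along a subsequence with increments of norm at most 4^(-k), the p-th
  powers of 2^k times the increments have a finite integrated sum. So almost everywhere the
  increments are eventually at most 2^(-k) and the subsequence converges pointwise.\<close>

lemma Lp_complete:
  assumes p: "1 \<le> p" and f: "\<And>n. f n \<in> Lp m p"
    and cauchy: "\<And>e. 0 < e \<Longrightarrow> \<exists>N. \<forall>i\<ge>N. \<forall>j\<ge>N. Lp_norm m p (\<lambda>x. f i x - f j x) \<le> e"
  shows "\<exists>g\<in>Lp m p. (\<lambda>n. Lp_norm m p (\<lambda>x. f n x - g x)) \<longlonglongrightarrow> 0"
proof -
  have p0: "0 < p" using p by simp
  note [measurable] = Lp_measurable[OF f]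
  define \<epsilon> where "\<epsilon> k = (1/2::real) ^ k * (1/2) ^ k" for k :: nat
  have "\<exists>N. \<forall>i\<ge>N. \<forall>j\<ge>N. Lp_norm m p (\<lambda>x. f i x - f j x) \<le> \<epsilon> k" for k
    by (rule cauchy) (simp add: \<epsilon>_def)
  then obtain N where N: "\<And>k i j. N k \<le> i \<Longrightarrow> N k \<le> j \<Longrightarrow> Lp_norm m p (\<lambda>x. f i x - f j x) \<le> \<epsilon> k"
    by metis
  define r where "r = rec_nat (N 0) (\<lambda>k n. max (Suc n) (N (Suc k)))"
  have r0: "r 0 = N 0" and rS: "\<And>k. r (Suc k) = max (Suc (r k)) (N (Suc k))"
    by (simp_all add: r_def)
  have rN: "N k \<le> r k" for k by (cases k) (auto simp: r0 rS)
  have smr: "strict_mono r" by (rule strict_monoI_Suc) (simp add: rS)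
  define D where "D k x = f (r (Suc k)) x - f (r k) x" for k x
  have [measurable]: "D k \<in> borel_measurable m" for k unfolding D_def by measurable
  have DL: "D k \<in> Lp m p" for k unfolding D_def by (intro Lp_diff p f)
  have Dn: "Lp_norm m p (D k) \<le> \<epsilon> k" for k unfolding D_def
    by (intro N) (meson rN smr order.trans lessI less_imp_le strict_mono_less_eq)+
  have "(\<integral>\<^sup>+x. (\<Sum>k. ennreal ((2 ^ k) powr p * norm (D k x) powr p)) \<partial>m)
      = (\<Sum>k. \<integral>\<^sup>+x. ennreal ((2 ^ k) powr p * norm (D k x) powr p) \<partial>m)"
    by (intro nn_integral_suminf) measurable
  also have "\<dots> \<le> (\<Sum>k. ennreal ((1/2) ^ k))"
  proof (intro suminf_le allI summableI)
    fix k
    have "(\<integral>\<^sup>+x. ennreal ((2 ^ k) powr p * norm (D k x) powr p) \<partial>m) = ennreal ((2 ^ k) powr p) * ennreal (Lp_norm m p (D k) powr p)"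
      by (simp add: ennreal_mult nn_integral_cmult nn_integral_Lp[OF p0 DL])
    also have "\<dots> = ennreal ((2 ^ k * Lp_norm m p (D k)) powr p)"
      by (simp add: ennreal_mult powr_mult)
    also have "\<dots> \<le> ennreal ((2 ^ k * \<epsilon> k) powr p)"
      using p0 Dn by (intro ennreal_leI powr_mono2 mult_left_mono) auto
    also have "2 ^ k * \<epsilon> k = (1/2) ^ k" by (simp add: \<epsilon>_def power_divide field_simps)
    also have "ennreal (((1/2) ^ k) powr p) \<le> ennreal ((1/2) ^ k)"
    proof (rule ennreal_leI)
      have "((1/2::real) ^ k) powr p \<le> ((1/2) ^ k) powr 1"
        using p by (intro powr_mono') (auto simp: power_le_one)
      then show "((1/2::real) ^ k) powr p \<le> (1/2) ^ k" by simp
    qed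
    finally show "(\<integral>\<^sup>+x. ennreal ((2 ^ k) powr p * norm (D k x) powr p) \<partial>m) \<le> ennreal ((1/2) ^ k)" .
  qed
  also have "\<dots> = ennreal 2"
    by (subst suminf_ennreal2) (auto simp: suminf_geometric summable_geometric)
  also have "\<dots> < \<infinity>" by simp
  finally have "AE x in m. (\<Sum>k. ennreal ((2 ^ k) powr p * norm (D k x) powr p)) \<noteq> \<infinity>"
    by (intro nn_integral_PInf_AE) (auto simp: less_top)
  then have conv: "AE x in m. convergent (\<lambda>k. f (r k) x)"
  proof eventually_elim
    case (elim x)
    then have "summable (\<lambda>k. (2 ^ k) powr p * norm (D k x) powr p)"
      by (intro summable_suminf_not_top) auto
    then have "(\<lambda>k. (2 ^ k * norm (D k x)) powr p) \<longlonglongrightarrow> 0"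
      by (simp add: powr_mult summable_LIMSEQ_zero)
    then have "\<forall>\<^sub>F k in sequentially. (2 ^ k * norm (D k x)) powr p < 1"
      by (rule order_tendstoD) simp
    then have "\<forall>\<^sub>F k in sequentially. norm (D k x) \<le> (1/2) ^ k"
    proof eventually_elim
      case (elim k)
      have "2 ^ k * norm (D k x) < 1"
      proof (rule ccontr)
        assume "\<not> 2 ^ k * norm (D k x) < 1"
        then have "1 \<le> (2 ^ k * norm (D k x)) powr p" using p0 by (intro ge_one_powr_ge_zero) auto
        then show False using elim by simp
      qed
      then show ?case by (simp add: power_divide field_simps)
    qed
    then have "summable (\<lambda>k. D k x)"
      by (intro summable_comparison_test_ev[OF _ summable_geometric[of "1/2"]]) auto
    then have "convergent (\<lambda>n. f (r 0) x + (\<Sum>k<n. D k x))"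
      by (intro convergent_add convergent_const) (simp add: summable_iff_convergent)
    moreover have "f (r 0) x + (\<Sum>k<n. D k x) = f (r n) x" for n
      unfolding D_def using sum_lessThan_telescope[of "\<lambda>k. f (r k) x" n] by simp
    ultimately show ?case by simp
  qed
  define g where "g x = lim (\<lambda>k. f (r k) x)" for x
  have [measurable]: "g \<in> borel_measurable m" unfolding g_def by measurable
  have lim: "AE x in m. (\<lambda>k. f (r k) x) \<longlonglongrightarrow> g x"
    using conv by eventually_elim (simp add: g_def convergent_LIMSEQ_iff)
  \<comment> \<open>Fatou's lemma gives membership of the difference in \<open>Lp\<close> and the
    norm bound together; membership of g follows from a single such difference.\<close>
  have key: "(\<lambda>x. f n x - g x) \<in> Lp m p \<and> Lp_norm m p (\<lambda>x. f n x - g x) \<le> e"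
    if "0 < e" and M: "\<And>i. M \<le> i \<Longrightarrow> Lp_norm m p (\<lambda>x. f n x - f i x) \<le> e" for n e M
  proof -
    have "(\<integral>\<^sup>+x. ennreal (norm (f n x - g x) powr p) \<partial>m)
       \<le> (\<integral>\<^sup>+x. liminf (\<lambda>k. ennreal (norm (f n x - f (r k) x) powr p)) \<partial>m)"
    proof (intro nn_integral_mono_AE)
      show "AE x in m. ennreal (norm (f n x - g x) powr p) \<le> liminf (\<lambda>k. ennreal (norm (f n x - f (r k) x) powr p))"
        using lim
      proof eventually_elim
        case (elim x)
        have "(\<lambda>k. ennreal (norm (f n x - f (r k) x) powr p)) \<longlonglongrightarrow> ennreal (norm (f n x - g x) powr p)"
          using elim p0 by (intro tendsto_ennrealI tendsto_powr' tendsto_intros) auto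
        from lim_imp_Liminf[OF trivial_limit_sequentially this] show ?case by simp
      qed
    qed
    also have "\<dots> \<le> liminf (\<lambda>k. \<integral>\<^sup>+x. ennreal (norm (f n x - f (r k) x) powr p) \<partial>m)"
      by (intro nn_integral_liminf) measurable
    also have "\<dots> \<le> liminf (\<lambda>k. ennreal (e powr p))"
    proof (intro Liminf_mono eventually_sequentiallyI[of M])
      fix k assume "M \<le> k"
      then have "M \<le> r k" using seq_suble[OF smr, of k] by simp
      then have "Lp_norm m p (\<lambda>x. f n x - f (r k) x) powr p \<le> e powr p"
        using M p0 by (intro powr_mono2) auto
      then show "(\<integral>\<^sup>+x. ennreal (norm (f n x - f (r k) x) powr p) \<partial>m) \<le> ennreal (e powr p)"
        by (subst nn_integral_Lp[OF p0]) (auto intro!: Lp_diff p f ennreal_leI)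
    qed
    also have "\<dots> = ennreal (e powr p)" by (simp add: Liminf_const)
    finally have "(\<integral>\<^sup>+x. ennreal (norm (f n x - g x) powr p) \<partial>m) \<le> ennreal (e powr p)" .
    from Lp_boundI[OF p0 _ _ this] show ?thesis using that(1) by auto
  qed
  have "(\<lambda>x. f (N 0) x - g x) \<in> Lp m p"
    using key[of "\<epsilon> 0" "N 0" "N 0"] N[of 0] by (auto simp: \<epsilon>_def)
  from Lp_diff[OF p f[of "N 0"] this] have gL: "g \<in> Lp m p" by simp
  have "(\<lambda>n. Lp_norm m p (\<lambda>x. f n x - g x)) \<longlonglongrightarrow> 0"
  proof (rule LIMSEQ_I)
    fix e :: real assume "0 < e"
    then obtain M where M: "\<And>i j. M \<le> i \<Longrightarrow> M \<le> j \<Longrightarrow> Lp_norm m p (\<lambda>x. f i x - f j x) \<le> e / 2"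
      using cauchy[of "e/2"] by (metis half_gt_zero)
    have "norm (Lp_norm m p (\<lambda>x. f n x - g x) - 0) < e" if "M \<le> n" for n
      using key[of "e/2" M n] M[OF that] \<open>0 < e\<close> by simp
    then show "\<exists>M. \<forall>n\<ge>M. norm (Lp_norm m p (\<lambda>x. f n x - g x) - 0) < e" by blast
  qed
  then show ?thesis using gL by blast
qed

subsection \<open>Operators on \<open>L\<^sup>p\<close>\<close>

lemma
  assumes "bounded_Lp_operator m p T"
  shows bounded_Lp_closed: "\<And>f. f \<in> Lp m p \<Longrightarrow> T f \<in> Lp m p"
    and bounded_Lp_cong: "\<And>f g. f \<in> Lp m p \<Longrightarrow> g \<in> Lp m p \<Longrightarrow> AE x in m. f x = g x \<Longrightarrow> AE x in m. T f x = T g x"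
    and bounded_Lp_add: "\<And>f g. f \<in> Lp m p \<Longrightarrow> g \<in> Lp m p \<Longrightarrow> AE x in m. T (\<lambda>y. f y + g y) x = T f x + T g x"
    and bounded_Lp_cmult: "\<And>f c. f \<in> Lp m p \<Longrightarrow> AE x in m. T (\<lambda>y. c * f y) x = c * T f x"
  using assms by (auto simp: bounded_Lp_operator_def)

lemma bounded_Lp_diff:
  assumes "1 \<le> p" "bounded_Lp_operator m p T" "f \<in> Lp m p" "g \<in> Lp m p"
  shows "AE x in m. T (\<lambda>y. f y - g y) x = T f x - T g x"
proof -
  have *: "(\<lambda>y. -1 * g y) \<in> Lp m p" using assms by (intro Lp_cmult)
  from bounded_Lp_cmult[OF assms(2,4), of "-1"] bounded_Lp_add[OF assms(2,3) *]
   show ?thesis by eventually_elim simp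
qed

text \<open>Every identity holds only almost everywhere; it passes to the next iterate because T
  respects equality almost everywhere.\<close>

lemma bounded_Lp_iterate:
  assumes "1 \<le> p" "bounded_Lp_operator m p T"
  shows "f \<in> Lp m p \<Longrightarrow> (T ^^ n) f \<in> Lp m p"
    and "f \<in> Lp m p \<Longrightarrow> g \<in> Lp m p \<Longrightarrow> AE x in m. f x = g x \<Longrightarrow> AE x in m. (T ^^ n) f x = (T ^^ n) g x"
    and "f \<in> Lp m p \<Longrightarrow> g \<in> Lp m p \<Longrightarrow> AE x in m. (T ^^ n) (\<lambda>y. f y + g y) x = (T ^^ n) f x + (T ^^ n) g x"
    and "f \<in> Lp m p \<Longrightarrow> AE x in m. (T ^^ n) (\<lambda>y. c * f y) x = c * (T ^^ n) f x"
proof -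
  have L: "(T ^^ n) f \<in> Lp m p" if "f \<in> Lp m p" for f n
    using that by (induction n) (auto intro: bounded_Lp_closed[OF assms(2)])
  then show "f \<in> Lp m p \<Longrightarrow> (T ^^ n) f \<in> Lp m p" .
  show "AE x in m. (T ^^ n) f x = (T ^^ n) g x" if "f \<in> Lp m p" "g \<in> Lp m p" "AE x in m. f x = g x"
  proof (induction n)
    case (Suc n)
    have "AE x in m. T ((T ^^ n) f) x = T ((T ^^ n) g) x"
      by (rule bounded_Lp_cong[OF assms(2) L[OF that(1)] L[OF that(2)] Suc])
    then show ?case by simp
  qed (use that in simp)
  show "AE x in m. (T ^^ n) (\<lambda>y. f y + g y) x = (T ^^ n) f x + (T ^^ n) g x" if "f \<in> Lp m p" "g \<in> Lp m p"
  proof (induction n)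
    case (Suc n)
    have "AE x in m. T ((T ^^ n) (\<lambda>y. f y + g y)) x = T (\<lambda>y. (T ^^ n) f y + (T ^^ n) g y) x"
      by (intro bounded_Lp_cong[OF assms(2)] L Lp_add assms that Suc)
    moreover have "AE x in m. T (\<lambda>y. (T ^^ n) f y + (T ^^ n) g y) x = T ((T ^^ n) f) x + T ((T ^^ n) g) x"
      by (intro bounded_Lp_add[OF assms(2)] L that)
    ultimately show ?case by eventually_elim simp
  qed simp
  show "AE x in m. (T ^^ n) (\<lambda>y. c * f y) x = c * (T ^^ n) f x" if "f \<in> Lp m p"
  proof (induction n)
    case (Suc n)
    have "AE x in m. T ((T ^^ n) (\<lambda>y. c * f y)) x = T (\<lambda>y. c * (T ^^ n) f y) x"
      by (intro bounded_Lp_cong[OF assms(2)] L Lp_cmult that Suc)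
    moreover have "AE x in m. T (\<lambda>y. c * (T ^^ n) f y) x = c * T ((T ^^ n) f) x"
      by (intro bounded_Lp_cmult[OF assms(2)] L that)
    ultimately show ?case by eventually_elim simp
  qed simp
qed

lemma bounded_Lp_operatorI:
  assumes "1 \<le> p"
    and "\<And>f. f \<in> Lp m p \<Longrightarrow> T f \<in> Lp m p"
    and "\<And>f g. f \<in> Lp m p \<Longrightarrow> g \<in> Lp m p \<Longrightarrow> AE x in m. f x = g x \<Longrightarrow> AE x in m. T f x = T g x"
    and "\<And>f g. f \<in> Lp m p \<Longrightarrow> g \<in> Lp m p \<Longrightarrow> AE x in m. T (\<lambda>y. f y + g y) x = T f x + T g x"
    and "\<And>f c. f \<in> Lp m p \<Longrightarrow> AE x in m. T (\<lambda>y. c * f y) x = c * T f x"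
    and "0 \<le> B" and bd: "\<And>f. f \<in> Lp m p \<Longrightarrow> Lp_norm m p (T f) \<le> B * Lp_norm m p f"
  shows "bounded_Lp_operator m p T"
proof -
  have "Lp_op_norm m p T \<le> ennreal B"
    unfolding Lp_op_norm_def
  proof (intro SUP_least ennreal_leI)
    fix f assume "f \<in> {f \<in> Lp m p. Lp_norm m p f \<le> 1}"
    then show "Lp_norm m p (T f) \<le> B"
      using bd[of f] mult_left_mono[of "Lp_norm m p f" 1 B] assms(6) by auto
  qed
  then have "Lp_op_norm m p T < \<infinity>" by (simp add: le_less_trans)
  then show ?thesis unfolding bounded_Lp_operator_def using assms by blast
qed

text \<open>Scaling into the unit ball. A function of norm 0 cannot be normalized; it equals 0 * f
  almost everywhere, and homogeneity shows that its image is null.\<close>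

lemma Lp_norm_le_op_norm:
  assumes "1 \<le> p" "bounded_Lp_operator m p T" "f \<in> Lp m p"
    and C: "0 \<le> C" "Lp_op_norm m p (T ^^ n) \<le> ennreal C"
  shows "Lp_norm m p ((T ^^ n) f) \<le> C * Lp_norm m p f"
proof (cases "Lp_norm m p f = 0")
  case True
  then have "AE x in m. f x = 0" using assms Lp_norm_eq_0[of p f m] by simp
  then have 1: "AE x in m. (T ^^ n) f x = (T ^^ n) (\<lambda>y. 0 * f y) x"
    by (intro bounded_Lp_iterate(2)[OF assms(1-3) Lp_cmult[OF assms(3)]]) auto
  have 2: "AE x in m. (T ^^ n) (\<lambda>y. 0 * f y) x = 0 * (T ^^ n) f x"
    by (rule bounded_Lp_iterate(4)[OF assms(1-3)])
  from 1 2 have "AE x in m. (T ^^ n) f x = 0" by eventually_elim simp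
  then have "Lp_norm m p ((T ^^ n) f) = 0"
    using assms bounded_Lp_iterate(1)[OF assms(1-3)] Lp_norm_eq_0[of p _ m] by simp
  then show ?thesis using True by simp
next
  case False
  define a where "a = Lp_norm m p f"
  have a: "0 < a" using False unfolding a_def by (simp add: order_less_le)
  define h where "h = (\<lambda>y. of_real (1 / a) * f y)"
  have h: "h \<in> Lp m p" unfolding h_def using assms by (intro Lp_cmult)
  have "Lp_norm m p h = norm (complex_of_real (1/a)) * a" unfolding h_def a_def using assms by (intro Lp_norm_cmult) simp
  then have "Lp_norm m p h \<le> 1" using a by (simp add: norm_divide)
  then have "ennreal (Lp_norm m p ((T ^^ n) h)) \<le> Lp_op_norm m p (T ^^ n)"
    unfolding Lp_op_norm_def using h by (intro SUP_upper) auto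
  then have "ennreal (Lp_norm m p ((T ^^ n) h)) \<le> ennreal C" using C(2) by (rule order.trans)
  then have 1: "Lp_norm m p ((T ^^ n) h) \<le> C" using C by simp
  have "AE x in m. (T ^^ n) h x = of_real (1/a) * (T ^^ n) f x"
    unfolding h_def by (rule bounded_Lp_iterate(4)[OF assms(1-3)])
  then have "Lp_norm m p ((T ^^ n) h) = Lp_norm m p (\<lambda>x. of_real (1/a) * (T ^^ n) f x)"
    using bounded_Lp_iterate(1)[OF assms(1,2)] assms h by (intro Lp_norm_cong_AE Lp_measurable[of _ _ p] Lp_cmult) auto
  also have "\<dots> = norm (complex_of_real (1/a)) * Lp_norm m p ((T ^^ n) f)"
    using assms by (intro Lp_norm_cmult) simp
  finally show ?thesis using mult_left_mono[OF 1, of a] a by (simp add: norm_divide field_simps a_def[symmetric])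
qed

lemma cesaro_mean_Lp:
  assumes "1 \<le> p" "bounded_Lp_operator m p T"
  shows "f \<in> Lp m p \<Longrightarrow> cesaro_mean T n f \<in> Lp m p"
    and "f \<in> Lp m p \<Longrightarrow> g \<in> Lp m p \<Longrightarrow> AE x in m. f x = g x \<Longrightarrow> AE x in m. cesaro_mean T n f x = cesaro_mean T n g x"
    and "f \<in> Lp m p \<Longrightarrow> g \<in> Lp m p \<Longrightarrow> AE x in m. cesaro_mean T n (\<lambda>y. f y + g y) x = cesaro_mean T n f x + cesaro_mean T n g x"
    and "f \<in> Lp m p \<Longrightarrow> AE x in m. cesaro_mean T n (\<lambda>y. c * f y) x = c * cesaro_mean T n f x"
proof -
  show "f \<in> Lp m p \<Longrightarrow> cesaro_mean T n f \<in> Lp m p"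
    unfolding cesaro_mean_def by (intro Lp_cmult Lp_sum assms bounded_Lp_iterate)
  show "AE x in m. cesaro_mean T n f x = cesaro_mean T n g x" if "f \<in> Lp m p" "g \<in> Lp m p" "AE x in m. f x = g x"
  proof -
    have "AE x in m. \<forall>k\<in>{1..n}. (T ^^ k) f x = (T ^^ k) g x"
      by (intro AE_ball_countable' countable_finite finite_atLeastAtMost bounded_Lp_iterate(2)[OF assms] that)
    then show ?thesis by eventually_elim (simp add: cesaro_mean_def)
  qed
  show "AE x in m. cesaro_mean T n (\<lambda>y. f y + g y) x = cesaro_mean T n f x + cesaro_mean T n g x" if "f \<in> Lp m p" "g \<in> Lp m p"
  proof -
    have "AE x in m. \<forall>k\<in>{1..n}. (T ^^ k) (\<lambda>y. f y + g y) x = (T ^^ k) f x + (T ^^ k) g x"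
      by (intro AE_ball_countable' countable_finite finite_atLeastAtMost bounded_Lp_iterate(3)[OF assms] that)
    then show ?thesis by eventually_elim (simp add: cesaro_mean_def sum.distrib add_divide_distrib)
  qed
  show "AE x in m. cesaro_mean T n (\<lambda>y. c * f y) x = c * cesaro_mean T n f x" if "f \<in> Lp m p"
  proof -
    have "AE x in m. \<forall>k\<in>{1..n}. (T ^^ k) (\<lambda>y. c * f y) x = c * (T ^^ k) f x"
      by (intro AE_ball_countable' countable_finite finite_atLeastAtMost bounded_Lp_iterate(4)[OF assms] that)
    then show ?thesis by eventually_elim (simp add: cesaro_mean_def sum_distrib_left)
  qed
qed

text \<open>Written as a convex combination of the old mean and the newest iterate, this keeps the
  means in a convex hull and also isolates the newest iterate for growth estimates. For n = 0 the
  empty mean has weight 0.\<close>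

lemma cesaro_mean_Suc:
  "cesaro_mean T (Suc n) f x =
     of_real (real n / real (Suc n)) * cesaro_mean T n f x + of_real (1 - real n / real (Suc n)) * (T ^^ Suc n) f x"
proof (cases "n = 0")
  case False
  have "real n / real (Suc n) * (1 / real n) = 1 / real (Suc n)" "1 - real n / real (Suc n) = 1 / real (Suc n)"
    using False by (simp_all add: field_simps)
  from this[THEN arg_cong[where f = complex_of_real]]
  have "of_real (real n / real (Suc n)) * (1 / of_nat n) = (1 / of_nat (Suc n) :: complex)"
    "of_real (1 - real n / real (Suc n)) = (1 / of_nat (Suc n) :: complex)"
    by (simp_all only: of_real_mult of_real_divide of_real_of_nat_eq of_real_1)
  then show ?thesis
    by (simp only: cesaro_mean_def mult.assoc[symmetric] sum.cl_ivl_Suc) (simp add: distrib_left)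
qed (simp add: cesaro_mean_def)

definition Lp_contraction :: "'a measure \<Rightarrow> real \<Rightarrow> (('a \<Rightarrow> complex) \<Rightarrow> ('a \<Rightarrow> complex)) \<Rightarrow> bool" where
  "Lp_contraction m p T \<longleftrightarrow> bounded_Lp_operator m p T \<and> (\<forall>f\<in>Lp m p. Lp_norm m p (T f) \<le> Lp_norm m p f)"

lemma Lp_contraction_iterate:
  assumes "1 \<le> p" "Lp_contraction m p T" "f \<in> Lp m p"
  shows "Lp_norm m p ((T ^^ n) f) \<le> Lp_norm m p f"
proof (induction n)
  case (Suc n)
  have "Lp_norm m p (T ((T ^^ n) f)) \<le> Lp_norm m p ((T ^^ n) f)"
    using assms bounded_Lp_iterate(1)[OF assms(1) _ assms(3)] unfolding Lp_contraction_def by blast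
  then show ?case using Suc by simp
qed simp

lemma Lp_contraction_cesaro:
  assumes "1 \<le> p" "Lp_contraction m p T" "f \<in> Lp m p"
  shows "Lp_norm m p (cesaro_mean T n f) \<le> Lp_norm m p f"
proof -
  have T: "bounded_Lp_operator m p T" using assms by (simp add: Lp_contraction_def)
  have "Lp_norm m p (cesaro_mean T n f) = norm (1 / of_nat n :: complex) * Lp_norm m p (\<lambda>x. \<Sum>k=1..n. (T ^^ k) f x)"
    unfolding cesaro_mean_def using assms by (intro Lp_norm_cmult) simp
  also have "\<dots> \<le> norm (1 / of_nat n :: complex) * (\<Sum>k=1..n. Lp_norm m p ((T ^^ k) f))"
    by (intro mult_left_mono Lp_norm_sum assms bounded_Lp_iterate(1)[OF assms(1) T]) auto
  also have "\<dots> \<le> norm (1 / of_nat n :: complex) * (\<Sum>k=1..n. Lp_norm m p f)"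
    by (intro mult_left_mono sum_mono Lp_contraction_iterate assms) auto
  also have "\<dots> \<le> Lp_norm m p f" by (cases "n = 0") (auto simp: norm_divide)
  finally show ?thesis .
qed

lemma Lp_contraction_power_bounded:
  assumes "1 \<le> p" "Lp_contraction m p T"
  shows "power_bounded m p T"
proof -
  have "Lp_op_norm m p (T ^^ n) \<le> 1" for n
    unfolding Lp_op_norm_def
  proof (intro SUP_least)
    fix f assume "f \<in> {f \<in> Lp m p. Lp_norm m p f \<le> 1}"
    then have "Lp_norm m p ((T ^^ n) f) \<le> 1"
      using Lp_contraction_iterate[OF assms, of f n] by auto
    then show "ennreal (Lp_norm m p ((T ^^ n) f)) \<le> 1" by simp
  qed
  then have "(SUP n. Lp_op_norm m p (T ^^ n)) \<le> 1" by (rule SUP_least)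
  then show ?thesis unfolding power_bounded_def by (rule le_less_trans) simp
qed

lemma Lp_norm_tendsto_0:
  assumes "\<And>n. Lp_norm m p (f n) \<le> g n" "g \<longlonglongrightarrow> 0"
  shows "(\<lambda>n. Lp_norm m p (f n)) \<longlonglongrightarrow> 0"
  by (rule tendsto_sandwich[OF _ _ tendsto_const assms(2)]) (auto simp: assms(1))

text \<open>Serves to prove identities for operators defined as limits: approximants that agree
  almost everywhere have limits that agree almost everywhere.\<close>

lemma Lp_limit_unique:
  assumes p: "1 \<le> p" and L: "\<And>n. f n \<in> Lp m p" "\<And>n. g n \<in> Lp m p" "a \<in> Lp m p" "b \<in> Lp m p"
    and eq: "\<And>n. AE x in m. f n x = g n x"
    and f: "(\<lambda>n. Lp_norm m p (\<lambda>x. f n x - a x)) \<longlonglongrightarrow> 0"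
    and g: "(\<lambda>n. Lp_norm m p (\<lambda>x. g n x - b x)) \<longlonglongrightarrow> 0"
  shows "AE x in m. a x = b x"
proof -
  have "Lp_norm m p (\<lambda>x. a x - b x) \<le> Lp_norm m p (\<lambda>x. f n x - a x) + Lp_norm m p (\<lambda>x. g n x - b x)" for n
  proof -
    have "Lp_norm m p (\<lambda>x. f n x - b x) = Lp_norm m p (\<lambda>x. g n x - b x)"
      using eq[of n] by (intro Lp_norm_cong_AE Lp_measurable[of _ _ p] Lp_diff p L) (auto elim: eventually_mono)
    then show ?thesis
      using Lp_norm_diff_triangle[OF p L(3) L(1)[of n] L(4)] Lp_norm_diff_commute[of m p a "f n"] by simp
  qed
  moreover have "(\<lambda>n. Lp_norm m p (\<lambda>x. f n x - a x) + Lp_norm m p (\<lambda>x. g n x - b x)) \<longlonglongrightarrow> 0 + 0"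
    by (intro tendsto_add f g)
  ultimately have "Lp_norm m p (\<lambda>x. a x - b x) \<le> 0"
    by (intro tendsto_lowerbound[of _ _ sequentially]) auto
  then have "Lp_norm m p (\<lambda>x. a x - b x) = 0" using Lp_norm_nonneg by (metis order_antisym)
  then have "AE x in m. a x - b x = 0"
    using Lp_norm_eq_0[OF _ Lp_diff[OF p L(3,4)]] p by simp
  then show ?thesis by (auto elim: eventually_mono)
qed

lemma mean_ergodicI:
  assumes p: "1 \<le> p" and T: "Lp_contraction m p T"
    and lim: "\<And>f. f \<in> Lp m p \<Longrightarrow> \<exists>g\<in>Lp m p. (\<lambda>n. Lp_norm m p (\<lambda>x. cesaro_mean T n f x - g x)) \<longlonglongrightarrow> 0"
  shows "mean_ergodic m p T"
proof -
  have B: "bounded_Lp_operator m p T" using T by (simp add: Lp_contraction_def)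
  \<comment> \<open>The limit is chosen separately for each representative, so linearity and
    compatibility with null sets are not built in; they come from uniqueness of limits.\<close>
  define P where "P f = (SOME g. g \<in> Lp m p \<and> (\<lambda>n. Lp_norm m p (\<lambda>x. cesaro_mean T n f x - g x)) \<longlonglongrightarrow> 0)" for f
  have P: "P f \<in> Lp m p" "(\<lambda>n. Lp_norm m p (\<lambda>x. cesaro_mean T n f x - P f x)) \<longlonglongrightarrow> 0" if "f \<in> Lp m p" for f
  proof -
    have "\<exists>g. g \<in> Lp m p \<and> (\<lambda>n. Lp_norm m p (\<lambda>x. cesaro_mean T n f x - g x)) \<longlonglongrightarrow> 0"
      using lim[OF that] by blast
    from someI_ex[OF this, folded P_def] show "P f \<in> Lp m p" "(\<lambda>n. Lp_norm m p (\<lambda>x. cesaro_mean T n f x - P f x)) \<longlonglongrightarrow> 0" by auto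
  qed
  note C = cesaro_mean_Lp[OF p B]
  have "bounded_Lp_operator m p P"
  proof (rule bounded_Lp_operatorI[OF p, where B = 1])
    fix f g assume f: "f \<in> Lp m p" and g: "g \<in> Lp m p"
    show "AE x in m. P f x = P g x" if "AE x in m. f x = g x"
      using f g that by (intro Lp_limit_unique[OF p _ _ _ _ _ P(2) P(2)] P C) auto
    show "AE x in m. P (\<lambda>y. f y + g y) x = P f x + P g x"
    proof (rule Lp_limit_unique[OF p _ _ _ _ _ P(2)])
      have bd: "Lp_norm m p (\<lambda>x. (cesaro_mean T n f x + cesaro_mean T n g x) - (P f x + P g x))
         \<le> Lp_norm m p (\<lambda>x. cesaro_mean T n f x - P f x) + Lp_norm m p (\<lambda>x. cesaro_mean T n g x - P g x)" for n
        using Lp_norm_triangle[OF p Lp_diff[OF p C(1)[OF f] P(1)[OF f]] Lp_diff[OF p C(1)[OF g] P(1)[OF g]], of n n]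
        by (simp add: algebra_simps)
      moreover have "(\<lambda>n. Lp_norm m p (\<lambda>x. cesaro_mean T n f x - P f x) + Lp_norm m p (\<lambda>x. cesaro_mean T n g x - P g x)) \<longlonglongrightarrow> 0 + 0"
        by (intro tendsto_add P f g)
      ultimately show "(\<lambda>n. Lp_norm m p (\<lambda>x. (cesaro_mean T n f x + cesaro_mean T n g x) - (P f x + P g x))) \<longlonglongrightarrow> 0"
        using Lp_norm_tendsto_0[OF bd] by simp
    qed (intro C P Lp_add f g p)+
  next
    fix f c assume f: "f \<in> Lp m p"
    show "AE x in m. P (\<lambda>y. c * f y) x = c * P f x"
    proof (rule Lp_limit_unique[OF p _ _ _ _ _ P(2)])
      have "(\<lambda>n. Lp_norm m p (\<lambda>x. c * cesaro_mean T n f x - c * P f x)) = (\<lambda>n. norm c * Lp_norm m p (\<lambda>x. cesaro_mean T n f x - P f x))"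
        using p by (simp add: right_diff_distrib[symmetric] Lp_norm_cmult)
      also have "\<dots> \<longlonglongrightarrow> norm c * 0" by (intro tendsto_mult tendsto_const P f)
      finally show "(\<lambda>n. Lp_norm m p (\<lambda>x. c * cesaro_mean T n f x - c * P f x)) \<longlonglongrightarrow> 0" by simp
    qed (intro C P Lp_cmult f)+
    have "Lp_norm m p (P f) \<le> Lp_norm m p f + Lp_norm m p (\<lambda>x. cesaro_mean T n f x - P f x)" for n
      using Lp_norm_diff_ineq[OF p P(1)[OF f] C(1)[OF f], of n] Lp_contraction_cesaro[OF p T f, of n]
        Lp_norm_diff_commute[of m p "P f" "cesaro_mean T n f"] by simp
    moreover have "(\<lambda>n. Lp_norm m p f + Lp_norm m p (\<lambda>x. cesaro_mean T n f x - P f x)) \<longlonglongrightarrow> Lp_norm m p f + 0"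
      by (intro tendsto_add tendsto_const P f)
    ultimately show "Lp_norm m p (P f) \<le> 1 * Lp_norm m p f"
      by (intro tendsto_lowerbound[of _ _ sequentially]) auto
  qed (use P in auto)
  then show ?thesis unfolding mean_ergodic_def using P by blast
qed

subsection \<open>The mean ergodic theorem for contractions\<close>

text \<open>The smallest convex set of representatives that contains f and is mapped into itself by
  T. Its infimal norm is the level at which uniform convexity is applied.\<close>

inductive_set orbit_hull :: "'a measure \<Rightarrow> (('a \<Rightarrow> complex) \<Rightarrow> ('a \<Rightarrow> complex)) \<Rightarrow> ('a \<Rightarrow> complex) \<Rightarrow> ('a \<Rightarrow> complex) set"
  for m T f where
  base: "f \<in> orbit_hull m T f"
| step: "z \<in> orbit_hull m T f \<Longrightarrow> T z \<in> orbit_hull m T f"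
| comb: "z \<in> orbit_hull m T f \<Longrightarrow> w \<in> orbit_hull m T f \<Longrightarrow> 0 \<le> t \<Longrightarrow> t \<le> 1 \<Longrightarrow>
    (\<lambda>x. of_real t * z x + of_real (1 - t) * w x) \<in> orbit_hull m T f"

lemma orbit_hull_cesaro:
  assumes "z \<in> orbit_hull m T f" "1 \<le> n"
  shows "cesaro_mean T n z \<in> orbit_hull m T f"
  using assms(2)
proof (induction n rule: dec_induct)
  case base
  have "cesaro_mean T 1 z = T z" by (rule ext) (simp add: cesaro_mean_def)
  then show ?case using assms orbit_hull.step by metis
next
  case (step n)
  have "(T ^^ k) z \<in> orbit_hull m T f" for k
    by (induction k) (auto intro: assms orbit_hull.step)
  then have "(\<lambda>x. of_real (real n / real (Suc n)) * cesaro_mean T n z x + of_real (1 - real n / real (Suc n)) * (T ^^ Suc n) z x)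
    \<in> orbit_hull m T f"
    using step by (intro orbit_hull.comb) (auto intro: orbit_hull.step)
  then show ?case by (subst cesaro_mean_Suc[abs_def])
qed

text \<open>All members have asymptotically the same Cesaro means: replacing z by T z changes the
  mean by a telescoping term of norm at most 2/n times the norm of z, and convex combinations
  preserve the property.\<close>

lemma orbit_hull_Lp:
  assumes p: "1 \<le> p" and T: "Lp_contraction m p T" and f: "f \<in> Lp m p" and z: "z \<in> orbit_hull m T f"
  shows "z \<in> Lp m p"
    and "(\<lambda>n. Lp_norm m p (\<lambda>x. cesaro_mean T n f x - cesaro_mean T n z x)) \<longlonglongrightarrow> 0"
proof -
  have B: "bounded_Lp_operator m p T" using T by (simp add: Lp_contraction_def)
  note C = cesaro_mean_Lp[OF p B]
  have "z \<in> Lp m p \<and> (\<lambda>n. Lp_norm m p (\<lambda>x. cesaro_mean T n f x - cesaro_mean T n z x)) \<longlonglongrightarrow> 0"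
    using z
  proof induction
    case base
    then show ?case using f by simp
  next
    case (step z)
    then have z: "z \<in> Lp m p" by simp
    have Tz: "T z \<in> Lp m p" using z B by (rule bounded_Lp_closed[rotated])
    have bd: "Lp_norm m p (\<lambda>x. cesaro_mean T n f x - cesaro_mean T n (T z) x)
       \<le> Lp_norm m p (\<lambda>x. cesaro_mean T n f x - cesaro_mean T n z x) + 2 * Lp_norm m p z * (1 / real n)" for n
    proof -
      have "cesaro_mean T n z x - cesaro_mean T n (T z) x = (1 / of_nat n) * (T z x - (T ^^ Suc n) z x)" for x
      proof -
        have "(\<Sum>k=1..n. (T ^^ k) z x) = (\<Sum>k=1..n. (T ^^ k) (T z) x) + T z x - (T ^^ Suc n) z x"
          by (induction n) (simp_all add: funpow_swap1)
        then have "(\<Sum>k=1..n. (T ^^ k) z x) - (\<Sum>k=1..n. (T ^^ k) (T z) x) = T z x - (T ^^ Suc n) z x" by simp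
        then show ?thesis by (simp add: cesaro_mean_def diff_divide_distrib[symmetric])
      qed
      then have "Lp_norm m p (\<lambda>x. cesaro_mean T n z x - cesaro_mean T n (T z) x) = norm (1 / of_nat n :: complex) * Lp_norm m p (\<lambda>x. T z x - (T ^^ Suc n) z x)"
        using p by (simp only: Lp_norm_cmult)
      also have "\<dots> \<le> norm (1 / of_nat n :: complex) * (Lp_norm m p (T z) + Lp_norm m p ((T ^^ Suc n) z))"
        by (intro mult_left_mono Lp_norm_triangle_diff p Tz bounded_Lp_iterate(1)[OF p B z]) simp
      also have "\<dots> \<le> norm (1 / of_nat n :: complex) * (Lp_norm m p z + Lp_norm m p z)"
        using Lp_contraction_iterate[OF p T z, of 1] Lp_contraction_iterate[OF p T z, of "Suc n"]
        by (intro mult_left_mono add_mono) auto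
      finally have "Lp_norm m p (\<lambda>x. cesaro_mean T n z x - cesaro_mean T n (T z) x) \<le> 2 * Lp_norm m p z * (1 / real n)"
        by (simp add: norm_divide)
      then show ?thesis
        using Lp_norm_diff_triangle[OF p C(1)[OF f] C(1)[OF z] C(1)[OF Tz], of n n n] by simp
    qed
    have "(\<lambda>n. Lp_norm m p (\<lambda>x. cesaro_mean T n f x - cesaro_mean T n z x) + 2 * Lp_norm m p z * (1 / real n)) \<longlonglongrightarrow> 0 + 2 * Lp_norm m p z * 0"
      using step by (intro tendsto_add tendsto_mult tendsto_const lim_1_over_n) auto
    then have "(\<lambda>n. Lp_norm m p (\<lambda>x. cesaro_mean T n f x - cesaro_mean T n (T z) x)) \<longlonglongrightarrow> 0"
      using Lp_norm_tendsto_0[OF bd] by simp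
    then show ?case using Tz by simp
  next
    case (comb z w t)
    then have zw: "z \<in> Lp m p" "w \<in> Lp m p" by auto
    let ?v = "\<lambda>x. of_real t * z x + of_real (1 - t) * w x"
    have L: "?v \<in> Lp m p" by (intro Lp_add Lp_cmult p zw)
    have bd: "Lp_norm m p (\<lambda>x. cesaro_mean T n f x - cesaro_mean T n ?v x)
      \<le> t * Lp_norm m p (\<lambda>x. cesaro_mean T n f x - cesaro_mean T n z x) + (1 - t) * Lp_norm m p (\<lambda>x. cesaro_mean T n f x - cesaro_mean T n w x)" for n
    proof -
      have "AE x in m. cesaro_mean T n ?v x = cesaro_mean T n (\<lambda>x. of_real t * z x) x + cesaro_mean T n (\<lambda>x. of_real (1 - t) * w x) x"
        "AE x in m. cesaro_mean T n (\<lambda>x. of_real t * z x) x = of_real t * cesaro_mean T n z x"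
        "AE x in m. cesaro_mean T n (\<lambda>x. of_real (1 - t) * w x) x = of_real (1 - t) * cesaro_mean T n w x"
        by (intro C Lp_cmult zw)+
      then have ae: "AE x in m. cesaro_mean T n f x - cesaro_mean T n ?v x = of_real t * (cesaro_mean T n f x - cesaro_mean T n z x)
           + of_real (1 - t) * (cesaro_mean T n f x - cesaro_mean T n w x)"
        by eventually_elim (simp add: algebra_simps)
      have "Lp_norm m p (\<lambda>x. cesaro_mean T n f x - cesaro_mean T n ?v x) = Lp_norm m p (\<lambda>x. of_real t * (cesaro_mean T n f x - cesaro_mean T n z x)
           + of_real (1 - t) * (cesaro_mean T n f x - cesaro_mean T n w x))"
        by (rule Lp_norm_cong_AE[OF _ _ ae]; intro Lp_measurable[of _ _ p] Lp_add Lp_diff Lp_cmult p C f L zw)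
      also have "\<dots> \<le> Lp_norm m p (\<lambda>x. of_real t * (cesaro_mean T n f x - cesaro_mean T n z x))
         + Lp_norm m p (\<lambda>x. of_real (1 - t) * (cesaro_mean T n f x - cesaro_mean T n w x))"
        by (intro Lp_norm_triangle Lp_cmult Lp_diff p C f zw)
      also have "\<dots> = t * Lp_norm m p (\<lambda>x. cesaro_mean T n f x - cesaro_mean T n z x) + (1 - t) * Lp_norm m p (\<lambda>x. cesaro_mean T n f x - cesaro_mean T n w x)"
        using p comb by (simp add: Lp_norm_cmult norm_of_real del: of_real_diff)
      finally show ?thesis .
    qed
    have "(\<lambda>n. t * Lp_norm m p (\<lambda>x. cesaro_mean T n f x - cesaro_mean T n z x) + (1 - t) * Lp_norm m p (\<lambda>x. cesaro_mean T n f x - cesaro_mean T n w x)) \<longlonglongrightarrow> t * 0 + (1 - t) * 0"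
      using comb by (intro tendsto_intros) auto
    then have "(\<lambda>n. Lp_norm m p (\<lambda>x. cesaro_mean T n f x - cesaro_mean T n ?v x)) \<longlonglongrightarrow> 0"
      using Lp_norm_tendsto_0[OF bd] by simp
    then show ?case using L by simp
  qed
  then show "z \<in> Lp m p"
    and "(\<lambda>n. Lp_norm m p (\<lambda>x. cesaro_mean T n f x - cesaro_mean T n z x)) \<longlonglongrightarrow> 0" by auto
qed

text \<open>Take z in the hull with norm close to the infimum D. The means of z have norm at most
  that of z, while midpoints of two such means lie in the hull and have norm at least D. Uniform
  convexity makes the means of z close to each other, and those of f follow them.\<close>

lemma Lp_contraction_cesaro_Cauchy:
  assumes p: "1 < p" and T: "Lp_contraction m p T" and f: "f \<in> Lp m p" and e: "0 < e"
  shows "\<exists>N. \<forall>i\<ge>N. \<forall>j\<ge>N. Lp_norm m p (\<lambda>x. cesaro_mean T i f x - cesaro_mean T j f x) \<le> e"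
proof -
  have p1: "1 \<le> p" using p by simp
  have B: "bounded_Lp_operator m p T" using T by (simp add: Lp_contraction_def)
  note C = cesaro_mean_Lp[OF p1 B]
  define D where "D = (INF z\<in>orbit_hull m T f. Lp_norm m p z)"
  have D: "0 \<le> D" "\<And>z. z \<in> orbit_hull m T f \<Longrightarrow> D \<le> Lp_norm m p z"
    unfolding D_def by (auto intro!: cINF_greatest cINF_lower bdd_belowI[of _ 0] orbit_hull.base)
  obtain d where d: "0 < d" "\<forall>f\<in>Lp m p. \<forall>g\<in>Lp m p. Lp_norm m p f \<le> D + d \<longrightarrow> Lp_norm m p g \<le> D + d \<longrightarrow>
     D - d \<le> Lp_norm m p (\<lambda>x. (f x + g x) / 2) \<longrightarrow> Lp_norm m p (\<lambda>x. f x - g x) \<le> e / 2"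
    using Lp_uniform_convexity[OF p half_gt_zero[OF e] D(1)] by blast
  obtain z where z: "z \<in> orbit_hull m T f" "Lp_norm m p z < D + d"
  proof -
    have "D < D + d" using d by simp
    then have "\<exists>z\<in>orbit_hull m T f. Lp_norm m p z < D + d"
      unfolding D_def by (subst (asm) cINF_less_iff) (auto intro!: bdd_belowI[of _ 0] intro: orbit_hull.base)
    then show ?thesis using that by blast
  qed
  note zL = orbit_hull_Lp[OF p1 T f z(1)]
  have 1: "Lp_norm m p (\<lambda>x. cesaro_mean T i z x - cesaro_mean T j z x) \<le> e / 2" if "1 \<le> i" "1 \<le> j" for i j
  proof -
    have "(\<lambda>x. of_real (1/2) * cesaro_mean T i z x + of_real (1 - 1/2) * cesaro_mean T j z x) \<in> orbit_hull m T f"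
      by (intro orbit_hull.comb orbit_hull_cesaro z that) auto
    then have "D \<le> Lp_norm m p (\<lambda>x. of_real (1/2) * cesaro_mean T i z x + of_real (1 - 1/2) * cesaro_mean T j z x)" by (rule D)
    also have "(\<lambda>x. of_real (1/2) * cesaro_mean T i z x + of_real (1 - 1/2) * cesaro_mean T j z x) = (\<lambda>x. (cesaro_mean T i z x + cesaro_mean T j z x) / 2)"
      by (simp add: add_divide_distrib)
    finally have "D - d \<le> Lp_norm m p (\<lambda>x. (cesaro_mean T i z x + cesaro_mean T j z x) / 2)" using d by simp
    moreover have "Lp_norm m p (cesaro_mean T k z) \<le> D + d" for k
      using Lp_contraction_cesaro[OF p1 T zL(1), of k] z by simp
    ultimately show ?thesis using d(2) C(1)[OF zL(1)] by blast
  qed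
  have "\<forall>\<^sub>F n in sequentially. Lp_norm m p (\<lambda>x. cesaro_mean T n f x - cesaro_mean T n z x) < e / 4"
    using zL(2) e by (intro order_tendstoD(2)) auto
  then obtain N where N: "\<And>n. N \<le> n \<Longrightarrow> Lp_norm m p (\<lambda>x. cesaro_mean T n f x - cesaro_mean T n z x) < e / 4"
    by (auto simp: eventually_sequentially)
  have "Lp_norm m p (\<lambda>x. cesaro_mean T i f x - cesaro_mean T j f x) \<le> e" if "max N 1 \<le> i" "max N 1 \<le> j" for i j
  proof -
    have "Lp_norm m p (\<lambda>x. cesaro_mean T i f x - cesaro_mean T j f x) \<le> Lp_norm m p (\<lambda>x. cesaro_mean T i f x - cesaro_mean T i z x)
        + Lp_norm m p (\<lambda>x. cesaro_mean T i z x - cesaro_mean T j f x)"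
      by (intro Lp_norm_diff_triangle p1 C f zL)
    also have "Lp_norm m p (\<lambda>x. cesaro_mean T i z x - cesaro_mean T j f x) \<le> Lp_norm m p (\<lambda>x. cesaro_mean T i z x - cesaro_mean T j z x)
        + Lp_norm m p (\<lambda>x. cesaro_mean T j z x - cesaro_mean T j f x)"
      by (intro Lp_norm_diff_triangle p1 C f zL)
    finally show ?thesis
      using 1[of i j] N[of i] N[of j] that Lp_norm_diff_commute[of m p "cesaro_mean T j z" "cesaro_mean T j f"] by simp
  qed
  then show ?thesis by blast
qed

lemma Lp_contraction_mean_ergodic:
  assumes p: "1 < p" and T: "Lp_contraction m p T"
  shows "mean_ergodic m p T"
proof (rule mean_ergodicI[OF _ T])
  have p1: "1 \<le> p" using p by simp
  have B: "bounded_Lp_operator m p T" using T by (simp add: Lp_contraction_def)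
  show "\<exists>g\<in>Lp m p. (\<lambda>n. Lp_norm m p (\<lambda>x. cesaro_mean T n f x - g x)) \<longlonglongrightarrow> 0" if "f \<in> Lp m p" for f
    using Lp_complete[OF p1 cesaro_mean_Lp(1)[OF p1 B that] Lp_contraction_cesaro_Cauchy[OF p T that]] .
qed (use p in simp)

text \<open>Jensen's inequality for a measure of total mass c, from the tangent at the mean value I
  / c.\<close>

lemma integral_powr_le:
  fixes h :: "'a \<Rightarrow> real"
  assumes "finite_measure M" "1 \<le> p" "h \<in> borel_measurable M" "\<And>x. 0 \<le> h x" "integrable M (\<lambda>x. h x powr p)"
  shows "integrable M h" and "(LINT x|M. h x) powr p \<le> measure M (space M) powr (p - 1) * (LINT x|M. h x powr p)"
proof -
  interpret finite_measure M by fact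
  have le: "h x \<le> 1 + h x powr p" for x
  proof (cases "h x \<le> 1")
    case False
    then have "h x powr 1 \<le> h x powr p" using assms by (intro powr_mono) auto
    then show ?thesis using False assms by simp
  qed (use powr_ge_zero[of "h x" p] in linarith)
  show h: "integrable M h"
    by (rule Bochner_Integration.integrable_bound[where f = "\<lambda>x. 1 + h x powr p"]) (use assms le in auto)
  define c where "c = measure M (space M)"
  define I where "I = (LINT x|M. h x)"
  have I0: "0 \<le> I" unfolding I_def using assms by simp
  have "I powr p \<le> c powr (p - 1) * (LINT x|M. h x powr p)"
  proof (cases "I = 0")
    case True
    then show ?thesis using assms by simp
  next
    case False
    then have I: "0 < I" using I0 by simp
    have "c \<noteq> 0"
    proof
      assume "c = 0"
      then have "emeasure M (space M) = 0" by (simp add: c_def emeasure_eq_measure)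
      then have "AE x in M. h x = 0" by (intro AE_I[of _ _ "space M"]) auto
      then have "I = 0" unfolding I_def by (simp add: integral_eq_zero_AE)
      then show False using False by simp
    qed
    then have c: "0 < c" by (simp add: c_def order_less_le)
    define a where "a = I / c"
    have a: "0 < a" using c I by (simp add: a_def)
    have "a powr p * c = (LINT x|M. a powr p + p * a powr (p - 1) * (h x - a))"
      using h c by (simp add: c_def[symmetric] I_def[symmetric] a_def field_simps)
    also have "\<dots> \<le> (LINT x|M. h x powr p)"
      using h assms a by (intro integral_mono powr_above_tangent) auto
    finally have "c powr (p - 1) * (a powr p * c) \<le> c powr (p - 1) * (LINT x|M. h x powr p)"
      by (intro mult_left_mono) auto
    moreover have "c powr (p - 1) * (a powr p * c) = I powr p"
      using c I by (simp add: a_def powr_divide powr_diff)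
    ultimately show ?thesis by simp
  qed
  then show "(LINT x|M. h x) powr p \<le> measure M (space M) powr (p - 1) * (LINT x|M. h x powr p)"
    by (simp add: I_def c_def)
qed

text \<open>Truncations of f lie in L^2, where the means are Cauchy, and on a finite measure space
  the L^2 norm controls the L^1 norm. Contractivity in L^1 bounds the truncation error uniformly in
  the number of averaged iterates.\<close>

lemma L1_contraction_mean_ergodic:
  assumes fin: "finite_measure m" and T1: "Lp_contraction m 1 T" and T2: "Lp_contraction m 2 T"
  shows "mean_ergodic m 1 T"
proof (rule mean_ergodicI[OF order_refl T1])
  interpret finite_measure m by fact
  fix f assume f: "f \<in> Lp m 1"
  have B: "bounded_Lp_operator m 1 T" "bounded_Lp_operator m 2 T" using T1 T2 by (auto simp: Lp_contraction_def)
  note C1 = cesaro_mean_Lp[OF order_refl B(1)]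
  have C2: "h \<in> Lp m 2 \<Longrightarrow> cesaro_mean T n h \<in> Lp m 2" for h n by (rule cesaro_mean_Lp(1)[OF _ B(2)]) simp
  note [measurable] = Lp_measurable[OF f]
  define c where "c = sqrt (measure m (space m))"
  have L21: "h \<in> Lp m 1 \<and> Lp_norm m 1 h \<le> c * Lp_norm m 2 h" if "h \<in> Lp m 2" for h
  proof -
    have h: "integrable m (\<lambda>x. norm (h x))" "(LINT x|m. norm (h x)) powr 2 \<le> measure m (space m) powr 1 * (LINT x|m. norm (h x) powr 2)"
      using integral_powr_le[OF fin, of 2 "\<lambda>x. norm (h x)"] Lp_measurable[OF that] Lp_integrable[OF that] by auto
    have n1: "Lp_norm m 1 h = (LINT x|m. norm (h x))" by (simp add: Lp_norm_def)
    have "(Lp_norm m 1 h)\<^sup>2 \<le> measure m (space m) * (Lp_norm m 2 h)\<^sup>2"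
      using h(2) Lp_norm_powr[of 2 m h] by (simp add: n1)
    then have "Lp_norm m 1 h \<le> sqrt (measure m (space m) * (Lp_norm m 2 h)\<^sup>2)" by (intro real_le_rsqrt)
    then have "Lp_norm m 1 h \<le> c * Lp_norm m 2 h" by (simp add: c_def real_sqrt_mult)
    moreover have "h \<in> Lp m 1" using h Lp_measurable[OF that] by (simp add: Lp_def)
    ultimately show ?thesis by simp
  qed
  have c0: "0 \<le> c" by (simp add: c_def)
  show "\<exists>g\<in>Lp m 1. (\<lambda>n. Lp_norm m 1 (\<lambda>x. cesaro_mean T n f x - g x)) \<longlonglongrightarrow> 0"
  proof (rule Lp_complete[OF order_refl C1(1)[OF f]])
    fix e :: real assume e: "0 < e"
    define g where "g k x = (if norm (f x) \<le> real k then f x else 0)" for k x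
    have [measurable]: "g k \<in> borel_measurable m" for k unfolding g_def by measurable
    have g1: "g k \<in> Lp m 1" for k
      by (rule Lp_norm_dominated(1)[OF _ f]) (auto simp: g_def)
    have g2: "g k \<in> Lp m 2" for k
      unfolding Lp_def by (auto intro!: integrable_const_bound[of _ "real k powr 2"] powr_mono2 simp: g_def)
    have "(\<lambda>k. LINT x|m. norm (f x - g k x) powr 1) \<longlonglongrightarrow> (LINT x|m. 0)"
    proof (rule integral_dominated_convergence[where w = "\<lambda>x. norm (f x) powr 1"])
      show "AE x in m. (\<lambda>k. norm (f x - g k x) powr 1) \<longlonglongrightarrow> 0"
      proof (rule AE_I2, rule tendsto_eventually)
        fix x
        show "\<forall>\<^sub>F k in sequentially. norm (f x - g k x) powr 1 = 0"
          using eventually_ge_at_top[of "nat \<lceil>norm (f x)\<rceil>"]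
          by eventually_elim (simp add: g_def nat_le_iff ceiling_le_iff)
      qed
    qed (use Lp_integrable[OF f] in \<open>auto simp: g_def\<close>)
    then have "\<forall>\<^sub>F k in sequentially. (LINT x|m. norm (f x - g k x) powr 1) < e / 4"
      using e by (intro order_tendstoD(2)) auto
    then obtain k where "(LINT x|m. norm (f x - g k x) powr 1) < e / 4"
      by (meson eventually_happens trivial_limit_sequentially)
    then have k: "Lp_norm m 1 (\<lambda>x. f x - g k x) < e / 4" by (simp add: Lp_norm_def)
    obtain N where N: "\<forall>i\<ge>N. \<forall>j\<ge>N. Lp_norm m 2 (\<lambda>x. cesaro_mean T i (g k) x - cesaro_mean T j (g k) x) \<le> e / (2 * (c + 1))"
      using Lp_contraction_cesaro_Cauchy[OF _ T2 g2, of "e / (2 * (c + 1))" k] e c0 by auto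
    have 1: "Lp_norm m 1 (\<lambda>x. cesaro_mean T i f x - cesaro_mean T i (g k) x) < e / 4" for i
    proof -
      have fg: "(\<lambda>x. f x - g k x) \<in> Lp m 1" by (intro Lp_diff f g1) simp
      have "AE x in m. cesaro_mean T i (\<lambda>x. (f x - g k x) + g k x) x = cesaro_mean T i (\<lambda>x. f x - g k x) x + cesaro_mean T i (g k) x"
        by (intro C1 g1 fg)
      then have "AE x in m. cesaro_mean T i f x - cesaro_mean T i (g k) x = cesaro_mean T i (\<lambda>x. f x - g k x) x"
        by (auto elim: eventually_mono)
      then have "Lp_norm m 1 (\<lambda>x. cesaro_mean T i f x - cesaro_mean T i (g k) x) = Lp_norm m 1 (cesaro_mean T i (\<lambda>x. f x - g k x))"
        by (intro Lp_norm_cong_AE) (auto intro!: Lp_diff Lp_measurable[of _ _ 1] C1 f g1 fg)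
      then show ?thesis using Lp_contraction_cesaro[OF order_refl T1 fg, of i] k by simp
    qed
    have "Lp_norm m 1 (\<lambda>x. cesaro_mean T i f x - cesaro_mean T j f x) \<le> e" if "N \<le> i" "N \<le> j" for i j
    proof -
      have "Lp_norm m 1 (\<lambda>x. cesaro_mean T i f x - cesaro_mean T j f x) \<le> Lp_norm m 1 (\<lambda>x. cesaro_mean T i f x - cesaro_mean T i (g k) x)
          + Lp_norm m 1 (\<lambda>x. cesaro_mean T i (g k) x - cesaro_mean T j f x)"
        by (intro Lp_norm_diff_triangle order_refl C1 f g1)
      also have "Lp_norm m 1 (\<lambda>x. cesaro_mean T i (g k) x - cesaro_mean T j f x) \<le> Lp_norm m 1 (\<lambda>x. cesaro_mean T i (g k) x - cesaro_mean T j (g k) x)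
          + Lp_norm m 1 (\<lambda>x. cesaro_mean T j (g k) x - cesaro_mean T j f x)"
        by (intro Lp_norm_diff_triangle order_refl C1 f g1)
      also have "Lp_norm m 1 (\<lambda>x. cesaro_mean T j (g k) x - cesaro_mean T j f x) = Lp_norm m 1 (\<lambda>x. cesaro_mean T j f x - cesaro_mean T j (g k) x)"
        by (rule Lp_norm_diff_commute)
      also have "Lp_norm m 1 (\<lambda>x. cesaro_mean T i (g k) x - cesaro_mean T j (g k) x) \<le> c * (e / (2 * (c + 1)))"
      proof -
        have "Lp_norm m 1 (\<lambda>x. cesaro_mean T i (g k) x - cesaro_mean T j (g k) x) \<le> c * Lp_norm m 2 (\<lambda>x. cesaro_mean T i (g k) x - cesaro_mean T j (g k) x)"
          using L21[OF Lp_diff[OF _ C2[OF g2] C2[OF g2]]] by auto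
        then show ?thesis using N that c0 by (meson mult_left_mono order.trans)
      qed
      also have "c * (e / (2 * (c + 1))) \<le> e / 2" using e c0 by (simp add: field_simps)
      finally show ?thesis using 1[of i] 1[of j] by simp
    qed
    then show "\<exists>N. \<forall>i\<ge>N. \<forall>j\<ge>N. Lp_norm m 1 (\<lambda>x. cesaro_mean T i f x - cesaro_mean T j f x) \<le> e" by blast
  qed
qed

subsection \<open>The parts of a complex measure\<close>

text \<open>A finite sum of suprema is approached by simultaneous choices. The suprema are replaced
  one index at a time, with the terms already chosen collected in a remainder r.\<close>

lemma sum_SUP_le:
  fixes f :: "'i \<Rightarrow> 'b \<Rightarrow> ennreal"
  assumes "finite I" "\<And>i. i \<in> I \<Longrightarrow> S i \<noteq> {}"
    and "\<And>c. (\<And>i. i \<in> I \<Longrightarrow> c i \<in> S i) \<Longrightarrow> (\<Sum>i\<in>I. f i (c i)) \<le> R"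
  shows "(\<Sum>i\<in>I. SUP x\<in>S i. f i x) \<le> R"
proof -
  have "(\<Sum>i\<in>I. SUP x\<in>S i. f i x) + r \<le> R"
    if "finite I" "\<And>i. i \<in> I \<Longrightarrow> S i \<noteq> {}"
      "\<And>c. (\<And>i. i \<in> I \<Longrightarrow> c i \<in> S i) \<Longrightarrow> (\<Sum>i\<in>I. f i (c i)) + r \<le> R" for I r
    using that
  proof (induction I arbitrary: r rule: finite_induct)
    case (insert j I)
    have "(\<Sum>i\<in>I. SUP x\<in>S i. f i x) + (f j x + r) \<le> R" if x: "x \<in> S j" for x
    proof (rule insert.IH)
      fix c assume c: "\<And>i. i \<in> I \<Longrightarrow> c i \<in> S i"
      have "(\<Sum>i\<in>insert j I. f i ((c(j := x)) i)) + r \<le> R"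
        by (rule insert.prems(2)) (use c x in auto)
      moreover have "(\<Sum>i\<in>I. f i ((c(j := x)) i)) = (\<Sum>i\<in>I. f i (c i))"
        using insert by (intro sum.cong) auto
      ultimately show "(\<Sum>i\<in>I. f i (c i)) + (f j x + r) \<le> R"
        using insert by (simp add: ac_simps)
    qed (use insert in auto)
    then have "(SUP x\<in>S j. f j x + ((\<Sum>i\<in>I. SUP x\<in>S i. f i x) + r)) \<le> R"
      by (intro SUP_least) (simp add: ac_simps)
    then have "(SUP x\<in>S j. f j x) + ((\<Sum>i\<in>I. SUP x\<in>S i. f i x) + r) \<le> R"
      using insert.prems(1)[of j] by (subst (asm) ennreal_SUP_add_left) auto
    then show ?case using insert by (simp add: ac_simps)
  qed simp
  from this[of I 0] show ?thesis using assms by simp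
qed

lemma SUP_add_SUP_le:
  fixes f g :: "'b \<Rightarrow> ennreal"
  assumes "A \<noteq> {}" "B \<noteq> {}" "\<And>x y. x \<in> A \<Longrightarrow> y \<in> B \<Longrightarrow> f x + g y \<le> R"
  shows "(SUP x\<in>A. f x) + (SUP y\<in>B. g y) \<le> R"
  unfolding ennreal_SUP_add_left[OF assms(1), symmetric] ennreal_SUP_add_right[OF assms(2)]
  using assms(3) by (intro SUP_least)

definition signed_measure :: "('a::topological_space set \<Rightarrow> real) \<Rightarrow> bool" where
  "signed_measure \<sigma> \<longleftrightarrow> (\<forall>A :: nat \<Rightarrow> 'a set. range A \<subseteq> sets borel \<longrightarrow> disjoint_family A \<longrightarrow>
     (\<lambda>i. \<sigma> (A i)) sums \<sigma> (\<Union>i. A i))"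

lemma signed_measureD:
  "signed_measure \<sigma> \<Longrightarrow> (\<And>i. A i \<in> sets borel) \<Longrightarrow> disjoint_family A \<Longrightarrow> (\<lambda>i::nat. \<sigma> (A i)) sums \<sigma> (\<Union>i. A i)"
  unfolding signed_measure_def by (meson image_subsetI)

lemma signed_measure_empty:
  assumes "signed_measure \<sigma>" shows "\<sigma> {} = 0"
proof -
  have "(\<lambda>i::nat. \<sigma> {}) sums \<sigma> (\<Union>i::nat. {})"
    using signed_measureD[OF assms, of "\<lambda>i. {}"] by (simp add: disjoint_family_on_def)
  then have "summable (\<lambda>i::nat. \<sigma> {})" by (rule sums_summable)
  then show ?thesis by (simp add: summable_const_iff)
qed

lemma signed_measure_Un:
  assumes "signed_measure \<sigma>" "A \<in> sets borel" "B \<in> sets borel" "A \<inter> B = {}"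
  shows "\<sigma> (A \<union> B) = \<sigma> A + \<sigma> B"
proof -
  have "(\<lambda>i. \<sigma> (binaryset A B i)) sums \<sigma> (\<Union>i. binaryset A B i)"
    using assms by (intro signed_measureD) (auto simp: binaryset_def disjoint_family_on_def)
  moreover have "(\<lambda>i. \<sigma> (binaryset A B i)) sums (\<sigma> A + \<sigma> B)"
    by (intro binaryset_sums signed_measure_empty assms)
  ultimately show ?thesis using sums_unique2 by (simp add: UN_binaryset_eq) blast
qed

lemma signed_measure_Diff:
  assumes "signed_measure \<sigma>" "A \<in> sets borel" "B \<in> sets borel" "B \<subseteq> A"
  shows "\<sigma> (A - B) = \<sigma> A - \<sigma> B"
proof -
  have "\<sigma> ((A - B) \<union> B) = \<sigma> (A - B) + \<sigma> B"
    using assms by (intro signed_measure_Un) auto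
  moreover have "(A - B) \<union> B = A" using assms by auto
  ultimately show ?thesis by simp
qed

lemma signed_measure_finite_UN:
  fixes A :: "nat \<Rightarrow> 'a::topological_space set"
  assumes "signed_measure \<sigma>" "\<And>i. i < n \<Longrightarrow> A i \<in> sets borel" "\<And>i j. i < n \<Longrightarrow> j < n \<Longrightarrow> i \<noteq> j \<Longrightarrow> A i \<inter> A j = {}"
  shows "\<sigma> (\<Union>i<n. A i) = (\<Sum>i<n. \<sigma> (A i))"
  using assms(2,3)
proof (induction n)
  case 0 then show ?case by (simp add: signed_measure_empty[OF assms(1)])
next
  case (Suc n)
  have "\<sigma> (A n \<union> (\<Union>i<n. A i)) = \<sigma> (A n) + \<sigma> (\<Union>i<n. A i)"
  proof (intro signed_measure_Un assms(1))
    have "A n \<inter> A i = {}" if "i < n" for i using Suc.prems(2)[of n i] that by auto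
    then show "A n \<inter> (\<Union>i<n. A i) = {}" by blast
    show "(\<Union>i<n. A i) \<in> sets borel" by (intro sets.finite_UN) (auto intro: Suc.prems(1))
  qed (auto intro: Suc.prems(1))
  moreover have "A n \<union> (\<Union>i<n. A i) = (\<Union>i<Suc n. A i)" by (auto simp: less_Suc_eq)
  ultimately show ?case using Suc by simp
qed

text \<open>The set function behind \<open>positive_part\<close>, separated from it so that
  countable additivity can be proved before the constructed measure is evaluated.\<close>

definition pos_variation :: "('a::topological_space set \<Rightarrow> real) \<Rightarrow> 'a set \<Rightarrow> ennreal" where
  "pos_variation \<sigma> A = (SUP B\<in>{B \<in> sets borel. B \<subseteq> A}. ennreal (\<sigma> B))"

text \<open>For one inequality, near-optimal subsets of the pieces are united; for the other, a
  subset of the union is cut into its intersections with the pieces and countable additivity of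
  \<open>\<sigma>\<close> is used.\<close>

lemma pos_variation_suminf:
  assumes \<sigma>: "signed_measure \<sigma>" and A: "\<And>i. A i \<in> sets borel" "disjoint_family A"
  shows "(\<Sum>i. pos_variation \<sigma> (A i)) = pos_variation \<sigma> (\<Union>i. A i)"
proof (rule antisym)
  have "(\<Sum>i<n. pos_variation \<sigma> (A i)) \<le> pos_variation \<sigma> (\<Union>i. A i)" for n
    unfolding pos_variation_def[of \<sigma> "A _"]
  proof (rule sum_SUP_le)
    fix B assume B: "\<And>i. i \<in> {..<n} \<Longrightarrow> B i \<in> {B \<in> sets borel. B \<subseteq> A i}"
    define B' where "B' i = (if 0 \<le> \<sigma> (B i) then B i else {})" for i
    have B': "B' i \<in> sets borel" "B' i \<subseteq> A i" if "i < n" for i using B[of i] that by (auto simp: B'_def)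
    have dj: "B' i \<inter> B' j = {}" if "i < n" "j < n" "i \<noteq> j" for i j
      using B'(2)[of i] B'(2)[of j] A(2) that by (fastforce simp: disjoint_family_on_def)
    have "(\<Sum>i<n. ennreal (\<sigma> (B i))) = (\<Sum>i<n. ennreal (\<sigma> (B' i)))"
      by (intro sum.cong) (auto simp: B'_def signed_measure_empty[OF \<sigma>] ennreal_neg)
    also have "\<dots> = ennreal (\<Sum>i<n. \<sigma> (B' i))"
      by (intro sum_ennreal) (auto simp: B'_def signed_measure_empty[OF \<sigma>])
    also have "(\<Sum>i<n. \<sigma> (B' i)) = \<sigma> (\<Union>i<n. B' i)"
      by (intro signed_measure_finite_UN[symmetric] \<sigma> B' dj)
    also have "ennreal \<dots> \<le> pos_variation \<sigma> (\<Union>i. A i)"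
    proof -
      have "(\<Union>i<n. B' i) \<in> sets borel" using B' by (intro sets.finite_UN) auto
      moreover have "(\<Union>i<n. B' i) \<subseteq> (\<Union>i. A i)" using B' by blast
      ultimately show ?thesis unfolding pos_variation_def by (intro SUP_upper) blast
    qed
    finally show "(\<Sum>i<n. ennreal (\<sigma> (B i))) \<le> pos_variation \<sigma> (\<Union>i. A i)" .
  qed auto
  then show "(\<Sum>i. pos_variation \<sigma> (A i)) \<le> pos_variation \<sigma> (\<Union>i. A i)"
    unfolding suminf_eq_SUP by (intro SUP_least)
  show "pos_variation \<sigma> (\<Union>i. A i) \<le> (\<Sum>i. pos_variation \<sigma> (A i))"
    unfolding pos_variation_def[of \<sigma> "\<Union>i. A i"]
  proof (rule SUP_least)
    fix B assume B: "B \<in> {B \<in> sets borel. B \<subseteq> (\<Union>i. A i)}"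
    have eq: "(\<Union>i. B \<inter> A i) = B" using B by auto
    have "(\<lambda>i. \<sigma> (B \<inter> A i)) sums \<sigma> (\<Union>i. B \<inter> A i)"
      using A B by (intro signed_measureD \<sigma>) (auto simp: disjoint_family_on_def)
    then have "(\<lambda>n. ennreal (\<Sum>i<n. \<sigma> (B \<inter> A i))) \<longlonglongrightarrow> ennreal (\<sigma> B)"
      unfolding eq sums_def by (rule tendsto_ennrealI)
    moreover have "ennreal (\<Sum>i<n. \<sigma> (B \<inter> A i)) \<le> (\<Sum>i. pos_variation \<sigma> (A i))" for n
    proof -
      have sub: "ennreal (a + b) \<le> ennreal a + ennreal b" for a b
        by (cases "0 \<le> a"; cases "0 \<le> b") (auto simp: ennreal_plus[symmetric] ennreal_neg intro!: ennreal_leI simp del: ennreal_plus)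
      have "ennreal (\<Sum>i<n. \<sigma> (B \<inter> A i)) \<le> (\<Sum>i<n. ennreal (\<sigma> (B \<inter> A i)))"
      proof (induction n)
        case (Suc n)
        show ?case using sub[of "\<Sum>i<n. \<sigma> (B \<inter> A i)" "\<sigma> (B \<inter> A n)"] Suc
          by (auto intro: order.trans add_right_mono)
      qed simp
      also have "\<dots> \<le> (\<Sum>i<n. pos_variation \<sigma> (A i))"
        unfolding pos_variation_def using A B by (intro sum_mono SUP_upper) auto
      also have "\<dots> \<le> (\<Sum>i. pos_variation \<sigma> (A i))" by (intro sum_le_suminf) auto
      finally show ?thesis .
    qed
    ultimately show "ennreal (\<sigma> B) \<le> (\<Sum>i. pos_variation \<sigma> (A i))"
      by (intro LIMSEQ_le_const2) auto
  qed
qed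

lemma
  assumes \<sigma>: "signed_measure \<sigma>"
  shows emeasure_positive_part: "A \<in> sets borel \<Longrightarrow> emeasure (positive_part \<sigma>) A = pos_variation \<sigma> A"
    and sets_positive_part: "sets (positive_part \<sigma>) = sets borel"
proof -
  have sa: "sigma_algebra UNIV (sets (borel :: 'a measure))"
    using sets.sigma_algebra_axioms[of "borel :: 'a measure"] by simp
  have pp: "positive_part \<sigma> = measure_of UNIV (sets borel) (pos_variation \<sigma>)"
    by (simp add: positive_part_def pos_variation_def[abs_def])
  show "sets (positive_part \<sigma>) = sets borel" unfolding pp
    using sigma_algebra.sets_measure_of_eq[OF sa] by simp
  have 0: "pos_variation \<sigma> {} = 0"
    by (auto simp: pos_variation_def signed_measure_empty[OF \<sigma>])
  show "A \<in> sets borel \<Longrightarrow> emeasure (positive_part \<sigma>) A = pos_variation \<sigma> A"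
    unfolding pp
    by (intro emeasure_measure_of_sigma sa) (auto simp: positive_def 0 countably_additive_def intro!: pos_variation_suminf \<sigma>)
qed

text \<open>A set A of infinite variation contains B with value above |\<sigma>(A)| + 1, so both B
  and A - B have values of modulus at least 1, and one of them again has infinite variation.
  Iterating gives disjoint differences with values of modulus at least 1, against
  summability.\<close>

lemma pos_variation_finite:
  assumes \<sigma>: "signed_measure \<sigma>"
  shows "pos_variation \<sigma> UNIV < \<infinity>"
proof (rule ccontr)
  assume "\<not> pos_variation \<sigma> UNIV < \<infinity>"
  then have top: "pos_variation \<sigma> UNIV = \<infinity>" by (simp add: less_top[symmetric])
  define P where "P A \<longleftrightarrow> A \<in> sets borel \<and> pos_variation \<sigma> A = \<infinity>" for A
  have split: "\<exists>A'. P A' \<and> A' \<subseteq> A \<and> 1 \<le> \<bar>\<sigma> (A - A')\<bar>" if "P A" for A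
  proof -
    have "ennreal (\<bar>\<sigma> A\<bar> + 1) < pos_variation \<sigma> A" using that by (simp add: P_def)
    then obtain B where B: "B \<in> sets borel" "B \<subseteq> A" "ennreal (\<bar>\<sigma> A\<bar> + 1) < ennreal (\<sigma> B)"
      unfolding pos_variation_def less_SUP_iff by blast
    have B': "\<bar>\<sigma> A\<bar> + 1 < \<sigma> B" by (rule ennreal_less_iff[THEN iffD1, OF _ B(3)]) simp
    have "emeasure (positive_part \<sigma>) (B \<union> (A - B)) = emeasure (positive_part \<sigma>) B + emeasure (positive_part \<sigma>) (A - B)"
      using B that by (intro plus_emeasure[symmetric]) (auto simp: sets_positive_part[OF \<sigma>] P_def)
    moreover have "B \<union> (A - B) = A" using B by auto
    ultimately have "pos_variation \<sigma> A = pos_variation \<sigma> B + pos_variation \<sigma> (A - B)"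
    proof -
      have "A - B \<in> sets borel" "A \<in> sets borel" using B that by (auto simp: P_def)
      from this[THEN emeasure_positive_part[OF \<sigma>]] B(1)[THEN emeasure_positive_part[OF \<sigma>]] show ?thesis
        using \<open>emeasure (positive_part \<sigma>) (B \<union> (A - B)) = _\<close> \<open>B \<union> (A - B) = A\<close> by simp
    qed
    then have "pos_variation \<sigma> B + pos_variation \<sigma> (A - B) = \<infinity>" using that by (metis P_def)
    then consider "pos_variation \<sigma> B = \<infinity>" | "pos_variation \<sigma> (A - B) = \<infinity>"
      by (auto simp: ennreal_add_eq_top)
    then show ?thesis
    proof cases
      case 1
      have "1 \<le> \<bar>\<sigma> (A - B)\<bar>" using B B' that by (simp add: signed_measure_Diff[OF \<sigma>] P_def)
      then show ?thesis using 1 B by (auto simp: P_def)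
    next
      case 2
      have "A - (A - B) = B" using B by auto
      then show ?thesis using 2 B B' that by (intro exI[of _ "A - B"]) (auto simp: P_def)
    qed
  qed
  have "\<exists>f. \<forall>n. P (f n) \<and> (f (Suc n) \<subseteq> f n \<and> 1 \<le> \<bar>\<sigma> (f n - f (Suc n))\<bar>)"
    by (rule dependent_nat_choice) (use top split in \<open>auto simp: P_def intro!: exI[of _ UNIV]\<close>)
  then obtain f where f: "\<And>n. P (f n)" "\<And>n. f (Suc n) \<subseteq> f n" "\<And>n. 1 \<le> \<bar>\<sigma> (f n - f (Suc n))\<bar>" by blast
  have dec: "f j \<subseteq> f i" if "i \<le> j" for i j using lift_Suc_antimono_le[of f, OF f(2) that] .
  have "(f i - f (Suc i)) \<inter> (f j - f (Suc j)) = {}" if "i < j" for i j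
    using dec[of "Suc i" j] that by auto
  then have "(f i - f (Suc i)) \<inter> (f j - f (Suc j)) = {}" if "i \<noteq> j" for i j
    using that by (cases "i < j") (auto simp: not_less order_le_less)
  then have "(\<lambda>i. \<sigma> (f i - f (Suc i))) sums \<sigma> (\<Union>i. f i - f (Suc i))"
    using f(1) by (intro signed_measureD \<sigma>) (auto simp: P_def disjoint_family_on_def)
  then have "(\<lambda>i. \<sigma> (f i - f (Suc i))) \<longlonglongrightarrow> 0" by (intro summable_LIMSEQ_zero sums_summable)
  then have "\<forall>\<^sub>F i in sequentially. \<bar>\<sigma> (f i - f (Suc i))\<bar> < 1"
    by (auto dest!: tendstoD[of _ _ _ 1])
  then have "\<exists>i. \<bar>\<sigma> (f i - f (Suc i))\<bar> < 1" by (meson eventually_happens trivial_limit_sequentially)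
  then obtain i where "\<bar>\<sigma> (f i - f (Suc i))\<bar> < 1" by blast
  then show False using f(3)[of i] by simp
qed

section \<open>Total variation and finite Radon measures\<close>

text \<open>Inner regularity is asked on open sets and with an absolute error, a form inherited by
  restrictions, reflections and bounded densities.\<close>

definition fin_radon :: "'a::topological_space measure \<Rightarrow> bool" where
  "fin_radon \<nu> \<longleftrightarrow> sets \<nu> = sets borel \<and> emeasure \<nu> UNIV < \<infinity> \<and>
     (\<forall>U e. open U \<longrightarrow> 0 < e \<longrightarrow> (\<exists>K. compact K \<and> K \<subseteq> U \<and> emeasure \<nu> (U - K) \<le> ennreal e))"

lemma total_variation_partition_le:
  assumes "finite P" "P \<subseteq> sets borel" "partition_on A P"
  shows "(\<Sum>E\<in>P. ennreal (norm (\<mu> E))) \<le> total_variation \<mu> A"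
  unfolding total_variation_def using assms by (intro SUP_upper) auto

text \<open>Partitions of two disjoint sets unite to a partition of the union;
  \<open>SUP_add_SUP_le\<close> lets both suprema be taken independently.\<close>

lemma total_variation_add_le:
  assumes AB: "A \<in> sets borel" "B \<in> sets borel" "A \<inter> B = {}"
  shows "total_variation \<mu> A + total_variation \<mu> B \<le> total_variation \<mu> (A \<union> B)"
proof -
  let ?S = "\<lambda>A. {P. finite P \<and> P \<subseteq> sets borel \<and> partition_on A P}"
  have ne: "?S A \<noteq> {}" if "A \<in> sets borel" for A :: "'a set"
  proof -
    \<comment> \<open>Blocks of a partition are nonempty; removing the empty set covers the case
      that A is empty.\<close>
    have "{A} - {{}} \<in> ?S A" using that by (auto simp: partition_on_def disjoint_def)
    then show ?thesis by blast
  qed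
  have "(\<Sum>E\<in>P. ennreal (norm (\<mu> E))) + (\<Sum>E\<in>Q. ennreal (norm (\<mu> E))) \<le> total_variation \<mu> (A \<union> B)"
    if P: "P \<in> ?S A" and Q: "Q \<in> ?S B" for P Q
  proof -
    have PQ: "X \<inter> Y = {}" if "X \<in> P" "Y \<in> Q" for X Y
      using that P Q AB(3) unfolding partition_on_def by blast
    have "X = {}" if "X \<in> P" "X \<in> Q" for X using PQ[OF that] by simp
    then have "P \<inter> Q = {}" using P by (auto simp: partition_on_def)
    then have "(\<Sum>E\<in>P. ennreal (norm (\<mu> E))) + (\<Sum>E\<in>Q. ennreal (norm (\<mu> E))) = (\<Sum>E\<in>P \<union> Q. ennreal (norm (\<mu> E)))"
      using P Q by (intro sum.union_disjoint[symmetric]) auto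
    also have "\<dots> \<le> total_variation \<mu> (A \<union> B)"
    proof (rule total_variation_partition_le)
      show "partition_on (A \<union> B) (P \<union> Q)"
        using P Q AB(3) unfolding partition_on_def by (auto intro!: disjoint_union)
    qed (use P Q in auto)
    finally show ?thesis .
  qed
  then show ?thesis
    unfolding total_variation_def[of \<mu> A] total_variation_def[of \<mu> B]
    by (intro SUP_add_SUP_le ne AB)
qed

lemma norm_le_total_variation:
  assumes "A \<in> sets borel" "B \<in> sets borel" "B \<subseteq> A" "\<mu> {} = 0"
  shows "ennreal (norm (\<mu> B)) \<le> total_variation \<mu> A"
proof (cases "B = {}")
  case False
  have "ennreal (norm (\<mu> B)) = (\<Sum>E\<in>{B}. ennreal (norm (\<mu> E)))" by simp
  also have "\<dots> \<le> (\<Sum>E\<in>{B, A - B} - {{}}. ennreal (norm (\<mu> E)))"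
    using False by (intro sum_mono2) auto
  also have "\<dots> \<le> total_variation \<mu> A"
    using assms by (intro total_variation_partition_le) (auto simp: partition_on_def disjoint_def)
  finally show ?thesis .
qed (use assms in simp)

lemma regular_complex_measure_parts:
  assumes \<mu>: "regular_complex_measure \<mu>"
  shows "signed_measure (\<lambda>A. Re (\<mu> A))" "signed_measure (\<lambda>A. - Re (\<mu> A))"
    "signed_measure (\<lambda>A. Im (\<mu> A))" "signed_measure (\<lambda>A. - Im (\<mu> A))"
  using \<mu> unfolding regular_complex_measure_def signed_measure_def
  by (auto intro!: sums_minus sums_Re sums_Im)

lemma regular_complex_measure_empty:
  assumes \<mu>: "regular_complex_measure \<mu>"
  shows "\<mu> {} = 0"
  using regular_complex_measure_parts[OF assms, THEN signed_measure_empty] by (simp add: complex_eq_iff)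

lemma emeasure_positive_part_eq:
  "signed_measure \<sigma> \<Longrightarrow> A \<in> sets borel \<Longrightarrow> emeasure (positive_part \<sigma>) A = (SUP B\<in>{B \<in> sets borel. B \<subseteq> A}. ennreal (\<sigma> B))"
  by (simp add: emeasure_positive_part pos_variation_def)

text \<open>The modulus of a value is at most the sum of the four one-sided variations of real and
  imaginary part. Each of these is a finite measure, so summing over any partition gives the same
  finite total.\<close>

lemma total_variation_finite:
  assumes \<mu>: "regular_complex_measure \<mu>"
  shows "total_variation \<mu> UNIV < \<infinity>"
proof -
  note s = regular_complex_measure_parts[OF \<mu>]
  define N where "N A = pos_variation (\<lambda>A. Re (\<mu> A)) A + pos_variation (\<lambda>A. - Re (\<mu> A)) A
     + pos_variation (\<lambda>A. Im (\<mu> A)) A + pos_variation (\<lambda>A. - Im (\<mu> A)) A" for A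
  have le: "ennreal (norm (\<mu> E)) \<le> N E" if E: "E \<in> sets borel" for E
  proof -
    have "ennreal (norm (\<mu> E)) \<le> ennreal (\<bar>Re (\<mu> E)\<bar> + \<bar>Im (\<mu> E)\<bar>)"
      by (intro ennreal_leI cmod_le)
    also have "\<dots> = ennreal \<bar>Re (\<mu> E)\<bar> + ennreal \<bar>Im (\<mu> E)\<bar>" by simp
    also have "ennreal \<bar>Re (\<mu> E)\<bar> \<le> ennreal (Re (\<mu> E)) + ennreal (- Re (\<mu> E))"
      by (cases "0 \<le> Re (\<mu> E)") auto
    also have "ennreal \<bar>Im (\<mu> E)\<bar> \<le> ennreal (Im (\<mu> E)) + ennreal (- Im (\<mu> E))"
      by (cases "0 \<le> Im (\<mu> E)") auto
    also have "ennreal (Re (\<mu> E)) + ennreal (- Re (\<mu> E)) + (ennreal (Im (\<mu> E)) + ennreal (- Im (\<mu> E))) \<le> N E"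
      unfolding N_def pos_variation_def add.assoc[symmetric] using E by (intro add_mono SUP_upper) auto
    finally show ?thesis by (simp add: add_mono)
  qed
  have "total_variation \<mu> UNIV \<le> N UNIV"
    unfolding total_variation_def
  proof (rule SUP_least, clarify)
    fix P :: "'a set set" assume P: "finite P" "P \<subseteq> sets borel" "partition_on UNIV P"
    have 1: "(\<Sum>E\<in>P. pos_variation \<sigma> E) = pos_variation \<sigma> UNIV" if "signed_measure \<sigma>" for \<sigma>
    proof -
      have "(\<Sum>E\<in>P. emeasure (positive_part \<sigma>) E) = emeasure (positive_part \<sigma>) (\<Union>E\<in>P. E)"
        using P that by (intro sum_emeasure) (auto simp: sets_positive_part partition_on_def disjoint_family_on_def disjoint_def)
      moreover have "(\<Union>E\<in>P. E) = UNIV" using P by (auto simp: partition_on_def)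
      moreover have "(\<Sum>E\<in>P. emeasure (positive_part \<sigma>) E) = (\<Sum>E\<in>P. pos_variation \<sigma> E)"
        using P that by (intro sum.cong) (auto simp: emeasure_positive_part)
      ultimately show ?thesis using that by (simp add: emeasure_positive_part)
    qed
    have "(\<Sum>E\<in>P. ennreal (norm (\<mu> E))) \<le> (\<Sum>E\<in>P. N E)"
      using P le by (intro sum_mono) auto
    also have "\<dots> = N UNIV"
      unfolding N_def sum.distrib 1[OF s(1)] 1[OF s(2)] 1[OF s(3)] 1[OF s(4)] ..
    finally show "(\<Sum>E\<in>P. ennreal (norm (\<mu> E))) \<le> N UNIV" .
  qed
  also have "N UNIV < \<infinity>"
    unfolding N_def using s[THEN pos_variation_finite] by simp
  finally show ?thesis .
qed

text \<open>Inner regularity is available for the total variation. Its superadditivity turns a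
  compact K of almost full variation in U into a small variation of U - K, which dominates the
  positive part there.\<close>

lemma fin_radon_positive_part:
  assumes \<mu>: "regular_complex_measure \<mu>" and \<sigma>: "signed_measure \<sigma>" and le: "\<And>A. \<sigma> A \<le> norm (\<mu> A)"
  shows "fin_radon (positive_part \<sigma> :: 'a::t2_space measure)"
  unfolding fin_radon_def
proof (intro conjI allI impI)
  show "sets (positive_part \<sigma>) = sets borel" by (rule sets_positive_part[OF \<sigma>])
  show "emeasure (positive_part \<sigma>) UNIV < \<infinity>"
    using pos_variation_finite[OF \<sigma>] by (simp add: emeasure_positive_part[OF \<sigma>])
  fix U :: "'a set" and e :: real assume U: "open U" and e: "0 < e"
  have Ub: "U \<in> sets borel" using U by simp
  have tvU: "total_variation \<mu> U = (SUP K\<in>{K. compact K \<and> K \<subseteq> U}. total_variation \<mu> K)"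
    using \<mu> Ub by (auto simp: regular_complex_measure_def inner_regular_at_def)
  have "total_variation \<mu> U \<le> total_variation \<mu> U + total_variation \<mu> (- U)" by simp
  also have "\<dots> \<le> total_variation \<mu> (U \<union> - U)"
    using Ub by (intro total_variation_add_le) auto
  finally have "total_variation \<mu> U \<le> total_variation \<mu> UNIV" by simp
  then have finU: "total_variation \<mu> U < \<infinity>"
    using total_variation_finite[OF \<mu>] by (rule le_less_trans)
  obtain K where K: "compact K" "K \<subseteq> U" "total_variation \<mu> U \<le> total_variation \<mu> K + ennreal e"
  proof (cases "total_variation \<mu> U = 0")
    case True
    then show ?thesis using that[of "{}"] by simp
  next
    case False
    then have "total_variation \<mu> U - ennreal e < total_variation \<mu> U"
      using finU e by (intro ennreal_between) (auto simp: zero_less_iff_neq_zero)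
    also note tvU
    finally obtain K where K: "compact K" "K \<subseteq> U" "total_variation \<mu> U - ennreal e < total_variation \<mu> K"
      unfolding less_SUP_iff by blast
    from K(3)[THEN less_imp_le] have "total_variation \<mu> U \<le> total_variation \<mu> K + ennreal e"
      by (simp add: ennreal_minus_le_iff add.commute)
    then show ?thesis using that K by blast
  qed
  have Kb: "K \<in> sets borel" using K by (simp add: borel_compact)
  have "total_variation \<mu> K + total_variation \<mu> (U - K) \<le> total_variation \<mu> (K \<union> (U - K))"
    using Ub Kb by (intro total_variation_add_le) auto
  also have "K \<union> (U - K) = U" using K by auto
  also note K(3)
  finally have "total_variation \<mu> K + total_variation \<mu> (U - K) \<le> total_variation \<mu> K + ennreal e" .
  moreover have "total_variation \<mu> K \<noteq> \<infinity>"
  proof -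
    have "total_variation \<mu> K \<le> total_variation \<mu> U" unfolding tvU using K by (intro SUP_upper) auto
    then show ?thesis using finU by auto
  qed
  ultimately have "total_variation \<mu> (U - K) \<le> ennreal e"
    by (simp add: ennreal_add_left_cancel_le)
  moreover have "emeasure (positive_part \<sigma>) (U - K) \<le> total_variation \<mu> (U - K)"
  proof -
    have "ennreal (\<sigma> B) \<le> total_variation \<mu> (U - K)" if "B \<in> sets borel" "B \<subseteq> U - K" for B
    proof -
      have "ennreal (\<sigma> B) \<le> ennreal (norm (\<mu> B))" by (intro ennreal_leI le)
      also have "\<dots> \<le> total_variation \<mu> (U - K)"
        using Ub Kb that regular_complex_measure_empty[OF \<mu>] by (intro norm_le_total_variation) auto
      finally show ?thesis .
    qed
    then show ?thesis using Ub Kb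
      by (simp add: emeasure_positive_part[OF \<sigma>] pos_variation_def SUP_le_iff)
  qed
  ultimately have "emeasure (positive_part \<sigma>) (U - K) \<le> ennreal e" by (rule order.trans[rotated])
  then show "\<exists>K. compact K \<and> K \<subseteq> U \<and> emeasure (positive_part \<sigma>) (U - K) \<le> ennreal e"
    using K by blast
qed

definition convolve :: "'a::topological_group_add measure \<Rightarrow> ('a \<Rightarrow> complex) \<Rightarrow> ('a \<Rightarrow> complex)" where
  "convolve \<nu> f = (\<lambda>s. LINT x|\<nu>. f (- x + s))"

lemma convolution_operator_decomposition:
  fixes \<mu> :: "'a::{topological_group_add, t2_space} set \<Rightarrow> complex"
  assumes \<mu>: "regular_complex_measure \<mu>"
  obtains \<nu>1 \<nu>2 \<nu>3 \<nu>4 :: "'a measure" where "fin_radon \<nu>1" "fin_radon \<nu>2" "fin_radon \<nu>3" "fin_radon \<nu>4"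
    "convolution_operator \<mu> = (\<lambda>f s. convolve \<nu>1 f s - convolve \<nu>2 f s + \<i> * (convolve \<nu>3 f s - convolve \<nu>4 f s))"
proof (rule that)
  note s = regular_complex_measure_parts[OF \<mu>]
  have "- x \<le> \<bar>x\<bar>" for x :: real by simp
  then have m: "- Re z \<le> norm z" "- Im z \<le> norm z" for z
    using abs_Re_le_cmod abs_Im_le_cmod order.trans by blast+
  show "fin_radon (positive_part (\<lambda>A. Re (\<mu> A)))" "fin_radon (positive_part (\<lambda>A. - Re (\<mu> A)))"
    "fin_radon (positive_part (\<lambda>A. Im (\<mu> A)))" "fin_radon (positive_part (\<lambda>A. - Im (\<mu> A)))"
    using m complex_Re_le_cmod abs_Im_le_cmod[THEN abs_le_D1] by (auto intro!: fin_radon_positive_part[OF \<mu>] s)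
  show "convolution_operator \<mu> = (\<lambda>f s. convolve (positive_part (\<lambda>A. Re (\<mu> A))) f s - convolve (positive_part (\<lambda>A. - Re (\<mu> A))) f s
     + \<i> * (convolve (positive_part (\<lambda>A. Im (\<mu> A))) f s - convolve (positive_part (\<lambda>A. - Im (\<mu> A))) f s))"
    by (simp add: fun_eq_iff convolution_operator_def complex_measure_integral_def convolve_def)
qed

text \<open>Three of the four parts vanish, and the remaining one takes the values of
  \<open>\<mu>\<close> itself. All partitions then give the same sum, so the total variation is the
  total mass.\<close>

lemma positive_complex_measure_convolve:
  fixes \<mu> :: "'a::{topological_group_add, t2_space} set \<Rightarrow> complex"
  assumes \<mu>: "regular_complex_measure \<mu>" and pos: "positive_complex_measure \<mu>"
  obtains \<nu> :: "'a measure" where "fin_radon \<nu>" "convolution_operator \<mu> = convolve \<nu>" "measure_norm \<mu> = emeasure \<nu> UNIV"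
proof (rule that)
  note s = regular_complex_measure_parts[OF \<mu>]
  have P: "0 \<le> Re (\<mu> A)" "Im (\<mu> A) = 0" "norm (\<mu> A) = Re (\<mu> A)" if "A \<in> sets borel" for A
    using pos that by (auto simp: positive_complex_measure_def complex_nonneg_Reals_iff cmod_eq_Re)
  define \<nu> where "\<nu> = positive_part (\<lambda>A. Re (\<mu> A))"
  show "fin_radon \<nu>" unfolding \<nu>_def
    by (intro fin_radon_positive_part[OF \<mu>] s complex_Re_le_cmod)
  have \<nu>: "emeasure \<nu> A = ennreal (Re (\<mu> A))" if A: "A \<in> sets borel" for A
    unfolding \<nu>_def emeasure_positive_part_eq[OF s(1) A]
  proof (rule antisym)
    show "(SUP B\<in>{B \<in> sets borel. B \<subseteq> A}. ennreal (Re (\<mu> B))) \<le> ennreal (Re (\<mu> A))"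
    proof (intro SUP_least ennreal_leI, clarify)
      fix B assume "B \<in> sets borel" "B \<subseteq> A"
      then show "Re (\<mu> B) \<le> Re (\<mu> A)"
        using signed_measure_Diff[OF s(1) A, of B] P(1)[of "A - B"] A by auto
    qed
  qed (use A in \<open>auto intro!: SUP_upper\<close>)
  have null: "(LINT x|positive_part \<sigma>. f x) = 0" if "signed_measure \<sigma>" "\<And>A. A \<in> sets borel \<Longrightarrow> \<sigma> A \<le> 0" for \<sigma> and f :: "'a \<Rightarrow> complex"
  proof -
    have "emeasure (positive_part \<sigma>) UNIV = 0"
      using that by (simp add: emeasure_positive_part_eq ennreal_neg bot_ennreal[symmetric] SUP_eq_iff)
    then have "AE x in positive_part \<sigma>. f x = 0"
      by (intro AE_I[of _ _ UNIV]) (auto simp: sets_positive_part[OF that(1)])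
    then show ?thesis by (rule integral_eq_zero_AE)
  qed
  have n: "(LINT x|positive_part (\<lambda>A. - Re (\<mu> A)). f x) = 0" "(LINT x|positive_part (\<lambda>A. Im (\<mu> A)). f x) = 0"
    "(LINT x|positive_part (\<lambda>A. - Im (\<mu> A)). f x) = 0" for f :: "'a \<Rightarrow> complex"
    by (intro null s; use P in auto)+
  show "convolution_operator \<mu> = convolve \<nu>"
    by (simp add: fun_eq_iff convolution_operator_def complex_measure_integral_def convolve_def n \<nu>_def)
  have sum: "(\<Sum>E\<in>P. ennreal (norm (\<mu> E))) = emeasure \<nu> UNIV"
    if "finite P" "P \<subseteq> sets borel" "partition_on UNIV P" for P
  proof -
    have "(\<Sum>E\<in>P. emeasure \<nu> E) = emeasure \<nu> (\<Union>E\<in>P. E)"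
      using that s(1) by (intro sum_emeasure) (auto simp: \<nu>_def sets_positive_part partition_on_def disjoint_family_on_def disjoint_def)
    moreover have "(\<Union>E\<in>P. E) = UNIV" using that by (auto simp: partition_on_def)
    moreover have "(\<Sum>E\<in>P. emeasure \<nu> E) = (\<Sum>E\<in>P. ennreal (norm (\<mu> E)))"
      using that by (intro sum.cong) (auto simp: \<nu> P)
    ultimately show ?thesis by simp
  qed
  show "measure_norm \<mu> = emeasure \<nu> UNIV"
  proof (rule antisym)
    show "measure_norm \<mu> \<le> emeasure \<nu> UNIV"
      unfolding total_variation_def by (rule SUP_least) (use sum in auto)
    have "emeasure \<nu> UNIV = ennreal (norm (\<mu> UNIV))" by (simp add: \<nu> P)
    also have "\<dots> \<le> measure_norm \<mu>"
      using regular_complex_measure_empty[OF \<mu>] by (intro norm_le_total_variation) auto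
    finally show "emeasure \<nu> UNIV \<le> measure_norm \<mu>" .
  qed
qed

subsection \<open>Convolution with a finite positive measure\<close>

lemma
  fixes \<nu> :: "'a::t2_space measure"
  assumes "fin_radon \<nu>"
  shows fin_radon_sets [measurable_cong]: "sets \<nu> = sets borel"
    and fin_radon_space: "space \<nu> = UNIV"
    and fin_radon_finite: "finite_measure \<nu>"
    and fin_radon_emeasure: "emeasure \<nu> A = ennreal (measure \<nu> A)"
proof -
  show s: "sets \<nu> = sets borel" using assms by (simp add: fin_radon_def)
  then show sp: "space \<nu> = UNIV" by (simp add: sets_eq_imp_space_eq)
  show "finite_measure \<nu>" using assms sp by (intro finite_measureI) (auto simp: fin_radon_def)
  then show "emeasure \<nu> A = ennreal (measure \<nu> A)" by (rule finite_measure.emeasure_eq_measure)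
qed

lemma fin_radon_inner:
  fixes \<nu> :: "'a::t2_space measure"
  assumes \<nu>: "fin_radon \<nu>" and U: "open U" and t: "t < emeasure \<nu> U"
  obtains K where "compact K" "K \<subseteq> U" "t < emeasure \<nu> K"
proof -
  note s = fin_radon_sets[OF \<nu>]
  obtain r where r: "t = ennreal r" "0 \<le> r" using t by (cases t) auto
  define q where "q = measure \<nu> U"
  have q: "emeasure \<nu> U = ennreal q" by (simp add: q_def fin_radon_emeasure[OF \<nu>])
  have rq: "r < q" using t r by (simp add: q ennreal_less_iff)
  define e where "e = (q - r) / 2"
  have e: "0 < e" using rq by (simp add: e_def)
  obtain K where K: "compact K" "K \<subseteq> U" "emeasure \<nu> (U - K) \<le> ennreal e"
    using \<nu> U e unfolding fin_radon_def by blast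
  have Ks: "K \<in> sets borel" "U \<in> sets borel" using K U by (auto simp: borel_compact)
  have "ennreal q = emeasure \<nu> (K \<union> (U - K))" using K q by (simp add: Un_absorb1)
  also have "\<dots> \<le> emeasure \<nu> K + emeasure \<nu> (U - K)"
    using Ks by (intro emeasure_subadditive) (auto simp: s)
  also have "\<dots> \<le> ennreal (measure \<nu> K) + ennreal e"
    using K by (intro add_mono) (auto simp: fin_radon_emeasure[OF \<nu>])
  finally have "q \<le> measure \<nu> K + e" using e by (simp add: ennreal_plus[symmetric] del: ennreal_plus)
  then have "r < measure \<nu> K" using rq by (simp add: e_def field_simps)
  then show ?thesis using that[OF K(1,2)] r by (simp add: fin_radon_emeasure[OF \<nu>] ennreal_less_iff)
qed

text \<open>A substitute for the Lindelof property: up to a null set the measure on G is carried by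
  countably many compact sets, each covered by finitely many of the prescribed neighbourhoods.
  Making the resulting sequence disjoint gives a countable partition as fine as desired.\<close>

lemma fin_radon_partition:
  fixes \<nu> :: "'a::t2_space measure"
  assumes \<nu>: "fin_radon \<nu>" and G: "open G" "G \<noteq> {}" and N: "\<And>x. x \<in> G \<Longrightarrow> open (N x) \<and> x \<in> N x"
  shows "\<exists>(x :: nat \<Rightarrow> 'a) E. (\<forall>i. x i \<in> G) \<and> (\<forall>i. E i \<in> sets borel) \<and> disjoint_family E \<and>
    (\<forall>i. E i \<subseteq> N (x i) \<inter> G) \<and> emeasure \<nu> (G - (\<Union>i. E i)) = 0"
proof -
  note s = fin_radon_sets[OF \<nu>]
  have "\<exists>K. compact K \<and> K \<subseteq> G \<and> emeasure \<nu> (G - K) \<le> ennreal (1 / real (Suc n))" for n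
    using \<nu> G unfolding fin_radon_def by auto
  then obtain K where K: "\<And>n. compact (K n)" "\<And>n. K n \<subseteq> G" "\<And>n. emeasure \<nu> (G - K n) \<le> ennreal (1 / real (Suc n))"
    by metis
  have "\<exists>F. F \<subseteq> K n \<and> finite F \<and> K n \<subseteq> (\<Union>y\<in>F. N y)" for n
  proof -
    have o: "open (N y) \<and> y \<in> N y" if "y \<in> K n" for y using N K(2)[of n] that by blast
    then have "K n \<subseteq> (\<Union>y\<in>K n. N y)" by blast
    from compactE_image[OF K(1) _ this] o show ?thesis by metis
  qed
  then obtain F where F: "\<And>n. F n \<subseteq> K n" "\<And>n. finite (F n)" "\<And>n. K n \<subseteq> (\<Union>y\<in>F n. N y)"
    by metis
  obtain g where g: "g \<in> G" using G by blast
  \<comment> \<open>The extra point keeps D nonempty, as its enumeration by the naturals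
    requires.\<close>
  define D where "D = insert g (\<Union>n. F n)"
  have D: "countable D" "D \<noteq> {}" "D \<subseteq> G"
  proof -
    have "countable (\<Union>n. F n)" using F(2) by (intro countable_UN) (auto intro: countable_finite)
    moreover have "F n \<subseteq> G" for n using F(1) K(2) by (rule order.trans)
    ultimately show "countable D" "D \<noteq> {}" "D \<subseteq> G" using g by (auto simp: D_def)
  qed
  define x where "x = from_nat_into D"
  have x: "range x = D" using D by (simp add: x_def)
  define E where "E = disjointed (\<lambda>i. N (x i) \<inter> G)"
  have xG: "x i \<in> G" for i using x D by blast
  have UE: "(\<Union>i. E i) = (\<Union>y\<in>D. N y \<inter> G)"
    unfolding E_def UN_disjointed_eq unfolding x[symmetric] by simp
  have Eb: "E i \<in> sets borel" for i
  proof -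
    have "range E \<subseteq> sets borel" unfolding E_def
      using N xG G by (intro sets.range_disjointed_sets) auto
    then show ?thesis by blast
  qed
  have "emeasure \<nu> (G - (\<Union>i. E i)) \<le> ennreal (1 / real (Suc n))" for n
  proof -
    have "G - (\<Union>i. E i) \<subseteq> G - K n" unfolding UE using F(3)[of n] by (auto simp: D_def)
    then have "emeasure \<nu> (G - (\<Union>i. E i)) \<le> emeasure \<nu> (G - K n)"
      using G K by (intro emeasure_mono) (auto simp: s borel_compact)
    then show ?thesis using K(3) by (rule order.trans)
  qed
  then have "measure \<nu> (G - (\<Union>i. E i)) \<le> inverse (real (Suc n))" for n
    by (simp add: fin_radon_emeasure[OF \<nu>] inverse_eq_divide)
  then have "measure \<nu> (G - (\<Union>i. E i)) \<le> 0"
    by (intro LIMSEQ_le_const[OF LIMSEQ_inverse_real_of_nat]) auto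
  then have "emeasure \<nu> (G - (\<Union>i. E i)) = 0"
    by (simp add: fin_radon_emeasure[OF \<nu>] measure_le_0_iff)
  moreover have "E i \<subseteq> N (x i) \<inter> G" for i unfolding E_def by (rule disjointed_subset)
  moreover have "disjoint_family E" unfolding E_def by (rule disjoint_family_disjointed)
  ultimately show ?thesis using xG Eb by blast
qed

lemma continuous_on_translate:
  fixes f g :: "'b::topological_space \<Rightarrow> 'a::topological_group_add"
  assumes "continuous_on S f" "continuous_on S g"
  shows "continuous_on S (\<lambda>x. - f x + g x)"
  using assms unfolding continuous_on_def by (auto intro!: tendsto_add tendsto_minus)

lemma measurable_translate [measurable]:
  fixes s :: "'a::topological_group_add"
  shows "(\<lambda>x. - x + s) \<in> borel_measurable borel" "(\<lambda>x. - s + x) \<in> borel_measurable borel"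
    "(\<lambda>x. s + x) \<in> borel_measurable borel" "uminus \<in> borel_measurable (borel :: 'a measure)"
proof -
  show "(\<lambda>x. - x + s) \<in> borel_measurable borel" "(\<lambda>x. - s + x) \<in> borel_measurable borel"
    by (intro borel_measurable_continuous_onI continuous_on_translate continuous_on_const continuous_on_id)+
  show "uminus \<in> borel_measurable (borel :: 'a measure)"
    using borel_measurable_continuous_onI[OF continuous_on_translate[OF continuous_on_id continuous_on_const[of _ 0]]]
    by simp
  show "(\<lambda>x. s + x) \<in> borel_measurable borel"
    using borel_measurable_continuous_onI[OF continuous_on_translate[OF continuous_on_const[of _ "- s"] continuous_on_id]]
    by simp
qed

lemma open_translate:
  fixes U :: "'a::topological_group_add set"
  assumes "open U"
  shows "open {x. - x + s \<in> U}" "open {x. - s + x \<in> U}" "open {z. - snd z + fst z \<in> U}"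
    "open {x. s + x \<in> U}" "open {x. x + s \<in> U}" "open {z. fst z + snd z \<in> U}" "open {x. - x \<in> U}"
proof -
  have *: "open {x. f x \<in> U}" if "continuous_on UNIV f" for f :: "'b::topological_space \<Rightarrow> 'a"
    using open_vimage[OF assms that] by (simp add: vimage_def)
  show "open {x. - x + s \<in> U}" "open {x. - s + x \<in> U}" "open {z. - snd z + fst z \<in> U}"
    by (intro * continuous_on_translate continuous_on_const continuous_on_id continuous_on_fst continuous_on_snd)+
  show "open {x. s + x \<in> U}" "open {x. x + s \<in> U}" "open {z. fst z + snd z \<in> U}"
    by (intro * continuous_on_add continuous_on_const continuous_on_id continuous_on_fst continuous_on_snd)+
  show "open {x. - x \<in> U}" using *[OF continuous_on_translate[OF continuous_on_id continuous_on_const[of _ 0]]] by simp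
qed

lemma compact_translate_tube:
  fixes K :: "'a::topological_group_add set"
  assumes "compact K" "open U" "\<And>x. x \<in> K \<Longrightarrow> - x + s \<in> U"
  obtains X where "open X" "s \<in> X" "\<And>t x. t \<in> X \<Longrightarrow> x \<in> K \<Longrightarrow> - x + t \<in> U"
proof -
  have "{s} \<times> K \<subseteq> {z. - snd z + fst z \<in> U}" using assms(3) by auto
  then obtain X where "s \<in> X" "open X" "X \<times> K \<subseteq> {z. - snd z + fst z \<in> U}"
    using Elementary_Topology.tube_lemma[OF assms(1) open_translate(3)[OF assms(2)], of s] by blast
  have "- x + t \<in> U" if "t \<in> X" "x \<in> K" for t x
  proof -
    have "(t, x) \<in> {z. - snd z + fst z \<in> U}" using that \<open>X \<times> K \<subseteq> _\<close> by blast
    then show ?thesis by simp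
  qed
  then show ?thesis using that[of X] \<open>open X\<close> \<open>s \<in> X\<close> by blast
qed

text \<open>Lower semicontinuity of the slice function: a compact part of the slice at s with mass
  above t still lies in the slices at all nearby points.\<close>

lemma open_slice_greater:
  fixes \<nu> :: "'a::{topological_group_add, t2_space} measure"
  assumes \<nu>: "fin_radon \<nu>" and U: "open U"
  shows "open {s. t < emeasure \<nu> {x. - x + s \<in> U}}"
proof (rule topological_space_class.openI)
  fix s assume "s \<in> {s. t < emeasure \<nu> {x. - x + s \<in> U}}"
  then obtain K where K: "compact K" "K \<subseteq> {x. - x + s \<in> U}" "t < emeasure \<nu> K"
    using fin_radon_inner[OF \<nu> open_translate(1)[OF U]] by blast
  obtain X where X: "open X" "s \<in> X" "\<And>t x. t \<in> X \<Longrightarrow> x \<in> K \<Longrightarrow> - x + t \<in> U"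
    using compact_translate_tube[OF K(1) U] K(2) by blast
  have "t < emeasure \<nu> {x. - x + s' \<in> U}" if "s' \<in> X" for s'
  proof -
    have "emeasure \<nu> K \<le> emeasure \<nu> {x. - x + s' \<in> U}"
      using X(3) that open_translate(1)[OF U] by (intro emeasure_mono) (auto simp: fin_radon_sets[OF \<nu>])
    then show ?thesis using K(3) by (rule less_le_trans[rotated])
  qed
  then show "\<exists>T. open T \<and> s \<in> T \<and> T \<subseteq> {s. t < emeasure \<nu> {x. - x + s \<in> U}}" using X by blast
qed

definition nnconv :: "'a::topological_group_add measure \<Rightarrow> ('a \<Rightarrow> ennreal) \<Rightarrow> 'a \<Rightarrow> ennreal" where
  "nnconv \<nu> h s = (\<integral>\<^sup>+x. h (- x + s) \<partial>\<nu>)"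

lemma slice_sets [measurable]:
  fixes A :: "'a::topological_group_add set"
  assumes "A \<in> sets borel"
  shows "{x. - x + s \<in> A} \<in> sets borel"
  using measurable_sets[OF measurable_translate(1) assms, of s] by (simp add: vimage_def)

lemma nnconv_indicator:
  fixes \<nu> :: "'a::{topological_group_add, t2_space} measure"
  assumes "fin_radon \<nu>" "A \<in> sets borel"
  shows "nnconv \<nu> (indicator A) s = emeasure \<nu> {x. - x + s \<in> A}"
proof -
  have "nnconv \<nu> (indicator A) s = (\<integral>\<^sup>+x. indicator {x. - x + s \<in> A} x \<partial>\<nu>)"
    unfolding nnconv_def by (intro nn_integral_cong) (auto simp: indicator_def)
  then show ?thesis using slice_sets[OF assms(2)] by (simp add: fin_radon_sets[OF assms(1)])
qed

text \<open>Borel sets of the product group need not belong to the product \<sigma>-algebra, so this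
  is proved by a Dynkin argument from open sets, where the function is semicontinuous. Finiteness of
  \<open>\<nu>\<close> makes complements work.\<close>

lemma measurable_slice:
  fixes \<nu> :: "'a::{topological_group_add, t2_space} measure"
  assumes \<nu>: "fin_radon \<nu>" and A: "A \<in> sets borel"
  shows "(\<lambda>s. emeasure \<nu> {x. - x + s \<in> A}) \<in> borel_measurable borel"
proof -
  note s = fin_radon_sets[OF \<nu>]
  interpret finite_measure \<nu> by (rule fin_radon_finite[OF \<nu>])
  have eq: "sets borel = sigma_sets UNIV {U :: 'a set. open U}" unfolding borel_def by simp
  have G: "Int_stable {U :: 'a set. open U}" "{U :: 'a set. open U} \<subseteq> Pow UNIV" by (auto simp: Int_stable_def)
  have "A \<in> sigma_sets UNIV {U. open U}" using A eq by simp
  with G show ?thesis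
  proof (induction A rule: sigma_sets_induct_disjoint)
    case (basic U)
    show ?case
    proof (rule borel_measurableI_greater)
      fix t
      have "open {s. t < emeasure \<nu> {x. - x + s \<in> U}}" using basic by (intro open_slice_greater \<nu>) simp
      then show "{s \<in> space borel. t < emeasure \<nu> {x. - x + s \<in> U}} \<in> sets borel" by simp
    qed
  next
    case empty then show ?case by simp
  next
    case (compl A)
    have "emeasure \<nu> {x. - x + s \<in> UNIV - A} = emeasure \<nu> UNIV - emeasure \<nu> {x. - x + s \<in> A}" for s
    proof -
      have "{x. - x + s \<in> UNIV - A} = UNIV - {x. - x + s \<in> A}" by auto
      moreover have "{x. - x + s \<in> A} \<in> sets \<nu>" using slice_sets[of A s] compl(1) by (simp add: s eq)
      ultimately show ?thesis using fin_radon_space[OF \<nu>] emeasure_compl[of "{x. - x + s \<in> A}" \<nu>] by simp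
    qed
    then show ?case using compl by simp
  next
    case (union A)
    have "emeasure \<nu> {x. - x + s \<in> (\<Union>i. A i)} = (\<Sum>i. emeasure \<nu> {x. - x + s \<in> A i})" for s
    proof -
      have "{x. - x + s \<in> (\<Union>i. A i)} = (\<Union>i. {x. - x + s \<in> A i})" by auto
      moreover have "range (\<lambda>i. {x. - x + s \<in> A i}) \<subseteq> sets \<nu>"
        using slice_sets[of "A _" s] union(2) by (auto simp: s eq)
      moreover have "disjoint_family (\<lambda>i. {x. - x + s \<in> A i})"
        using union(1) by (auto simp: disjoint_family_on_def)
      ultimately show ?thesis by (simp add: suminf_emeasure)
    qed
    then show ?case using union by simp
  qed
qed

lemma measurable_slice_fun:
  fixes \<nu> :: "'a::{topological_group_add, t2_space} measure"
  assumes \<nu>: "fin_radon \<nu>" and h: "h \<in> measurable borel M"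
  shows "(\<lambda>x. h (- x + s)) \<in> measurable \<nu> M"
  unfolding measurable_cong_sets[OF fin_radon_sets[OF \<nu>] refl]
  by (rule measurable_compose[OF measurable_translate(1) h])

lemma measurable_nnconv:
  fixes \<nu> :: "'a::{topological_group_add, t2_space} measure"
  assumes \<nu>: "fin_radon \<nu>" and h: "h \<in> borel_measurable borel"
  shows "nnconv \<nu> h \<in> borel_measurable borel"
  using h
proof (induction h)
  case (cong f g)
  then have "f = g" by auto
  then show ?case using cong by simp
next
  case (set A)
  then show ?case using measurable_slice[OF \<nu>, of A] by (simp add: nnconv_indicator[OF \<nu>] measurable_cong[of _ "nnconv \<nu> (indicator A)"])
next
  case (mult u c)
  have "nnconv \<nu> (\<lambda>x. c * u x) = (\<lambda>s. c * nnconv \<nu> u s)"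
    unfolding nnconv_def by (intro ext nn_integral_cmult measurable_slice_fun[OF \<nu>] mult.hyps)
  then show ?case using mult by simp
next
  case (add u v)
  have "nnconv \<nu> (\<lambda>x. v x + u x) = (\<lambda>s. nnconv \<nu> v s + nnconv \<nu> u s)"
    unfolding nnconv_def by (intro ext nn_integral_add measurable_slice_fun[OF \<nu>] add.hyps)
  then show ?case using add by simp
next
  case (seq U)
  have "nnconv \<nu> (SUP i. U i) = (\<lambda>s. SUP i. nnconv \<nu> (U i) s)"
  proof
    fix s
    have "(\<integral>\<^sup>+x. (SUP i. U i (- x + s)) \<partial>\<nu>) = (SUP i. \<integral>\<^sup>+x. U i (- x + s) \<partial>\<nu>)"
      using seq.hyps(3) by (intro nn_integral_monotone_convergence_SUP measurable_slice_fun[OF \<nu>] seq.hyps) (auto simp: incseq_def le_fun_def)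
    then show "nnconv \<nu> (SUP i. U i) s = (SUP i. nnconv \<nu> (U i) s)" unfolding nnconv_def SUP_apply .
  qed
  then have eq: "nnconv \<nu> (SUP i. U i) = (\<lambda>s. SUP i. nnconv \<nu> (U i) s)" .
  show ?case unfolding eq by (rule borel_measurable_SUP) (auto simp: seq.IH)
qed

section \<open>Haar measure and the integral of a slice function\<close>

locale lc_group =
  fixes m :: "'a::{topological_group_add, t2_space} measure"
  assumes lc: "locally_compact_space (euclidean :: 'a topology)"
    and haar: "left_haar_measure m"
begin

lemma sets_m [measurable_cong]: "sets m = sets borel"
  and m_compact: "compact K \<Longrightarrow> emeasure m K < \<infinity>"
  and m_outer: "A \<in> sets borel \<Longrightarrow> emeasure m A = (INF U\<in>{U. open U \<and> A \<subseteq> U}. emeasure m U)"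
  and m_inner: "open U \<Longrightarrow> emeasure m U = (SUP K\<in>{K. compact K \<and> K \<subseteq> U}. emeasure m K)"
  and m_UNIV: "emeasure m UNIV \<noteq> 0"
  and m_translate: "A \<in> sets borel \<Longrightarrow> emeasure m ((\<lambda>y. x + y) ` A) = emeasure m A"
  using haar by (auto simp: left_haar_measure_def radon_measure_def outer_regular_at_def inner_regular_at_def)

lemma space_m [simp]: "space m = UNIV"
  using sets_eq_imp_space_eq[OF sets_m] by simp

lemma measurable_m: "f \<in> measurable borel M \<Longrightarrow> f \<in> measurable m M"
  using measurable_cong_sets[OF sets_m refl] by blast

lemma m_slice: "A \<in> sets borel \<Longrightarrow> emeasure m {s. - x + s \<in> A} = emeasure m A"
proof -
  have "{s. - x + s \<in> A} = (\<lambda>y. x + y) ` A"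
    by (auto simp: image_iff intro!: bexI[of _ "- x + _"])
  then show "A \<in> sets borel \<Longrightarrow> emeasure m {s. - x + s \<in> A} = emeasure m A" by (simp add: m_translate)
qed

lemma compact_nbhd:
  fixes U :: "'a set"
  assumes "open U" "x \<in> U"
  obtains V K where "open V" "compact K" "x \<in> V" "V \<subseteq> K" "K \<subseteq> U"
proof -
  have "Hausdorff_space (euclidean :: 'a topology)"
    unfolding Hausdorff_space_def using hausdorff by (simp add: disjnt_def) blast
  then have nb: "neighbourhood_base_of (compactin euclidean) (euclidean :: 'a topology)"
    using lc locally_compact_space_neighbourhood_base by blast
  have "\<exists>V K. openin euclidean V \<and> compactin euclidean K \<and> x \<in> V \<and> V \<subseteq> K \<and> K \<subseteq> U"
    by (rule nb[unfolded neighbourhood_base_of, rule_format, of U x]) (use assms in simp)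
  then obtain V K where "openin euclidean V \<and> compactin euclidean K \<and> x \<in> V \<and> V \<subseteq> K \<and> K \<subseteq> U"
    by blast
  then show ?thesis using that[of V K] by simp
qed

text \<open>Cut \<open>\<nu>\<close> into cells E i contained in x i + V with V + D inside U. If y
  in E i and -y + t in D, then -x i + t = (-x i + y) + (-y + t) lies in U. So the slice function of
  D is below a countable sum of translated indicators of U, whose integrals left invariance
  computes.\<close>

lemma slice_compact_le:
  assumes \<nu>: "fin_radon \<nu>" and D: "compact D" and U: "open U" "D \<subseteq> U"
  shows "(\<integral>\<^sup>+s. emeasure \<nu> {x. - x + s \<in> D} \<partial>m) \<le> emeasure \<nu> UNIV * emeasure m U"
proof -
  note s = fin_radon_sets[OF \<nu>]
  have "{0} \<times> D \<subseteq> {z. fst z + snd z \<in> U}" using U(2) by auto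
  then obtain V where V: "0 \<in> V" "open V" "V \<times> D \<subseteq> {z. fst z + snd z \<in> U}"
    using Elementary_Topology.tube_lemma[OF D open_translate(6)[OF U(1)], of 0] by blast
  have "open {y. - x + y \<in> V} \<and> x \<in> {y. - x + y \<in> V}" for x using V open_translate(2)[OF V(2)] by simp
  from fin_radon_partition[OF \<nu> open_UNIV UNIV_not_empty this]
 obtain x E where E: "\<And>i::nat. E i \<in> sets borel" "disjoint_family E" "\<And>i. E i \<subseteq> {y. - x i + y \<in> V} \<inter> UNIV"
      "emeasure \<nu> (UNIV - (\<Union>i. E i)) = 0"
    by blast
  have Db: "D \<in> sets borel" using D by (rule borel_compact)
  have le: "emeasure \<nu> {y. - y + t \<in> D} \<le> (\<Sum>i. emeasure \<nu> (E i) * indicator {t. - x i + t \<in> U} t)" for t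
  proof -
    let ?S = "{y. - y + t \<in> D}"
    have Sb: "?S \<in> sets borel" by (rule slice_sets[OF Db])
    have "emeasure \<nu> ?S \<le> emeasure \<nu> ((\<Union>i. ?S \<inter> E i) \<union> (UNIV - (\<Union>i. E i)))"
      using Sb E by (intro emeasure_mono) (auto simp: s)
    also have "\<dots> \<le> emeasure \<nu> (\<Union>i. ?S \<inter> E i) + emeasure \<nu> (UNIV - (\<Union>i. E i))"
      using Sb E by (intro emeasure_subadditive) (auto simp: s)
    also have "\<dots> = emeasure \<nu> (\<Union>i. ?S \<inter> E i)" using E by simp
    also have "\<dots> = (\<Sum>i. emeasure \<nu> (?S \<inter> E i))"
      using Sb E by (intro suminf_emeasure[symmetric]) (auto simp: s disjoint_family_on_def)
    also have "\<dots> \<le> (\<Sum>i. emeasure \<nu> (E i) * indicator {t. - x i + t \<in> U} t)"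
    proof (intro suminf_le allI summableI)
      fix i
      show "emeasure \<nu> (?S \<inter> E i) \<le> emeasure \<nu> (E i) * indicator {t. - x i + t \<in> U} t"
      proof (cases "?S \<inter> E i = {}")
        case False
        then obtain y where y: "- y + t \<in> D" "y \<in> E i" by auto
        then have "(- x i + y, - y + t) \<in> V \<times> D" using E(3)[of i] by auto
        then have "(- x i + y) + (- y + t) \<in> U" using V(3) by auto
        then have "- x i + t \<in> U" by (simp add: add.assoc)
        then show ?thesis using E by (auto intro!: emeasure_mono simp: s)
      qed simp
    qed
    finally show ?thesis .
  qed
  have "(\<integral>\<^sup>+s. emeasure \<nu> {x. - x + s \<in> D} \<partial>m) \<le> (\<integral>\<^sup>+t. (\<Sum>i. emeasure \<nu> (E i) * indicator {t. - x i + t \<in> U} t) \<partial>m)"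
    by (intro nn_integral_mono le)
  also have "\<dots> = (\<Sum>i. \<integral>\<^sup>+t. emeasure \<nu> (E i) * indicator {t. - x i + t \<in> U} t \<partial>m)"
  proof -
    have [measurable]: "{t. - x i + t \<in> U} \<in> sets borel" for i using open_translate(2)[OF U(1)] by simp
    show ?thesis by (rule nn_integral_suminf, rule measurable_m) measurable
  qed
  also have "\<dots> = (\<Sum>i. emeasure \<nu> (E i) * emeasure m U)"
    using open_translate(2)[OF U(1)] U by (intro suminf_cong) (auto simp: nn_integral_cmult_indicator sets_m m_slice)
  also have "\<dots> = emeasure \<nu> (\<Union>i. E i) * emeasure m U"
    using E suminf_emeasure[of E \<nu>] by (simp add: s image_subset_iff)
  also have "\<dots> \<le> emeasure \<nu> UNIV * emeasure m U"
    using E by (intro mult_right_mono emeasure_mono) (auto simp: s)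
  finally show ?thesis .
qed

text \<open>Near each point of L a compact part of U already keeps the slice mass above t; finitely
  many of these compact parts suffice for all of L.\<close>

lemma slice_level_compact:
  fixes \<nu> :: "'a measure"
  assumes \<nu>: "fin_radon \<nu>" and U: "open U" and L: "compact L" "\<And>s. s \<in> L \<Longrightarrow> t < emeasure \<nu> {x. - x + s \<in> U}"
  shows "\<exists>D. compact D \<and> D \<subseteq> U \<and> (\<forall>s\<in>L. t < emeasure \<nu> {x. - x + s \<in> D})"
proof -
  note s = fin_radon_sets[OF \<nu>]
  have "\<exists>V D. open V \<and> s \<in> V \<and> compact D \<and> D \<subseteq> U \<and> (\<forall>s'\<in>V. t < emeasure \<nu> {x. - x + s' \<in> D})" if sL: "s \<in> L" for s
  proof -
    obtain K where K: "compact K" "K \<subseteq> {x. - x + s \<in> U}" "t < emeasure \<nu> K"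
      using fin_radon_inner[OF \<nu> open_translate(1)[OF U] L(2)[OF sL]] by blast
    obtain X where X: "open X" "s \<in> X" "\<And>t x. t \<in> X \<Longrightarrow> x \<in> K \<Longrightarrow> - x + t \<in> U"
      using compact_translate_tube[OF K(1) U] K(2) by blast
    obtain V Q where V: "open V" "compact Q" "s \<in> V" "V \<subseteq> Q" "Q \<subseteq> X" using compact_nbhd[OF X(1,2)] .
    define D where "D = (\<lambda>z. - snd z + fst z) ` (Q \<times> K)"
    have D: "compact D" unfolding D_def
      using V K by (intro compact_continuous_image compact_Times continuous_on_translate continuous_on_fst continuous_on_snd continuous_on_id)
    have "t < emeasure \<nu> {x. - x + s' \<in> D}" if "s' \<in> V" for s'
    proof -
      have "emeasure \<nu> K \<le> emeasure \<nu> {x. - x + s' \<in> D}"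
        using that V slice_sets[OF borel_compact[OF D], of s']
        by (intro emeasure_mono) (auto simp: s D_def image_iff intro!: bexI[of _ "(s', _)"])
      then show ?thesis using K(3) by (rule less_le_trans[rotated])
    qed
    moreover have "D \<subseteq> U" using X(3) V(5) by (auto simp: D_def)
    ultimately show ?thesis using V D by blast
  qed
  then obtain V D where VD: "\<And>s. s \<in> L \<Longrightarrow> open (V s) \<and> s \<in> V s \<and> compact (D s) \<and> D s \<subseteq> U \<and> (\<forall>s'\<in>V s. t < emeasure \<nu> {x. - x + s' \<in> D s})"
    by metis
  have "L \<subseteq> (\<Union>s\<in>L. V s)" using VD by blast
  from compactE_image[OF L(1) _ this] VD obtain F where F: "F \<subseteq> L" "finite F" "L \<subseteq> (\<Union>s\<in>F. V s)"
    by metis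
  define D' where "D' = (\<Union>s\<in>F. D s)"
  have D': "compact D'" unfolding D'_def using F VD by (intro compact_UN) auto
  have "t < emeasure \<nu> {x. - x + s' \<in> D'}" if sL: "s' \<in> L" for s'
  proof -
    obtain r where r: "r \<in> F" "s' \<in> V r" using F sL by blast
    then have "t < emeasure \<nu> {x. - x + s' \<in> D r}" using VD F by blast
    also have "\<dots> \<le> emeasure \<nu> {x. - x + s' \<in> D'}"
      using r slice_sets[OF borel_compact[OF D']] by (intro emeasure_mono) (auto simp: s D'_def)
    finally show ?thesis .
  qed
  moreover have "D' \<subseteq> U" using F VD by (auto simp: D'_def)
  ultimately show ?thesis using D' by blast
qed

text \<open>Since \<open>G\<close> need not be second countable, Tonelli's theorem is not available. For open \<open>U\<close> the slice
  function is lower semicontinuous and is approximated by its (open) level sets, to which inner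
  regularity of the Haar measure applies.\<close>

lemma slice_open_le:
  assumes \<nu>: "fin_radon \<nu>" and U: "open U"
  shows "(\<integral>\<^sup>+s. emeasure \<nu> {x. - x + s \<in> U} \<partial>m) \<le> emeasure \<nu> UNIV * emeasure m U"
proof -
  note s = fin_radon_sets[OF \<nu>]
  define g where "g s = emeasure \<nu> {x. - x + s \<in> U}" for s
  define W where "W n k = {s. ennreal (real k / real n) < g s}" for n k :: nat
  have W: "open (W n k)" for n k unfolding W_def g_def by (rule open_slice_greater[OF \<nu> U])
  have [measurable]: "W n k \<in> sets borel" for n k using W by simp
  \<comment> \<open>A layer-cake sum with steps of height 1/n reaching up to height n.\<close>
  define h where "h n t = (\<Sum>k=1..n*n. ennreal (1 / real n) * indicator (W n k) t)" for n t
  \<comment> \<open>Once level sets are replaced by compact subsets they need not be nested. Their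
    number at t is still at most the largest index present, which bounds the sum by r.\<close>
  have card_le: "(\<Sum>k=1..n*n. ennreal (1 / real n) * indicator (L k) t) \<le> ennreal r"
    if n: "1 \<le> n" and r: "0 \<le> r" and L: "\<And>k. 1 \<le> k \<Longrightarrow> k \<le> n*n \<Longrightarrow> t \<in> L k \<Longrightarrow> real k / real n < r" for n r t and L :: "nat \<Rightarrow> 'a set"
  proof -
    define J where "J = {k\<in>{1..n*n}. t \<in> L k}"
    have fin: "finite J" by (simp add: J_def)
    have "(\<Sum>k=1..n*n. ennreal (1 / real n) * indicator (L k) t) = (\<Sum>k\<in>J. ennreal (1 / real n))"
      unfolding J_def by (intro sum.mono_neutral_cong_right) auto
    also have "\<dots> = ennreal (real (card J) * (1 / real n))"
      by (simp add: ennreal_of_nat_eq_real_of_nat ennreal_mult[symmetric])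
    also have "\<dots> \<le> ennreal r"
    proof (rule ennreal_leI, cases "J = {}")
      case False
      define k where "k = Max J"
      have k: "k \<in> J" using fin False by (simp add: k_def)
      have "J \<subseteq> {1..k}" using fin by (auto simp: k_def J_def)
      then have "card J \<le> k" using card_mono[of "{1..k}" J] by simp
      then have "real (card J) * (1 / real n) \<le> real k / real n" by (simp add: divide_right_mono)
      then show "real (card J) * (1 / real n) \<le> r" using L[of k] k by (auto simp: J_def)
    qed (use r in simp)
    finally show ?thesis .
  qed
  have bound: "(\<integral>\<^sup>+t. h n t \<partial>m) \<le> emeasure \<nu> UNIV * emeasure m U" if n: "1 \<le> n" for n
  proof -
    have "(\<integral>\<^sup>+t. h n t \<partial>m) = (\<Sum>k=1..n*n. ennreal (1 / real n) * emeasure m (W n k))"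
    proof -
      have "(\<integral>\<^sup>+t. h n t \<partial>m) = (\<Sum>k=1..n*n. \<integral>\<^sup>+t. ennreal (1 / real n) * indicator (W n k) t \<partial>m)"
        unfolding h_def by (rule nn_integral_sum, rule measurable_m) measurable
      then show ?thesis by (simp add: nn_integral_cmult_indicator sets_m)
    qed
    also have "\<dots> = (\<Sum>k=1..n*n. SUP K\<in>{K. compact K \<and> K \<subseteq> W n k}. ennreal (1 / real n) * emeasure m K)"
      by (simp add: m_inner[OF W] SUP_mult_left_ennreal)
    also have "\<dots> \<le> emeasure \<nu> UNIV * emeasure m U"
    proof (rule sum_SUP_le)
      fix L assume L: "\<And>k. k \<in> {1..n*n} \<Longrightarrow> L k \<in> {K. compact K \<and> K \<subseteq> W n k}"
      have "\<exists>D. compact D \<and> D \<subseteq> U \<and> (\<forall>s\<in>L k. ennreal (real k / real n) < emeasure \<nu> {x. - x + s \<in> D})" if "k \<in> {1..n*n}" for k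
        using L[OF that] by (intro slice_level_compact \<nu> U) (auto simp: W_def g_def)
      then obtain D where D: "\<And>k. k \<in> {1..n*n} \<Longrightarrow> compact (D k) \<and> D k \<subseteq> U \<and> (\<forall>s\<in>L k. ennreal (real k / real n) < emeasure \<nu> {x. - x + s \<in> D k})"
        by metis
      define D' where "D' = (\<Union>k\<in>{1..n*n}. D k)"
      have "compact (D k)" "D k \<subseteq> U" if "k \<in> {1..n*n}" for k using D[OF that] by auto
      then have D': "compact D'" "D' \<subseteq> U" unfolding D'_def by (blast intro: compact_UN finite_atLeastAtMost)+
      have Lb: "L k \<in> sets borel" if "k \<in> {1..n*n}" for k using L[OF that] by (auto intro: borel_compact)
      have "(\<Sum>k=1..n*n. ennreal (1 / real n) * emeasure m (L k)) = (\<integral>\<^sup>+t. (\<Sum>k=1..n*n. ennreal (1 / real n) * indicator (L k) t) \<partial>m)"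
      proof -
        have "(\<integral>\<^sup>+t. (\<Sum>k=1..n*n. ennreal (1 / real n) * indicator (L k) t) \<partial>m) = (\<Sum>k=1..n*n. \<integral>\<^sup>+t. ennreal (1 / real n) * indicator (L k) t \<partial>m)"
        proof (rule nn_integral_sum)
          fix k assume "k \<in> {1..n*n}"
          then have [measurable]: "L k \<in> sets borel" by (rule Lb)
          show "(\<lambda>t. ennreal (1 / real n) * indicator (L k) t) \<in> borel_measurable m" by (rule measurable_m) measurable
        qed
        then show ?thesis using Lb by (simp add: nn_integral_cmult_indicator sets_m)
      qed
      also have "\<dots> \<le> (\<integral>\<^sup>+t. emeasure \<nu> {x. - x + t \<in> D'} \<partial>m)"
      proof (intro nn_integral_mono)
        fix t
        show "(\<Sum>k=1..n*n. ennreal (1 / real n) * indicator (L k) t) \<le> emeasure \<nu> {x. - x + t \<in> D'}"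
          unfolding fin_radon_emeasure[OF \<nu>]
        proof (rule card_le[OF n])
          fix k assume k: "1 \<le> k" "k \<le> n*n" "t \<in> L k"
          then have "ennreal (real k / real n) < emeasure \<nu> {x. - x + t \<in> D k}" using D by simp
          also have "\<dots> \<le> emeasure \<nu> {x. - x + t \<in> D'}"
            using k slice_sets[OF borel_compact[OF D'(1)]] by (intro emeasure_mono) (auto simp: s D'_def)
          finally show "real k / real n < measure \<nu> {x. - x + t \<in> D'}"
            by (simp add: fin_radon_emeasure[OF \<nu>] ennreal_less_iff)
        qed simp
      qed
      also have "\<dots> \<le> emeasure \<nu> UNIV * emeasure m U" by (rule slice_compact_le[OF \<nu> D'(1) U D'(2)])
      finally show "(\<Sum>k=1..n*n. ennreal (1 / real n) * emeasure m (L k)) \<le> emeasure \<nu> UNIV * emeasure m U" .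
    qed auto
    finally show ?thesis .
  qed
  have lim: "g t \<le> liminf (\<lambda>n. h n t)" for t
  proof -
    define r where "r = measure \<nu> {x. - x + t \<in> U}"
    have g: "g t = ennreal r" by (simp add: g_def r_def fin_radon_emeasure[OF \<nu>])
    have r: "0 \<le> r" by (simp add: r_def)
    have "((\<lambda>n. ennreal (r - 1 / real n)) \<longlonglongrightarrow> ennreal (r - 0))"
      by (intro tendsto_ennrealI tendsto_diff tendsto_const lim_1_over_n)
    then have "g t = liminf (\<lambda>n. ennreal (r - 1 / real n))"
      using lim_imp_Liminf[OF trivial_limit_sequentially] g by fastforce
    also have "\<dots> \<le> liminf (\<lambda>n. h n t)"
    proof (rule Liminf_mono, rule eventually_sequentiallyI[of "max 1 (nat \<lceil>r\<rceil>)"])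
      fix n assume n: "max 1 (nat \<lceil>r\<rceil>) \<le> n"
      then have rn: "r \<le> real n" "1 \<le> n" by (auto simp: nat_le_iff ceiling_le_iff)
      \<comment> \<open>For r > 0 this counts the levels k/n strictly below r; the strict inequality
        in W costs the 1. The loss against r is at most 1/n.\<close>
      define N where "N = nat \<lceil>real n * r\<rceil> - 1"
      have N1: "real n * r - 1 \<le> real N"
        unfolding N_def by linarith
      have N2: "k \<in> {1..n*n} \<and> t \<in> W n k" if "k \<in> {1..N}" for k
      proof -
        have "real k < real n * r" using that unfolding N_def by (auto, linarith)
        then have "real k / real n < r" using rn by (simp add: field_simps)
        moreover have "real n * r \<le> real n * real n" using rn by (intro mult_left_mono) auto
        then have "real k \<le> real (n * n)" using \<open>real k < real n * r\<close> by simp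
        then have "k \<le> n * n" by (simp only: of_nat_le_iff)
        ultimately show ?thesis using that by (auto simp: W_def g ennreal_less_iff)
      qed
      have "ennreal (r - 1 / real n) \<le> ennreal (real N * (1 / real n))"
      proof (rule ennreal_leI)
        have "(real n * r - 1) / real n \<le> real N / real n" using N1 by (intro divide_right_mono) auto
        then show "r - 1 / real n \<le> real N * (1 / real n)" using rn by (simp add: diff_divide_distrib)
      qed
      also have "\<dots> = (\<Sum>k=1..N. ennreal (1 / real n))"
        by (simp add: ennreal_of_nat_eq_real_of_nat ennreal_mult[symmetric])
      also have "\<dots> = (\<Sum>k=1..N. ennreal (1 / real n) * indicator (W n k) t)"
        using N2 by (intro sum.cong) auto
      also have "\<dots> \<le> h n t" unfolding h_def using N2 by (intro sum_mono2) auto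
      finally show "ennreal (r - 1 / real n) \<le> h n t" .
    qed
    finally show ?thesis .
  qed
  have "(\<integral>\<^sup>+t. g t \<partial>m) \<le> (\<integral>\<^sup>+t. liminf (\<lambda>n. h n t) \<partial>m)"
    by (intro nn_integral_mono lim)
  also have "\<dots> \<le> liminf (\<lambda>n. \<integral>\<^sup>+t. h n t \<partial>m)"
    unfolding h_def by (rule nn_integral_liminf, rule measurable_m) measurable
  also have "\<dots> \<le> liminf (\<lambda>n. emeasure \<nu> UNIV * emeasure m U)"
    by (rule Liminf_mono, rule eventually_sequentiallyI[of 1], rule bound)
  also have "\<dots> = emeasure \<nu> UNIV * emeasure m U" by (simp add: Liminf_const)
  finally show ?thesis by (simp add: g_def)
qed

text \<open>Outer regularity of the Haar measure carries the bound from open sets to Borel sets. The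
  total mass of \<open>\<nu>\<close> is divided out to pass to the infimum, so mass 0 is treated
  apart.\<close>

lemma slice_le:
  assumes \<nu>: "fin_radon \<nu>" and A: "A \<in> sets borel"
  shows "(\<integral>\<^sup>+s. emeasure \<nu> {x. - x + s \<in> A} \<partial>m) \<le> emeasure \<nu> UNIV * emeasure m A" (is "?I \<le> ?c * _")
proof -
  note s = fin_radon_sets[OF \<nu>]
  have le: "?I \<le> ?c * emeasure m U" if U: "open U" "A \<subseteq> U" for U
  proof -
    have "?I \<le> (\<integral>\<^sup>+s. emeasure \<nu> {x. - x + s \<in> U} \<partial>m)"
      using U open_translate(1)[OF U(1)] by (intro nn_integral_mono emeasure_mono) (auto simp: s)
    also have "\<dots> \<le> ?c * emeasure m U" by (rule slice_open_le[OF \<nu> U(1)])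
    finally show ?thesis .
  qed
  show ?thesis
  proof (cases "?c = 0")
    case True
    then have "?I \<le> 0" using le[of UNIV] by simp
    then show ?thesis by simp
  next
    case False
    have c: "?c \<noteq> \<infinity>" using \<nu> by (auto simp: fin_radon_def)
    have "?I / ?c \<le> emeasure m A"
      unfolding m_outer[OF A] using False le
      by (intro INF_greatest divide_le_posI_ennreal) (auto simp: zero_less_iff_neq_zero)
    then have "?c * (?I / ?c) \<le> ?c * emeasure m A" by (intro mult_left_mono) auto
    moreover have "?c * (?I / ?c) = ?I" using False c
      by (simp add: ennreal_times_divide mult.commute[of ?c] ennreal_mult_divide_eq)
    ultimately show ?thesis by simp
  qed
qed

text \<open>This one-sided Tonelli estimate is the source of the norm bound for convolution.\<close>

lemma nn_integral_nnconv_le: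
  assumes \<nu>: "fin_radon \<nu>" and h: "h \<in> borel_measurable borel"
  shows "(\<integral>\<^sup>+s. nnconv \<nu> h s \<partial>m) \<le> emeasure \<nu> UNIV * (\<integral>\<^sup>+x. h x \<partial>m)"
  using h
proof (induction h)
  case (cong f g)
  then have "f = g" by auto
  then show ?case using cong by simp
next
  case (set A)
  then show ?case using slice_le[OF \<nu>, of A] by (simp add: nnconv_indicator[OF \<nu>] sets_m)
next
  case (mult u c)
  note M = mult.hyps(2)[THEN measurable_m] measurable_nnconv[OF \<nu> mult.hyps(2), THEN measurable_m]
  have "nnconv \<nu> (\<lambda>x. c * u x) = (\<lambda>s. c * nnconv \<nu> u s)"
    unfolding nnconv_def by (intro ext nn_integral_cmult measurable_slice_fun[OF \<nu>] mult.hyps)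
  then have "(\<integral>\<^sup>+s. nnconv \<nu> (\<lambda>x. c * u x) s \<partial>m) = c * (\<integral>\<^sup>+s. nnconv \<nu> u s \<partial>m)"
    by (simp add: nn_integral_cmult M)
  also have "\<dots> \<le> c * (emeasure \<nu> UNIV * (\<integral>\<^sup>+x. u x \<partial>m))" by (intro mult_left_mono mult.IH) simp
  finally show ?case by (simp add: nn_integral_cmult M ac_simps)
next
  case (add u v)
  note M = add.hyps(1,3)[THEN measurable_m] measurable_nnconv[OF \<nu> add.hyps(1), THEN measurable_m] measurable_nnconv[OF \<nu> add.hyps(3), THEN measurable_m]
  have "nnconv \<nu> (\<lambda>x. v x + u x) = (\<lambda>s. nnconv \<nu> v s + nnconv \<nu> u s)"
    unfolding nnconv_def by (intro ext nn_integral_add measurable_slice_fun[OF \<nu>] add.hyps)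
  then show ?case using add.IH by (simp add: nn_integral_add M distrib_left add_mono)
next
  case (seq U)
  note M = seq.hyps(1)[THEN measurable_m] measurable_nnconv[OF \<nu> seq.hyps(1), THEN measurable_m]
  have eq: "nnconv \<nu> (SUP i. U i) s = (SUP i. nnconv \<nu> (U i) s)" for s
  proof -
    have "(\<integral>\<^sup>+x. (SUP i. U i (- x + s)) \<partial>\<nu>) = (SUP i. \<integral>\<^sup>+x. U i (- x + s) \<partial>\<nu>)"
      using seq.hyps(3) by (intro nn_integral_monotone_convergence_SUP measurable_slice_fun[OF \<nu>] seq.hyps) (auto simp: incseq_def le_fun_def)
    then show "nnconv \<nu> (SUP i. U i) s = (SUP i. nnconv \<nu> (U i) s)" unfolding nnconv_def SUP_apply .
  qed
  have inc: "incseq (\<lambda>i. nnconv \<nu> (U i))"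
    using seq.hyps(3) unfolding incseq_def le_fun_def nnconv_def by (auto intro!: nn_integral_mono)
  have "(\<integral>\<^sup>+s. nnconv \<nu> (SUP i. U i) s \<partial>m) = (SUP i. \<integral>\<^sup>+s. nnconv \<nu> (U i) s \<partial>m)"
    unfolding eq by (intro nn_integral_monotone_convergence_SUP inc M)
  also have "\<dots> \<le> (SUP i. emeasure \<nu> UNIV * (\<integral>\<^sup>+x. U i x \<partial>m))"
    by (intro SUP_mono') (rule seq.IH)
  also have "\<dots> = emeasure \<nu> UNIV * (SUP i. \<integral>\<^sup>+x. U i x \<partial>m)" by (simp add: SUP_mult_left_ennreal)
  also have "(SUP i. \<integral>\<^sup>+x. U i x \<partial>m) = (\<integral>\<^sup>+x. (SUP i. U i) x \<partial>m)"
    unfolding SUP_apply by (intro nn_integral_monotone_convergence_SUP[symmetric] seq.hyps(3) M)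
  finally show ?case .
qed

end

section \<open>Bounded operators and sublinear growth of orbits\<close>

lemma bounded_Lp_bound:
  assumes "1 \<le> p" "bounded_Lp_operator m p T"
  obtains C where "0 \<le> C" "\<And>f. f \<in> Lp m p \<Longrightarrow> Lp_norm m p (T f) \<le> C * Lp_norm m p f"
proof -
  have "Lp_op_norm m p T < \<infinity>" using assms by (simp add: bounded_Lp_operator_def)
  then obtain C where C: "0 \<le> C" "Lp_op_norm m p T = ennreal C" by (cases "Lp_op_norm m p T") auto
  show ?thesis
  proof (rule that[OF C(1)])
    fix f assume "f \<in> Lp m p"
    from Lp_norm_le_op_norm[OF assms this C(1), of 1] show "Lp_norm m p (T f) \<le> C * Lp_norm m p f"
      using C(2) by simp
  qed
qed

lemma bounded_Lp_lincomb:
  assumes p: "1 \<le> p" and T: "bounded_Lp_operator m p T" and S: "bounded_Lp_operator m p S"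
  shows "bounded_Lp_operator m p (\<lambda>f x. T f x + c * S f x)"
proof -
  obtain C D where C: "0 \<le> C" "\<And>f. f \<in> Lp m p \<Longrightarrow> Lp_norm m p (T f) \<le> C * Lp_norm m p f"
    and D: "0 \<le> D" "\<And>f. f \<in> Lp m p \<Longrightarrow> Lp_norm m p (S f) \<le> D * Lp_norm m p f"
    using bounded_Lp_bound[OF p T] bounded_Lp_bound[OF p S] by metis
  show ?thesis
  proof (rule bounded_Lp_operatorI[OF p, where B = "C + norm c * D"])
    fix f g assume f: "f \<in> Lp m p" and g: "g \<in> Lp m p"
    show "AE x in m. T f x + c * S f x = T g x + c * S g x" if "AE x in m. f x = g x"
      using bounded_Lp_cong[OF T f g that] bounded_Lp_cong[OF S f g that] by eventually_elim simp
    show "AE x in m. T (\<lambda>y. f y + g y) x + c * S (\<lambda>y. f y + g y) x = (T f x + c * S f x) + (T g x + c * S g x)"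
      using bounded_Lp_add[OF T f g] bounded_Lp_add[OF S f g] by eventually_elim (simp add: algebra_simps)
  next
    fix f a assume f: "f \<in> Lp m p"
    show "(\<lambda>x. T f x + c * S f x) \<in> Lp m p" by (intro Lp_add Lp_cmult p bounded_Lp_closed[OF T f] bounded_Lp_closed[OF S f])
    show "AE x in m. T (\<lambda>y. a * f y) x + c * S (\<lambda>y. a * f y) x = a * (T f x + c * S f x)"
      using bounded_Lp_cmult[OF T f, of a] bounded_Lp_cmult[OF S f, of a] by eventually_elim (simp add: algebra_simps)
    have "Lp_norm m p (\<lambda>x. T f x + c * S f x) \<le> Lp_norm m p (T f) + Lp_norm m p (\<lambda>x. c * S f x)"
      by (intro Lp_norm_triangle Lp_cmult p bounded_Lp_closed[OF T f] bounded_Lp_closed[OF S f])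
    also have "\<dots> = Lp_norm m p (T f) + norm c * Lp_norm m p (S f)" using p by (simp add: Lp_norm_cmult)
    also have "\<dots> \<le> C * Lp_norm m p f + norm c * (D * Lp_norm m p f)"
      by (intro add_mono mult_left_mono C D f) simp
    finally show "Lp_norm m p (\<lambda>x. T f x + c * S f x) \<le> (C + norm c * D) * Lp_norm m p f"
      by (simp add: algebra_simps)
  qed (use C D in auto)
qed

text \<open>The iterate of order n + 1 divided by n + 1 is the mean of that order minus n / (n + 1)
  times the previous mean. Both means tend to P f, and the mismatch of the coefficients contributes
  only P f / (n + 1).\<close>

lemma mean_ergodic_growth:
  assumes p: "1 \<le> p" and T: "bounded_Lp_operator m p T" and me: "mean_ergodic m p T" and f: "f \<in> Lp m p"
  shows "(\<lambda>n. Lp_norm m p ((T ^^ n) f) / real n) \<longlonglongrightarrow> 0"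
proof -
  obtain P where P: "bounded_Lp_operator m p P" "(\<lambda>n. Lp_norm m p (\<lambda>x. cesaro_mean T n f x - P f x)) \<longlonglongrightarrow> 0"
    using me f unfolding mean_ergodic_def by blast
  note C = cesaro_mean_Lp(1)[OF p T f]
  have Pf: "P f \<in> Lp m p" by (rule bounded_Lp_closed[OF P(1) f])
  define a where "a n = Lp_norm m p (\<lambda>x. cesaro_mean T n f x - P f x)" for n
  have bd: "Lp_norm m p ((T ^^ Suc n) f) / real (Suc n) \<le> a (Suc n) + a n + Lp_norm m p (P f) * (1 / real (Suc n))" for n
  proof -
    let ?c = "complex_of_real (real n / real (Suc n))" and ?d = "complex_of_real (1 / real (Suc n))"
    have cd: "1 - ?c = ?d" "norm ?c \<le> 1" "norm ?d = 1 / real (Suc n)"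
    proof -
      have "1 - real n / real (Suc n) = 1 / real (Suc n)" by (simp add: field_simps)
      from arg_cong[where f = complex_of_real, OF this] show "1 - ?c = ?d" by (simp only: of_real_diff of_real_1)
      show "norm ?c \<le> 1" "norm ?d = 1 / real (Suc n)" unfolding norm_of_real by auto
    qed
    have "(\<lambda>x. ?d * (T ^^ Suc n) f x) = (\<lambda>x. ((cesaro_mean T (Suc n) f x - P f x) - ?c * (cesaro_mean T n f x - P f x)) + ?d * P f x)"
      unfolding cesaro_mean_Suc of_real_diff of_real_1 cd(1)[symmetric] by (simp add: algebra_simps)
    then have "Lp_norm m p (\<lambda>x. ?d * (T ^^ Suc n) f x) = Lp_norm m p (\<lambda>x. ((cesaro_mean T (Suc n) f x - P f x) - ?c * (cesaro_mean T n f x - P f x)) + ?d * P f x)"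
      by simp
    also have "\<dots> \<le> Lp_norm m p (\<lambda>x. (cesaro_mean T (Suc n) f x - P f x) - ?c * (cesaro_mean T n f x - P f x)) + Lp_norm m p (\<lambda>x. ?d * P f x)"
      by (intro Lp_norm_triangle Lp_diff Lp_cmult p C Pf)
    also have "Lp_norm m p (\<lambda>x. (cesaro_mean T (Suc n) f x - P f x) - ?c * (cesaro_mean T n f x - P f x)) \<le> a (Suc n) + Lp_norm m p (\<lambda>x. ?c * (cesaro_mean T n f x - P f x))"
      unfolding a_def by (intro Lp_norm_triangle_diff Lp_diff Lp_cmult p C Pf)
    also have "Lp_norm m p (\<lambda>x. ?c * (cesaro_mean T n f x - P f x)) = norm ?c * a n"
      unfolding a_def using p by (intro Lp_norm_cmult) simp
    also have "\<dots> \<le> 1 * a n" by (intro mult_right_mono cd) (simp add: a_def)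
    also have "Lp_norm m p (\<lambda>x. ?d * P f x) = norm ?d * Lp_norm m p (P f)" using p by (intro Lp_norm_cmult) simp
    also have "Lp_norm m p (\<lambda>x. ?d * (T ^^ Suc n) f x) = norm ?d * Lp_norm m p ((T ^^ Suc n) f)"
      using p by (intro Lp_norm_cmult) simp
    finally show ?thesis unfolding cd(3) by (simp add: field_simps)
  qed
  have a: "a \<longlonglongrightarrow> 0" using P(2) by (simp add: a_def[abs_def])
  have "(\<lambda>n. a (Suc n) + a n + Lp_norm m p (P f) * (1 / real (Suc n))) \<longlonglongrightarrow> 0 + 0 + Lp_norm m p (P f) * 0"
    by (intro tendsto_add tendsto_mult tendsto_const LIMSEQ_Suc[OF a] a LIMSEQ_Suc[OF lim_1_over_n])
  then have lim: "(\<lambda>n. a (Suc n) + a n + Lp_norm m p (P f) * (1 / real (Suc n))) \<longlonglongrightarrow> 0" by simp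
  have "(\<lambda>n. Lp_norm m p ((T ^^ Suc n) f) / real (Suc n)) \<longlonglongrightarrow> 0"
    by (rule tendsto_sandwich[OF _ _ tendsto_const lim]) (use bd in auto)
  then show ?thesis by (rule LIMSEQ_imp_Suc)
qed

lemma power_bounded_growth:
  assumes p: "1 \<le> p" and T: "bounded_Lp_operator m p T" and pb: "power_bounded m p T" and f: "f \<in> Lp m p"
  shows "(\<lambda>n. Lp_norm m p ((T ^^ n) f) / real n) \<longlonglongrightarrow> 0"
proof -
  obtain C where C: "0 \<le> C" "(SUP n. Lp_op_norm m p (T ^^ n)) = ennreal C"
    using pb unfolding power_bounded_def by (cases "SUP n. Lp_op_norm m p (T ^^ n)") auto
  have le: "Lp_norm m p ((T ^^ n) f) \<le> C * Lp_norm m p f" for n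
    by (rule Lp_norm_le_op_norm[OF p T f C(1)]) (use C(2) in \<open>metis SUP_upper UNIV_I\<close>)
  have lim: "(\<lambda>n. C * Lp_norm m p f * (1 / real n)) \<longlonglongrightarrow> C * Lp_norm m p f * 0"
    by (intro tendsto_mult tendsto_const lim_1_over_n)
  show ?thesis
    by (rule tendsto_sandwich[OF _ _ tendsto_const lim[simplified mult_zero_right]])
      (auto intro!: always_eventually divide_right_mono le)
qed

section \<open>Convolution as a bounded operator\<close>

lemma integrable_of_powr:
  fixes g :: "'a \<Rightarrow> complex"
  assumes fin: "finite_measure M" and p: "1 \<le> p" and g: "g \<in> borel_measurable M"
    and bd: "(\<integral>\<^sup>+x. ennreal (norm (g x) powr p) \<partial>M) < \<infinity>"
  shows "integrable M g"
proof -
  note [measurable] = g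
  have "integrable M (\<lambda>x. norm (g x) powr p)"
    using bd by (intro integrableI_nonneg) auto
  then have "integrable M (\<lambda>x. norm (g x))"
    using integral_powr_le(1)[OF fin p, of "\<lambda>x. norm (g x)"] by simp
  then show ?thesis by (simp add: integrable_norm_iff g)
qed

text \<open>Stated so as to cover non-integrable g as well: an infinite integral on the right forces
  positive mass, so the right side is then infinite.\<close>

lemma norm_integral_powr_le:
  fixes g :: "'a \<Rightarrow> complex"
  assumes fin: "finite_measure M" and p: "1 \<le> p" and g: "g \<in> borel_measurable M"
  shows "ennreal (norm (LINT x|M. g x) powr p) \<le> ennreal (measure M (space M) powr (p - 1)) * (\<integral>\<^sup>+x. ennreal (norm (g x) powr p) \<partial>M)"
proof -
  interpret finite_measure M by fact
  note [measurable] = g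
  show ?thesis
  proof (cases "(\<integral>\<^sup>+x. ennreal (norm (g x) powr p) \<partial>M) < \<infinity>")
    case True
    then have i: "integrable M (\<lambda>x. norm (g x) powr p)"
      by (intro integrableI_nonneg) auto
    have "norm (LINT x|M. g x) powr p \<le> (LINT x|M. norm (g x)) powr p"
      using p by (intro powr_mono2 integral_norm_bound) auto
    also have "\<dots> \<le> measure M (space M) powr (p - 1) * (LINT x|M. norm (g x) powr p)"
      by (rule integral_powr_le(2)[OF fin p]) (use i in auto)
    finally show ?thesis using i by (simp add: nn_integral_eq_integral ennreal_mult[symmetric])
  next
    case False
    then have top: "(\<integral>\<^sup>+x. ennreal (norm (g x) powr p) \<partial>M) = \<infinity>" by (simp add: less_top[symmetric])
    have "measure M (space M) \<noteq> 0"
    proof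
      assume "measure M (space M) = 0"
      then have "emeasure M (space M) = 0" by (simp add: emeasure_eq_measure)
      then have "AE x in M. ennreal (norm (g x) powr p) = 0" by (intro AE_I[of _ _ "space M"]) auto
      then have "(\<integral>\<^sup>+x. ennreal (norm (g x) powr p) \<partial>M) = 0" by (simp add: nn_integral_0_iff_AE)
      then show False using top by simp
    qed
    then show ?thesis using top by (simp add: ennreal_mult_top)
  qed
qed

text \<open>The convolution is assembled from positive and negative parts of real and imaginary part
  wherever the integral exists, and is 0 elsewhere by the convention of the Bochner integral. All
  pieces are \<open>nnconv\<close> functions.\<close>

lemma convolve_measurable:
  fixes \<nu> :: "'a::{topological_group_add, t2_space} measure"
  assumes \<nu>: "fin_radon \<nu>" and f: "f \<in> borel_measurable borel"
  shows "convolve \<nu> f \<in> borel_measurable borel"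
proof -
  define I where "I h s = enn2real (nnconv \<nu> (\<lambda>x. ennreal (h (f x))) s) - enn2real (nnconv \<nu> (\<lambda>x. ennreal (- h (f x))) s)"
    for h and s
  note [measurable] = f
  have [measurable]: "I Re \<in> borel_measurable borel" "I Im \<in> borel_measurable borel"
    unfolding I_def by (intro borel_measurable_diff borel_measurable_enn2real measurable_nnconv[OF \<nu>]; measurable)+
  have [measurable]: "nnconv \<nu> (\<lambda>x. ennreal (norm (f x))) \<in> borel_measurable borel"
    by (intro measurable_nnconv[OF \<nu>]) measurable
  have "convolve \<nu> f = (\<lambda>s. if nnconv \<nu> (\<lambda>x. ennreal (norm (f x))) s < \<infinity> then of_real (I Re s) + \<i> * of_real (I Im s) else 0)"
  proof
    fix s
    note [measurable] = measurable_slice_fun[OF \<nu> f, of s]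
    have i: "integrable \<nu> (\<lambda>x. f (- x + s)) \<longleftrightarrow> nnconv \<nu> (\<lambda>x. ennreal (norm (f x))) s < \<infinity>"
      by (simp add: integrable_iff_bounded nnconv_def)
    show "convolve \<nu> f s = (if nnconv \<nu> (\<lambda>x. ennreal (norm (f x))) s < \<infinity> then of_real (I Re s) + \<i> * of_real (I Im s) else 0)"
    proof (cases "integrable \<nu> (\<lambda>x. f (- x + s))")
      case True
      have "Re (convolve \<nu> f s) = (LINT x|\<nu>. Re (f (- x + s)))" "Im (convolve \<nu> f s) = (LINT x|\<nu>. Im (f (- x + s)))"
        unfolding convolve_def using integral_bounded_linear[OF bounded_linear_Re True] integral_bounded_linear[OF bounded_linear_Im True] by auto
      moreover have "integrable \<nu> (\<lambda>x. Re (f (- x + s)))" "integrable \<nu> (\<lambda>x. Im (f (- x + s)))"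
        using integrable_bounded_linear[OF bounded_linear_Re True] integrable_bounded_linear[OF bounded_linear_Im True] by auto
      ultimately have "Re (convolve \<nu> f s) = I Re s" "Im (convolve \<nu> f s) = I Im s"
        by (simp_all add: real_lebesgue_integral_def I_def nnconv_def)
      then show ?thesis using True i by (simp add: complex_eq_iff)
    next
      case False
      then show ?thesis using i by (simp add: convolve_def not_integrable_integral_eq)
    qed
  qed
  then show ?thesis by (simp only:) measurable
qed

context lc_group
begin

lemma Lp_borel: "f \<in> Lp m p \<Longrightarrow> f \<in> borel_measurable borel"
  using Lp_measurable measurable_cong_sets[OF sets_m refl] by blast

lemma nnconv_powr_finite_AE:
  assumes \<nu>: "fin_radon (\<nu> :: 'a measure)" and p: "1 \<le> p" and f: "f \<in> Lp m p"
  shows "(\<integral>\<^sup>+s. nnconv \<nu> (\<lambda>x. ennreal (norm (f x) powr p)) s \<partial>m) \<le> ennreal (measure \<nu> UNIV * Lp_norm m p f powr p)"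
    and "AE s in m. nnconv \<nu> (\<lambda>x. ennreal (norm (f x) powr p)) s < \<infinity>"
proof -
  note [measurable] = Lp_borel[OF f]
  have "(\<integral>\<^sup>+s. nnconv \<nu> (\<lambda>x. ennreal (norm (f x) powr p)) s \<partial>m) \<le> emeasure \<nu> UNIV * (\<integral>\<^sup>+x. ennreal (norm (f x) powr p) \<partial>m)"
    by (intro nn_integral_nnconv_le[OF \<nu>]) measurable
  then show le: "(\<integral>\<^sup>+s. nnconv \<nu> (\<lambda>x. ennreal (norm (f x) powr p)) s \<partial>m) \<le> ennreal (measure \<nu> UNIV * Lp_norm m p f powr p)"
    using p f by (simp add: fin_radon_emeasure[OF \<nu>] nn_integral_Lp ennreal_mult)
  have "AE s in m. nnconv \<nu> (\<lambda>x. ennreal (norm (f x) powr p)) s \<noteq> \<infinity>"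
    using le by (intro nn_integral_PInf_AE measurable_m measurable_nnconv[OF \<nu>]) (measurable, auto simp: top_unique)
  then show "AE s in m. nnconv \<nu> (\<lambda>x. ennreal (norm (f x) powr p)) s < \<infinity>"
    by eventually_elim (simp add: less_top)
qed

lemma convolve_integrable_AE:
  assumes \<nu>: "fin_radon (\<nu> :: 'a measure)" and p: "1 \<le> p" and f: "f \<in> Lp m p"
  shows "AE s in m. integrable \<nu> (\<lambda>x. f (- x + s))"
  using nnconv_powr_finite_AE(2)[OF assms]
proof eventually_elim
  case (elim s)
  then show ?case
    by (intro integrable_of_powr[OF fin_radon_finite[OF \<nu>] p] measurable_slice_fun[OF \<nu> Lp_borel[OF f]]) (simp add: nnconv_def)
qed

lemma
  assumes \<nu>: "fin_radon (\<nu> :: 'a measure)" and p: "1 \<le> p" and f: "f \<in> Lp m p"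
  shows convolve_Lp: "convolve \<nu> f \<in> Lp m p"
    and Lp_norm_convolve_le: "Lp_norm m p (convolve \<nu> f) \<le> measure \<nu> UNIV * Lp_norm m p f"
proof -
  have p0: "0 < p" using p by simp
  note [measurable] = Lp_borel[OF f]
  define c where "c = measure \<nu> UNIV"
  have "(\<integral>\<^sup>+s. ennreal (norm (convolve \<nu> f s) powr p) \<partial>m) \<le> (\<integral>\<^sup>+s. ennreal (c powr (p - 1)) * nnconv \<nu> (\<lambda>x. ennreal (norm (f x) powr p)) s \<partial>m)"
    unfolding convolve_def nnconv_def c_def fin_radon_space[OF \<nu>, symmetric]
    by (intro nn_integral_mono norm_integral_powr_le fin_radon_finite[OF \<nu>] p measurable_slice_fun[OF \<nu> Lp_borel[OF f]])
  also have "\<dots> = ennreal (c powr (p - 1)) * (\<integral>\<^sup>+s. nnconv \<nu> (\<lambda>x. ennreal (norm (f x) powr p)) s \<partial>m)"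
    by (intro nn_integral_cmult measurable_m measurable_nnconv[OF \<nu>]) measurable
  also have "\<dots> \<le> ennreal (c powr (p - 1)) * ennreal (c * Lp_norm m p f powr p)"
    using nnconv_powr_finite_AE(1)[OF assms] by (intro mult_left_mono) (auto simp: c_def)
  also have "\<dots> = ennreal ((c * Lp_norm m p f) powr p)"
  proof -
    have "c powr (p - 1) * c = c powr p"
      by (cases "c = 0") (auto simp: c_def powr_diff)
    then have "c powr (p - 1) * (c * Lp_norm m p f powr p) = (c * Lp_norm m p f) powr p"
      by (simp add: powr_mult mult.assoc[symmetric] c_def)
    then show ?thesis by (simp add: ennreal_mult[symmetric] c_def)
  qed
  finally have *: "(\<integral>\<^sup>+s. ennreal (norm (convolve \<nu> f s) powr p) \<partial>m) \<le> ennreal ((c * Lp_norm m p f) powr p)" .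
  have m: "convolve \<nu> f \<in> borel_measurable m" by (intro measurable_m convolve_measurable \<nu> Lp_borel[OF f])
  show "convolve \<nu> f \<in> Lp m p" "Lp_norm m p (convolve \<nu> f) \<le> measure \<nu> UNIV * Lp_norm m p f"
    using Lp_boundI[OF p0 m _ *] by (auto simp: c_def)
qed

text \<open>The delicate point is compatibility with equality almost everywhere. By the slice
  inequality the slices of a Haar null set are \<open>\<nu>\<close>-null for almost every s, so the
  two integrands then agree almost everywhere.\<close>

lemma bounded_convolve:
  assumes \<nu>: "fin_radon (\<nu> :: 'a measure)" and p: "1 \<le> p"
  shows "bounded_Lp_operator m p (convolve \<nu>)"
proof (rule bounded_Lp_operatorI[OF p, where B = "measure \<nu> UNIV"])
  fix f g assume f: "f \<in> Lp m p" and g: "g \<in> Lp m p"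
  show "AE x in m. convolve \<nu> f x = convolve \<nu> g x" if "AE x in m. f x = g x"
  proof -
    note [measurable] = Lp_borel[OF f] Lp_borel[OF g]
    define N where "N = {x. f x \<noteq> g x}"
    have N[measurable]: "N \<in> sets borel" unfolding N_def by measurable
    have "emeasure m N = 0"
      using that N unfolding N_def by (subst (asm) AE_iff_measurable[OF _ refl]) (auto simp: sets_m)
    then have "(\<integral>\<^sup>+s. emeasure \<nu> {x. - x + s \<in> N} \<partial>m) = 0"
      using slice_le[OF \<nu> N] by simp
    then have "AE s in m. emeasure \<nu> {x. - x + s \<in> N} = 0"
      using measurable_slice[OF \<nu> N, THEN measurable_m] by (simp add: nn_integral_0_iff_AE)
    then show ?thesis
    proof eventually_elim
      case (elim s)
      then have "AE x in \<nu>. f (- x + s) = g (- x + s)"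
        using slice_sets[OF N, of s] by (intro AE_I[of _ _ "{x. - x + s \<in> N}"]) (auto simp: N_def fin_radon_sets[OF \<nu>])
      then show ?case unfolding convolve_def
        by (intro integral_cong_AE measurable_slice_fun[OF \<nu>] Lp_borel[OF f] Lp_borel[OF g])
    qed
  qed
  show "AE x in m. convolve \<nu> (\<lambda>y. f y + g y) x = convolve \<nu> f x + convolve \<nu> g x"
    using convolve_integrable_AE[OF \<nu> p f] convolve_integrable_AE[OF \<nu> p g]
    by eventually_elim (simp add: convolve_def)
next
  fix f assume f: "f \<in> Lp m p"
  show "convolve \<nu> f \<in> Lp m p" "Lp_norm m p (convolve \<nu> f) \<le> measure \<nu> UNIV * Lp_norm m p f"
    by (rule convolve_Lp[OF \<nu> p f], rule Lp_norm_convolve_le[OF \<nu> p f])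
  show "AE x in m. convolve \<nu> (\<lambda>y. c * f y) x = c * convolve \<nu> f x" for c
    by (simp add: convolve_def)
qed simp

lemma bounded_convolution_operator:
  assumes \<mu>: "regular_complex_measure (\<mu> :: 'a set \<Rightarrow> complex)" and p: "1 \<le> p"
  shows "bounded_Lp_operator m p (convolution_operator \<mu>)"
proof -
  obtain \<nu>1 \<nu>2 \<nu>3 \<nu>4 :: "'a measure" where \<nu>: "fin_radon \<nu>1" "fin_radon \<nu>2" "fin_radon \<nu>3" "fin_radon \<nu>4"
    and T: "convolution_operator \<mu> = (\<lambda>f s. convolve \<nu>1 f s - convolve \<nu>2 f s + \<i> * (convolve \<nu>3 f s - convolve \<nu>4 f s))"
    using convolution_operator_decomposition[OF \<mu>] .
  have "bounded_Lp_operator m p (\<lambda>f s. ((convolve \<nu>1 f s + (-1) * convolve \<nu>2 f s) + \<i> * convolve \<nu>3 f s) + (- \<i>) * convolve \<nu>4 f s)"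
    by (intro bounded_Lp_lincomb p bounded_convolve \<nu>)
  then show ?thesis unfolding T by (simp add: algebra_simps)
qed

end

subsection \<open>Approximation by finite combinations of translations\<close>

lemma fin_radon_restrict:
  fixes \<nu> :: "'a::t2_space measure"
  assumes \<nu>: "fin_radon \<nu>" and E: "E \<in> sets borel"
  shows "fin_radon (density \<nu> (indicator E))"
    and "A \<in> sets borel \<Longrightarrow> emeasure (density \<nu> (indicator E)) A = emeasure \<nu> (E \<inter> A)"
proof -
  note s = fin_radon_sets[OF \<nu>]
  have [measurable]: "indicator E \<in> borel_measurable \<nu>" using E by (intro borel_measurable_indicator) (simp add: s)
  have em: "emeasure (density \<nu> (indicator E)) A = emeasure \<nu> (E \<inter> A)" if "A \<in> sets borel" for A
    using that E by (subst emeasure_density) (auto simp: s indicator_inter_arith[symmetric])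
  then show "A \<in> sets borel \<Longrightarrow> emeasure (density \<nu> (indicator E)) A = emeasure \<nu> (E \<inter> A)" .
  show "fin_radon (density \<nu> (indicator E))"
    unfolding fin_radon_def
  proof (intro conjI allI impI)
    show "emeasure (density \<nu> (indicator E)) UNIV < \<infinity>" using E \<nu> by (simp add: em fin_radon_emeasure)
    fix U :: "'a set" and e :: real assume U: "open U" and "0 < e"
    then obtain K where K: "compact K" "K \<subseteq> U" "emeasure \<nu> (U - K) \<le> ennreal e"
      using \<nu> unfolding fin_radon_def by blast
    have "emeasure (density \<nu> (indicator E)) (U - K) = emeasure \<nu> (E \<inter> (U - K))"
      using U K by (intro em) (auto simp: borel_compact)
    also have "\<dots> \<le> emeasure \<nu> (U - K)" using U K by (intro emeasure_mono) (auto simp: s borel_compact)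
    finally show "\<exists>K. compact K \<and> K \<subseteq> U \<and> emeasure (density \<nu> (indicator E)) (U - K) \<le> ennreal e"
      using K by (blast intro: order.trans)
  qed (simp add: s)
qed

lemma convolve_restrict:
  fixes \<nu> :: "'a::{topological_group_add, t2_space} measure"
  assumes \<nu>: "fin_radon \<nu>" and E: "E \<in> sets borel" and f: "f \<in> borel_measurable borel"
  shows "convolve (density \<nu> (indicator E)) f s = (LINT y|\<nu>. indicator E y *\<^sub>R f (- y + s))"
  unfolding convolve_def
  using borel_measurable_indicator[of E \<nu>] E measurable_slice_fun[OF \<nu> f, of s]
  by (subst integral_density[of "\<lambda>x. f (- x + s)" \<nu> "indicator E", symmetric])
    (auto simp: fin_radon_sets[OF \<nu>] ennreal_indicator)

context lc_group
begin

lemma distr_translate: "distr m m (\<lambda>s. - x + s) = m"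
proof (rule measure_eqI)
  fix A assume "A \<in> sets (distr m m (\<lambda>s. - x + s))"
  then have A: "A \<in> sets borel" by (simp add: sets_m)
  have "(\<lambda>s. - x + s) \<in> measurable m m"
    using measurable_translate(2)[of x] by (simp add: measurable_cong_sets[OF sets_m sets_m])
  then show "emeasure (distr m m (\<lambda>s. - x + s)) A = emeasure m A"
    using A m_slice[OF A, of x] by (subst emeasure_distr) (auto simp: sets_m vimage_def)
qed simp

lemma measurable_m_translate: "(\<lambda>s. - x + s) \<in> measurable m m"
  using measurable_translate(2)[of x] by (simp add: measurable_cong_sets[OF sets_m sets_m])

lemma nn_integral_translate:
  "h \<in> borel_measurable borel \<Longrightarrow> (\<integral>\<^sup>+s. h (- x + s) \<partial>m) = (\<integral>\<^sup>+s. h s \<partial>m)"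
  using nn_integral_distr[OF measurable_m_translate, of h x] by (simp add: distr_translate measurable_m)

lemma integral_translate:
  fixes h :: "'a \<Rightarrow> 'b::{banach, second_countable_topology}"
  shows "h \<in> borel_measurable borel \<Longrightarrow> (LINT s|m. h (- x + s)) = (LINT s|m. h s)"
  using integral_distr[OF measurable_m_translate, of h x] by (simp add: distr_translate measurable_m)

lemma
  assumes p: "0 < p" and f: "f \<in> Lp m p"
  shows Lp_translate: "(\<lambda>s. f (- x + s)) \<in> Lp m p"
    and Lp_norm_translate: "Lp_norm m p (\<lambda>s. f (- x + s)) = Lp_norm m p f"
proof -
  note [measurable] = Lp_borel[OF f]
  have "(\<integral>\<^sup>+s. ennreal (norm (f (- x + s)) powr p) \<partial>m) = ennreal (Lp_norm m p f powr p)"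
    using nn_integral_translate[of "\<lambda>s. ennreal (norm (f s) powr p)" x] nn_integral_Lp[OF p f] by simp
  then show "(\<lambda>s. f (- x + s)) \<in> Lp m p"
    by (intro Lp_boundI(1)[OF p, where r = "Lp_norm m p f"]) (auto intro!: measurable_m)
  show "Lp_norm m p (\<lambda>s. f (- x + s)) = Lp_norm m p f"
    unfolding Lp_norm_def using integral_translate[of "\<lambda>s. norm (f s) powr p" x] by simp
qed

lemma m_outer_eps:
  assumes A: "A \<in> sets borel" "emeasure m A < \<infinity>" and e: "0 < e"
  shows "\<exists>U. open U \<and> A \<subseteq> U \<and> emeasure m U < \<infinity> \<and> emeasure m (U - A) \<le> ennreal e"
proof -
  have "emeasure m A < emeasure m A + ennreal e"
    using A e by (cases "emeasure m A") (auto simp: ennreal_plus[symmetric] ennreal_less_iff simp del: ennreal_plus)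
  then have "(INF U\<in>{U. open U \<and> A \<subseteq> U}. emeasure m U) < emeasure m A + ennreal e"
    using m_outer[OF A(1)] by simp
  then obtain U where U: "open U" "A \<subseteq> U" "emeasure m U < emeasure m A + ennreal e"
    unfolding INF_less_iff by blast
  have "emeasure m A + emeasure m (U - A) = emeasure m (A \<union> (U - A))"
    using U A by (intro plus_emeasure) (auto simp: sets_m)
  also have "A \<union> (U - A) = U" using U by auto
  finally have "emeasure m A + emeasure m (U - A) \<le> emeasure m A + ennreal e" using U by simp
  then have "emeasure m (U - A) \<le> ennreal e" using A by (auto simp: ennreal_add_left_cancel_le)
  moreover have "emeasure m U < \<infinity>" using U(3) A by (auto simp: less_top[symmetric] top_unique)
  ultimately show ?thesis using U by blast
qed

lemma m_inner_eps:
  assumes U: "open U" "emeasure m U < \<infinity>" and e: "0 < e"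
  shows "\<exists>K. compact K \<and> K \<subseteq> U \<and> emeasure m (U - K) \<le> ennreal e"
proof (cases "emeasure m U = 0")
  case True
  then show ?thesis by (intro exI[of _ "{}"]) auto
next
  case False
  then have "emeasure m U - ennreal e < emeasure m U"
    using U e by (intro ennreal_between) (auto simp: zero_less_iff_neq_zero)
  also note m_inner[OF U(1)]
  finally obtain K where K: "compact K" "K \<subseteq> U" "emeasure m U - ennreal e < emeasure m K"
    unfolding less_SUP_iff by blast
  from K(3)[THEN less_imp_le] have le: "emeasure m U \<le> emeasure m K + ennreal e"
    by (simp add: ennreal_minus_le_iff add.commute)
  have "emeasure m K + emeasure m (U - K) = emeasure m (K \<union> (U - K))"
    using U K by (intro plus_emeasure) (auto simp: sets_m borel_compact)
  also have "K \<union> (U - K) = U" using K by auto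
  finally have "emeasure m K + emeasure m (U - K) \<le> emeasure m K + ennreal e" using le by simp
  then have "emeasure m (U - K) \<le> ennreal e"
    using m_compact[OF K(1)] by (auto simp: ennreal_add_left_cancel_le)
  then show ?thesis using K by blast
qed

text \<open>Inner regularity extends from open sets to Borel sets of finite measure: take U open
  around A, W open around U - A, K compact in U, and use K - W, a compact subset of A.\<close>

lemma m_compact_eps:
  assumes A: "A \<in> sets borel" "emeasure m A < \<infinity>" and e: "0 < e"
  shows "\<exists>K. compact K \<and> K \<subseteq> A \<and> emeasure m (A - K) \<le> ennreal e"
proof -
  obtain U where U: "open U" "A \<subseteq> U" "emeasure m U < \<infinity>" "emeasure m (U - A) \<le> ennreal (e/4)"
    using m_outer_eps[OF A, of "e/4"] e by auto
  have "emeasure m (U - A) < \<infinity>" using U(4) by (simp add: le_less_trans)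
  then obtain W where W: "open W" "U - A \<subseteq> W" "emeasure m (W - (U - A)) \<le> ennreal (e/4)"
    using m_outer_eps[of "U - A" "e/4"] U A e by auto
  obtain K where K: "compact K" "K \<subseteq> U" "emeasure m (U - K) \<le> ennreal (e/4)"
    using m_inner_eps[OF U(1,3), of "e/4"] e by auto
  have b: "U \<in> sets m" "W \<in> sets m" "K \<in> sets m" "A \<in> sets m"
    using U W K A by (auto simp: sets_m borel_compact)
  have "emeasure m (A - (K - W)) \<le> emeasure m ((U - K) \<union> ((W - (U - A)) \<union> (U - A)))"
    using b U W by (intro emeasure_mono) auto
  also have "\<dots> \<le> emeasure m (U - K) + emeasure m ((W - (U - A)) \<union> (U - A))"
    using b by (intro emeasure_subadditive) auto
  also have "emeasure m ((W - (U - A)) \<union> (U - A)) \<le> emeasure m (W - (U - A)) + emeasure m (U - A)"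
    using b by (intro emeasure_subadditive) auto
  also have "emeasure m (U - K) + (emeasure m (W - (U - A)) + emeasure m (U - A)) \<le> ennreal (e/4) + (ennreal (e/4) + ennreal (e/4))"
    by (intro add_mono K W U)
  also have "\<dots> \<le> ennreal e" using e by (simp add: ennreal_plus[symmetric] del: ennreal_plus)
  finally have "emeasure m (A - (K - W)) \<le> ennreal e" by (simp add: add_left_mono)
  moreover have "compact (K - W)" using K W by (simp add: compact_diff)
  moreover have "K - W \<subseteq> A" using K W by auto
  ultimately show ?thesis by blast
qed

lemma Lp_indicator:
  assumes "0 < p" "A \<in> sets borel" "emeasure m A \<le> ennreal r" "0 \<le> r"
  shows "indicator A \<in> Lp m p" "Lp_norm m p (indicator A) \<le> r powr (1 / p)"
proof -
  have "(\<integral>\<^sup>+x. ennreal (norm (indicator A x :: complex) powr p) \<partial>m) = (\<integral>\<^sup>+x. indicator A x \<partial>m)"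
    using assms by (intro nn_integral_cong) (auto simp: indicator_def)
  also have "\<dots> = emeasure m A" using assms by (simp add: sets_m)
  also have "\<dots> \<le> ennreal ((r powr (1 / p)) powr p)" using assms by (simp add: powr_powr)
  finally have le: "(\<integral>\<^sup>+x. ennreal (norm (indicator A x :: complex) powr p) \<partial>m) \<le> ennreal ((r powr (1 / p)) powr p)" .
  have "indicator A \<in> borel_measurable m" using assms by (intro borel_measurable_indicator) (simp add: sets_m)
  from Lp_boundI[OF assms(1) this _ le] show "indicator A \<in> Lp m p" "Lp_norm m p (indicator A) \<le> r powr (1 / p)" by auto
qed

text \<open>An induction rule expressing density: indicators of compact sets generate
  \<open>Lp\<close> under multiples, sums and norm limits, through indicators of Borel sets of
  finite measure and simple functions.\<close>

lemma Lp_induct [consumes 2, case_names compact cmult add lim]: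
  assumes p: "1 \<le> p" and f: "f \<in> Lp m p"
    and compact: "\<And>D. compact D \<Longrightarrow> P (indicator D)"
    and cmult: "\<And>f c. f \<in> Lp m p \<Longrightarrow> P f \<Longrightarrow> P (\<lambda>x. c * f x)"
    and add: "\<And>f g. f \<in> Lp m p \<Longrightarrow> g \<in> Lp m p \<Longrightarrow> P f \<Longrightarrow> P g \<Longrightarrow> P (\<lambda>x. f x + g x)"
    and lim: "\<And>f. f \<in> Lp m p \<Longrightarrow> (\<And>e. 0 < e \<Longrightarrow> \<exists>g\<in>Lp m p. P g \<and> Lp_norm m p (\<lambda>x. f x - g x) \<le> e) \<Longrightarrow> P f"
  shows "P f"
proof -
  have p0: "0 < p" using p by simp
  have ind: "P (indicator A)" if A: "A \<in> sets borel" "emeasure m A < \<infinity>" for A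
  proof (rule lim)
    obtain a where "emeasure m A = ennreal a" "0 \<le> a" using A by (cases "emeasure m A") auto
    then show AL: "indicator A \<in> Lp m p" using Lp_indicator(1)[OF p0 A(1)] by auto
    fix e :: real assume e: "0 < e"
    obtain K where K: "compact K" "K \<subseteq> A" "emeasure m (A - K) \<le> ennreal (e powr p)"
      using m_compact_eps[OF A, of "e powr p"] e by auto
    have Kb: "K \<in> sets borel" using K by (simp add: borel_compact)
    obtain k where "emeasure m K = ennreal k" "0 \<le> k" using m_compact[OF K(1)] by (cases "emeasure m K") auto
    then have KL: "indicator K \<in> Lp m p" using Lp_indicator(1)[OF p0 Kb] by auto
    have "Lp_norm m p (\<lambda>x. indicator A x - indicator K x) = Lp_norm m p (indicator (A - K))"
      using K by (intro arg_cong[where f = "Lp_norm m p"]) (auto simp: indicator_def fun_eq_iff)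
    also have "\<dots> \<le> (e powr p) powr (1 / p)" using A Kb K by (intro Lp_indicator(2)[OF p0]) auto
    also have "\<dots> = e" using p0 e by (simp add: powr_powr)
    finally show "\<exists>g\<in>Lp m p. P g \<and> Lp_norm m p (\<lambda>x. indicator A x - g x) \<le> e"
      using KL compact[OF K(1)] by blast
  qed
  show ?thesis
  proof (rule lim[OF f])
    fix e :: real assume e: "0 < e"
    note [measurable] = Lp_borel[OF f]
    obtain F where F: "\<And>i. simple_function borel (F i)" "\<And>x. (\<lambda>i. F i x) \<longlonglongrightarrow> f x" "\<And>i x. norm (F i x) \<le> 2 * norm (f x)"
      using borel_measurable_implies_sequence_metric[OF Lp_borel[OF f], of 0] by auto
    have Fm[measurable]: "F i \<in> borel_measurable borel" for i using F(1) by (rule borel_measurable_simple_function)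
    have FL: "F i \<in> Lp m p" for i
    proof (rule Lp_norm_dominated(1)[OF p0 Lp_cmult[OF f, of 2]])
      show "F i \<in> borel_measurable m" by (rule measurable_m[OF Fm])
      show "AE x in m. norm (F i x) \<le> norm (2 * f x)" using F(3) by (simp add: norm_mult)
    qed
    have "(\<lambda>i. LINT x|m. norm (f x - F i x) powr p) \<longlonglongrightarrow> (LINT x|m. 0)"
    proof (rule integral_dominated_convergence[where w = "\<lambda>x. 3 powr p * norm (f x) powr p"])
      show "integrable m (\<lambda>x. 3 powr p * norm (f x) powr p)" using Lp_integrable[OF f] by simp
      show "AE x in m. (\<lambda>i. norm (f x - F i x) powr p) \<longlonglongrightarrow> 0"
      proof (rule AE_I2)
        fix x
        have "(\<lambda>i. norm (f x - F i x)) \<longlonglongrightarrow> norm (f x - f x)" by (intro tendsto_intros F)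
        then have "(\<lambda>i. norm (f x - F i x)) \<longlonglongrightarrow> 0" by simp
        then show "(\<lambda>i. norm (f x - F i x) powr p) \<longlonglongrightarrow> 0"
          by (rule tendsto_zero_powrI[OF _ tendsto_const]) (use p0 in auto)
      qed
      show "AE x in m. norm (norm (f x - F i x) powr p) \<le> 3 powr p * norm (f x) powr p" for i
      proof (rule AE_I2)
        fix x
        have "norm (f x - F i x) \<le> 3 * norm (f x)" using norm_triangle_ineq4[of "f x" "F i x"] F(3)[of i x] by simp
        then have "norm (f x - F i x) powr p \<le> (3 * norm (f x)) powr p" using p0 by (intro powr_mono2) auto
        then show "norm (norm (f x - F i x) powr p) \<le> 3 powr p * norm (f x) powr p" by (simp add: powr_mult)
      qed
    qed (auto intro!: measurable_m)
    then have "\<forall>\<^sub>F i in sequentially. (LINT x|m. norm (f x - F i x) powr p) < e powr p"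
      using e by (intro order_tendstoD(2)) auto
    then have "\<exists>i. (LINT x|m. norm (f x - F i x) powr p) < e powr p"
      by (meson eventually_happens trivial_limit_sequentially)
    then obtain i where "(LINT x|m. norm (f x - F i x) powr p) < e powr p" by blast
    then have 1: "Lp_norm m p (\<lambda>x. f x - F i x) \<le> e" using e by (intro Lp_norm_leI p0) auto
    \<comment> \<open>A level set for a value y different from 0 has finite measure, since its
      indicator is dominated by F i / y.\<close>
    have ind': "indicator (F i -` {y}) \<in> Lp m p \<and> P (indicator (F i -` {y}))" if y: "y \<noteq> 0" for y
    proof -
      have A: "F i -` {y} \<in> sets borel" using measurable_sets[OF Fm, of "{y}" i] by simp
      have L: "indicator (F i -` {y}) \<in> Lp m p"
      proof (rule Lp_norm_dominated(1)[OF p0 Lp_cmult[OF FL, of "1 / y" i]])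
        show "indicator (F i -` {y}) \<in> borel_measurable m" using A by (intro borel_measurable_indicator) (simp add: sets_m)
        show "AE x in m. norm (indicator (F i -` {y}) x :: complex) \<le> norm (1 / y * F i x)"
          using y by (auto simp: indicator_def)
      qed
      have "(\<integral>\<^sup>+x. ennreal (norm (indicator (F i -` {y}) x :: complex) powr p) \<partial>m) = (\<integral>\<^sup>+x. indicator (F i -` {y}) x \<partial>m)"
        using p0 by (intro nn_integral_cong) (auto simp: indicator_def)
      also have "\<dots> = emeasure m (F i -` {y})" using A by (simp add: sets_m)
      finally have "emeasure m (F i -` {y}) = ennreal (Lp_norm m p (indicator (F i -` {y})) powr p)"
        using nn_integral_Lp[OF p0 L] by simp
      then show ?thesis using L ind[OF A] by simp
    qed
    have fin: "P (\<lambda>x. \<Sum>y\<in>Y. y * indicator (F i -` {y}) x)" if "finite Y" "0 \<notin> Y" for Y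
      using that
    proof (induction Y rule: finite_induct)
      case empty
      have "P (\<lambda>x. 0 * indicator {} x)" using Lp_zero[of m p] by (intro cmult compact) (simp_all add: indicator_def)
      then show ?case by simp
    next
      case (insert y Y)
      have "(\<lambda>x. \<Sum>y\<in>Y. y * indicator (F i -` {y}) x) \<in> Lp m p"
        using insert by (intro Lp_sum p Lp_cmult ind'[THEN conjunct1]) auto
      then have "P (\<lambda>x. y * indicator (F i -` {y}) x + (\<Sum>y\<in>Y. y * indicator (F i -` {y}) x))"
        using insert ind'[of y] by (intro add cmult Lp_cmult) auto
      then show ?case by (simp only: sum.insert[OF insert(1,2)])
    qed
    have "F i x = (\<Sum>y\<in>F i ` UNIV - {0}. y * indicator (F i -` {y}) x)" for x
    proof (cases "F i x = 0")
      case True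
      then show ?thesis by (auto simp: indicator_def intro!: sum.neutral[symmetric])
    next
      case False
      have "(\<Sum>y\<in>F i ` UNIV - {0}. y * indicator (F i -` {y}) x) = (\<Sum>y\<in>F i ` UNIV - {0}. if F i x = y then y else 0)"
        by (intro sum.cong) (auto simp: indicator_def)
      also have "\<dots> = F i x" using False simple_functionD(1)[OF F(1), of i] by (subst sum.delta') auto
      finally show ?thesis by simp
    qed
    then have "F i = (\<lambda>x. \<Sum>y\<in>F i ` UNIV - {0}. y * indicator (F i -` {y}) x)" by (rule ext)
    moreover have "P (\<lambda>x. \<Sum>y\<in>F i ` UNIV - {0}. y * indicator (F i -` {y}) x)"
      using simple_functionD(1)[OF F(1), of i] by (intro fin) auto
    ultimately have "P (F i)" by simp
    then show "\<exists>g\<in>Lp m p. P g \<and> Lp_norm m p (\<lambda>x. f x - g x) \<le> e" using FL 1 by blast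
  qed
qed

lemma symmetric_nbhd:
  fixes U :: "'a set"
  assumes D: "compact D" and U: "open U" "D \<subseteq> U"
  obtains V where "open V" "0 \<in> V" "\<And>v. v \<in> V \<Longrightarrow> - v \<in> V" "\<And>v d. v \<in> V \<Longrightarrow> d \<in> D \<Longrightarrow> v + d \<in> U"
proof -
  have "{0} \<times> D \<subseteq> {z. fst z + snd z \<in> U}" using U(2) by auto
  then obtain V where V: "0 \<in> V" "open V" "V \<times> D \<subseteq> {z. fst z + snd z \<in> U}"
    using Elementary_Topology.tube_lemma[OF D open_translate(6)[OF U(1)], of 0] by blast
  define W where "W = V \<inter> {x. - x \<in> V}"
  have "v + d \<in> U" if "v \<in> W" "d \<in> D" for v d
  proof -
    have "(v, d) \<in> {z. fst z + snd z \<in> U}" using V(3) that by (auto simp: W_def)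
    then show ?thesis by simp
  qed
  moreover have "open W" unfolding W_def using V open_translate(7)[OF V(2)] by auto
  ultimately show ?thesis using that[of W] V by (auto simp: W_def)
qed

text \<open>On a small cell E near x, convolution with the restricted measure resembles translation
  by x. The error is proportional to the mass of E, so errors add up over a partition, and V does
  not depend on x.\<close>

definition locally_constant_convolution :: "'a measure \<Rightarrow> real \<Rightarrow> ('a \<Rightarrow> complex) \<Rightarrow> bool" where
  "locally_constant_convolution \<nu> p f \<longleftrightarrow> (\<forall>e>0. \<exists>V. open V \<and> 0 \<in> V \<and> (\<forall>E x. E \<in> sets borel \<longrightarrow> E \<subseteq> {y. - x + y \<in> V} \<longrightarrow>
     Lp_norm m p (\<lambda>s. convolve (density \<nu> (indicator E)) f s - of_real (measure \<nu> E) * f (- x + s)) \<le> e * measure \<nu> E))"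

text \<open>Translates of the indicator by x and by a point y of E differ at t only if -x + t or -y
  + t lies in the thin shell R = U - D. Symmetry of V allows passing between x and y in both
  directions.\<close>

lemma locally_constant_convolution_compact:
  assumes \<nu>: "fin_radon \<nu>" and p: "1 \<le> p" and D: "compact D"
  shows "locally_constant_convolution \<nu> p (indicator D)"
  unfolding locally_constant_convolution_def
proof (intro allI impI)
  fix e :: real assume e: "0 < e"
  have p0: "0 < p" using p by simp
  note s = fin_radon_sets[OF \<nu>]
  have Db[measurable]: "D \<in> sets borel" using D by (rule borel_compact)
  \<comment> \<open>Both the translate by x and the average over E contribute the shell once, hence
    the factor 1/2.\<close>
  define \<eta> where "\<eta> = e powr p / 2"
  have \<eta>: "0 < \<eta>" using e by (simp add: \<eta>_def)
  obtain U where U: "open U" "D \<subseteq> U" "emeasure m (U - D) \<le> ennreal \<eta>"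
    using m_outer_eps[OF Db m_compact[OF D] \<eta>] by blast
  define R where "R = U - D"
  have R[measurable]: "R \<in> sets borel" using U by (auto simp: R_def)
  obtain V where V: "open V" "0 \<in> V" "\<And>v. v \<in> V \<Longrightarrow> - v \<in> V" "\<And>v d. v \<in> V \<Longrightarrow> d \<in> D \<Longrightarrow> v + d \<in> U"
    using symmetric_nbhd[OF D U(1,2)] by blast
  have "Lp_norm m p (\<lambda>s. convolve (density \<nu> (indicator E)) (indicator D) s - of_real (measure \<nu> E) * indicator D (- x + s)) \<le> e * measure \<nu> E"
    if E[measurable]: "E \<in> sets borel" and Ex: "E \<subseteq> {y. - x + y \<in> V}" for E x
  proof -
    define \<nu>' where "\<nu>' = density \<nu> (indicator E)"
    have \<nu>': "fin_radon \<nu>'" unfolding \<nu>'_def by (rule fin_radon_restrict(1)[OF \<nu> E])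
    have c: "measure \<nu>' UNIV = measure \<nu> E"
      using fin_radon_restrict(2)[OF \<nu> E, of UNIV] by (simp add: \<nu>'_def measure_def)
    interpret \<nu>': finite_measure \<nu>' by (rule fin_radon_finite[OF \<nu>'])
    have AE: "AE y in \<nu>'. y \<in> E"
      unfolding \<nu>'_def using borel_measurable_indicator[of E \<nu>] by (subst AE_density) (auto simp: indicator_def s)
    define h where "h t = (indicator D t :: complex)" for t
    have hm[measurable]: "h \<in> borel_measurable borel" unfolding h_def by measurable
    have diff: "convolve \<nu>' h t - of_real (measure \<nu> E) * h (- x + t) = (LINT y|\<nu>'. h (- y + t) - h (- x + t))" for t
    proof -
      have "integrable \<nu>' (\<lambda>y. h (- y + t))"
        by (rule \<nu>'.integrable_const_bound[where B = 1]) (auto simp: h_def indicator_def intro!: measurable_slice_fun[OF \<nu>'] )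
      then show ?thesis by (simp add: convolve_def fin_radon_space[OF \<nu>'] c scaleR_conv_of_real)
    qed
    have pt: "ennreal (norm (h (- y + t) - h (- x + t)) powr p) \<le> indicator R (- x + t) + indicator R (- y + t)" if "y \<in> E" for y t
    proof -
      have v: "- x + y \<in> V" "- (- x + y) \<in> V" using that Ex V(3) by auto
      have a: "- x + t \<in> R" if "- y + t \<in> D" "- x + t \<notin> D"
      proof -
        have "(- x + y) + (- y + t) \<in> U" by (rule V(4)[OF v(1) that(1)])
        then show ?thesis using that by (simp add: R_def add.assoc)
      qed
      have b: "- y + t \<in> R" if "- x + t \<in> D" "- y + t \<notin> D"
      proof -
        have "- (- x + y) + (- x + t) \<in> U" by (rule V(4)[OF v(2) that(1)])
        then show ?thesis using that by (simp add: R_def add.assoc minus_add)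
      qed
      show ?thesis using a b p0 by (auto simp: h_def indicator_def)
    qed
    have "(\<integral>\<^sup>+t. ennreal (norm (convolve \<nu>' h t - of_real (measure \<nu> E) * h (- x + t)) powr p) \<partial>m)
      \<le> (\<integral>\<^sup>+t. ennreal (measure \<nu> E powr (p - 1)) * (ennreal (measure \<nu> E) * indicator R (- x + t) + nnconv \<nu>' (indicator R) t) \<partial>m)"
    proof (rule nn_integral_mono)
      fix t
      have "ennreal (norm (LINT y|\<nu>'. h (- y + t) - h (- x + t)) powr p)
        \<le> ennreal (measure \<nu>' (space \<nu>') powr (p - 1)) * (\<integral>\<^sup>+y. ennreal (norm (h (- y + t) - h (- x + t)) powr p) \<partial>\<nu>')"
        by (intro norm_integral_powr_le \<nu>'.finite_measure_axioms p borel_measurable_diff measurable_slice_fun[OF \<nu>' hm] borel_measurable_const)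
      also have "(\<integral>\<^sup>+y. ennreal (norm (h (- y + t) - h (- x + t)) powr p) \<partial>\<nu>') \<le> (\<integral>\<^sup>+y. indicator R (- x + t) + indicator R (- y + t) \<partial>\<nu>')"
        using AE by (intro nn_integral_mono_AE) (auto elim!: eventually_mono intro: pt)
      also have "\<dots> = indicator R (- x + t) * emeasure \<nu>' UNIV + nnconv \<nu>' (indicator R) t"
        unfolding nnconv_def fin_radon_space[OF \<nu>', symmetric]
        by (subst nn_integral_add) (auto intro!: measurable_slice_fun[OF \<nu>'])
      also have "\<dots> = ennreal (measure \<nu> E) * indicator R (- x + t) + nnconv \<nu>' (indicator R) t"
        by (simp add: fin_radon_emeasure[OF \<nu>'] c mult.commute)
      finally show "ennreal (norm (convolve \<nu>' h t - of_real (measure \<nu> E) * h (- x + t)) powr p)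
        \<le> ennreal (measure \<nu> E powr (p - 1)) * (ennreal (measure \<nu> E) * indicator R (- x + t) + nnconv \<nu>' (indicator R) t)"
        unfolding diff by (simp add: fin_radon_space[OF \<nu>'] c mult_left_mono)
    qed
    also have "\<dots> = ennreal (measure \<nu> E powr (p - 1)) * (ennreal (measure \<nu> E) * (\<integral>\<^sup>+t. indicator R (- x + t) \<partial>m) + (\<integral>\<^sup>+t. nnconv \<nu>' (indicator R) t \<partial>m))"
    proof -
      have [measurable]: "(\<lambda>t. nnconv \<nu>' (indicator R) t) \<in> borel_measurable m"
        by (rule measurable_m, rule measurable_nnconv[OF \<nu>']) measurable
      have [measurable]: "(\<lambda>t. indicator R (- x + t) :: ennreal) \<in> borel_measurable m"
        by (rule measurable_m) measurable
      show ?thesis by (simp add: nn_integral_cmult nn_integral_add)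
    qed
    also have "(\<integral>\<^sup>+t. indicator R (- x + t) \<partial>m) = emeasure m R"
      using nn_integral_translate[of "indicator R" x] by (simp add: sets_m)
    also have "(\<integral>\<^sup>+t. nnconv \<nu>' (indicator R) t \<partial>m) \<le> ennreal (measure \<nu> E) * emeasure m R"
      using nn_integral_nnconv_le[OF \<nu>', of "indicator R"] by (simp add: sets_m fin_radon_emeasure[OF \<nu>'] c)
    also have "ennreal (measure \<nu> E powr (p - 1)) * (ennreal (measure \<nu> E) * emeasure m R + ennreal (measure \<nu> E) * emeasure m R)
      \<le> ennreal (measure \<nu> E powr (p - 1)) * (ennreal (measure \<nu> E) * ennreal \<eta> + ennreal (measure \<nu> E) * ennreal \<eta>)"
      using U(3) by (intro mult_left_mono add_mono) (auto simp: R_def)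
    also have "\<dots> = ennreal ((e * measure \<nu> E) powr p)"
    proof -
      have "measure \<nu> E powr (p - 1) * (measure \<nu> E * \<eta> + measure \<nu> E * \<eta>) = (e * measure \<nu> E) powr p"
        by (cases "measure \<nu> E = 0") (auto simp: \<eta>_def powr_diff powr_mult)
      then show ?thesis using \<eta> by (simp add: ennreal_mult[symmetric] ennreal_plus[symmetric] del: ennreal_plus)
    qed
    finally have "(\<integral>\<^sup>+t. ennreal (norm (convolve \<nu>' h t - of_real (measure \<nu> E) * h (- x + t)) powr p) \<partial>m) \<le> ennreal ((e * measure \<nu> E) powr p)"
      by (simp add: add_left_mono mult_left_mono)
    moreover have "(\<lambda>t. convolve \<nu>' h t - of_real (measure \<nu> E) * h (- x + t)) \<in> borel_measurable m"
    proof (rule measurable_m)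
      note [measurable] = convolve_measurable[OF \<nu>' hm]
      show "(\<lambda>t. convolve \<nu>' h t - of_real (measure \<nu> E) * h (- x + t)) \<in> borel_measurable borel" by measurable
    qed
    ultimately show ?thesis
      using e Lp_boundI(2)[OF p0, of "\<lambda>t. convolve \<nu>' h t - of_real (measure \<nu> E) * h (- x + t)" m "e * measure \<nu> E"]
      by (simp add: \<nu>'_def h_def[abs_def])
  qed
  then show "\<exists>V. open V \<and> 0 \<in> V \<and> (\<forall>E x. E \<in> sets borel \<longrightarrow> E \<subseteq> {y. - x + y \<in> V} \<longrightarrow>
     Lp_norm m p (\<lambda>s. convolve (density \<nu> (indicator E)) (indicator D) s - of_real (measure \<nu> E) * indicator D (- x + s)) \<le> e * measure \<nu> E)"
    using V by blast
qed

lemma locally_constant_convolution: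
  assumes \<nu>: "fin_radon \<nu>" and p: "1 \<le> p" and f: "f \<in> Lp m p"
  shows "locally_constant_convolution \<nu> p f"
  using p f
proof (induction rule: Lp_induct)
  case (compact D)
  then show ?case by (rule locally_constant_convolution_compact[OF \<nu> p])
next
  case (cmult f c)
  show ?case unfolding locally_constant_convolution_def
  proof (intro allI impI)
    fix e :: real assume e: "0 < e"
    have "0 < e / (norm c + 1)" using e by (intro divide_pos_pos) (auto intro: add_nonneg_pos)
    then obtain V where V: "open V" "0 \<in> V" "\<And>E x. E \<in> sets borel \<Longrightarrow> E \<subseteq> {y. - x + y \<in> V} \<Longrightarrow>
      Lp_norm m p (\<lambda>s. convolve (density \<nu> (indicator E)) f s - of_real (measure \<nu> E) * f (- x + s)) \<le> e / (norm c + 1) * measure \<nu> E"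
      using cmult(2) unfolding locally_constant_convolution_def by meson
    have "Lp_norm m p (\<lambda>s. convolve (density \<nu> (indicator E)) (\<lambda>x. c * f x) s - of_real (measure \<nu> E) * (c * f (- x + s))) \<le> e * measure \<nu> E"
      if "E \<in> sets borel" "E \<subseteq> {y. - x + y \<in> V}" for E x
    proof -
      have "Lp_norm m p (\<lambda>s. convolve (density \<nu> (indicator E)) (\<lambda>x. c * f x) s - of_real (measure \<nu> E) * (c * f (- x + s)))
        = Lp_norm m p (\<lambda>s. c * (convolve (density \<nu> (indicator E)) f s - of_real (measure \<nu> E) * f (- x + s)))"
        by (simp add: convolve_def algebra_simps)
      also have "\<dots> = norm c * Lp_norm m p (\<lambda>s. convolve (density \<nu> (indicator E)) f s - of_real (measure \<nu> E) * f (- x + s))"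
        using p by (intro Lp_norm_cmult) simp
      also have "\<dots> \<le> norm c * (e / (norm c + 1) * measure \<nu> E)"
        by (intro mult_left_mono V(3) that) simp
      also have "\<dots> = (norm c / (norm c + 1)) * (e * measure \<nu> E)" by simp
      also have "\<dots> \<le> 1 * (e * measure \<nu> E)"
        using e by (intro mult_right_mono) (auto simp: divide_le_eq_1 add_nonneg_pos)
      finally show ?thesis by simp
    qed
    then show "\<exists>V. open V \<and> 0 \<in> V \<and> (\<forall>E x. E \<in> sets borel \<longrightarrow> E \<subseteq> {y. - x + y \<in> V} \<longrightarrow>
      Lp_norm m p (\<lambda>s. convolve (density \<nu> (indicator E)) (\<lambda>x. c * f x) s - of_real (measure \<nu> E) * (c * f (- x + s))) \<le> e * measure \<nu> E)"
      using V by blast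
  qed
next
  case (add f g)
  have p0: "0 < p" using p by simp
  show ?case unfolding locally_constant_convolution_def
  proof (intro allI impI)
    fix e :: real assume e: "0 < e"
    obtain V where V: "open V" "0 \<in> V" "\<And>E x. E \<in> sets borel \<Longrightarrow> E \<subseteq> {y. - x + y \<in> V} \<Longrightarrow>
      Lp_norm m p (\<lambda>s. convolve (density \<nu> (indicator E)) f s - of_real (measure \<nu> E) * f (- x + s)) \<le> e / 2 * measure \<nu> E"
      using add(3) half_gt_zero[OF e] unfolding locally_constant_convolution_def by meson
    obtain W where W: "open W" "0 \<in> W" "\<And>E x. E \<in> sets borel \<Longrightarrow> E \<subseteq> {y. - x + y \<in> W} \<Longrightarrow>
      Lp_norm m p (\<lambda>s. convolve (density \<nu> (indicator E)) g s - of_real (measure \<nu> E) * g (- x + s)) \<le> e / 2 * measure \<nu> E"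
      using add(4) half_gt_zero[OF e] unfolding locally_constant_convolution_def by meson
    have "Lp_norm m p (\<lambda>s. convolve (density \<nu> (indicator E)) (\<lambda>x. f x + g x) s - of_real (measure \<nu> E) * (f (- x + s) + g (- x + s))) \<le> e * measure \<nu> E"
      if E: "E \<in> sets borel" "E \<subseteq> {y. - x + y \<in> V \<inter> W}" for E x
    proof -
      define \<nu>' where "\<nu>' = density \<nu> (indicator E)"
      have \<nu>': "fin_radon \<nu>'" unfolding \<nu>'_def by (rule fin_radon_restrict(1)[OF \<nu> E(1)])
      note L = convolve_Lp[OF \<nu>' p] Lp_cmult Lp_translate[OF p0] add(1,2)
      have "AE s in m. convolve \<nu>' (\<lambda>x. f x + g x) s = convolve \<nu>' f s + convolve \<nu>' g s"
        by (rule bounded_Lp_add[OF bounded_convolve[OF \<nu>' p] add(1,2)])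
      then have "Lp_norm m p (\<lambda>s. convolve \<nu>' (\<lambda>x. f x + g x) s - of_real (measure \<nu> E) * (f (- x + s) + g (- x + s)))
        = Lp_norm m p (\<lambda>s. (convolve \<nu>' f s - of_real (measure \<nu> E) * f (- x + s)) + (convolve \<nu>' g s - of_real (measure \<nu> E) * g (- x + s)))"
        by (intro Lp_norm_cong_AE Lp_measurable[of _ _ p] Lp_add Lp_diff p L) (auto elim!: eventually_mono simp: algebra_simps)
      also have "\<dots> \<le> Lp_norm m p (\<lambda>s. convolve \<nu>' f s - of_real (measure \<nu> E) * f (- x + s)) + Lp_norm m p (\<lambda>s. convolve \<nu>' g s - of_real (measure \<nu> E) * g (- x + s))"
        by (intro Lp_norm_triangle Lp_diff p L)
      also have "\<dots> \<le> e / 2 * measure \<nu> E + e / 2 * measure \<nu> E"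
        unfolding \<nu>'_def using E by (intro add_mono V W) auto
      finally show ?thesis by (simp add: \<nu>'_def)
    qed
    then show "\<exists>V. open V \<and> 0 \<in> V \<and> (\<forall>E x. E \<in> sets borel \<longrightarrow> E \<subseteq> {y. - x + y \<in> V} \<longrightarrow>
      Lp_norm m p (\<lambda>s. convolve (density \<nu> (indicator E)) (\<lambda>x. f x + g x) s - of_real (measure \<nu> E) * (f (- x + s) + g (- x + s))) \<le> e * measure \<nu> E)"
      using V(1,2) W(1,2) by (intro exI[of _ "V \<inter> W"]) (simp add: open_Int)
  qed
next
  case (lim f)
  have p0: "0 < p" using p by simp
  show ?case unfolding locally_constant_convolution_def
  proof (intro allI impI)
    fix e :: real assume e: "0 < e"
    then have e3: "0 < e / 3" by simp
    obtain g where g: "g \<in> Lp m p" "locally_constant_convolution \<nu> p g" "Lp_norm m p (\<lambda>x. f x - g x) \<le> e / 3"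
      using lim(2)[OF e3] by blast
    obtain V where V: "open V" "0 \<in> V" "\<And>E x. E \<in> sets borel \<Longrightarrow> E \<subseteq> {y. - x + y \<in> V} \<Longrightarrow>
      Lp_norm m p (\<lambda>s. convolve (density \<nu> (indicator E)) g s - of_real (measure \<nu> E) * g (- x + s)) \<le> e / 3 * measure \<nu> E"
      using g(2) e3 unfolding locally_constant_convolution_def by meson
    have "Lp_norm m p (\<lambda>s. convolve (density \<nu> (indicator E)) f s - of_real (measure \<nu> E) * f (- x + s)) \<le> e * measure \<nu> E"
      if E: "E \<in> sets borel" "E \<subseteq> {y. - x + y \<in> V}" for E x
    proof -
      define \<nu>' where "\<nu>' = density \<nu> (indicator E)"
      have \<nu>': "fin_radon \<nu>'" unfolding \<nu>'_def by (rule fin_radon_restrict(1)[OF \<nu> E(1)])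
      have c: "measure \<nu>' UNIV = measure \<nu> E"
        using fin_radon_restrict(2)[OF \<nu> E(1), of UNIV] by (simp add: \<nu>'_def measure_def)
      have fg: "(\<lambda>x. f x - g x) \<in> Lp m p" by (intro Lp_diff p lim g)
      note L = convolve_Lp[OF \<nu>' p] Lp_cmult Lp_translate[OF p0] lim(1) g(1) fg
      have "AE s in m. convolve \<nu>' (\<lambda>x. f x - g x) s = convolve \<nu>' f s - convolve \<nu>' g s"
        by (rule bounded_Lp_diff[OF p bounded_convolve[OF \<nu>' p] lim(1) g(1)])
      then have "Lp_norm m p (\<lambda>s. convolve \<nu>' f s - of_real (measure \<nu> E) * f (- x + s))
        = Lp_norm m p (\<lambda>s. (convolve \<nu>' (\<lambda>x. f x - g x) s + (convolve \<nu>' g s - of_real (measure \<nu> E) * g (- x + s))) - of_real (measure \<nu> E) * (f (- x + s) - g (- x + s)))"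
        by (intro Lp_norm_cong_AE Lp_measurable[of _ _ p] Lp_add Lp_diff p L) (auto elim!: eventually_mono simp: algebra_simps)
      also have "\<dots> \<le> Lp_norm m p (\<lambda>s. convolve \<nu>' (\<lambda>x. f x - g x) s + (convolve \<nu>' g s - of_real (measure \<nu> E) * g (- x + s))) + Lp_norm m p (\<lambda>s. of_real (measure \<nu> E) * (f (- x + s) - g (- x + s)))"
        by (intro Lp_norm_triangle_diff Lp_add Lp_diff p L)
      also have "Lp_norm m p (\<lambda>s. convolve \<nu>' (\<lambda>x. f x - g x) s + (convolve \<nu>' g s - of_real (measure \<nu> E) * g (- x + s)))
        \<le> Lp_norm m p (convolve \<nu>' (\<lambda>x. f x - g x)) + Lp_norm m p (\<lambda>s. convolve \<nu>' g s - of_real (measure \<nu> E) * g (- x + s))"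
        by (intro Lp_norm_triangle Lp_diff p L)
      also have "Lp_norm m p (convolve \<nu>' (\<lambda>x. f x - g x)) \<le> measure \<nu> E * (e / 3)"
        using Lp_norm_convolve_le[OF \<nu>' p fg] mult_left_mono[OF g(3), of "measure \<nu> E"] by (simp add: c)
      also have "Lp_norm m p (\<lambda>s. convolve \<nu>' g s - of_real (measure \<nu> E) * g (- x + s)) \<le> e / 3 * measure \<nu> E"
        unfolding \<nu>'_def by (intro V E)
      also have "Lp_norm m p (\<lambda>s. of_real (measure \<nu> E) * (f (- x + s) - g (- x + s))) = measure \<nu> E * Lp_norm m p (\<lambda>x. f x - g x)"
        using Lp_norm_translate[OF p0 fg, of x] p0 by (simp add: Lp_norm_cmult)
      also have "\<dots> \<le> measure \<nu> E * (e / 3)" by (intro mult_left_mono g) simp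
      finally show ?thesis by (simp add: \<nu>'_def field_simps)
    qed
    then show "\<exists>V. open V \<and> 0 \<in> V \<and> (\<forall>E x. E \<in> sets borel \<longrightarrow> E \<subseteq> {y. - x + y \<in> V} \<longrightarrow>
      Lp_norm m p (\<lambda>s. convolve (density \<nu> (indicator E)) f s - of_real (measure \<nu> E) * f (- x + s)) \<le> e * measure \<nu> E)"
      using V by blast
  qed
qed

end

definition fin_conv :: "(complex \<times> 'a::topological_group_add) list \<Rightarrow> ('a \<Rightarrow> complex) \<Rightarrow> 'a \<Rightarrow> complex" where
  "fin_conv xs f s = (\<Sum>(c, x)\<leftarrow>xs. c * f (- x + s))"

lemma fin_conv_simps [simp]:
  "fin_conv [] f s = 0"
  "fin_conv ((c, x) # xs) f s = c * f (- x + s) + fin_conv xs f s"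
  "fin_conv (xs @ ys) f s = fin_conv xs f s + fin_conv ys f s"
  by (simp_all add: fin_conv_def)

lemma fin_conv_scale: "fin_conv (map (\<lambda>(c, x). (a * c, x)) xs) f s = a * fin_conv xs f s"
  by (induction xs) (auto simp: algebra_simps)

context lc_group
begin

lemma
  assumes p: "1 \<le> p" and f: "f \<in> Lp m p"
  shows fin_conv_Lp: "fin_conv xs f \<in> Lp m p"
    and Lp_norm_fin_conv_le: "Lp_norm m p (fin_conv xs f) \<le> (\<Sum>(c, x)\<leftarrow>xs. norm c) * Lp_norm m p f"
proof -
  have p0: "0 < p" using p by simp
  have "fin_conv xs f \<in> Lp m p \<and> Lp_norm m p (fin_conv xs f) \<le> (\<Sum>(c, x)\<leftarrow>xs. norm c) * Lp_norm m p f"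
  proof (induction xs)
    case Nil
    have "fin_conv [] f = (\<lambda>x. 0)" by (rule ext) simp
    then show ?case by (simp add: Lp_zero)
  next
    case (Cons a xs)
    obtain c x where a: "a = (c, x)" by (cases a)
    have eq: "fin_conv (a # xs) f = (\<lambda>s. c * f (- x + s) + fin_conv xs f s)" by (rule ext) (simp add: a)
    have L: "(\<lambda>s. c * f (- x + s)) \<in> Lp m p" by (intro Lp_cmult Lp_translate p0 f)
    have "Lp_norm m p (\<lambda>s. c * f (- x + s) + fin_conv xs f s) \<le> Lp_norm m p (\<lambda>s. c * f (- x + s)) + Lp_norm m p (fin_conv xs f)"
      using Cons by (intro Lp_norm_triangle p L) simp
    also have "Lp_norm m p (\<lambda>s. c * f (- x + s)) = norm c * Lp_norm m p f"
      by (simp add: Lp_norm_cmult[OF p0] Lp_norm_translate[OF p0 f])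
    finally show ?case using Cons L Lp_add[OF p L] by (simp add: eq a algebra_simps)
  qed
  then show "fin_conv xs f \<in> Lp m p" "Lp_norm m p (fin_conv xs f) \<le> (\<Sum>(c, x)\<leftarrow>xs. norm c) * Lp_norm m p f" by auto
qed

text \<open>One list approximates T at two functions simultaneously, and the coefficient sums are
  bounded independently of the accuracy. Both features serve to compare T (T f) with the square of
  an approximant applied to f.\<close>

definition translation_limit :: "real \<Rightarrow> (('a \<Rightarrow> complex) \<Rightarrow> 'a \<Rightarrow> complex) \<Rightarrow> bool" where
  "translation_limit p T \<longleftrightarrow> (\<exists>C\<ge>0. \<forall>f\<in>Lp m p. \<forall>g\<in>Lp m p. \<forall>e>0. \<exists>xs. (\<Sum>(c, x)\<leftarrow>xs. norm c) \<le> C \<and>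
     Lp_norm m p (\<lambda>s. T f s - fin_conv xs f s) \<le> e \<and> Lp_norm m p (\<lambda>s. T g s - fin_conv xs g s) \<le> e)"

text \<open>A countable partition fine enough for f and g is truncated to finitely many cells. The
  translates at the cell points account for half of e, the convolution with the leftover part of the
  measure for the other half.\<close>

lemma translation_limit_convolve:
  assumes \<nu>: "fin_radon (\<nu> :: 'a measure)" and p: "1 \<le> p"
  shows "translation_limit p (convolve \<nu>)"
  unfolding translation_limit_def
proof (intro exI[of _ "measure \<nu> UNIV"] conjI ballI allI impI)
  fix f g and e :: real assume f: "f \<in> Lp m p" and g: "g \<in> Lp m p" and e: "0 < e"
  have p0: "0 < p" using p by simp
  note s = fin_radon_sets[OF \<nu>]
  interpret \<nu>: finite_measure \<nu> by (rule fin_radon_finite[OF \<nu>])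
  define c where "c = measure \<nu> UNIV"
  have c: "0 \<le> c" by (simp add: c_def)
  define \<delta> where "\<delta> = e / (2 * (c + 1))"
  have \<delta>: "0 < \<delta>" using e c by (simp add: \<delta>_def)
  have \<delta>c: "c * \<delta> \<le> e / 2" using e c by (simp add: \<delta>_def field_simps)
  obtain V where V: "open V" "0 \<in> V" "\<And>E x. E \<in> sets borel \<Longrightarrow> E \<subseteq> {y. - x + y \<in> V} \<Longrightarrow>
      Lp_norm m p (\<lambda>s. convolve (density \<nu> (indicator E)) f s - of_real (measure \<nu> E) * f (- x + s)) \<le> \<delta> * measure \<nu> E"
    using locally_constant_convolution[OF \<nu> p f] \<delta> unfolding locally_constant_convolution_def by meson
  obtain W where W: "open W" "0 \<in> W" "\<And>E x. E \<in> sets borel \<Longrightarrow> E \<subseteq> {y. - x + y \<in> W} \<Longrightarrow>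
      Lp_norm m p (\<lambda>s. convolve (density \<nu> (indicator E)) g s - of_real (measure \<nu> E) * g (- x + s)) \<le> \<delta> * measure \<nu> E"
    using locally_constant_convolution[OF \<nu> p g] \<delta> unfolding locally_constant_convolution_def by meson
  have "open {y. - x + y \<in> V \<inter> W} \<and> x \<in> {y. - x + y \<in> V \<inter> W}" for x
    using V W open_translate(2)[of "V \<inter> W" x] by (auto simp: open_Int)
  from fin_radon_partition[OF \<nu> open_UNIV UNIV_not_empty this]
  obtain x E where E: "\<And>i::nat. E i \<in> sets borel" "disjoint_family E" "\<And>i. E i \<subseteq> {y. - x i + y \<in> V \<inter> W} \<inter> UNIV"
      "emeasure \<nu> (UNIV - (\<Union>i. E i)) = 0"
    by blast
  define R where "R n = UNIV - (\<Union>i<n. E i)" for n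
  have Rb: "R n \<in> sets borel" for n unfolding R_def using E by auto
  have "(\<lambda>n. measure \<nu> (R n)) \<longlonglongrightarrow> measure \<nu> (\<Inter>n. R n)"
    using Rb by (intro \<nu>.finite_Lim_measure_decseq) (auto simp: s R_def decseq_def)
  moreover have "(\<Inter>n. R n) = UNIV - (\<Union>i. E i)" by (auto simp: R_def)
  ultimately have "(\<lambda>n. measure \<nu> (R n)) \<longlonglongrightarrow> 0" using E(4) by (simp add: measure_def)
  \<comment> \<open>The mass left out of the finite partition stays below this bound. The added 1
    avoids division by 0 when both functions are null.\<close>
  moreover define \<gamma> where "\<gamma> = e / (2 * (Lp_norm m p f + Lp_norm m p g + 1))"
  have nf: "0 < Lp_norm m p f + Lp_norm m p g + 1" using Lp_norm_nonneg[of m p f] Lp_norm_nonneg[of m p g] by linarith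
  have \<gamma>: "0 < \<gamma>" using e nf by (simp add: \<gamma>_def)
  ultimately have "\<forall>\<^sub>F n in sequentially. measure \<nu> (R n) < \<gamma>" by (auto intro: order_tendstoD)
  then have "\<exists>n. measure \<nu> (R n) < \<gamma>" by (meson eventually_happens trivial_limit_sequentially)
  then obtain n where n: "measure \<nu> (R n) < \<gamma>" by blast
  define xs where "xs = map (\<lambda>i. (complex_of_real (measure \<nu> (E i)), x i)) [0..<n]"
  have xs: "fin_conv xs h s = (\<Sum>i<n. of_real (measure \<nu> (E i)) * h (- x i + s))" for h s
    by (simp add: xs_def fin_conv_def o_def interv_sum_list_conv_sum_set_nat atLeast0LessThan)
  have "(\<Sum>(c, x)\<leftarrow>xs. norm c) = (\<Sum>i<n. measure \<nu> (E i))"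
    by (simp add: xs_def o_def interv_sum_list_conv_sum_set_nat atLeast0LessThan)
  also have "\<dots> = measure \<nu> (\<Union>i<n. E i)"
    using E by (intro \<nu>.finite_measure_finite_Union[symmetric]) (auto simp: s disjoint_family_on_def)
  also have "\<dots> \<le> c" unfolding c_def using E by (intro \<nu>.finite_measure_mono) (auto simp: s)
  finally have xsc: "(\<Sum>(c, x)\<leftarrow>xs. norm c) \<le> c" and Ec: "(\<Sum>i<n. measure \<nu> (E i)) \<le> c"
    by (simp_all add: xs_def o_def interv_sum_list_conv_sum_set_nat atLeast0LessThan)
  have main: "Lp_norm m p (\<lambda>s. convolve \<nu> h s - fin_conv xs h s) \<le> e"
    if h: "h \<in> Lp m p" and hn: "Lp_norm m p h \<le> Lp_norm m p f + Lp_norm m p g"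
      and hV: "\<And>i. Lp_norm m p (\<lambda>s. convolve (density \<nu> (indicator (E i))) h s - of_real (measure \<nu> (E i)) * h (- x i + s)) \<le> \<delta> * measure \<nu> (E i)" for h
  proof -
    have hb: "h \<in> borel_measurable borel" by (rule Lp_borel[OF h])
    note rE = fin_radon_restrict[OF \<nu> E(1)] and rR = fin_radon_restrict[OF \<nu> Rb]
    have ae: "AE s in m. convolve \<nu> h s - fin_conv xs h s = (\<Sum>i<n. convolve (density \<nu> (indicator (E i))) h s - of_real (measure \<nu> (E i)) * h (- x i + s))
        + convolve (density \<nu> (indicator (R n))) h s"
      using convolve_integrable_AE[OF \<nu> p h]
    proof eventually_elim
      case (elim s)
      have i: "integrable \<nu> (\<lambda>y. indicator A y *\<^sub>R h (- y + s))" if "A \<in> sets borel" for A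
        using elim that by (intro integrable_mult_indicator) (auto simp: fin_radon_sets[OF \<nu>])
      have "(\<Sum>i<n. indicator (E i) y) + indicator (R n) y = (1::real)" for y
      proof -
        have "(\<Sum>i<n. indicator (E i) y) = (indicator (\<Union>i<n. E i) y :: real)"
          using E(2) by (intro indicator_UN_disjoint[symmetric]) (auto simp: disjoint_family_on_def)
        then show ?thesis by (auto simp: R_def indicator_def)
      qed
      then have "convolve \<nu> h s = (LINT y|\<nu>. ((\<Sum>i<n. indicator (E i) y) + indicator (R n) y) *\<^sub>R h (- y + s))"
        by (simp add: convolve_def)
      also have "\<dots> = (LINT y|\<nu>. (\<Sum>i<n. indicator (E i) y *\<^sub>R h (- y + s)) + indicator (R n) y *\<^sub>R h (- y + s))"
        by (simp only: scaleR_left_distrib scaleR_sum_left)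
      also have "\<dots> = (LINT y|\<nu>. (\<Sum>i<n. indicator (E i) y *\<^sub>R h (- y + s))) + (LINT y|\<nu>. indicator (R n) y *\<^sub>R h (- y + s))"
        by (intro Bochner_Integration.integral_add Bochner_Integration.integrable_sum i E(1) Rb)
      also have "(LINT y|\<nu>. (\<Sum>i<n. indicator (E i) y *\<^sub>R h (- y + s))) = (\<Sum>i<n. LINT y|\<nu>. indicator (E i) y *\<^sub>R h (- y + s))"
        by (intro Bochner_Integration.integral_sum i E(1))
      also have "\<dots> + (LINT y|\<nu>. indicator (R n) y *\<^sub>R h (- y + s)) = (\<Sum>i<n. convolve (density \<nu> (indicator (E i))) h s) + convolve (density \<nu> (indicator (R n))) h s"
        by (simp only: convolve_restrict[OF \<nu> E(1) hb] convolve_restrict[OF \<nu> Rb hb])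
      finally show ?case by (simp add: xs sum_subtractf)
    qed
    have L: "(\<lambda>s. convolve (density \<nu> (indicator (E i))) h s - of_real (measure \<nu> (E i)) * h (- x i + s)) \<in> Lp m p" for i
      by (intro Lp_diff Lp_cmult convolve_Lp Lp_translate p p0 h rE(1))
    have "Lp_norm m p (\<lambda>s. convolve \<nu> h s - fin_conv xs h s) = Lp_norm m p (\<lambda>s. (\<Sum>i<n. convolve (density \<nu> (indicator (E i))) h s - of_real (measure \<nu> (E i)) * h (- x i + s))
        + convolve (density \<nu> (indicator (R n))) h s)"
      by (rule Lp_norm_cong_AE[OF _ _ ae]; intro Lp_measurable[of _ _ p] Lp_diff Lp_add Lp_sum p L convolve_Lp fin_conv_Lp \<nu> h rR(1))
    also have "\<dots> \<le> Lp_norm m p (\<lambda>s. \<Sum>i<n. convolve (density \<nu> (indicator (E i))) h s - of_real (measure \<nu> (E i)) * h (- x i + s))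
        + Lp_norm m p (convolve (density \<nu> (indicator (R n))) h)"
      by (intro Lp_norm_triangle Lp_sum p L convolve_Lp h rR(1))
    also have "Lp_norm m p (\<lambda>s. \<Sum>i<n. convolve (density \<nu> (indicator (E i))) h s - of_real (measure \<nu> (E i)) * h (- x i + s))
       \<le> (\<Sum>i<n. Lp_norm m p (\<lambda>s. convolve (density \<nu> (indicator (E i))) h s - of_real (measure \<nu> (E i)) * h (- x i + s)))"
      by (intro Lp_norm_sum p L)
    also have "\<dots> \<le> (\<Sum>i<n. \<delta> * measure \<nu> (E i))" by (intro sum_mono hV)
    also have "\<dots> = (\<Sum>i<n. measure \<nu> (E i)) * \<delta>" by (simp add: sum_distrib_left mult.commute)
    also have "\<dots> \<le> c * \<delta>" using Ec \<delta> by (intro mult_right_mono) auto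
    also note \<delta>c
    also have "Lp_norm m p (convolve (density \<nu> (indicator (R n))) h) \<le> measure \<nu> (R n) * Lp_norm m p h"
      using Lp_norm_convolve_le[OF rR(1) p h] rR(2)[of UNIV] by (simp add: measure_def)
    also have "\<dots> \<le> \<gamma> * (Lp_norm m p f + Lp_norm m p g + 1)"
      using n hn \<gamma> by (intro mult_mono) auto
    also have "\<dots> = e / 2"
    proof -
      have "e / (2 * X) * X = e / 2" if "0 < X" for X :: real using that by simp
      then show ?thesis unfolding \<gamma>_def using nf .
    qed
    finally show ?thesis by simp
  qed
  have "Lp_norm m p (\<lambda>s. convolve \<nu> f s - fin_conv xs f s) \<le> e"
    by (rule main[OF f _ V(3)[OF E(1)]]) (use E(3) in fastforce)+
  moreover have "Lp_norm m p (\<lambda>s. convolve \<nu> g s - fin_conv xs g s) \<le> e"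
    by (rule main[OF g _ W(3)[OF E(1)]]) (use E(3) in fastforce)+
  ultimately show "\<exists>xs. (\<Sum>(c, x)\<leftarrow>xs. norm c) \<le> measure \<nu> UNIV \<and>
     Lp_norm m p (\<lambda>s. convolve \<nu> f s - fin_conv xs f s) \<le> e \<and> Lp_norm m p (\<lambda>s. convolve \<nu> g s - fin_conv xs g s) \<le> e"
    using xsc c_def by blast
qed simp

lemma translation_limit_lincomb:
  assumes p: "1 \<le> p" and T: "translation_limit p T" and S: "translation_limit p S"
    and LT: "\<And>f. f \<in> Lp m p \<Longrightarrow> T f \<in> Lp m p" and LS: "\<And>f. f \<in> Lp m p \<Longrightarrow> S f \<in> Lp m p"
  shows "translation_limit p (\<lambda>f s. T f s + a * S f s)"
proof -
  have p0: "0 < p" using p by simp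
  obtain C where C: "0 \<le> C" "\<And>f g e. f \<in> Lp m p \<Longrightarrow> g \<in> Lp m p \<Longrightarrow> 0 < e \<Longrightarrow> \<exists>xs. (\<Sum>(c, x)\<leftarrow>xs. norm c) \<le> C \<and>
     Lp_norm m p (\<lambda>s. T f s - fin_conv xs f s) \<le> e \<and> Lp_norm m p (\<lambda>s. T g s - fin_conv xs g s) \<le> e"
    using T unfolding translation_limit_def by meson
  obtain D where D: "0 \<le> D" "\<And>f g e. f \<in> Lp m p \<Longrightarrow> g \<in> Lp m p \<Longrightarrow> 0 < e \<Longrightarrow> \<exists>xs. (\<Sum>(c, x)\<leftarrow>xs. norm c) \<le> D \<and>
     Lp_norm m p (\<lambda>s. S f s - fin_conv xs f s) \<le> e \<and> Lp_norm m p (\<lambda>s. S g s - fin_conv xs g s) \<le> e"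
    using S unfolding translation_limit_def by meson
  show ?thesis unfolding translation_limit_def
  proof (intro exI[of _ "C + norm a * D"] conjI ballI allI impI)
    fix f g and e :: real assume f: "f \<in> Lp m p" and g: "g \<in> Lp m p" and e: "0 < e"
    define \<delta> where "\<delta> = e / (1 + norm a)"
    have na: "0 < 1 + norm a" by (simp add: add_pos_nonneg)
    have \<delta>: "0 < \<delta>" using e na by (simp add: \<delta>_def)
    obtain xs where xs: "(\<Sum>(c, x)\<leftarrow>xs. norm c) \<le> C" "Lp_norm m p (\<lambda>s. T f s - fin_conv xs f s) \<le> \<delta>" "Lp_norm m p (\<lambda>s. T g s - fin_conv xs g s) \<le> \<delta>"
      using C(2)[OF f g \<delta>] by blast
    obtain ys where ys: "(\<Sum>(c, x)\<leftarrow>ys. norm c) \<le> D" "Lp_norm m p (\<lambda>s. S f s - fin_conv ys f s) \<le> \<delta>" "Lp_norm m p (\<lambda>s. S g s - fin_conv ys g s) \<le> \<delta>"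
      using D(2)[OF f g \<delta>] by blast
    define zs where "zs = xs @ map (\<lambda>(c, x). (a * c, x)) ys"
    have "(\<Sum>(c, x)\<leftarrow>map (\<lambda>(c, x). (a * c, x)) ys. norm c) = norm a * (\<Sum>(c, x)\<leftarrow>ys. norm c)"
      by (induction ys) (auto simp: norm_mult algebra_simps)
    then have zn: "(\<Sum>(c, x)\<leftarrow>zs. norm c) \<le> C + norm a * D"
      using xs(1) mult_left_mono[OF ys(1), of "norm a"] by (simp add: zs_def)
    have z: "Lp_norm m p (\<lambda>s. T h s + a * S h s - fin_conv zs h s) \<le> e"
      if h: "h \<in> Lp m p" and 1: "Lp_norm m p (\<lambda>s. T h s - fin_conv xs h s) \<le> \<delta>" and 2: "Lp_norm m p (\<lambda>s. S h s - fin_conv ys h s) \<le> \<delta>" for h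
    proof -
      have "(\<lambda>s. T h s + a * S h s - fin_conv zs h s) = (\<lambda>s. (T h s - fin_conv xs h s) + a * (S h s - fin_conv ys h s))"
      proof -
        have "fin_conv zs h s = fin_conv xs h s + a * fin_conv ys h s" for s by (simp add: zs_def fin_conv_scale)
        then show ?thesis by (simp add: algebra_simps)
      qed
      then have "Lp_norm m p (\<lambda>s. T h s + a * S h s - fin_conv zs h s) \<le> Lp_norm m p (\<lambda>s. T h s - fin_conv xs h s) + Lp_norm m p (\<lambda>s. a * (S h s - fin_conv ys h s))"
        using Lp_norm_triangle[OF p Lp_diff[OF p LT[OF h] fin_conv_Lp[OF p h]] Lp_cmult[OF Lp_diff[OF p LS[OF h] fin_conv_Lp[OF p h]]], of xs a ys] by simp
      also have "\<dots> \<le> \<delta> + norm a * \<delta>"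
        using 1 2 by (simp add: Lp_norm_cmult[OF p0] add_mono mult_left_mono)
      also have "\<dots> = (1 + norm a) * \<delta>" by (simp add: algebra_simps)
      also have "\<dots> = e" using na by (simp add: \<delta>_def)
      finally show ?thesis .
    qed
    show "\<exists>zs. (\<Sum>(c, x)\<leftarrow>zs. norm c) \<le> C + norm a * D \<and> Lp_norm m p (\<lambda>s. T f s + a * S f s - fin_conv zs f s) \<le> e \<and>
      Lp_norm m p (\<lambda>s. T g s + a * S g s - fin_conv zs g s) \<le> e"
      using zn z[OF f xs(2) ys(2)] z[OF g xs(3) ys(3)] by blast
  qed (use C D in auto)
qed

lemma translation_limit_convolution_operator:
  assumes \<mu>: "regular_complex_measure (\<mu> :: 'a set \<Rightarrow> complex)" and p: "1 \<le> p"
  shows "translation_limit p (convolution_operator \<mu>)"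
proof -
  obtain \<nu>1 \<nu>2 \<nu>3 \<nu>4 :: "'a measure" where \<nu>: "fin_radon \<nu>1" "fin_radon \<nu>2" "fin_radon \<nu>3" "fin_radon \<nu>4"
    and T: "convolution_operator \<mu> = (\<lambda>f s. convolve \<nu>1 f s - convolve \<nu>2 f s + \<i> * (convolve \<nu>3 f s - convolve \<nu>4 f s))"
    using convolution_operator_decomposition[OF \<mu>] .
  have "translation_limit p (\<lambda>f s. ((convolve \<nu>1 f s + (-1) * convolve \<nu>2 f s) + \<i> * convolve \<nu>3 f s) + (- \<i>) * convolve \<nu>4 f s)"
    by (intro translation_limit_lincomb translation_limit_convolve p \<nu> Lp_add Lp_cmult convolve_Lp)
  then show ?thesis unfolding T by (simp add: algebra_simps)
qed

subsection \<open>Abelian groups\<close>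

definition L2_inner :: "('a \<Rightarrow> complex) \<Rightarrow> ('a \<Rightarrow> complex) \<Rightarrow> complex" where
  "L2_inner f g = (LINT s|m. f s * cnj (g s))"

lemma L2_norm_powr: "Lp_norm m 2 f ^ 2 = (LINT s|m. norm (f s) ^ 2)"
  using Lp_norm_powr[of 2 m f] by simp

lemma L2_integrable: "f \<in> Lp m 2 \<Longrightarrow> integrable m (\<lambda>s. norm (f s) ^ 2)"
  using Lp_integrable[of f m 2] by simp

lemma L2_product_integrable:
  assumes f: "f \<in> Lp m 2" and g: "g \<in> Lp m 2"
  shows "integrable m (\<lambda>s. f s * cnj (g s))"
proof (rule Bochner_Integration.integrable_bound)
  show "integrable m (\<lambda>s. (norm (f s) ^ 2 + norm (g s) ^ 2) / 2)"
    using L2_integrable[OF f] L2_integrable[OF g] by simp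
  show "(\<lambda>s. f s * cnj (g s)) \<in> borel_measurable m"
  proof (rule measurable_m)
    note [measurable] = Lp_borel[OF f] Lp_borel[OF g]
    have [measurable]: "(\<lambda>s. cnj (g s)) \<in> borel_measurable borel"
      by (rule borel_measurable_continuous_on[OF continuous_on_cnj[OF continuous_on_id] Lp_borel[OF g]])
    show "(\<lambda>s. f s * cnj (g s)) \<in> borel_measurable borel" by measurable
  qed
  have "norm (f s) * norm (g s) \<le> (norm (f s) ^ 2 + norm (g s) ^ 2) / 2" for s
    using sum_squares_bound[of "norm (f s)" "norm (g s)"] by simp
  then show "AE s in m. norm (f s * cnj (g s)) \<le> norm ((norm (f s) ^ 2 + norm (g s) ^ 2) / 2)"
    by (simp add: norm_mult)
qed

lemma L2_inner_self: "L2_inner f f = of_real (Lp_norm m 2 f ^ 2)"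
  unfolding L2_inner_def L2_norm_powr complex_norm_square[symmetric] by (rule integral_complex_of_real)

text \<open>The weighted inequality 2 a b \<le> t a^2 + b^2 / t is integrated and used with t = B /
  A.\<close>

lemma L2_Cauchy_Schwarz:
  assumes f: "f \<in> Lp m 2" and g: "g \<in> Lp m 2"
  shows "norm (L2_inner f g) \<le> Lp_norm m 2 f * Lp_norm m 2 g"
proof -
  define A where "A = Lp_norm m 2 f"
  define B where "B = Lp_norm m 2 g"
  note i = L2_product_integrable[OF f g, THEN integrable_norm]
  have le: "norm (L2_inner f g) \<le> (t * A\<^sup>2 + B\<^sup>2 / t) / 2" if t: "0 < t" for t
  proof -
    have "norm (L2_inner f g) \<le> (LINT s|m. norm (f s * cnj (g s)))"
      unfolding L2_inner_def by (rule integral_norm_bound)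
    also have "\<dots> \<le> (LINT s|m. (t * norm (f s) ^ 2 + norm (g s) ^ 2 / t) / 2)"
    proof (rule integral_mono[OF i])
      show "integrable m (\<lambda>s. (t * norm (f s) ^ 2 + norm (g s) ^ 2 / t) / 2)"
        using L2_integrable[OF f] L2_integrable[OF g] by simp
      fix s
      have "2 * (sqrt t * norm (f s)) * (norm (g s) / sqrt t) \<le> (sqrt t * norm (f s))\<^sup>2 + (norm (g s) / sqrt t)\<^sup>2"
        by (rule sum_squares_bound)
      then show "norm (f s * cnj (g s)) \<le> (t * norm (f s) ^ 2 + norm (g s) ^ 2 / t) / 2"
        using t by (simp add: norm_mult power_mult_distrib power_divide)
    qed
    also have "\<dots> = (t * A\<^sup>2 + B\<^sup>2 / t) / 2"
      using L2_integrable[OF f] L2_integrable[OF g] by (simp add: A_def B_def L2_norm_powr)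
    finally show ?thesis .
  qed
  have AB: "0 \<le> A" "0 \<le> B" by (auto simp: A_def B_def)
  consider "A = 0" | "B = 0" | "0 < A" "0 < B" using AB by fastforce
  then show ?thesis
  proof cases
    case 1
    then have "AE s in m. f s = 0" using Lp_norm_eq_0[OF _ f] by (simp add: A_def)
    then have "L2_inner f g = 0" unfolding L2_inner_def by (intro integral_eq_zero_AE) (auto elim: eventually_mono)
    then show ?thesis using AB by (simp add: A_def[symmetric] B_def[symmetric])
  next
    case 2
    then have "AE s in m. g s = 0" using Lp_norm_eq_0[OF _ g] by (simp add: B_def)
    then have "L2_inner f g = 0" unfolding L2_inner_def by (intro integral_eq_zero_AE) (auto elim: eventually_mono)
    then show ?thesis using AB by (simp add: A_def[symmetric] B_def[symmetric])
  next
    case 3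
    then have "norm (L2_inner f g) \<le> (B / A * A\<^sup>2 + B\<^sup>2 / (B / A)) / 2" by (intro le) simp
    also have "\<dots> = A * B" using 3 by (simp add: power2_eq_square)
    finally show ?thesis by (simp add: A_def B_def)
  qed
qed

definition adjoint_list :: "(complex \<times> 'a) list \<Rightarrow> (complex \<times> 'a) list" where
  "adjoint_list xs = map (\<lambda>(c, x). (cnj c, - x)) xs"

lemma L2_inner_fin_conv:
  assumes f: "f \<in> Lp m 2" and g: "g \<in> Lp m 2"
  shows "L2_inner (fin_conv xs f) g = L2_inner f (fin_conv (adjoint_list xs) g)"
proof (induction xs)
  case Nil
  then show ?case by (simp add: L2_inner_def adjoint_list_def)
next
  case (Cons a xs)
  obtain c x where a: "a = (c, x)" by (cases a)
  have L: "fin_conv xs f \<in> Lp m 2" "fin_conv (adjoint_list xs) g \<in> Lp m 2" for xs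
    by (intro fin_conv_Lp f g; simp)+
  have T: "(\<lambda>s. f (- x + s)) \<in> Lp m 2" "(\<lambda>s. g (x + s)) \<in> Lp m 2"
    using Lp_translate[OF _ f, of x] Lp_translate[OF _ g, of "- x"] by auto
  have "L2_inner (fin_conv (a # xs) f) g = (LINT s|m. c * (f (- x + s) * cnj (g s)) + fin_conv xs f s * cnj (g s))"
    unfolding L2_inner_def by (simp add: a algebra_simps)
  also have "\<dots> = c * (LINT s|m. f (- x + s) * cnj (g s)) + L2_inner (fin_conv xs f) g"
    unfolding L2_inner_def using L2_product_integrable[OF T(1) g] L2_product_integrable[OF L(1) g] by simp
  also have "(LINT s|m. f (- x + s) * cnj (g s)) = (LINT s|m. f s * cnj (g (x + s)))"
  proof -
    have "(LINT s|m. (\<lambda>s. f s * cnj (g (x + s))) (- x + s)) = (LINT s|m. f s * cnj (g (x + s)))"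
    proof (rule integral_translate)
      note [measurable] = Lp_borel[OF f] Lp_borel[OF g]
      have [measurable]: "(\<lambda>s. cnj (g (x + s))) \<in> borel_measurable borel"
        by (rule borel_measurable_continuous_on[OF continuous_on_cnj[OF continuous_on_id]]) measurable
      show "(\<lambda>s. f s * cnj (g (x + s))) \<in> borel_measurable borel" by measurable
    qed
    then show ?thesis by (simp add: add.assoc[symmetric])
  qed
  also have "c * (LINT s|m. f s * cnj (g (x + s))) + L2_inner (fin_conv xs f) g
     = (LINT s|m. c * (f s * cnj (g (x + s))) + f s * cnj (fin_conv (adjoint_list xs) g s))"
    unfolding Cons unfolding L2_inner_def
    using L2_product_integrable[OF f T(2)] L2_product_integrable[OF f L(2)] by simp
  also have "\<dots> = L2_inner f (fin_conv (adjoint_list (a # xs)) g)"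
    unfolding L2_inner_def by (simp add: a adjoint_list_def algebra_simps)
  finally show ?case .
qed

lemma fin_conv_commute:
  fixes xs ys :: "(complex \<times> 'a) list"
  assumes comm: "\<And>x y :: 'a. x + y = y + x"
  shows "fin_conv xs (fin_conv ys f) = fin_conv ys (fin_conv xs f)"
proof -
  have 1: "fin_conv ys (\<lambda>s. c * f (- x + s) + g s) s = c * fin_conv ys f (- x + s) + fin_conv ys g s" for c x g s
  proof (induction ys)
    case (Cons a ys)
    obtain d y where a: "a = (d, y)" by (cases a)
    have "- x + (- y + s) = - y + (- x + s)"
      using comm[of "- x" "- y"] by (metis add.assoc)
    then show ?case using Cons by (simp add: a algebra_simps)
  qed simp
  have 0: "fin_conv ys (\<lambda>s. 0) s = 0" for s by (induction ys) auto
  have "fin_conv xs (fin_conv ys f) s = fin_conv ys (fin_conv xs f) s" for s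
  proof (induction xs)
    case Nil
    have "fin_conv [] f = (\<lambda>s. 0)" by (rule ext) simp
    then show ?case by (simp add: 0)
  next
    case (Cons a xs)
    obtain c x where a: "a = (c, x)" by (cases a)
    have "fin_conv (a # xs) f = (\<lambda>s. c * f (- x + s) + fin_conv xs f s)" by (rule ext) (simp add: a)
    then show ?case using Cons by (simp add: a 1)
  qed
  then show ?thesis by (rule ext)
qed

text \<open>A finite combination S commutes with its adjoint R, so R and S give the same norm at S
  f. Cauchy-Schwarz applied to the inner product of f with R (S f), which is the squared norm of S
  f, gives the claim.\<close>

lemma fin_conv_normal:
  assumes comm: "\<And>x y :: 'a. x + y = y + x" and f: "f \<in> Lp m 2"
  shows "Lp_norm m 2 (fin_conv xs f) ^ 2 \<le> Lp_norm m 2 (fin_conv xs (fin_conv xs f)) * Lp_norm m 2 f"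
proof -
  let ?S = "fin_conv xs" and ?R = "fin_conv (adjoint_list xs)"
  have L: "fin_conv ys g \<in> Lp m 2" if "g \<in> Lp m 2" for ys g using that by (intro fin_conv_Lp) auto
  have Sf: "?S f \<in> Lp m 2" by (rule L[OF f])
  have "L2_inner (?R (?S f)) (?R (?S f)) = L2_inner (?S (?R (?S f))) (?S f)"
    by (rule L2_inner_fin_conv[OF L[OF Sf] Sf, symmetric])
  also have "?S (?R (?S f)) = ?R (?S (?S f))" by (rule fin_conv_commute[OF comm])
  also have "L2_inner (?R (?S (?S f))) (?S f) = cnj (L2_inner (?S f) (?R (?S (?S f))))"
    unfolding L2_inner_def by (simp add: Bochner_Integration.integral_cnj[symmetric] mult.commute)
  also have "L2_inner (?S f) (?R (?S (?S f))) = L2_inner (?S (?S f)) (?S (?S f))"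
    by (rule L2_inner_fin_conv[OF Sf L[OF Sf], symmetric])
  finally have "complex_of_real (Lp_norm m 2 (?R (?S f)) ^ 2) = of_real (Lp_norm m 2 (?S (?S f)) ^ 2)"
    by (simp add: L2_inner_self)
  then have "Lp_norm m 2 (?R (?S f)) ^ 2 = Lp_norm m 2 (?S (?S f)) ^ 2" by (simp only: of_real_eq_iff)
  then have eq: "Lp_norm m 2 (?R (?S f)) = Lp_norm m 2 (?S (?S f))" by (simp add: power2_eq_iff_nonneg)
  have "complex_of_real (Lp_norm m 2 (?S f) ^ 2) = L2_inner f (?R (?S f))"
    using L2_inner_fin_conv[OF f Sf, of xs] by (simp add: L2_inner_self)
  then have "Lp_norm m 2 (?S f) ^ 2 = norm (L2_inner f (?R (?S f)))"
    by (metis norm_of_real abs_of_nonneg zero_le_power2)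
  also have "\<dots> \<le> Lp_norm m 2 f * Lp_norm m 2 (?R (?S f))" by (rule L2_Cauchy_Schwarz[OF f L[OF Sf]])
  finally show ?thesis by (simp add: eq mult.commute)
qed

text \<open>The inequality survives strong approximation. The distance from S (S f) to S (T f) is at
  most the coefficient bound C times the distance from S f to T f, which is why C must be
  uniform.\<close>

lemma translation_limit_normal:
  assumes comm: "\<And>x y :: 'a. x + y = y + x" and T: "translation_limit 2 T"
    and LT: "\<And>f. f \<in> Lp m 2 \<Longrightarrow> T f \<in> Lp m 2" and f: "f \<in> Lp m 2"
  shows "Lp_norm m 2 (T f) ^ 2 \<le> Lp_norm m 2 (T (T f)) * Lp_norm m 2 f"
proof -
  have p: "1 \<le> (2::real)" by simp
  note Tf = LT[OF f] and TTf = LT[OF LT[OF f]]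
  obtain C where C: "0 \<le> C" "\<And>f g e. f \<in> Lp m 2 \<Longrightarrow> g \<in> Lp m 2 \<Longrightarrow> 0 < e \<Longrightarrow> \<exists>xs. (\<Sum>(c, x)\<leftarrow>xs. norm c) \<le> C \<and>
     Lp_norm m 2 (\<lambda>s. T f s - fin_conv xs f s) \<le> e \<and> Lp_norm m 2 (\<lambda>s. T g s - fin_conv xs g s) \<le> e"
    using T unfolding translation_limit_def by meson
  define a where "a = Lp_norm m 2 (T f)"
  define b where "b = Lp_norm m 2 (T (T f))"
  define d where "d = Lp_norm m 2 f"
  have main: "(max 0 (a - e))\<^sup>2 \<le> (b + e + C * e) * d" if e: "0 < e" for e
  proof -
    obtain xs where xs: "(\<Sum>(c, x)\<leftarrow>xs. norm c) \<le> C" "Lp_norm m 2 (\<lambda>s. T f s - fin_conv xs f s) \<le> e" "Lp_norm m 2 (\<lambda>s. T (T f) s - fin_conv xs (T f) s) \<le> e"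
      using C(2)[OF f Tf e] by blast
    have L: "fin_conv xs g \<in> Lp m 2" if "g \<in> Lp m 2" for g using that by (intro fin_conv_Lp) auto
    have "a \<le> Lp_norm m 2 (fin_conv xs f) + e"
      using Lp_norm_diff_ineq[OF p Tf L[OF f]] xs(2) by (simp add: a_def)
    then have "(max 0 (a - e))\<^sup>2 \<le> (Lp_norm m 2 (fin_conv xs f))\<^sup>2"
      by (intro power_mono) auto
    also have "\<dots> \<le> Lp_norm m 2 (fin_conv xs (fin_conv xs f)) * d"
      unfolding d_def by (rule fin_conv_normal[OF comm f])
    also have "\<dots> \<le> (b + e + C * e) * d"
    proof (rule mult_right_mono)
      have dd: "(\<lambda>s. fin_conv xs f s - T f s) \<in> Lp m 2" by (intro Lp_diff p L f Tf)
      have "fin_conv xs (\<lambda>s. g s - h s) s = fin_conv xs g s - fin_conv xs h s" for g h s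
        by (induction xs) (auto simp: algebra_simps)
      then have eq: "(\<lambda>s. fin_conv xs (fin_conv xs f) s - fin_conv xs (T f) s) = fin_conv xs (\<lambda>s. fin_conv xs f s - T f s)"
        by auto
      have "Lp_norm m 2 (fin_conv xs (fin_conv xs f)) \<le> Lp_norm m 2 (fin_conv xs (T f)) + Lp_norm m 2 (\<lambda>s. fin_conv xs (fin_conv xs f) s - fin_conv xs (T f) s)"
        by (intro Lp_norm_diff_ineq p L f Tf)
      also have "Lp_norm m 2 (fin_conv xs (T f)) \<le> b + e"
        using Lp_norm_diff_ineq[OF p L[OF Tf] TTf] xs(3) Lp_norm_diff_commute[of m 2 "T (T f)" "fin_conv xs (T f)"] by (simp add: b_def)
      also have "Lp_norm m 2 (\<lambda>s. fin_conv xs (fin_conv xs f) s - fin_conv xs (T f) s) \<le> (\<Sum>(c, x)\<leftarrow>xs. norm c) * Lp_norm m 2 (\<lambda>s. fin_conv xs f s - T f s)"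
        unfolding eq by (rule Lp_norm_fin_conv_le[OF p dd])
      also have "\<dots> \<le> C * e"
        using xs C(1) Lp_norm_diff_commute[of m 2 "T f" "fin_conv xs f"] by (intro mult_mono) auto
      finally show "Lp_norm m 2 (fin_conv xs (fin_conv xs f)) \<le> b + e + C * e" by simp
    qed (simp add: d_def)
    finally show ?thesis .
  qed
  have "(\<lambda>n. (max 0 (a - inverse (real (Suc n))))\<^sup>2) \<longlonglongrightarrow> (max 0 (a - 0))\<^sup>2"
    by (intro tendsto_power tendsto_max tendsto_diff tendsto_const LIMSEQ_inverse_real_of_nat)
  moreover have "(\<lambda>n. (b + inverse (real (Suc n)) + C * inverse (real (Suc n))) * d) \<longlonglongrightarrow> (b + 0 + C * 0) * d"
    by (intro tendsto_mult tendsto_add tendsto_const LIMSEQ_inverse_real_of_nat)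
  ultimately have "(max 0 (a - 0))\<^sup>2 \<le> (b + 0 + C * 0) * d"
    by (rule LIMSEQ_le) (use main in auto)
  then show ?thesis by (simp add: a_def b_def d_def)
qed

text \<open>The norms a n of the orbit are log-convex, so the ratios of consecutive norms do not
  decrease. A first ratio q > 1 yields at least q^n growth, against the growth hypothesis.\<close>

lemma normal_contraction:
  assumes T: "bounded_Lp_operator m 2 T"
    and norm: "\<And>f. f \<in> Lp m 2 \<Longrightarrow> Lp_norm m 2 (T f) ^ 2 \<le> Lp_norm m 2 (T (T f)) * Lp_norm m 2 f"
    and growth: "\<And>f. f \<in> Lp m 2 \<Longrightarrow> (\<lambda>n. Lp_norm m 2 ((T ^^ n) f) / real n) \<longlonglongrightarrow> 0"
  shows "Lp_contraction m 2 T"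
proof -
  have "Lp_norm m 2 (T f) \<le> Lp_norm m 2 f" if f: "f \<in> Lp m 2" for f
  proof (rule ccontr)
    assume neg: "\<not> Lp_norm m 2 (T f) \<le> Lp_norm m 2 f"
    define a where "a n = Lp_norm m 2 ((T ^^ n) f)" for n
    have a_nn: "0 \<le> a n" for n by (simp add: a_def)
    have conv: "(a (Suc n))\<^sup>2 \<le> a (Suc (Suc n)) * a n" for n
      using norm[OF bounded_Lp_iterate(1)[OF _ T f], of n] by (simp add: a_def)
    \<comment> \<open>If the starting norm were 0, log-convexity would make the next one 0, and the
      assumed increase would fail.\<close>
    have "a 0 \<noteq> 0"
    proof
      assume "a 0 = 0"
      then have "(a 1)\<^sup>2 \<le> 0" using conv[of 0] by simp
      then have "a 1 = 0" by simp
      then show False using neg \<open>a 0 = 0\<close> by (simp add: a_def)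
    qed
    then have a0: "0 < a 0" using a_nn[of 0] by simp
    define q where "q = a 1 / a 0"
    have q: "1 < q" using neg a0 by (simp add: q_def a_def)
    have step: "0 < a n \<and> q * a n \<le> a (Suc n)" for n
    proof (induction n)
      case 0
      then show ?case using a0 by (simp add: q_def)
    next
      case (Suc n)
      then have pos: "0 < a (Suc n)" using q by (meson less_le_trans mult_pos_pos order.strict_trans zero_less_one)
      have "q * a n * a (Suc n) \<le> (a (Suc n))\<^sup>2"
        using Suc pos by (simp add: power2_eq_square mult_right_mono)
      also have "\<dots> \<le> a (Suc (Suc n)) * a n" by (rule conv)
      finally have "(q * a (Suc n)) * a n \<le> a (Suc (Suc n)) * a n" by (simp add: ac_simps)
      then have "q * a (Suc n) \<le> a (Suc (Suc n))" using Suc by (simp add: mult_le_cancel_right)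
      then show ?case using pos by simp
    qed
    have pow: "q ^ n * a 0 \<le> a n" for n
    proof (induction n)
      case (Suc n)
      have "q ^ Suc n * a 0 \<le> q * a n" using mult_left_mono[OF Suc, of q] q by simp
      then show ?case using step[of n] by linarith
    qed simp
    have bern: "1 + real n * (q - 1) \<le> q ^ n" for n
      using Bernoulli_inequality[of "q - 1" n] q by simp
    have "(q - 1) * a 0 \<le> a n / real n" if "1 \<le> n" for n
    proof -
      have "real n * (q - 1) * a 0 \<le> q ^ n * a 0" using bern[of n] a0 by (intro mult_right_mono) auto
      also have "\<dots> \<le> a n" by (rule pow)
      finally show ?thesis using that by (simp add: field_simps)
    qed
    then have "(q - 1) * a 0 \<le> 0"
      using growth[OF f] by (intro LIMSEQ_le_const[of "\<lambda>n. a n / real n"]) (auto simp: a_def)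
    then show False using q a0 by (simp add: mult_le_0_iff)
  qed
  then show ?thesis using T by (simp add: Lp_contraction_def)
qed

end

subsection \<open>Positive kernels\<close>

text \<open>The calculus of positive kernels as a property closed under composition, sums and
  multiples, so that it reaches the compound operator B from its convolution factors.\<close>

definition kernel_op :: "(('a::topological_space \<Rightarrow> ennreal) \<Rightarrow> 'a \<Rightarrow> ennreal) \<Rightarrow> bool" where
  "kernel_op A \<longleftrightarrow> (\<forall>h\<in>borel_measurable borel. A h \<in> borel_measurable borel) \<and>
     (\<forall>h\<in>borel_measurable borel. \<forall>g\<in>borel_measurable borel. A (\<lambda>s. h s + g s) = (\<lambda>s. A h s + A g s)) \<and>
     (\<forall>c. \<forall>h\<in>borel_measurable borel. A (\<lambda>s. c * h s) = (\<lambda>s. c * A h s)) \<and>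
     (\<forall>h :: nat \<Rightarrow> 'a \<Rightarrow> ennreal. (\<forall>i. h i \<in> borel_measurable borel) \<longrightarrow> A (\<lambda>s. \<Sum>i. h i s) = (\<lambda>s. \<Sum>i. A (h i) s)) \<and>
     (\<forall>h g. (\<forall>s. h s \<le> g s) \<longrightarrow> (\<forall>s. A h s \<le> A g s))"

lemma
  assumes "kernel_op A"
  shows kernel_op_measurable: "h \<in> borel_measurable borel \<Longrightarrow> A h \<in> borel_measurable borel"
    and kernel_op_add: "h \<in> borel_measurable borel \<Longrightarrow> g \<in> borel_measurable borel \<Longrightarrow> A (\<lambda>s. h s + g s) = (\<lambda>s. A h s + A g s)"
    and kernel_op_cmult: "h \<in> borel_measurable borel \<Longrightarrow> A (\<lambda>s. c * h s) = (\<lambda>s. c * A h s)"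
    and kernel_op_suminf: "(\<And>i::nat. k i \<in> borel_measurable borel) \<Longrightarrow> A (\<lambda>s. \<Sum>i. k i s) = (\<lambda>s. \<Sum>i. A (k i) s)"
    and kernel_op_mono: "(\<And>s. h s \<le> g s) \<Longrightarrow> A h s \<le> A g s"
  using assms by (auto simp: kernel_op_def)

lemma kernel_op_compose:
  assumes A: "kernel_op A" and B: "kernel_op B"
  shows "kernel_op (\<lambda>h. A (B h))"
proof -
  note M = kernel_op_measurable[OF B]
  show ?thesis unfolding kernel_op_def
    by (intro conjI ballI allI impI)
      (simp_all add: kernel_op_measurable[OF A] M kernel_op_add[OF A] kernel_op_add[OF B] kernel_op_cmult[OF A] kernel_op_cmult[OF B]
        kernel_op_suminf[OF A] kernel_op_suminf[OF B] kernel_op_mono[OF A] kernel_op_mono[OF B])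
qed

lemma kernel_op_id: "kernel_op (\<lambda>h. h)"
  by (simp add: kernel_op_def)

lemma kernel_op_sum:
  fixes A B :: "('a::topological_space \<Rightarrow> ennreal) \<Rightarrow> 'a \<Rightarrow> ennreal"
  assumes A: "kernel_op A" and B: "kernel_op B"
  shows "kernel_op (\<lambda>h s. A h s + B h s)"
  unfolding kernel_op_def
proof (intro conjI ballI allI impI)
  fix k :: "nat \<Rightarrow> 'a \<Rightarrow> ennreal" assume "\<forall>i. k i \<in> borel_measurable borel"
  then show "(\<lambda>s. A (\<lambda>s. \<Sum>i. k i s) s + B (\<lambda>s. \<Sum>i. k i s) s) = (\<lambda>s. \<Sum>i. A (k i) s + B (k i) s)"
    by (simp add: kernel_op_suminf[OF A] kernel_op_suminf[OF B] suminf_add)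
next
  fix h :: "'a \<Rightarrow> ennreal" assume h: "h \<in> borel_measurable borel"
  note [measurable] = kernel_op_measurable[OF A h] kernel_op_measurable[OF B h]
  show "(\<lambda>s. A h s + B h s) \<in> borel_measurable borel" by measurable
  show "(\<lambda>s. A (\<lambda>s. h s + g s) s + B (\<lambda>s. h s + g s) s) = (\<lambda>s. A h s + B h s + (A g s + B g s))"
    if "g \<in> borel_measurable borel" for g
    using h that by (simp add: kernel_op_add[OF A] kernel_op_add[OF B] ac_simps)
  show "(\<lambda>s. A (\<lambda>s. c * h s) s + B (\<lambda>s. c * h s) s) = (\<lambda>s. c * (A h s + B h s))" for c
    using h by (simp add: kernel_op_cmult[OF A] kernel_op_cmult[OF B] distrib_left)
qed (auto intro!: add_mono kernel_op_mono[OF A] kernel_op_mono[OF B])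

lemma kernel_op_scale:
  fixes A :: "('a::topological_space \<Rightarrow> ennreal) \<Rightarrow> 'a \<Rightarrow> ennreal"
  assumes A: "kernel_op A"
  shows "kernel_op (\<lambda>h s. a * A h s)"
  unfolding kernel_op_def
proof (intro conjI ballI allI impI)
  fix h :: "'a \<Rightarrow> ennreal" assume h: "h \<in> borel_measurable borel"
  note [measurable] = kernel_op_measurable[OF A h]
  show "(\<lambda>s. a * A h s) \<in> borel_measurable borel" by measurable
  show "(\<lambda>s. a * A (\<lambda>s. h s + g s) s) = (\<lambda>s. a * A h s + a * A g s)" if "g \<in> borel_measurable borel" for g
    using h that by (simp add: kernel_op_add[OF A] distrib_left)
  show "(\<lambda>s. a * A (\<lambda>s. c * h s) s) = (\<lambda>s. c * (a * A h s))" for c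
    using h by (simp add: kernel_op_cmult[OF A] ac_simps)
qed (auto simp: kernel_op_suminf[OF A] intro!: mult_left_mono kernel_op_mono[OF A])

lemma kernel_op_nnconv:
  fixes \<nu> :: "'a::{topological_group_add, t2_space} measure"
  assumes \<nu>: "fin_radon \<nu>"
  shows "kernel_op (nnconv \<nu>)"
  unfolding kernel_op_def
proof (intro conjI ballI allI impI)
  fix h :: "'a \<Rightarrow> ennreal" assume h: "h \<in> borel_measurable borel"
  show "nnconv \<nu> h \<in> borel_measurable borel" by (rule measurable_nnconv[OF \<nu> h])
  show "nnconv \<nu> (\<lambda>s. h s + g s) = (\<lambda>s. nnconv \<nu> h s + nnconv \<nu> g s)" if "g \<in> borel_measurable borel" for g
    unfolding nnconv_def by (intro ext nn_integral_add measurable_slice_fun[OF \<nu>] h that)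
  show "nnconv \<nu> (\<lambda>s. c * h s) = (\<lambda>s. c * nnconv \<nu> h s)" for c
    unfolding nnconv_def by (intro ext nn_integral_cmult measurable_slice_fun[OF \<nu>] h)
next
  fix k :: "nat \<Rightarrow> 'a \<Rightarrow> ennreal" assume "\<forall>i. k i \<in> borel_measurable borel"
  then show "nnconv \<nu> (\<lambda>s. \<Sum>i. k i s) = (\<lambda>s. \<Sum>i. nnconv \<nu> (k i) s)"
    unfolding nnconv_def by (intro ext nn_integral_suminf measurable_slice_fun[OF \<nu>]) auto
next
  fix h g :: "'a \<Rightarrow> ennreal" and s assume "\<forall>s. h s \<le> g s"
  then show "nnconv \<nu> h s \<le> nnconv \<nu> g s" unfolding nnconv_def by (intro nn_integral_mono) auto
qed

text \<open>The image of \<open>\<nu>\<close> under inversion; convolution with it averages h over x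
  + s instead of -x + s.\<close>

definition reflect :: "'a::topological_group_add measure \<Rightarrow> 'a measure" where
  "reflect \<nu> = distr \<nu> borel uminus"

lemma
  fixes \<nu> :: "'a::{topological_group_add, t2_space} measure"
  assumes \<nu>: "fin_radon \<nu>"
  shows fin_radon_reflect: "fin_radon (reflect \<nu>)"
    and emeasure_reflect: "A \<in> sets borel \<Longrightarrow> emeasure (reflect \<nu>) A = emeasure \<nu> {x. - x \<in> A}"
    and nnconv_reflect: "h \<in> borel_measurable borel \<Longrightarrow> nnconv (reflect \<nu>) h s = (\<integral>\<^sup>+x. h (x + s) \<partial>\<nu>)"
proof -
  note s = fin_radon_sets[OF \<nu>]
  have um: "uminus \<in> measurable \<nu> (borel :: 'a measure)"
    using measurable_translate(4) by (simp add: measurable_cong_sets[OF s refl])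
  have em: "emeasure (reflect \<nu>) A = emeasure \<nu> {x. - x \<in> A}" if "A \<in> sets borel" for A
    unfolding reflect_def using that by (simp add: emeasure_distr[OF um] vimage_def fin_radon_space[OF \<nu>])
  then show "A \<in> sets borel \<Longrightarrow> emeasure (reflect \<nu>) A = emeasure \<nu> {x. - x \<in> A}" .
  show "h \<in> borel_measurable borel \<Longrightarrow> nnconv (reflect \<nu>) h s = (\<integral>\<^sup>+x. h (x + s) \<partial>\<nu>)"
    unfolding nnconv_def reflect_def
    using measurable_compose[OF measurable_translate(1)[of s], of h borel] by (subst nn_integral_distr[OF um]) auto
  show "fin_radon (reflect \<nu>)"
    unfolding fin_radon_def
  proof (intro conjI allI impI)
    show "sets (reflect \<nu>) = sets borel" by (simp add: reflect_def)
    show "emeasure (reflect \<nu>) UNIV < \<infinity>" using \<nu> by (simp add: em fin_radon_def)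
    fix U :: "'a set" and e :: real assume U: "open U" and e: "0 < e"
    obtain K where K: "compact K" "K \<subseteq> {x. - x \<in> U}" "emeasure \<nu> ({x. - x \<in> U} - K) \<le> ennreal e"
      using \<nu> e open_translate(7)[OF U] unfolding fin_radon_def by blast
    have c: "compact (uminus ` K)"
      using K(1) continuous_on_translate[OF continuous_on_id continuous_on_const[of _ 0]] by (intro compact_continuous_image) auto
    have "emeasure (reflect \<nu>) (U - uminus ` K) = emeasure \<nu> {x. - x \<in> U - uminus ` K}"
      using U c by (intro em) (auto simp: borel_compact)
    also have "{x. - x \<in> U - uminus ` K} = {x. - x \<in> U} - K" by auto
    finally show "\<exists>K. compact K \<and> K \<subseteq> U \<and> emeasure (reflect \<nu>) (U - K) \<le> ennreal e"
      using K c by (intro exI[of _ "uminus ` K"]) auto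
  qed
qed

lemma fin_radon_density:
  fixes \<nu> :: "'a::t2_space measure"
  assumes \<nu>: "fin_radon \<nu>" and g: "g \<in> borel_measurable borel" and b: "\<And>x. g x \<le> ennreal b" "0 < b"
  shows "fin_radon (density \<nu> g)"
proof -
  note s = fin_radon_sets[OF \<nu>]
  have gm: "g \<in> borel_measurable \<nu>" using g by (simp add: measurable_cong_sets[OF s refl])
  have le: "emeasure (density \<nu> g) A \<le> ennreal b * emeasure \<nu> A" if A: "A \<in> sets borel" for A
  proof -
    have "emeasure (density \<nu> g) A = (\<integral>\<^sup>+x. g x * indicator A x \<partial>\<nu>)"
      using A by (intro emeasure_density gm) (simp add: s)
    also have "\<dots> \<le> (\<integral>\<^sup>+x. ennreal b * indicator A x \<partial>\<nu>)" by (intro nn_integral_mono mult_right_mono b) auto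
    also have "\<dots> = ennreal b * emeasure \<nu> A" using A by (simp add: nn_integral_cmult_indicator s)
    finally show ?thesis .
  qed
  show ?thesis unfolding fin_radon_def
  proof (intro conjI allI impI)
    show "emeasure (density \<nu> g) UNIV < \<infinity>"
      using le[of UNIV] by (rule le_less_trans) (auto simp: fin_radon_emeasure[OF \<nu>] ennreal_mult[symmetric] b less_imp_le)
    fix U :: "'a set" and e :: real assume U: "open U" and e: "0 < e"
    obtain K where K: "compact K" "K \<subseteq> U" "emeasure \<nu> (U - K) \<le> ennreal (e / b)"
      using \<nu> U e b(2) unfolding fin_radon_def by (metis divide_pos_pos)
    have "emeasure (density \<nu> g) (U - K) \<le> ennreal b * emeasure \<nu> (U - K)"
      using U K by (intro le) (auto simp: borel_compact)
    also have "\<dots> \<le> ennreal b * ennreal (e / b)" by (intro mult_left_mono K) simp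
    also have "\<dots> = ennreal e" using b e by (simp add: ennreal_mult[symmetric])
    finally show "\<exists>K. compact K \<and> K \<subseteq> U \<and> emeasure (density \<nu> g) (U - K) \<le> ennreal e" using K by blast
  qed (simp add: s)
qed

context lc_group
begin

text \<open>Finitely many translates of a null open set would cover any compact set, so all compact
  sets would be null, and by inner regularity the whole group.\<close>

lemma m_open_pos:
  assumes U: "open U" "U \<noteq> {}"
  shows "0 < emeasure m U"
proof (rule ccontr)
  assume "\<not> 0 < emeasure m U"
  then have U0: "emeasure m U = 0" by (simp add: zero_less_iff_neq_zero)
  obtain u where u: "u \<in> U" using U by blast
  have "emeasure m K = 0" if K: "compact K" for K
  proof -
    define N where "N x = {y. - (x + - u) + y \<in> U}" for x
    have o: "open (N x) \<and> x \<in> N x" for x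
      using u open_translate(2)[OF U(1), of "x + - u"] by (simp add: N_def minus_add add.assoc)
    then have "K \<subseteq> (\<Union>x\<in>K. N x)" by blast
    from compactE_image[OF K _ this] o obtain F where F: "finite F" "K \<subseteq> (\<Union>x\<in>F. N x)"
      by metis
    have N: "N x \<in> null_sets m" for x
      using m_slice[of U "x + - u"] U U0 o[of x] by (auto simp: null_sets_def sets_m N_def)
    have "(\<Union>x\<in>F. N x) \<in> null_sets m" using F N by (intro null_sets_UN') (auto intro: countable_finite)
    then show ?thesis using F K by (meson emeasure_eq_0 null_setsD1 null_setsD2)
  qed
  then have "(SUP K\<in>{K. compact K \<and> K \<subseteq> UNIV}. emeasure m K) \<le> 0" by (intro SUP_least) simp
  then have "emeasure m UNIV = 0" using m_inner[OF open_UNIV] by simp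
  then show False using m_UNIV by simp
qed

text \<open>Inner approximation with small error is available for open sets of finite Haar measure.
  U is therefore cut down to an open neighbourhood of W of finite measure, which loses nothing
  because the density vanishes off W.\<close>

lemma fin_radon_haar_density:
  assumes \<theta>: "continuous_on UNIV \<theta>" "\<And>x. 0 \<le> \<theta> x" and W: "compact W" "\<And>x. \<theta> x \<noteq> 0 \<Longrightarrow> x \<in> W"
  shows "fin_radon (density m (\<lambda>x. ennreal (\<theta> x)))"
proof -
  have tm[measurable]: "\<theta> \<in> borel_measurable borel" by (rule borel_measurable_continuous_onI[OF \<theta>(1)])
  have Wb: "W \<in> sets borel" using W by (simp add: borel_compact)
  obtain b where b: "0 < b" "\<And>x. \<theta> x \<le> b"
  proof (cases "W = {}")
    case True
    then show ?thesis using W that[of 1] by (metis empty_iff zero_less_one zero_le_one)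
  next
    case False
    obtain w where "w \<in> W" "\<And>x. x \<in> W \<Longrightarrow> \<theta> x \<le> \<theta> w"
      using continuous_attains_sup[OF W(1) False continuous_on_subset[OF \<theta>(1) subset_UNIV]] by blast
    then have "\<theta> x \<le> \<theta> w + 1" for x using W(2)[of x] \<theta>(2)[of w] by (cases "\<theta> x = 0") fastforce+
    then show ?thesis using that[of "\<theta> w + 1"] \<theta>(2)[of w] by simp
  qed
  have le: "emeasure (density m (\<lambda>x. ennreal (\<theta> x))) A \<le> ennreal b * emeasure m (A \<inter> W)" if A: "A \<in> sets borel" for A
  proof -
    have "emeasure (density m (\<lambda>x. ennreal (\<theta> x))) A = (\<integral>\<^sup>+x. ennreal (\<theta> x) * indicator A x \<partial>m)"
      using A by (intro emeasure_density measurable_m) (auto simp: sets_m)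
    also have "\<dots> \<le> (\<integral>\<^sup>+x. ennreal b * indicator (A \<inter> W) x \<partial>m)"
    proof (rule nn_integral_mono)
      fix x show "ennreal (\<theta> x) * indicator A x \<le> ennreal b * indicator (A \<inter> W) x"
        using b(2)[of x] W(2)[of x] by (cases "\<theta> x = 0") (auto simp: indicator_def intro: ennreal_leI)
    qed
    also have "\<dots> = ennreal b * emeasure m (A \<inter> W)" using A Wb by (simp add: nn_integral_cmult_indicator sets_m)
    finally show ?thesis .
  qed
  show ?thesis unfolding fin_radon_def
  proof (intro conjI allI impI)
    show "emeasure (density m (\<lambda>x. ennreal (\<theta> x))) UNIV < \<infinity>"
      using le[of UNIV] m_compact[OF W(1)] by (auto simp: ennreal_mult_less_top intro: le_less_trans)
    fix U :: "'a set" and e :: real assume U: "open U" and e: "0 < e"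
    obtain O' where O: "open O'" "W \<subseteq> O'" "emeasure m O' < \<infinity>"
      using m_outer_eps[OF Wb m_compact[OF W(1)], of 1] by auto
    have "emeasure m (U \<inter> O') \<le> emeasure m O'" using U O by (intro emeasure_mono) (auto simp: sets_m)
    then have fin: "emeasure m (U \<inter> O') < \<infinity>" using O(3) by (rule le_less_trans)
    obtain K where K: "compact K" "K \<subseteq> U \<inter> O'" "emeasure m ((U \<inter> O') - K) \<le> ennreal (e / b)"
      using m_inner_eps[OF open_Int[OF U O(1)] fin, of "e / b"] e b by auto
    have "emeasure (density m (\<lambda>x. ennreal (\<theta> x))) (U - K) \<le> ennreal b * emeasure m ((U - K) \<inter> W)"
      using U K by (intro le) (auto simp: borel_compact)
    also have "\<dots> \<le> ennreal b * ennreal (e / b)"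
    proof (rule mult_left_mono)
      have "emeasure m ((U - K) \<inter> W) \<le> emeasure m ((U \<inter> O') - K)"
        using U O K by (intro emeasure_mono) (auto simp: sets_m borel_compact)
      then show "emeasure m ((U - K) \<inter> W) \<le> ennreal (e / b)" using K(3) by (rule order.trans)
    qed simp
    also have "\<dots> = ennreal e" using b e by (simp add: ennreal_mult[symmetric])
    finally show "\<exists>K. compact K \<and> K \<subseteq> U \<and> emeasure (density m (\<lambda>x. ennreal (\<theta> x))) (U - K) \<le> ennreal e"
      using K by blast
  qed (simp add: sets_m)
qed

text \<open>A locally compact Hausdorff space is completely regular, which gives a bump of compact
  support at each point; a finite sum over a cover of \<open>\<Omega>\<close> is positive on all of
  it.\<close>

lemma compact_bump:
  fixes \<Omega> :: "'a set"
  assumes \<Omega>: "compact \<Omega>"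
  shows "\<exists>\<theta> W. continuous_on UNIV (\<theta> :: 'a \<Rightarrow> real) \<and> (\<forall>x. 0 \<le> \<theta> x) \<and> compact W \<and> (\<forall>x. \<theta> x \<noteq> 0 \<longrightarrow> x \<in> W) \<and> (\<forall>x\<in>\<Omega>. 0 < \<theta> x)"
proof -
  have "Hausdorff_space (euclidean :: 'a topology)"
    unfolding Hausdorff_space_def using hausdorff by (simp add: disjnt_def) blast
  then have cr: "completely_regular_space (euclidean :: 'a topology)"
    using lc locally_compact_Hausdorff_imp_regular_space locally_compact_regular_imp_completely_regular_space by blast
  define P where "P x f W \<longleftrightarrow> continuous_on UNIV f \<and> (\<forall>y. 0 \<le> f y) \<and> f x = (1::real) \<and> compact W \<and> (\<forall>y. f y \<noteq> 0 \<longrightarrow> y \<in> W)"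
    for x :: 'a and f W
  have "\<exists>f W. P x f W" for x
  proof -
    obtain V W where V: "open V" "compact W" "x \<in> V" "V \<subseteq> W" "W \<subseteq> UNIV" using compact_nbhd[OF open_UNIV UNIV_I] .
    have "closedin euclidean (- V) \<and> x \<in> topspace euclidean - (- V)" using V by (simp add: closed_Compl)
    then obtain g :: "'a \<Rightarrow> real" where g: "continuous_map euclidean (top_of_set {0..1}) g" "g x = 0" "g ` (- V) \<subseteq> {1}"
      using cr[unfolded completely_regular_space_def, rule_format, of "- V" x] by blast
    have gc: "continuous_on UNIV g" "\<And>y. g y \<in> {0..1}"
      using g(1) by (auto simp: continuous_map_in_subtopology)
    have "y \<in> W" if "1 - g y \<noteq> 0" for y using that g(3) V(4) by (cases "y \<in> V") auto
    moreover have "0 \<le> 1 - g y" for y using gc(2)[of y] by simp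
    ultimately show ?thesis using V g gc unfolding P_def by (intro exI[of _ "\<lambda>y. 1 - g y"] exI[of _ W]) (auto intro!: continuous_on_diff continuous_on_const)
  qed
  then obtain f W where P: "\<And>x. P x (f x) (W x)" by metis
  then have f: "\<And>x. continuous_on UNIV (f x)" "\<And>x y. 0 \<le> f x y" "\<And>x. f x x = (1::real)" "\<And>x. compact (W x)" "\<And>x y. f x y \<noteq> 0 \<Longrightarrow> y \<in> W x"
    unfolding P_def by auto
  have o: "open {y. 0 < f x y} \<and> x \<in> {y. 0 < f x y}" for x
    using f by (auto intro!: open_Collect_less continuous_on_const)
  then have "\<Omega> \<subseteq> (\<Union>x\<in>\<Omega>. {y. 0 < f x y})" by blast
  from compactE_image[OF \<Omega> _ this] o obtain F where F: "finite F" "\<Omega> \<subseteq> (\<Union>x\<in>F. {y. 0 < f x y})"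
    by metis
  define \<theta> where "\<theta> y = (\<Sum>x\<in>F. f x y)" for y
  have "continuous_on UNIV \<theta>" unfolding \<theta>_def by (intro continuous_on_sum f)
  moreover have "0 \<le> \<theta> y" for y unfolding \<theta>_def by (intro sum_nonneg f)
  moreover have "compact (\<Union>x\<in>F. W x)" using F f by (intro compact_UN) auto
  moreover have "y \<in> (\<Union>x\<in>F. W x)" if "\<theta> y \<noteq> 0" for y
  proof -
    obtain x where "x \<in> F" "f x y \<noteq> 0" using \<open>\<theta> y \<noteq> 0\<close> unfolding \<theta>_def by (meson sum.neutral)
    then show ?thesis using f(5) by blast
  qed
  moreover have "0 < \<theta> y" if y: "y \<in> \<Omega>" for y
  proof -
    obtain x where "x \<in> F" "0 < f x y" using F y by blast
    then show ?thesis unfolding \<theta>_def using F f by (intro sum_pos2[of F x]) auto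
  qed
  ultimately show ?thesis by blast
qed

lemma symmetric_kernel:
  fixes \<Omega> :: "'a set"
  assumes \<Omega>: "compact \<Omega>"
  obtains \<theta> :: "'a \<Rightarrow> real" and W where "continuous_on UNIV \<theta>" "\<And>x. 0 \<le> \<theta> x" "compact W" "\<And>x. \<theta> x \<noteq> 0 \<Longrightarrow> x \<in> W"
    "\<And>x. x \<in> \<Omega> \<Longrightarrow> 0 < \<theta> x" "\<And>x. \<theta> (- x) = \<theta> x" "0 < \<theta> 0" "(\<integral>\<^sup>+x. ennreal (\<theta> x) \<partial>m) = 1"
proof -
  \<comment> \<open>The point 0 is added so that the kernel is positive at the neutral element,
    hence on a neighbourhood of it.\<close>
  have "compact (insert 0 \<Omega>)" using \<Omega> by (simp add: compact_insert)
  from compact_bump[OF this] obtain t :: "'a \<Rightarrow> real" and W where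
    t: "continuous_on UNIV t" "\<And>x. 0 \<le> t x" "compact W" "\<And>x. t x \<noteq> 0 \<Longrightarrow> x \<in> W" "\<And>x. x \<in> insert 0 \<Omega> \<Longrightarrow> 0 < t x"
    by blast
  define r where "r x = t x + t (- x)" for x
  have um: "continuous_on UNIV (uminus :: 'a \<Rightarrow> 'a)"
    using continuous_on_translate[OF continuous_on_id continuous_on_const[of _ 0]] by simp
  have r: "continuous_on UNIV r" "\<And>x. 0 \<le> r x" "\<And>x. r x \<noteq> 0 \<Longrightarrow> x \<in> W \<union> uminus ` W" "\<And>x. x \<in> insert 0 \<Omega> \<Longrightarrow> 0 < r x" "\<And>x. r (- x) = r x"
  proof -
    show "continuous_on UNIV r" unfolding r_def
      by (intro continuous_on_add t continuous_on_compose2[OF t(1) um]) auto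
    show "0 \<le> r x" for x unfolding r_def using t by simp
    show "x \<in> W \<union> uminus ` W" if "r x \<noteq> 0" for x
      using that t(4)[of x] t(4)[of "- x"] by (cases "t x = 0") (auto simp: r_def image_iff intro!: bexI[of _ "- x"])
    show "0 < r x" if "x \<in> insert 0 \<Omega>" for x unfolding r_def using t(5)[OF that] t(2)[of "- x"] by simp
    show "r (- x) = r x" for x by (simp add: r_def)
  qed
  have W: "compact (W \<union> uminus ` W)" using t um by (intro compact_Un compact_continuous_image) (auto intro: continuous_on_subset)
  have fr: "fin_radon (density m (\<lambda>x. ennreal (r x)))" by (rule fin_radon_haar_density[OF r(1,2) W r(3)])
  have rm[measurable]: "r \<in> borel_measurable borel" by (rule borel_measurable_continuous_onI[OF r(1)])
  define I where "I = (\<integral>\<^sup>+x. ennreal (r x) \<partial>m)"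
  have "emeasure (density m (\<lambda>x. ennreal (r x))) UNIV = I"
    unfolding I_def by (subst emeasure_density) (auto intro!: measurable_m simp: sets_m)
  then have "I < \<infinity>" using fr by (simp add: fin_radon_def)
  then obtain i where i: "I = ennreal i" "0 \<le> i" by (cases I) auto
  have "i \<noteq> 0"
  proof
    assume "i = 0"
    have rmm: "(\<lambda>x. ennreal (r x)) \<in> borel_measurable m" by (rule measurable_m) measurable
    have "I = 0" using i(1) \<open>i = 0\<close> by simp
    then have "AE x in m. ennreal (r x) = 0"
      unfolding I_def nn_integral_0_iff_AE[OF rmm] .
    then have "AE x in m. \<not> 0 < r x" by eventually_elim (simp add: ennreal_eq_0_iff)
    moreover have o: "open {x. 0 < r x}" by (intro open_Collect_less r continuous_on_const)
    ultimately have "emeasure m {x. 0 < r x} = 0"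
      by (subst (asm) AE_iff_measurable[OF _ refl]) (auto simp: sets_m)
    moreover have "0 < emeasure m {x. 0 < r x}" using r(4)[of 0] o by (intro m_open_pos) auto
    ultimately show False by simp
  qed
  then have ip: "0 < i" using i by simp
  show ?thesis
  proof (rule that[of "\<lambda>x. r x / i"])
    show "continuous_on UNIV (\<lambda>x. r x / i)" using r ip by (intro continuous_on_divide continuous_on_const) auto
    show "compact (W \<union> uminus ` W)" by (rule W)
    have "(\<integral>\<^sup>+x. ennreal (r x / i) \<partial>m) = (\<integral>\<^sup>+x. ennreal (1 / i) * ennreal (r x) \<partial>m)"
      using ip r(2) by (intro nn_integral_cong) (simp add: ennreal_mult[symmetric])
    also have "\<dots> = ennreal (1 / i) * I" unfolding I_def by (rule nn_integral_cmult) (auto intro!: measurable_m)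
    also have "\<dots> = 1" using ip by (simp add: i ennreal_mult[symmetric])
    finally show "(\<integral>\<^sup>+x. ennreal (r x / i) \<partial>m) = 1" .
  qed (use r ip in \<open>auto simp: divide_nonneg_pos\<close>)
qed

end

subsection \<open>Superharmonic functions\<close>

text \<open>One neighbourhood V serves all base points s. Where h is positive and finite this is
  uniform continuity of ln h under small left translations; the multiplicative form survives
  positive combinations.\<close>

definition harnack :: "('a::topological_group_add \<Rightarrow> ennreal) \<Rightarrow> bool" where
  "harnack h \<longleftrightarrow> (\<forall>e>0. \<exists>V. open V \<and> 0 \<in> V \<and> (\<forall>v\<in>V. \<forall>s. h s \<le> ennreal (1 + e) * h (v + s)))"

text \<open>The probability measure \<open>\<tau>\<close> lives on the compact set
  \<open>\<Omega>\<close>, where the kernel density \<open>\<theta>\<close> is positive. Thus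
  \<open>\<tau>\<close> is carried by any subgroup that contains the set where
  \<open>\<theta>\<close> is positive.\<close>

locale smoothing = lc_group m for m :: "'a::{topological_group_add, t2_space} measure" +
  fixes \<theta> :: "'a \<Rightarrow> real" and W0 \<Omega> :: "'a set" and \<tau> :: "'a measure"
  assumes \<theta>_cont: "continuous_on UNIV \<theta>" and \<theta>_nonneg: "\<And>x. 0 \<le> \<theta> x"
    and W0: "compact W0" "\<And>x. \<theta> x \<noteq> 0 \<Longrightarrow> x \<in> W0"
    and \<theta>_sym: "\<And>x. \<theta> (- x) = \<theta> x" and \<theta>_0: "0 < \<theta> 0" and \<theta>_int: "(\<integral>\<^sup>+x. ennreal (\<theta> x) \<partial>m) = 1"
    and \<tau>: "fin_radon \<tau>" "emeasure \<tau> UNIV = 1"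
    and \<Omega>: "compact \<Omega>" "emeasure \<tau> (- \<Omega>) = 0" "\<And>x. x \<in> \<Omega> \<Longrightarrow> 0 < \<theta> x"
begin

definition U0 :: "'a set" where "U0 = {x. 0 < \<theta> x}"
definition W :: "'a set" where "W = closure U0"
definition \<kappa> :: "'a measure" where "\<kappa> = density m (\<lambda>x. ennreal (\<theta> x))"
definition "K = nnconv \<kappa>"
definition "K' = nnconv (reflect \<kappa>)"
text \<open>The identity part gives h \<le> 3 S h, which absorbs additional kernels, and its average
  with \<open>\<tau>\<close> is the midpoint in the convexity argument. The reflected part makes S
  symmetric.\<close>

definition S :: "('a \<Rightarrow> ennreal) \<Rightarrow> 'a \<Rightarrow> ennreal" where
  "S h s = ennreal (1 / 3) * (h s + (nnconv \<tau> h s + nnconv (reflect \<tau>) h s))"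
text \<open>Outer and inner kernel are reflections of each other, so their contributions to the
  moment of an odd function cancel.\<close>

definition "B h = K (S (K' h))"

lemma \<theta>_measurable [measurable]: "\<theta> \<in> borel_measurable borel"
  by (rule borel_measurable_continuous_onI[OF \<theta>_cont])

lemma open_U0: "open U0" unfolding U0_def by (intro open_Collect_less \<theta>_cont continuous_on_const)
lemma U0_uminus: "- x \<in> U0 \<longleftrightarrow> x \<in> U0" by (simp add: U0_def \<theta>_sym)
lemma zero_U0: "0 \<in> U0" using \<theta>_0 by (simp add: U0_def)
lemma \<Omega>_U0: "\<Omega> \<subseteq> U0" using \<Omega> by (auto simp: U0_def)
lemma U0_W: "U0 \<subseteq> W" unfolding W_def by (rule closure_subset)
lemma compact_W: "compact W"
proof -
  have "U0 \<subseteq> W0" using W0 by (auto simp: U0_def)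
  then have "W \<subseteq> W0" unfolding W_def using W0 by (intro closure_minimal compact_imp_closed)
  then have "W = W0 \<inter> W" by auto
  moreover have "compact (W0 \<inter> W)" using W0 by (intro compact_Int_closed) (auto simp: W_def)
  ultimately show ?thesis by simp
qed
lemma \<theta>_outside_W: "x \<notin> W \<Longrightarrow> \<theta> x = 0"
  using subsetD[OF U0_W, of x] \<theta>_nonneg[of x] by (force simp: U0_def)

lemma m_open_not_AE:
  assumes "open A" "A \<noteq> {}"
  shows "\<not> (AE x in m. x \<notin> A)"
  using AE_iff_measurable[of A m "\<lambda>x. x \<notin> A"] m_open_pos[OF assms] assms by (simp add: sets_m space_m)

lemma \<theta>_bound: "\<exists>b>0. \<forall>x. \<theta> x \<le> b"
proof -
  have "W \<noteq> {}" using zero_U0 U0_W by auto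
  then obtain w where w: "w \<in> W" "\<And>x. x \<in> W \<Longrightarrow> \<theta> x \<le> \<theta> w"
    using continuous_attains_sup[OF compact_W _ continuous_on_subset[OF \<theta>_cont subset_UNIV]] by blast
  have "\<theta> x \<le> \<theta> w" for x using w(2)[of x] \<theta>_outside_W[of x] \<theta>_nonneg[of w] by (cases "x \<in> W") auto
  moreover have "0 < \<theta> w" using w(2)[of 0] \<theta>_0 zero_U0 U0_W by auto
  ultimately show ?thesis by blast
qed

lemma \<kappa>: "fin_radon \<kappa>"
  unfolding \<kappa>_def by (rule fin_radon_haar_density[OF \<theta>_cont \<theta>_nonneg W0])

lemma nn_integral_\<kappa>:
  assumes h: "h \<in> borel_measurable borel"
  shows "(\<integral>\<^sup>+x. h x \<partial>\<kappa>) = (\<integral>\<^sup>+x. ennreal (\<theta> x) * h x \<partial>m)"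
  unfolding \<kappa>_def
proof (rule nn_integral_density)
  show "(\<lambda>x. ennreal (\<theta> x)) \<in> borel_measurable m" by (rule measurable_m) measurable
  show "h \<in> borel_measurable m" by (rule measurable_m[OF h])
qed

lemma \<kappa>_1: "emeasure \<kappa> UNIV = 1"
  using nn_integral_\<kappa>[of "\<lambda>x. 1"] \<theta>_int fin_radon_space[OF \<kappa>] by simp

lemma \<kappa>_W: "emeasure \<kappa> (- W) = 0"
proof -
  have Wb: "- W \<in> sets borel" unfolding W_def by simp
  have "emeasure \<kappa> (- W) = (\<integral>\<^sup>+x. indicator (- W) x \<partial>\<kappa>)" using Wb by (simp add: fin_radon_sets[OF \<kappa>])
  also have "\<dots> = (\<integral>\<^sup>+x. ennreal (\<theta> x) * indicator (- W) x \<partial>m)" using Wb by (intro nn_integral_\<kappa>) simp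
  also have "\<dots> = (\<integral>\<^sup>+x. 0 \<partial>m)" using \<theta>_outside_W by (intro nn_integral_cong) (auto simp: indicator_def)
  finally show ?thesis by simp
qed

lemma \<kappa>_pos:
  assumes A: "open A" "A \<inter> U0 \<noteq> {}"
  obtains c where "0 < c" "ennreal c \<le> emeasure \<kappa> A"
proof -
  have "emeasure \<kappa> A \<noteq> 0"
  proof
    assume "emeasure \<kappa> A = 0"
    then have "(\<integral>\<^sup>+x. indicator A x \<partial>\<kappa>) = 0" using A by (simp add: fin_radon_sets[OF \<kappa>])
    then have z: "(\<integral>\<^sup>+x. ennreal (\<theta> x) * indicator A x \<partial>m) = 0" using nn_integral_\<kappa>[of "indicator A"] A by simp
    have [measurable]: "A \<in> sets borel" using A by simp
    have mm: "(\<lambda>x. ennreal (\<theta> x) * indicator A x) \<in> borel_measurable m" by (rule measurable_m) measurable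
    have "AE x in m. ennreal (\<theta> x) * indicator A x = 0" using z unfolding nn_integral_0_iff_AE[OF mm] .
    then have "AE x in m. x \<notin> A \<inter> U0" by eventually_elim (auto simp: U0_def ennreal_eq_0_iff indicator_def split: if_splits)
    then show False using m_open_not_AE[OF open_Int[OF A(1) open_U0] A(2)] by simp
  qed
  then show ?thesis
    using that[of "measure \<kappa> A"] by (simp add: fin_radon_emeasure[OF \<kappa>] order_less_le)
qed

lemma reflect_\<kappa>: "fin_radon (reflect \<kappa>)" by (rule fin_radon_reflect[OF \<kappa>])
lemma reflect_\<tau>: "fin_radon (reflect \<tau>)" by (rule fin_radon_reflect[OF \<tau>(1)])

lemma kernel_op_K: "kernel_op K" and kernel_op_K': "kernel_op K'"
  unfolding K_def K'_def by (rule kernel_op_nnconv[OF \<kappa>], rule kernel_op_nnconv[OF reflect_\<kappa>])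

lemma kernel_op_S: "kernel_op S"
  unfolding S_def[abs_def]
  by (rule kernel_op_scale[OF kernel_op_sum[OF kernel_op_id kernel_op_sum[OF kernel_op_nnconv[OF \<tau>(1)] kernel_op_nnconv[OF reflect_\<tau>]]]])

lemma kernel_op_B: "kernel_op B"
  unfolding B_def[abs_def] by (intro kernel_op_compose[OF kernel_op_K kernel_op_compose[OF kernel_op_S kernel_op_K']])

lemma K'_eq: "h \<in> borel_measurable borel \<Longrightarrow> K' h s = (\<integral>\<^sup>+x. h (x + s) \<partial>\<kappa>)"
  unfolding K'_def by (rule nnconv_reflect[OF \<kappa>])

lemma measurable_right_translate [measurable]: "(\<lambda>x. x + s) \<in> borel_measurable (borel :: 'a measure)"
  by (intro borel_measurable_continuous_onI continuous_on_add continuous_on_const continuous_on_id)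

text \<open>Left invariance moves the shift v from the function to the kernel, so regularity of K q
  under translation reduces to continuity of \<open>\<theta>\<close>.\<close>

lemma K_shift:
  assumes q[measurable]: "q \<in> borel_measurable borel"
  shows "K q (v + s) = (\<integral>\<^sup>+a. ennreal (\<theta> (v + a)) * q (- a + s) \<partial>m)"
proof -
  have "K q (v + s) = (\<integral>\<^sup>+a. ennreal (\<theta> a) * q (- a + (v + s)) \<partial>m)"
    unfolding K_def nnconv_def by (intro nn_integral_\<kappa>) measurable
  also have "\<dots> = (\<integral>\<^sup>+a. (\<lambda>a. ennreal (\<theta> a) * q (- a + (v + s))) (- (- v) + a) \<partial>m)"
    by (intro nn_integral_translate[symmetric]) measurable
  also have "\<dots> = (\<integral>\<^sup>+a. ennreal (\<theta> (v + a)) * q (- a + s) \<partial>m)"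
    by (simp only: minus_add minus_minus add.assoc neg_equal_iff_equal left_minus minus_add_cancel)
  finally show ?thesis .
qed

text \<open>K K' K integrates \<open>\<theta>\<close> ((b - a) + d) q (-d + s) over b, a and d. For
  b near 0, a near a0 and d near d0 the value of \<open>\<theta>\<close> is bounded below, and the
  ranges of a and b have positive \<open>\<kappa>\<close> measure. The inner reflected kernel thus
  leaves room to reach products of two points of U0.\<close>

lemma minorant:
  assumes a0: "a0 \<in> U0" "- a0 + d0 \<in> U0"
  shows "\<exists>D C. open D \<and> d0 \<in> D \<and> 0 < C \<and> (\<forall>q\<in>borel_measurable borel. \<forall>s.
    (\<integral>\<^sup>+d. indicator D d * q (- d + s) \<partial>m) \<le> ennreal C * K (K' (K q)) s)"
proof -
  define \<eta> where "\<eta> = \<theta> (- a0 + d0) / 2"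
  have \<eta>: "0 < \<eta>" using a0 by (simp add: \<eta>_def U0_def)
  \<comment> \<open>Triples (b, a, d) at which the kernel still exceeds half its value at (0, a0,
    d0).\<close>
  define P where "P = {z :: 'a \<times> 'a \<times> 'a. \<eta> < \<theta> ((fst z + - fst (snd z)) + snd (snd z))}"
  have cm: "continuous_on UNIV (\<lambda>z :: 'a \<times> 'a \<times> 'a. - fst (snd z))"
    using continuous_on_translate[OF continuous_on_fst[OF continuous_on_snd[OF continuous_on_id]] continuous_on_const[of _ 0]] by simp
  have "continuous_on UNIV (\<lambda>z :: 'a \<times> 'a \<times> 'a. (fst z + - fst (snd z)) + snd (snd z))"
    by (intro continuous_on_add cm continuous_on_fst continuous_on_snd continuous_on_id)
  then have P: "open P" unfolding P_def
    by (intro open_Collect_less continuous_on_const continuous_on_compose2[OF \<theta>_cont]) auto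
  have "(0, a0, d0) \<in> P" using \<eta> by (simp add: P_def \<eta>_def)
  then obtain Bn AD where 1: "open Bn" "open AD" "(0, a0, d0) \<in> Bn \<times> AD" "Bn \<times> AD \<subseteq> P"
    by (rule open_prod_elim[OF P])
  from 1(3) have "(a0, d0) \<in> AD" by simp
  then obtain A D where 2: "open A" "open D" "(a0, d0) \<in> A \<times> D" "A \<times> D \<subseteq> AD"
    by (rule open_prod_elim[OF 1(2)])
  have \<theta>_ge: "\<eta> \<le> \<theta> ((b + - a) + d)" if "b \<in> Bn" "a \<in> A" "d \<in> D" for a b d
  proof -
    have "(a, d) \<in> AD" using 2(4) that by blast
    then have "(b, a, d) \<in> P" using 1(4) that by blast
    then show ?thesis by (simp add: P_def)
  qed
  obtain ca where ca: "0 < ca" "ennreal ca \<le> emeasure \<kappa> A"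
    by (rule \<kappa>_pos[OF 2(1)]) (use 2(3) a0 in auto)
  obtain cb where cb: "0 < cb" "ennreal cb \<le> emeasure \<kappa> Bn"
    by (rule \<kappa>_pos[OF 1(1)]) (use 1(3) zero_U0 in auto)
  define C where "C = 1 / (ca * (cb * \<eta>))"
  have C: "0 < C" using ca cb \<eta> by (simp add: C_def)
  have "(\<integral>\<^sup>+d. indicator D d * q (- d + s) \<partial>m) \<le> ennreal C * K (K' (K q)) s"
    if q[measurable]: "q \<in> borel_measurable borel" for q s
  proof -
    define I where "I = (\<integral>\<^sup>+d. indicator D d * q (- d + s) \<partial>m)"
    note Kq = kernel_op_measurable[OF kernel_op_K q]
    have [measurable]: "A \<in> sets borel" "Bn \<in> sets borel" "D \<in> sets borel" using 1 2 by auto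
    have s1: "ennreal \<eta> * I \<le> K q (b + (- a + s))" if "b \<in> Bn" "a \<in> A" for a b
    proof -
      have "ennreal \<eta> * I = (\<integral>\<^sup>+d. ennreal \<eta> * (indicator D d * q (- d + s)) \<partial>m)"
        unfolding I_def by (rule nn_integral_cmult[symmetric], rule measurable_m) measurable
      also have "\<dots> \<le> (\<integral>\<^sup>+d. ennreal (\<theta> ((b + - a) + d)) * q (- d + s) \<partial>m)"
      proof (rule nn_integral_mono)
        fix d show "ennreal \<eta> * (indicator D d * q (- d + s)) \<le> ennreal (\<theta> ((b + - a) + d)) * q (- d + s)"
          using \<theta>_ge[OF that, of d] by (cases "d \<in> D") (auto intro!: mult_right_mono ennreal_leI)
      qed
      also have "\<dots> = K q ((b + - a) + s)" by (rule K_shift[OF q, symmetric])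
      finally show ?thesis by (simp only: add.assoc)
    qed
    have s2: "ennreal cb * (ennreal \<eta> * I) \<le> K' (K q) (- a + s)" if a: "a \<in> A" for a
    proof -
      have "ennreal cb * (ennreal \<eta> * I) \<le> emeasure \<kappa> Bn * (ennreal \<eta> * I)" by (intro mult_right_mono cb) simp
      also have "\<dots> = (\<integral>\<^sup>+b. (ennreal \<eta> * I) * indicator Bn b \<partial>\<kappa>)"
        by (subst nn_integral_cmult_indicator) (auto simp: fin_radon_sets[OF \<kappa>] mult.commute)
      also have "\<dots> \<le> (\<integral>\<^sup>+b. K q (b + (- a + s)) \<partial>\<kappa>)"
        using s1[OF _ a] by (intro nn_integral_mono) (auto simp: indicator_def)
      also have "\<dots> = K' (K q) (- a + s)" by (rule K'_eq[OF Kq, symmetric])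
      finally show ?thesis .
    qed
    have "ennreal ca * (ennreal cb * (ennreal \<eta> * I)) \<le> emeasure \<kappa> A * (ennreal cb * (ennreal \<eta> * I))" by (intro mult_right_mono ca) simp
    also have "\<dots> = (\<integral>\<^sup>+a. (ennreal cb * (ennreal \<eta> * I)) * indicator A a \<partial>\<kappa>)"
      by (subst nn_integral_cmult_indicator) (auto simp: fin_radon_sets[OF \<kappa>] mult.commute)
    also have "\<dots> \<le> (\<integral>\<^sup>+a. K' (K q) (- a + s) \<partial>\<kappa>)"
      using s2 by (intro nn_integral_mono) (auto simp: indicator_def)
    also have "\<dots> = K (K' (K q)) s" by (simp add: K_def nnconv_def)
    finally have "ennreal C * (ennreal ca * (ennreal cb * (ennreal \<eta> * I))) \<le> ennreal C * K (K' (K q)) s"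
      by (intro mult_left_mono) auto
    moreover have "ennreal C * (ennreal ca * (ennreal cb * (ennreal \<eta> * I))) = I"
    proof -
      have "ennreal C * (ennreal ca * (ennreal cb * (ennreal \<eta> * I))) = ennreal (C * (ca * (cb * \<eta>))) * I"
        using C ca cb \<eta> by (simp add: ennreal_mult ac_simps)
      also have "C * (ca * (cb * \<eta>)) = 1" using ca cb \<eta> by (simp add: C_def)
      finally show ?thesis by simp
    qed
    ultimately show ?thesis by (simp add: I_def)
  qed
  then show ?thesis using 2 C by blast
qed

lemma minorant_compact:
  assumes W': "compact W'" "\<And>d. d \<in> W' \<Longrightarrow> \<exists>a\<in>U0. - a + d \<in> U0"
  shows "\<exists>C>0. \<forall>q\<in>borel_measurable borel. \<forall>s. (\<integral>\<^sup>+d. indicator W' d * q (- d + s) \<partial>m) \<le> ennreal C * K (K' (K q)) s"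
proof -
  define R where "R d0 D C \<longleftrightarrow> open D \<and> d0 \<in> D \<and> 0 < C \<and> (\<forall>q\<in>borel_measurable borel. \<forall>s.
    (\<integral>\<^sup>+d. indicator D d * q (- d + s) \<partial>m) \<le> ennreal C * K (K' (K q)) s)" for d0 D C
  have "\<exists>D C. R d0 D C" if d0: "d0 \<in> W'" for d0
    using W'(2)[OF d0] minorant unfolding R_def by blast
  then obtain D C where R: "\<And>d0. d0 \<in> W' \<Longrightarrow> R d0 (D d0) (C d0)" by metis
  have o: "open (D d) \<and> d \<in> D d" if d: "d \<in> W'" for d using R[OF d] by (simp add: R_def)
  then have "W' \<subseteq> (\<Union>d\<in>W'. D d)" by blast
  from compactE_image[OF W'(1) _ this] o obtain F where F: "F \<subseteq> W'" "finite F" "W' \<subseteq> (\<Union>d\<in>F. D d)" by metis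
  have Cp: "0 < C d" if "d \<in> F" for d using R[of d] F that by (auto simp: R_def)
  \<comment> \<open>The added 1 keeps the constant positive when the finite cover is empty.\<close>
  define C' where "C' = (\<Sum>d\<in>F. C d) + 1"
  have C': "0 < C'" unfolding C'_def using Cp by (intro add_nonneg_pos sum_nonneg) (auto simp: less_imp_le)
  have "(\<integral>\<^sup>+d. indicator W' d * q (- d + s) \<partial>m) \<le> ennreal C' * K (K' (K q)) s"
    if q[measurable]: "q \<in> borel_measurable borel" for q s
  proof -
    have Db[measurable]: "D x \<in> sets borel" if "x \<in> F" for x using R[of x] F that by (auto simp: R_def)
    have "(\<integral>\<^sup>+d. indicator W' d * q (- d + s) \<partial>m) \<le> (\<integral>\<^sup>+d. (\<Sum>x\<in>F. indicator (D x) d * q (- d + s)) \<partial>m)"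
    proof (rule nn_integral_mono)
      fix d show "indicator W' d * q (- d + s) \<le> (\<Sum>x\<in>F. indicator (D x) d * q (- d + s))"
      proof (cases "d \<in> W'")
        case True
        then obtain x where x: "x \<in> F" "d \<in> D x" using F by blast
        then have "indicator W' d * q (- d + s) = indicator (D x) d * q (- d + s)" using True by simp
        also have "\<dots> \<le> (\<Sum>x\<in>F. indicator (D x) d * q (- d + s))" using x F by (intro member_le_sum) auto
        finally show ?thesis .
      qed simp
    qed
    also have "\<dots> = (\<Sum>x\<in>F. \<integral>\<^sup>+d. indicator (D x) d * q (- d + s) \<partial>m)"
    proof (rule nn_integral_sum)
      fix x assume "x \<in> F"
      then have [measurable]: "D x \<in> sets borel" by (rule Db)
      show "(\<lambda>d. indicator (D x) d * q (- d + s)) \<in> borel_measurable m" by (rule measurable_m) measurable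
    qed
    also have "\<dots> \<le> (\<Sum>x\<in>F. ennreal (C x) * K (K' (K q)) s)"
      using R F q by (intro sum_mono) (auto simp: R_def)
    also have "\<dots> = (\<Sum>x\<in>F. ennreal (C x)) * K (K' (K q)) s" by (simp add: sum_distrib_right)
    also have "(\<Sum>x\<in>F. ennreal (C x)) = ennreal (\<Sum>x\<in>F. C x)" using Cp by (intro sum_ennreal) (simp add: less_imp_le)
    also have "ennreal (\<Sum>x\<in>F. C x) * K (K' (K q)) s \<le> ennreal C' * K (K' (K q)) s"
      by (intro mult_right_mono ennreal_leI) (auto simp: C'_def)
    finally show ?thesis .
  qed
  then show ?thesis using C' by blast
qed

text \<open>Approximate w by u in U0. Then -v + w is the product of -v + (w - u), close to -v and
  hence in U0, and u.\<close>

lemma translate_W: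
  assumes v: "v \<in> U0" and w: "w \<in> W"
  shows "\<exists>a\<in>U0. - a + (- v + w) \<in> U0"
proof -
  define N where "N = {u. - v + (w + - u) \<in> U0}"
  have "continuous_on UNIV (\<lambda>u :: 'a. - v + (w + - u))"
    by (intro continuous_on_translate continuous_on_add continuous_on_const)
      (use continuous_on_translate[OF continuous_on_id continuous_on_const[of UNIV "0::'a"]] in simp)
  from open_vimage[OF open_U0 this] have N: "open N" by (simp add: N_def vimage_def)
  have "w \<in> N" using v by (simp add: N_def U0_uminus)
  then have "N \<inter> U0 \<noteq> {}" using w N unfolding W_def closure_iff_nhds_not_empty by blast
  then obtain u where u: "u \<in> N" "u \<in> U0" by blast
  then show ?thesis
    by (intro bexI[of _ "- v + (w + - u)"]) (auto simp: N_def minus_add add.assoc)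
qed

text \<open>F is superharmonic for B. The function f = B F is studied in its place because its
  outermost factor is convolution with a continuous density, so its translates can be
  compared.\<close>

context
  fixes F f :: "'a \<Rightarrow> ennreal"
  assumes F[measurable]: "F \<in> borel_measurable borel" and f: "f = B F" and super: "\<And>s. B F s \<le> F s"
begin

lemma f_measurable [measurable]: "f \<in> borel_measurable borel"
  unfolding f by (rule kernel_op_measurable[OF kernel_op_B F])

definition "q = S (K' F)"

lemma q_measurable [measurable]: "q \<in> borel_measurable borel"
  unfolding q_def by (intro kernel_op_measurable[OF kernel_op_S] kernel_op_measurable[OF kernel_op_K'] F)

lemma f_eq: "f = K q" unfolding f B_def q_def ..

text \<open>K K' f is at most 3 B f by the identity part of S, and B f = B (B F) \<le> B F = f.
  Superharmonicity thus absorbs the two additional kernels.\<close>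

lemma KKK_le: "K (K' (K q)) s \<le> 3 * f s"
proof -
  have "h t \<le> 3 * S h t" for h t
  proof -
    have "3 * S h t = (ennreal 3 * ennreal (1/3)) * (h t + (nnconv \<tau> h t + nnconv (reflect \<tau>) h t))"
      by (simp add: S_def mult.assoc)
    also have "ennreal 3 * ennreal (1/3) = 1" using ennreal_mult[of 3 "1/3"] by simp
    finally show ?thesis by (simp add: add_increasing2)
  qed
  then have "K (K' (K q)) s \<le> K (\<lambda>t. 3 * S (K' (K q)) t) s" by (intro kernel_op_mono[OF kernel_op_K])
  also have "\<dots> = 3 * K (S (K' (K q))) s"
    by (subst kernel_op_cmult[OF kernel_op_K]) (auto intro!: kernel_op_measurable[OF kernel_op_S] kernel_op_measurable[OF kernel_op_K'] kernel_op_measurable[OF kernel_op_K])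
  also have "K (S (K' (K q))) s = B f s" by (simp add: B_def f_eq)
  also have "B f s \<le> B F s" unfolding f by (intro kernel_op_mono[OF kernel_op_B] super)
  finally show ?thesis unfolding f by (simp add: mult_left_mono)
qed

text \<open>A small shift changes the density by at most \<open>\<delta>\<close>, and only on a
  compact set W'. There the minorant bounds the integral of q by a multiple of K K' K q, hence of f
  itself, so an additive error in the density becomes a multiplicative error in f.\<close>

lemma harnack_f: "harnack f"
  unfolding harnack_def
proof (intro allI impI)
  fix e :: real assume e: "0 < e"
  obtain N0 Nc where N: "open N0" "compact Nc" "0 \<in> N0" "N0 \<subseteq> Nc" "Nc \<subseteq> U0"
    using compact_nbhd[OF open_U0 zero_U0] .
  \<comment> \<open>Contains every a with v + a in W for some admissible v; at other points the
    shifted density is 0.\<close>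
  define W' where "W' = (\<lambda>z. - fst z + snd z) ` (Nc \<times> W)"
  have W': "compact W'" unfolding W'_def
    by (intro compact_continuous_image compact_Times N compact_W continuous_on_translate continuous_on_fst continuous_on_snd continuous_on_id)
  have "\<exists>a\<in>U0. - a + d \<in> U0" if "d \<in> W'" for d
    using that N(5) translate_W unfolding W'_def by auto
  from minorant_compact[OF W' this] obtain C where C: "0 < C"
    "\<And>q s. q \<in> borel_measurable borel \<Longrightarrow> (\<integral>\<^sup>+d. indicator W' d * q (- d + s) \<partial>m) \<le> ennreal C * K (K' (K q)) s"
    by blast
  \<comment> \<open>The minorant costs C and \<open>KKK_le\<close> costs 3, so the total relative
    error is e.\<close>
  define \<delta> where "\<delta> = e / (3 * C)"
  have \<delta>: "0 < \<delta>" using e C by (simp add: \<delta>_def)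
  define Z where "Z = {z :: 'a \<times> 'a. \<theta> (fst z + snd z) < \<theta> (snd z) + \<delta>}"
  have Z: "open Z" unfolding Z_def
    by (intro open_Collect_less continuous_on_add continuous_on_const continuous_on_compose2[OF \<theta>_cont]
        continuous_on_fst continuous_on_snd continuous_on_id) auto
  have "{0} \<times> W' \<subseteq> Z" using \<delta> by (auto simp: Z_def)
  from Elementary_Topology.tube_lemma[OF W' Z this] obtain V1 where V1: "0 \<in> V1" "open V1" "V1 \<times> W' \<subseteq> Z"
    by metis
  define V where "V = V1 \<inter> N0"
  have le: "f (v + s) \<le> ennreal (1 + e) * f s" if v: "v \<in> V" for v s
  proof -
    have \<theta>_le: "\<theta> (v + a) \<le> \<theta> a + \<delta> * indicator W' a" for a
    proof (cases "a \<in> W'")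
      case True
      then have "(v, a) \<in> Z" using V1(3) v by (auto simp: V_def)
      then show ?thesis using True by (simp add: Z_def)
    next
      case False
      have "v + a \<notin> W"
      proof
        assume "v + a \<in> W"
        then have "- v + (v + a) \<in> W'" using v N(4) unfolding W'_def V_def by (intro image_eqI[of _ _ "(v, v + a)"]) auto
        then show False using False by (simp add: add.assoc[symmetric])
      qed
      then show ?thesis using False \<theta>_nonneg[of a] by (simp add: \<theta>_outside_W)
    qed
    have [measurable]: "W' \<in> sets borel" using W' by (rule borel_compact)
    have "f (v + s) = (\<integral>\<^sup>+a. ennreal (\<theta> (v + a)) * q (- a + s) \<partial>m)" unfolding f_eq by (rule K_shift) measurable
    also have "\<dots> \<le> (\<integral>\<^sup>+a. ennreal (\<theta> a) * q (- a + s) + ennreal \<delta> * (indicator W' a * q (- a + s)) \<partial>m)"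
    proof (rule nn_integral_mono)
      fix a
      have "ennreal (\<theta> (v + a)) \<le> ennreal (\<theta> a + \<delta> * indicator W' a)" by (intro ennreal_leI \<theta>_le)
      also have "\<dots> = ennreal (\<theta> a) + ennreal \<delta> * indicator W' a"
        using \<theta>_nonneg[of a] \<delta> by (cases "a \<in> W'") auto
      finally have "ennreal (\<theta> (v + a)) * q (- a + s) \<le> (ennreal (\<theta> a) + ennreal \<delta> * indicator W' a) * q (- a + s)"
        by (intro mult_right_mono) auto
      then show "ennreal (\<theta> (v + a)) * q (- a + s) \<le> ennreal (\<theta> a) * q (- a + s) + ennreal \<delta> * (indicator W' a * q (- a + s))"
        by (simp add: distrib_right mult.assoc)
    qed
    also have "\<dots> = (\<integral>\<^sup>+a. ennreal (\<theta> a) * q (- a + s) \<partial>m) + (\<integral>\<^sup>+a. ennreal \<delta> * (indicator W' a * q (- a + s)) \<partial>m)"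
      by (rule nn_integral_add; rule measurable_m; measurable)
    also have "(\<integral>\<^sup>+a. ennreal (\<theta> a) * q (- a + s) \<partial>m) = f s"
      using K_shift[of q 0 s] by (simp add: f_eq)
    also have "(\<integral>\<^sup>+a. ennreal \<delta> * (indicator W' a * q (- a + s)) \<partial>m) = ennreal \<delta> * (\<integral>\<^sup>+a. indicator W' a * q (- a + s) \<partial>m)"
      by (rule nn_integral_cmult; rule measurable_m; measurable)
    also have "\<dots> \<le> ennreal \<delta> * (ennreal C * (3 * f s))"
    proof (rule mult_left_mono)
      have "(\<integral>\<^sup>+a. indicator W' a * q (- a + s) \<partial>m) \<le> ennreal C * K (K' (K q)) s" by (rule C(2)) measurable
      also have "\<dots> \<le> ennreal C * (3 * f s)" by (intro mult_left_mono KKK_le) simp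
      finally show "(\<integral>\<^sup>+a. indicator W' a * q (- a + s) \<partial>m) \<le> ennreal C * (3 * f s)" .
    qed simp
    also have "ennreal \<delta> * (ennreal C * (3 * f s)) = ennreal e * f s"
    proof -
      have "ennreal \<delta> * (ennreal C * (3 * f s)) = (ennreal \<delta> * ennreal C * ennreal 3) * f s" by (simp add: mult.assoc)
      also have "ennreal \<delta> * ennreal C * ennreal 3 = ennreal (\<delta> * C * 3)" using \<delta> C by (simp add: ennreal_mult)
      also have "\<delta> * C * 3 = e" using C by (simp add: \<delta>_def)
      finally show ?thesis .
    qed
    finally have "f (v + s) \<le> f s + ennreal e * f s" by (simp add: add_left_mono)
    also have "\<dots> = ennreal (1 + e) * f s" using e by (simp add: distrib_right)
    finally show ?thesis .
  qed
  \<comment> \<open>So far f (v + s) is bounded by f s; a symmetric neighbourhood lets -v be used to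
    get the reverse bound.\<close>
  define V' where "V' = V \<inter> {x. - x \<in> V}"
  have oV: "open V" using V1 N by (auto simp: V_def)
  have "f s \<le> ennreal (1 + e) * f (v + s)" if "v \<in> V'" for v s
    using le[of "- v" "v + s"] that by (simp add: V'_def add.assoc[symmetric])
  moreover have "open V'" unfolding V'_def using oV open_translate(7)[OF oV] by auto
  moreover have "0 \<in> V'" using V1 N by (simp add: V'_def V_def)
  ultimately show "\<exists>V. open V \<and> 0 \<in> V \<and> (\<forall>v\<in>V. \<forall>s. f s \<le> ennreal (1 + e) * f (v + s))" by blast
qed

text \<open>For y in U0, not necessarily small, the shifted density is simply bounded by its maximum
  b on the compact set -y + W, which the minorant covers.\<close>

lemma f_translate_bound:
  assumes y: "y \<in> U0"
  shows "\<exists>C>0. \<forall>s. f (y + s) \<le> ennreal C * f s"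
proof -
  define W' where "W' = (\<lambda>w. - y + w) ` W"
  have W': "compact W'" unfolding W'_def
    by (intro compact_continuous_image compact_W continuous_on_translate continuous_on_const continuous_on_id)
  have "\<exists>a\<in>U0. - a + d \<in> U0" if "d \<in> W'" for d
    using that y translate_W unfolding W'_def by auto
  from minorant_compact[OF W' this] obtain C where C: "0 < C"
    "\<And>q s. q \<in> borel_measurable borel \<Longrightarrow> (\<integral>\<^sup>+d. indicator W' d * q (- d + s) \<partial>m) \<le> ennreal C * K (K' (K q)) s"
    by blast
  obtain b where b: "0 < b" "\<And>x. \<theta> x \<le> b" using \<theta>_bound by blast
  have [measurable]: "W' \<in> sets borel" using W' by (rule borel_compact)
  have "f (y + s) \<le> ennreal (b * (C * 3)) * f s" for s
  proof -
    have "f (y + s) = (\<integral>\<^sup>+a. ennreal (\<theta> (y + a)) * q (- a + s) \<partial>m)" unfolding f_eq by (rule K_shift) measurable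
    also have "\<dots> \<le> (\<integral>\<^sup>+a. ennreal b * (indicator W' a * q (- a + s)) \<partial>m)"
    proof (rule nn_integral_mono)
      fix a
      show "ennreal (\<theta> (y + a)) * q (- a + s) \<le> ennreal b * (indicator W' a * q (- a + s))"
      proof (cases "a \<in> W'")
        case True
        then show ?thesis using b(2)[of "y + a"] by (auto intro!: mult_right_mono ennreal_leI)
      next
        case False
        have "y + a \<notin> W"
        proof
          assume "y + a \<in> W"
          then have "- y + (y + a) \<in> W'" unfolding W'_def by (rule imageI)
          then show False using False by (simp add: add.assoc[symmetric])
        qed
        then show ?thesis by (simp add: \<theta>_outside_W)
      qed
    qed
    also have "\<dots> = ennreal b * (\<integral>\<^sup>+a. indicator W' a * q (- a + s) \<partial>m)"
      by (rule nn_integral_cmult; rule measurable_m; measurable)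
    also have "\<dots> \<le> ennreal b * (ennreal C * (3 * f s))"
    proof (rule mult_left_mono)
      have "(\<integral>\<^sup>+a. indicator W' a * q (- a + s) \<partial>m) \<le> ennreal C * K (K' (K q)) s" by (rule C(2)) measurable
      also have "\<dots> \<le> ennreal C * (3 * f s)" by (intro mult_left_mono KKK_le) simp
      finally show "(\<integral>\<^sup>+a. indicator W' a * q (- a + s) \<partial>m) \<le> ennreal C * (3 * f s)" .
    qed simp
    also have "\<dots> = (ennreal b * (ennreal C * ennreal 3)) * f s" by (simp add: mult.assoc)
    also have "ennreal b * (ennreal C * ennreal 3) = ennreal (b * (C * 3))" using b C by (simp add: ennreal_mult)
    finally show ?thesis .
  qed
  then show ?thesis using b C by (intro exI[of _ "b * (C * 3)"]) auto
qed

text \<open>Local integrability yields a finite value at some point near s, and the Harnack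
  inequality carries finiteness from there to s.\<close>

lemma f_finite:
  assumes fin: "\<And>Q. compact Q \<Longrightarrow> (\<integral>\<^sup>+s. indicator Q s * f s \<partial>m) < \<infinity>"
  shows "f s < \<infinity>"
proof -
  have "\<exists>V. open V \<and> 0 \<in> V \<and> (\<forall>v\<in>V. \<forall>s. f s \<le> ennreal (1 + 1) * f (v + s))"
    using harnack_f unfolding harnack_def by (meson zero_less_one)
  then obtain V where V: "open V" "0 \<in> V" "\<And>v s. v \<in> V \<Longrightarrow> f s \<le> ennreal (1 + 1) * f (v + s)" by blast
  have Vs: "open {t. t + - s \<in> V}" "s \<in> {t. t + - s \<in> V}" using open_translate(5)[OF V(1), of "- s"] V(2) by auto
  obtain V2 Q where Q: "open V2" "compact Q" "s \<in> V2" "V2 \<subseteq> Q" "Q \<subseteq> {t. t + - s \<in> V}" using compact_nbhd[OF Vs] .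
  have [measurable]: "Q \<in> sets borel" using Q by (simp add: borel_compact)
  have "AE t in m. indicator Q t * f t \<noteq> \<infinity>"
  proof (rule nn_integral_PInf_AE)
    show "(\<lambda>t. indicator Q t * f t) \<in> borel_measurable m" by (rule measurable_m) measurable
    show "(\<integral>\<^sup>+t. indicator Q t * f t \<partial>m) \<noteq> \<infinity>" using fin[OF Q(2)] by simp
  qed
  then have ae: "AE t in m. \<not> (t \<in> V2 \<and> f t = \<infinity>)" by eventually_elim (use Q(4) in \<open>auto simp: indicator_def split: if_splits\<close>)
  have "\<exists>t\<in>V2. f t \<noteq> \<infinity>"
  proof (rule ccontr)
    assume "\<not> (\<exists>t\<in>V2. f t \<noteq> \<infinity>)"
    then have "AE t in m. t \<notin> V2" by (intro eventually_mono[OF ae]) blast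
    then show False using m_open_not_AE[OF Q(1)] Q(3) by auto
  qed
  then obtain t where t: "t \<in> V2" "f t \<noteq> \<infinity>" by blast
  have "t + - s \<in> V" using Q t by auto
  from V(3)[OF this, of s] have "f s \<le> ennreal (1 + 1) * f t" by (simp add: add.assoc)
  also have "\<dots> < \<infinity>" using t by (simp add: ennreal_mult_less_top less_top)
  finally show ?thesis .
qed

text \<open>For b and a near 0 the difference b - a lies in U0 and so in W, where F is at least 1.
  Both kernels give these points positive mass, and the identity part of S links them.\<close>

lemma f_0_pos:
  assumes FW: "\<And>s. indicator W s \<le> F s"
  shows "0 < f 0"
proof -
  have [measurable]: "W \<in> sets borel" unfolding W_def by simp
  have "open {z :: 'a \<times> 'a. fst z + - snd z \<in> U0}"
  proof -
    have "continuous_on UNIV (\<lambda>z :: 'a \<times> 'a. - snd z)"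
      using continuous_on_translate[OF continuous_on_snd[OF continuous_on_id] continuous_on_const[of _ 0]] by simp
    then have "continuous_on UNIV (\<lambda>z :: 'a \<times> 'a. fst z + - snd z)"
      by (intro continuous_on_add continuous_on_fst continuous_on_id)
    from open_vimage[OF open_U0 this] show ?thesis by (simp add: vimage_def)
  qed
  moreover have "(0, 0) \<in> {z :: 'a \<times> 'a. fst z + - snd z \<in> U0}" using zero_U0 by simp
  ultimately obtain X Y where XY: "open X" "open Y" "(0, 0) \<in> X \<times> Y" "X \<times> Y \<subseteq> {z :: 'a \<times> 'a. fst z + - snd z \<in> U0}"
    by (rule open_prod_elim)
  obtain cx where cx: "0 < cx" "ennreal cx \<le> emeasure \<kappa> X"
    by (rule \<kappa>_pos[OF XY(1)]) (use XY(3) zero_U0 in auto)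
  obtain cy where cy: "0 < cy" "ennreal cy \<le> emeasure \<kappa> Y"
    by (rule \<kappa>_pos[OF XY(2)]) (use XY(3) zero_U0 in auto)
  have s2: "ennreal cx \<le> S (K' F) (- a) * 3" if a: "a \<in> Y" for a
  proof -
    have "ennreal cx \<le> emeasure \<kappa> X" by (rule cx)
    also have "\<dots> = (\<integral>\<^sup>+b. indicator X b \<partial>\<kappa>)" using XY by (simp add: fin_radon_sets[OF \<kappa>])
    also have "\<dots> \<le> (\<integral>\<^sup>+b. F (b + - a) \<partial>\<kappa>)"
    proof (rule nn_integral_mono)
      fix b
      show "indicator X b \<le> F (b + - a)"
      proof (cases "b \<in> X")
        case True
        then have "(b, a) \<in> {z. fst z + - snd z \<in> U0}" using XY(4) a by blast
        then have "b + - a \<in> W" using U0_W by auto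
        then show ?thesis using FW[of "b + - a"] True by simp
      qed simp
    qed
    also have "\<dots> = K' F (- a)" by (rule K'_eq[symmetric]) measurable
    also have "\<dots> \<le> (ennreal (1/3) * ennreal 3) * (K' F (- a) + (nnconv \<tau> (K' F) (- a) + nnconv (reflect \<tau>) (K' F) (- a)))"
      using ennreal_mult[of "1/3" 3] by (simp add: add_increasing2)
    also have "\<dots> = S (K' F) (- a) * 3" by (simp add: S_def ac_simps)
    finally show ?thesis .
  qed
  have "ennreal cy * ennreal cx \<le> emeasure \<kappa> Y * ennreal cx" by (intro mult_right_mono cy) simp
  also have "\<dots> = (\<integral>\<^sup>+a. ennreal cx * indicator Y a \<partial>\<kappa>)"
    using XY by (subst nn_integral_cmult_indicator) (auto simp: fin_radon_sets[OF \<kappa>] mult.commute)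
  also have "\<dots> \<le> (\<integral>\<^sup>+a. S (K' F) (- a) * 3 \<partial>\<kappa>)"
    using s2 by (intro nn_integral_mono) (auto simp: indicator_def)
  also have "\<dots> = (\<integral>\<^sup>+a. S (K' F) (- a + 0) \<partial>\<kappa>) * 3"
    using measurable_slice_fun[OF \<kappa> q_measurable, of 0] by (simp add: nn_integral_multc q_def)
  also have "\<dots> = f 0 * 3" by (simp add: f_eq q_def K_def nnconv_def)
  finally have "ennreal cy * ennreal cx \<le> f 0 * 3" .
  moreover have "0 < ennreal cy * ennreal cx" using cx cy by (simp add: ennreal_mult[symmetric])
  ultimately have "f 0 * 3 \<noteq> 0" by auto
  then show ?thesis by (simp add: zero_less_iff_neq_zero)
qed

end

end

subsection \<open>Means on open subgroups\<close>

definition bcont :: "'a::topological_space set \<Rightarrow> ('a \<Rightarrow> real) set" where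
  "bcont H = {\<phi>. continuous_on H \<phi> \<and> (\<exists>C. \<forall>s\<in>H. \<bar>\<phi> s\<bar> \<le> C)}"

definition open_subgroup :: "'a::topological_group_add set \<Rightarrow> bool" where
  "open_subgroup H \<longleftrightarrow> open H \<and> 0 \<in> H \<and> (\<forall>x\<in>H. \<forall>y\<in>H. x + y \<in> H) \<and> (\<forall>x\<in>H. - x \<in> H)"

lemma
  assumes "open_subgroup H"
  shows open_subgroup_open: "open H" and open_subgroup_zero: "0 \<in> H"
    and open_subgroup_add: "x \<in> H \<Longrightarrow> y \<in> H \<Longrightarrow> x + y \<in> H" and open_subgroup_uminus: "x \<in> H \<Longrightarrow> - x \<in> H"
  using assms by (auto simp: open_subgroup_def)

lemma bcont_const: "(\<lambda>s. c) \<in> bcont H"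
  by (auto simp: bcont_def)

lemma bcont_add:
  assumes "\<phi> \<in> bcont H" "\<psi> \<in> bcont H" shows "(\<lambda>s. \<phi> s + \<psi> s) \<in> bcont H"
proof -
  obtain C D where C: "\<And>s. s \<in> H \<Longrightarrow> \<bar>\<phi> s\<bar> \<le> C" and D: "\<And>s. s \<in> H \<Longrightarrow> \<bar>\<psi> s\<bar> \<le> D" using assms by (auto simp: bcont_def)
  have "\<bar>\<phi> s + \<psi> s\<bar> \<le> C + D" if "s \<in> H" for s using C[OF that] D[OF that] by linarith
  then show ?thesis using assms by (auto simp: bcont_def intro: continuous_on_add)
qed

lemma bcont_cmult:
  assumes "\<phi> \<in> bcont H" shows "(\<lambda>s. c * \<phi> s) \<in> bcont H"
proof -
  obtain C where C: "\<And>s. s \<in> H \<Longrightarrow> \<bar>\<phi> s\<bar> \<le> C" using assms by (auto simp: bcont_def)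
  have "\<bar>c * \<phi> s\<bar> \<le> \<bar>c\<bar> * C" if "s \<in> H" for s using C[OF that] by (simp add: abs_mult mult_left_mono)
  then show ?thesis using assms by (auto simp: bcont_def intro: continuous_on_mult_left)
qed

text \<open>
  A function on \<open>H\<close> is extended to the group along a choice of representatives of the right cosets of
  \<open>H\<close>; the extension is continuous and commutes with left translations by elements of \<open>H\<close>.
\<close>

lemma (in lc_group) mean_on_open_subgroup:
  fixes H :: "'a set"
  assumes am: "amenable m" and H: "open_subgroup H"
  shows "\<exists>N. (\<forall>\<phi>\<in>bcont H. \<forall>\<psi>\<in>bcont H. N (\<lambda>s. \<phi> s + \<psi> s) = N \<phi> + N \<psi>) \<and>
    (\<forall>c. \<forall>\<phi>\<in>bcont H. N (\<lambda>s. c * \<phi> s) = c * N \<phi>) \<and>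
    (\<forall>\<phi>\<in>bcont H. \<forall>a. (\<forall>s\<in>H. \<phi> s \<le> a) \<longrightarrow> N \<phi> \<le> a) \<and>
    (\<forall>y\<in>H. \<forall>\<phi>\<in>bcont H. N (\<lambda>s. \<phi> (y + s)) = N \<phi>)"
proof -
  note h0 = open_subgroup_zero[OF H] and hadd = open_subgroup_add[OF H] and hminus = open_subgroup_uminus[OF H]
  obtain M where M: "is_mean m M" and inv: "\<And>x f. f \<in> Linfty m \<Longrightarrow> M (\<lambda>s. f (- x + s)) = M f"
    using am unfolding amenable_def by blast
  have Madd: "\<And>f g. f \<in> Linfty m \<Longrightarrow> g \<in> Linfty m \<Longrightarrow> M (\<lambda>x. f x + g x) = M f + M g"
    and Mc: "\<And>f c. f \<in> Linfty m \<Longrightarrow> M (\<lambda>x. c * f x) = c * M f"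
    and Mb: "\<And>f C. f \<in> Linfty m \<Longrightarrow> locally_AE m (\<lambda>x. norm (f x) \<le> C) \<Longrightarrow> norm (M f) \<le> C"
    and M1: "M (\<lambda>x. 1) = 1"
    using M unfolding is_mean_def by blast+
  \<comment> \<open>The predicate depends on s only through its right coset, so the chosen
    representative is constant on cosets.\<close>
  define rep where "rep s = (SOME r. s + - r \<in> H)" for s
  have rep: "s + - rep s \<in> H" for s
    unfolding rep_def by (rule someI[of "\<lambda>r. s + - r \<in> H" s]) (use h0 in simp)
  have rep_H: "rep (x + s) = rep s" if x: "x \<in> H" for x s
  proof -
    have "(x + s) + - r \<in> H \<longleftrightarrow> s + - r \<in> H" for r
    proof
      assume "(x + s) + - r \<in> H"
      then have "- x + ((x + s) + - r) \<in> H" using hadd hminus x by blast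
      then show "s + - r \<in> H" by (simp only: add.assoc minus_add_cancel)
    next
      assume "s + - r \<in> H"
      then have "x + (s + - r) \<in> H" using hadd x by blast
      then show "(x + s) + - r \<in> H" by (simp only: add.assoc)
    qed
    then show ?thesis unfolding rep_def by (simp only:)
  qed
  define lift where "lift \<phi> s = complex_of_real (\<phi> (s + - rep s))" for \<phi> :: "'a \<Rightarrow> real" and s
  have lift_Linfty: "lift \<phi> \<in> Linfty m" if \<phi>: "\<phi> \<in> bcont H" for \<phi>
  proof -
    define C where "C s0 = {s. s + - s0 \<in> H}" for s0
    have C: "open (C s0)" "s0 \<in> C s0" for s0
      using open_translate(5)[OF open_subgroup_open[OF H], of "- s0"] h0 by (auto simp: C_def)
    have "continuous_on (C s0) (lift \<phi>)" for s0
    proof -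
      have req: "rep s = rep s0" if "s \<in> C s0" for s
        using rep_H[of "s + - s0" s0] that by (simp add: C_def)
      have "s + - rep s0 \<in> H" if "s \<in> C s0" for s using rep[of s] req[OF that] by simp
      then have "continuous_on (C s0) (\<lambda>s. complex_of_real (\<phi> (s + - rep s0)))"
        using \<phi> by (intro continuous_on_of_real continuous_on_compose2[of H \<phi> "C s0"] continuous_on_add continuous_on_id continuous_on_const)
          (auto simp: bcont_def)
      then show ?thesis using req by (subst continuous_on_cong[OF refl]) (auto simp: lift_def)
    qed
    then have "continuous_on (\<Union>s0\<in>UNIV. C s0) (lift \<phi>)" using C by (intro continuous_on_open_UN) auto
    moreover have "(\<Union>s0\<in>UNIV. C s0) = UNIV" using C by blast
    ultimately have "lift \<phi> \<in> borel_measurable m" by (intro measurable_m borel_measurable_continuous_onI) simp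
    moreover obtain D where "\<And>s. s \<in> H \<Longrightarrow> \<bar>\<phi> s\<bar> \<le> D" using \<phi> by (auto simp: bcont_def)
    then have "norm (lift \<phi> s) \<le> D" for s using rep[of s] by (simp add: lift_def)
    ultimately show ?thesis by (auto simp: Linfty_def locally_AE_def)
  qed
  define N where "N \<phi> = Re (M (lift \<phi>))" for \<phi>
  have "N (\<lambda>s. \<phi> s + \<psi> s) = N \<phi> + N \<psi>" if "\<phi> \<in> bcont H" "\<psi> \<in> bcont H" for \<phi> \<psi>
    using Madd[OF lift_Linfty[OF that(1)] lift_Linfty[OF that(2)]] by (simp add: N_def lift_def[abs_def])
  moreover have "N (\<lambda>s. c * \<phi> s) = c * N \<phi>" if "\<phi> \<in> bcont H" for \<phi> c
    using Mc[OF lift_Linfty[OF that], of "of_real c"] by (simp add: N_def lift_def[abs_def])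
  moreover have "N \<phi> \<le> a" if \<phi>: "\<phi> \<in> bcont H" and a: "\<forall>s\<in>H. \<phi> s \<le> a" for \<phi> a
  proof -
    obtain D where D: "\<And>s. s \<in> H \<Longrightarrow> \<bar>\<phi> s\<bar> \<le> D" using \<phi> by (auto simp: bcont_def)
    \<comment> \<open>A mean is given by a norm bound only. The range of \<open>\<phi>\<close> lies
      in [-D, a], the ball of radius r about c, and c + r = a recovers the one-sided bound.\<close>
    define c r where "c = (a - D) / 2" and "r = (a + D) / 2"
    have c_L: "(\<lambda>x. complex_of_real (- c) * 1) \<in> Linfty m" by (auto simp: Linfty_def locally_AE_def)
    have one_L: "(\<lambda>x. 1) \<in> Linfty m" by (auto simp: Linfty_def locally_AE_def)
    have cr: "c + r = a" "c - r = - D" by (simp_all add: c_def r_def field_simps)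
    have "norm (lift \<phi> s + complex_of_real (- c) * 1) \<le> r" for s
    proof -
      have eq: "lift \<phi> s + complex_of_real (- c) * 1 = of_real (\<phi> (s + - rep s) - c)" by (simp add: lift_def)
      show ?thesis unfolding eq norm_of_real using a rep[of s] D[OF rep[of s]] cr by (fastforce simp: abs_le_iff)
    qed
    moreover have "(\<lambda>s. lift \<phi> s + complex_of_real (- c) * 1) \<in> Linfty m"
    proof -
      have "lift (\<lambda>s. \<phi> s + - c) \<in> Linfty m" by (rule lift_Linfty[OF bcont_add[OF \<phi> bcont_const]])
      then show ?thesis by (simp add: lift_def[abs_def])
    qed
    ultimately have "norm (M (\<lambda>s. lift \<phi> s + complex_of_real (- c) * 1)) \<le> r"
      by (intro Mb) (auto simp: locally_AE_def)
    also have "M (\<lambda>s. lift \<phi> s + complex_of_real (- c) * 1) = M (lift \<phi>) + of_real (- c) * 1"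
      by (subst Madd[OF lift_Linfty[OF \<phi>] c_L], subst Mc[OF one_L]) (simp add: M1)
    finally have "\<bar>Re (M (lift \<phi>) + of_real (- c) * 1)\<bar> \<le> r" by (rule order_trans[OF abs_Re_le_cmod])
    then show ?thesis using cr by (simp add: N_def)
  qed
  moreover have "N (\<lambda>s. \<phi> (y + s)) = N \<phi>" if y: "y \<in> H" and \<phi>: "\<phi> \<in> bcont H" for y \<phi>
  proof -
    have "lift (\<lambda>s. \<phi> (y + s)) = (\<lambda>s. lift \<phi> (- (- y) + s))"
      using rep_H[OF y] by (simp add: lift_def[abs_def] add.assoc add_diff_eq)
    then show ?thesis using inv[OF lift_Linfty[OF \<phi>], of "- y"] by (simp add: N_def)
  qed
  ultimately show ?thesis by blast
qed

subsection \<open>Harnack inequalities and discretization\<close>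

lemma harnackD:
  "harnack h \<Longrightarrow> 0 < e \<Longrightarrow> \<exists>V. open V \<and> 0 \<in> V \<and> (\<forall>v\<in>V. \<forall>s. h s \<le> ennreal (1 + e) * h (v + s))"
  by (simp add: harnack_def)

lemma harnack_add:
  assumes "harnack g" "harnack h" shows "harnack (\<lambda>s. g s + h s)"
  unfolding harnack_def
proof (intro allI impI)
  fix e :: real assume e: "0 < e"
  obtain V where V: "open V" "0 \<in> V" "\<And>v s. v \<in> V \<Longrightarrow> g s \<le> ennreal (1 + e) * g (v + s)" using harnackD[OF assms(1) e] by blast
  obtain V' where V': "open V'" "0 \<in> V'" "\<And>v s. v \<in> V' \<Longrightarrow> h s \<le> ennreal (1 + e) * h (v + s)" using harnackD[OF assms(2) e] by blast
  show "\<exists>V. open V \<and> 0 \<in> V \<and> (\<forall>v\<in>V. \<forall>s. g s + h s \<le> ennreal (1 + e) * (g (v + s) + h (v + s)))"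
    using V V' by (intro exI[of _ "V \<inter> V'"]) (auto simp: distrib_left intro!: add_mono)
qed

lemma harnack_cmult:
  assumes "harnack h" shows "harnack (\<lambda>s. c * h s)"
  unfolding harnack_def
proof (intro allI impI)
  fix e :: real assume e: "0 < e"
  obtain V where V: "open V" "0 \<in> V" "\<And>v s. v \<in> V \<Longrightarrow> h s \<le> ennreal (1 + e) * h (v + s)" using harnackD[OF assms(1) e] by blast
  have "c * h s \<le> ennreal (1 + e) * (c * h (v + s))" if "v \<in> V" for v s
    using mult_left_mono[OF V(3)[OF that, of s], of c] by (simp add: mult.left_commute)
  then show "\<exists>V. open V \<and> 0 \<in> V \<and> (\<forall>v\<in>V. \<forall>s. c * h s \<le> ennreal (1 + e) * (c * h (v + s)))" using V by blast
qed

text \<open>A shift by v of the argument turns into a shift by the conjugate -b + v + b inside the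
  integral. Compactness of the carrier of \<open>\<nu>\<close> makes these conjugates uniformly
  small.\<close>

lemma harnack_nnconv:
  fixes \<nu> :: "'a::{topological_group_add, t2_space} measure"
  assumes \<nu>: "fin_radon \<nu>" and D: "compact D" "emeasure \<nu> (- D) = 0"
    and h: "harnack h" and hm: "h \<in> borel_measurable borel"
  shows "harnack (nnconv \<nu> h)"
  unfolding harnack_def
proof (intro allI impI)
  fix e :: real assume e: "0 < e"
  obtain V where V: "open V" "0 \<in> V" "\<And>v s. v \<in> V \<Longrightarrow> h s \<le> ennreal (1 + e) * h (v + s)" using harnackD[OF h e] by blast
  define Z where "Z = {z :: 'a \<times> 'a. (- snd z + fst z) + snd z \<in> V}"
  have "continuous_on UNIV (\<lambda>z :: 'a \<times> 'a. (- snd z + fst z) + snd z)"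
    by (intro continuous_on_add continuous_on_translate continuous_on_fst continuous_on_snd continuous_on_id)
  from open_vimage[OF V(1) this] have Z: "open Z" by (simp add: Z_def vimage_def)
  have "{0} \<times> D \<subseteq> Z" using V(2) by (auto simp: Z_def)
  from Elementary_Topology.tube_lemma[OF D(1) Z this] obtain V' where V': "0 \<in> V'" "open V'" "V' \<times> D \<subseteq> Z" by metis
  have Db: "D \<in> sets borel" using D by (simp add: borel_compact)
  have AE: "AE b in \<nu>. b \<in> D"
    by (rule AE_I'[of "- D"]) (use D Db in \<open>auto simp: null_sets_def fin_radon_sets[OF \<nu>]\<close>)
  have "nnconv \<nu> h s \<le> ennreal (1 + e) * nnconv \<nu> h (v + s)" if v: "v \<in> V'" for v s
  proof -
    have "h (- b + s) \<le> ennreal (1 + e) * h (- b + (v + s))" if b: "b \<in> D" for b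
    proof -
      have "(v, b) \<in> Z" using V' v b by blast
      then have "(- b + v) + b \<in> V" by (simp add: Z_def)
      from V(3)[OF this, of "- b + s"] show ?thesis by (simp add: add.assoc add_diff_eq)
    qed
    then have "nnconv \<nu> h s \<le> (\<integral>\<^sup>+b. ennreal (1 + e) * h (- b + (v + s)) \<partial>\<nu>)"
      unfolding nnconv_def using AE by (intro nn_integral_mono_AE) auto
    also have "\<dots> = ennreal (1 + e) * nnconv \<nu> h (v + s)"
      unfolding nnconv_def by (rule nn_integral_cmult[OF measurable_slice_fun[OF \<nu> hm]])
    finally show ?thesis .
  qed
  then show "\<exists>V. open V \<and> 0 \<in> V \<and> (\<forall>v\<in>V. \<forall>s. nnconv \<nu> h s \<le> ennreal (1 + e) * nnconv \<nu> h (v + s))" using V' by blast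
qed

lemma harnack_nnconv_reflect:
  fixes \<nu> :: "'a::{topological_group_add, t2_space} measure"
  assumes \<nu>: "fin_radon \<nu>" and D: "compact D" "emeasure \<nu> (- D) = 0"
    and h: "harnack h" and hm: "h \<in> borel_measurable borel"
  shows "harnack (nnconv (reflect \<nu>) h)"
proof (rule harnack_nnconv[OF fin_radon_reflect[OF \<nu>] _ _ h hm])
  have c: "continuous_on D uminus" using continuous_on_translate[OF continuous_on_id continuous_on_const[of D "0::'a"]] by simp
  show cu: "compact (uminus ` D)" by (rule compact_continuous_image[OF c D(1)])
  have "emeasure (reflect \<nu>) (- (uminus ` D)) = emeasure \<nu> {x. - x \<in> - (uminus ` D)}"
    using borel_compact[OF cu] by (intro emeasure_reflect[OF \<nu>]) auto
  also have "{x. - x \<in> - (uminus ` D)} = - D" by force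
  finally show "emeasure (reflect \<nu>) (- (uminus ` D)) = 0" using D by simp
qed

text \<open>A Riemann sum over a fine partition replaces the integral, because a finitely additive
  mean cannot be moved past an integral. The same points and weights serve \<open>\<nu>\<close> and
  its reflection, so moments at x i and -x i cancel exactly.\<close>

lemma nnconv_discretize:
  fixes \<nu> :: "'a::{topological_group_add, t2_space} measure"
  assumes \<nu>: "fin_radon \<nu>" "emeasure \<nu> UNIV = 1" and H: "open_subgroup H" "emeasure \<nu> (- H) = 0"
    and h: "harnack h1" "harnack h2" "h1 \<in> borel_measurable borel" "h2 \<in> borel_measurable borel" and e: "0 < e"
  shows "\<exists>n (x :: nat \<Rightarrow> 'a) d. (\<forall>i. x i \<in> H) \<and> (\<forall>i. 0 \<le> d i) \<and> 1 - e \<le> (\<Sum>i<n. d i) \<and>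
    (\<forall>s. (\<Sum>i<n. ennreal (d i) * h1 (- x i + s)) \<le> ennreal (1 + e) * nnconv \<nu> h1 s) \<and>
    (\<forall>s. (\<Sum>i<n. ennreal (d i) * h2 (x i + s)) \<le> ennreal (1 + e) * nnconv (reflect \<nu>) h2 s)"
proof -
  obtain V1 where V1: "open V1" "0 \<in> V1" "\<And>v s. v \<in> V1 \<Longrightarrow> h1 s \<le> ennreal (1 + e) * h1 (v + s)" using harnackD[OF h(1) e] by blast
  obtain V2 where V2: "open V2" "0 \<in> V2" "\<And>v s. v \<in> V2 \<Longrightarrow> h2 s \<le> ennreal (1 + e) * h2 (v + s)" using harnackD[OF h(2) e] by blast
  \<comment> \<open>For h1 the points x i and z enter inverted, which produces the displacement -z +
    x; for h2 they enter directly, which produces z - x.\<close>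
  define N where "N x = {z. - z + x \<in> V1} \<inter> {z. z + - x \<in> V2}" for x
  have N: "open (N x) \<and> x \<in> N x" for x
    unfolding N_def using open_translate(1)[OF V1(1), of x] open_translate(5)[OF V2(1), of "- x"] V1 V2 by auto
  have Hn: "H \<noteq> {}" using open_subgroup_zero[OF H(1)] by auto
  obtain x :: "nat \<Rightarrow> 'a" and E where x: "\<And>i. x i \<in> H" and Es: "\<And>i. E i \<in> sets borel" and Ed: "disjoint_family E"
    and EN: "\<And>i. E i \<subseteq> N (x i) \<inter> H" and E0: "emeasure \<nu> (H - (\<Union>i. E i)) = 0"
    using fin_radon_partition[OF \<nu>(1) open_subgroup_open[OF H(1)] Hn N] by blast
  note sets_\<nu> = fin_radon_sets[OF \<nu>(1)]
  interpret finite_measure \<nu> by (rule fin_radon_finite[OF \<nu>(1)])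
  define d where "d i = measure \<nu> (E i)" for i
  have UE: "(\<Union>i. E i) \<in> sets borel" using Es by auto
  have Hb: "H \<in> sets borel" using open_subgroup_open[OF H(1)] by simp
  have "emeasure \<nu> UNIV \<le> emeasure \<nu> ((\<Union>i. E i) \<union> (H - (\<Union>i. E i)) \<union> (- H))"
    using UE Hb by (intro emeasure_mono) (auto simp: sets_\<nu>)
  also have "\<dots> \<le> emeasure \<nu> ((\<Union>i. E i) \<union> (H - (\<Union>i. E i))) + emeasure \<nu> (- H)"
    using UE Hb by (intro emeasure_subadditive) (auto simp: sets_\<nu>)
  also have "\<dots> \<le> (emeasure \<nu> (\<Union>i. E i) + emeasure \<nu> (H - (\<Union>i. E i))) + emeasure \<nu> (- H)"
    using UE Hb by (intro add_right_mono emeasure_subadditive) (auto simp: sets_\<nu>)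
  finally have "1 \<le> measure \<nu> (\<Union>i. E i)" using E0 H(2) \<nu>(2) by (simp add: emeasure_eq_measure)
  moreover have "d sums measure \<nu> (\<Union>i. E i)" unfolding d_def using Es Ed by (intro finite_measure_UNION) (auto simp: sets_\<nu>)
  ultimately have "eventually (\<lambda>n. 1 - e < (\<Sum>i<n. d i)) sequentially"
    using e by (intro order_tendstoD(1)[of _ "measure \<nu> (\<Union>i. E i)"]) (auto simp: sums_def)
  then obtain n where n: "1 - e < (\<Sum>i<n. d i)" by (auto simp: eventually_sequentially)
  have riemann: "(\<Sum>i<n. ennreal (d i) * c i) \<le> (\<integral>\<^sup>+z. g z \<partial>\<nu>)"
    if c: "\<And>i z. z \<in> E i \<Longrightarrow> c i \<le> g z" for c g
  proof -
    have "(\<Sum>i<n. ennreal (d i) * c i) = (\<Sum>i<n. \<integral>\<^sup>+z. c i * indicator (E i) z \<partial>\<nu>)"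
      using Es by (intro sum.cong refl, subst nn_integral_cmult_indicator) (auto simp: sets_\<nu> d_def emeasure_eq_measure mult.commute)
    also have "\<dots> = (\<integral>\<^sup>+z. (\<Sum>i<n. c i * indicator (E i) z) \<partial>\<nu>)"
      using Es by (intro nn_integral_sum[symmetric] borel_measurable_times_ennreal borel_measurable_const borel_measurable_indicator) (auto simp: sets_\<nu>)
    also have "\<dots> \<le> (\<integral>\<^sup>+z. g z \<partial>\<nu>)"
    proof (rule nn_integral_mono)
      fix z
      have "(\<Sum>i<n. c i * indicator (E i) z) \<le> (\<Sum>i<n. g z * indicator (E i) z)"
        using c by (intro sum_mono) (auto simp: indicator_def)
      also have "\<dots> = g z * indicator (\<Union>i<n. E i) z"
        using disjoint_family_on_mono[OF subset_UNIV Ed] by (subst indicator_UN_disjoint) (auto simp: sum_distrib_left)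
      also have "\<dots> \<le> g z" by (auto simp: indicator_def)
      finally show "(\<Sum>i<n. c i * indicator (E i) z) \<le> g z" .
    qed
    finally show ?thesis .
  qed
  have "(\<Sum>i<n. ennreal (d i) * h1 (- x i + s)) \<le> ennreal (1 + e) * nnconv \<nu> h1 s" for s
  proof -
    have "(\<Sum>i<n. ennreal (d i) * h1 (- x i + s)) \<le> (\<integral>\<^sup>+z. ennreal (1 + e) * h1 (- z + s) \<partial>\<nu>)"
    proof (rule riemann)
      fix i z assume "z \<in> E i"
      then have "- z + x i \<in> V1" using EN by (auto simp: N_def)
      from V1(3)[OF this, of "- x i + s"] show "h1 (- x i + s) \<le> ennreal (1 + e) * h1 (- z + s)" by (simp add: add.assoc)
    qed
    also have "\<dots> = ennreal (1 + e) * nnconv \<nu> h1 s"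
      unfolding nnconv_def by (rule nn_integral_cmult[OF measurable_slice_fun[OF \<nu>(1) h(3)]])
    finally show ?thesis .
  qed
  moreover have "(\<Sum>i<n. ennreal (d i) * h2 (x i + s)) \<le> ennreal (1 + e) * nnconv (reflect \<nu>) h2 s" for s
  proof -
    have m2: "(\<lambda>z. h2 (z + s)) \<in> borel_measurable \<nu>"
    proof -
      have "(\<lambda>z. z + s) \<in> borel_measurable (borel :: 'a measure)"
        by (intro borel_measurable_continuous_onI continuous_on_add continuous_on_const continuous_on_id)
      from measurable_compose[OF this h(4)] show ?thesis by (simp add: measurable_cong_sets[OF sets_\<nu> refl])
    qed
    have "(\<Sum>i<n. ennreal (d i) * h2 (x i + s)) \<le> (\<integral>\<^sup>+z. ennreal (1 + e) * h2 (z + s) \<partial>\<nu>)"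
    proof (rule riemann)
      fix i z assume "z \<in> E i"
      then have "z + - x i \<in> V2" using EN by (auto simp: N_def)
      from V2(3)[OF this, of "x i + s"] show "h2 (x i + s) \<le> ennreal (1 + e) * h2 (z + s)" by (simp add: add.assoc[symmetric])
    qed
    also have "\<dots> = ennreal (1 + e) * nnconv (reflect \<nu>) h2 s"
      by (simp add: nnconv_reflect[OF \<nu>(1) h(4)] nn_integral_cmult[OF m2])
    finally show ?thesis .
  qed
  moreover have "0 \<le> d i" for i by (simp add: d_def)
  ultimately show ?thesis using x less_imp_le[OF n] by blast
qed

subsection \<open>Finite lower bounds by translates\<close>

text \<open>The list is a finite measure on H with repetitions allowed: h dominates the
  corresponding sum of translates of f, w is the mass and c the moment of \<open>\<xi>\<close>. Both
  numbers follow the operations that make up B.\<close>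

definition translate_minorant :: "('a::group_add \<Rightarrow> ennreal) \<Rightarrow> 'a set \<Rightarrow> ('a \<Rightarrow> real) \<Rightarrow> ('a \<Rightarrow> ennreal) \<Rightarrow> real \<Rightarrow> real \<Rightarrow> bool" where
  "translate_minorant f H \<xi> h w c \<longleftrightarrow> (\<exists>xs :: (real \<times> 'a) list. (\<forall>p\<in>set xs. 0 \<le> fst p \<and> snd p \<in> H) \<and>
     w = (\<Sum>p\<leftarrow>xs. fst p) \<and> c = (\<Sum>p\<leftarrow>xs. fst p * \<xi> (snd p)) \<and>
     (\<forall>t. (\<Sum>p\<leftarrow>xs. ennreal (fst p) * f (snd p + t)) \<le> h t))"

context
  fixes f :: "'a::topological_group_add \<Rightarrow> ennreal" and H and \<xi> :: "'a \<Rightarrow> real"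
  assumes H: "open_subgroup H" and \<xi>: "\<forall>x\<in>H. \<forall>y\<in>H. \<xi> (x + y) = \<xi> x + \<xi> y"
begin

abbreviation "tm \<equiv> translate_minorant f H \<xi>"

lemma tm_self: "tm f 1 0"
  using bspec[OF bspec[OF \<xi>, of 0], of 0] open_subgroup_zero[OF H] unfolding translate_minorant_def
  by (intro exI[of _ "[(1, 0)]"]) auto

lemma tm_mono:
  assumes "tm h w c" "\<And>t. h t \<le> g t" shows "tm g w c"
proof -
  have "s \<le> g t" if "s \<le> h t" for s t using order_trans[OF that assms(2)] .
  then show ?thesis using assms(1) unfolding translate_minorant_def by blast
qed

lemma tm_add:
  assumes "tm g w c" "tm h w' c'" shows "tm (\<lambda>t. g t + h t) (w + w') (c + c')"
proof -
  obtain xs where xs: "\<forall>p\<in>set xs. 0 \<le> fst p \<and> snd p \<in> H" "w = (\<Sum>p\<leftarrow>xs. fst p)" "c = (\<Sum>p\<leftarrow>xs. fst p * \<xi> (snd p))"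
    "\<And>t. (\<Sum>p\<leftarrow>xs. ennreal (fst p) * f (snd p + t)) \<le> g t" using assms(1) unfolding translate_minorant_def by blast
  obtain ys where ys: "\<forall>p\<in>set ys. 0 \<le> fst p \<and> snd p \<in> H" "w' = (\<Sum>p\<leftarrow>ys. fst p)" "c' = (\<Sum>p\<leftarrow>ys. fst p * \<xi> (snd p))"
    "\<And>t. (\<Sum>p\<leftarrow>ys. ennreal (fst p) * f (snd p + t)) \<le> h t" using assms(2) unfolding translate_minorant_def by blast
  show ?thesis unfolding translate_minorant_def using xs ys by (intro exI[of _ "xs @ ys"]) (auto intro: add_mono)
qed

lemma tm_cmult:
  assumes "tm h w c" and a: "0 \<le> a" shows "tm (\<lambda>t. ennreal a * h t) (a * w) (a * c)"
proof -
  obtain xs where xs: "\<forall>p\<in>set xs. 0 \<le> fst p \<and> snd p \<in> H" "w = (\<Sum>p\<leftarrow>xs. fst p)" "c = (\<Sum>p\<leftarrow>xs. fst p * \<xi> (snd p))"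
    "\<And>t. (\<Sum>p\<leftarrow>xs. ennreal (fst p) * f (snd p + t)) \<le> h t" using assms(1) unfolding translate_minorant_def by blast
  have "(\<Sum>p\<leftarrow>map (\<lambda>p. (a * fst p, snd p)) xs. ennreal (fst p) * f (snd p + t)) \<le> ennreal a * h t" for t
  proof -
    have "(\<Sum>p\<leftarrow>map (\<lambda>p. (a * fst p, snd p)) xs. ennreal (fst p) * f (snd p + t)) = (\<Sum>p\<leftarrow>xs. ennreal a * (ennreal (fst p) * f (snd p + t)))"
      using xs(1) a by (auto simp: ennreal_mult mult.assoc o_def intro!: arg_cong[of _ _ sum_list])
    also have "\<dots> = ennreal a * (\<Sum>p\<leftarrow>xs. ennreal (fst p) * f (snd p + t))" by (rule sum_list_const_mult)
    also have "\<dots> \<le> ennreal a * h t" by (intro mult_left_mono xs) simp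
    finally show ?thesis .
  qed
  then show ?thesis unfolding translate_minorant_def using xs(1-3) a
    by (intro exI[of _ "map (\<lambda>p. (a * fst p, snd p)) xs"]) (auto simp: o_def mult.assoc sum_list_const_mult)
qed

text \<open>Every point moves by y, and since \<open>\<xi>\<close> is additive the moment gains mass
  times \<open>\<xi> y\<close>.\<close>

lemma tm_translate:
  assumes "tm h w c" and y: "y \<in> H" shows "tm (\<lambda>t. h (y + t)) w (c + w * \<xi> y)"
proof -
  obtain xs where xs: "\<forall>p\<in>set xs. 0 \<le> fst p \<and> snd p \<in> H" "w = (\<Sum>p\<leftarrow>xs. fst p)" "c = (\<Sum>p\<leftarrow>xs. fst p * \<xi> (snd p))"
    "\<And>t. (\<Sum>p\<leftarrow>xs. ennreal (fst p) * f (snd p + t)) \<le> h t" using assms(1) unfolding translate_minorant_def by blast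
  have "(\<Sum>p\<leftarrow>xs. fst p * \<xi> (snd p + y)) = (\<Sum>p\<leftarrow>xs. fst p * \<xi> (snd p) + fst p * \<xi> y)"
    using xs(1) \<xi> y by (auto simp: distrib_left intro!: arg_cong[of _ _ sum_list])
  also have "\<dots> = c + w * \<xi> y" by (simp add: sum_list_addf sum_list_mult_const xs)
  finally show ?thesis unfolding translate_minorant_def using xs(1,2) xs(4)[of "y + _"] open_subgroup_add[OF H _ y]
    by (intro exI[of _ "map (\<lambda>p. (fst p, snd p + y)) xs"]) (auto simp: o_def add.assoc)
qed

lemma tm_sum:
  assumes "\<And>i. i < n \<Longrightarrow> tm (h i) (w i) (c i)"
  shows "tm (\<lambda>t. \<Sum>i<n. h i t) (\<Sum>i<n. w i) (\<Sum>i<n::nat. c i)"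
  using assms
proof (induction n)
  case 0
  show ?case unfolding translate_minorant_def by (intro exI[of _ "[]"]) auto
next
  case (Suc n)
  show ?case using tm_add[OF Suc.IH[OF Suc.prems[OF less_SucI]] Suc.prems[OF lessI]] by simp
qed

end

subsection \<open>Amenability and the spectral radius\<close>

lemma ennreal_add_le: "ennreal (a + b) \<le> ennreal a + ennreal b"
proof -
  have "ennreal (a + b) \<le> ennreal (max 0 a + max 0 b)" by (intro ennreal_leI) simp
  also have "\<dots> = ennreal (max 0 a) + ennreal (max 0 b)" by (intro ennreal_plus) auto
  also have "\<dots> = ennreal a + ennreal b" by (auto simp: max_def ennreal_neg)
  finally show ?thesis .
qed

lemma emeasure_subset_null:
  assumes "sets \<nu> = sets borel" "emeasure \<nu> (- A) = 0" "A \<in> sets borel" "A \<subseteq> B"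
  shows "emeasure \<nu> (- B) = 0"
proof -
  have "emeasure \<nu> (- B) \<le> emeasure \<nu> (- A)" using assms by (intro emeasure_mono) auto
  then show ?thesis using assms by simp
qed

context smoothing
begin

text \<open>Discretizing each factor of B gives a minorant of (1 + e)^3 B f with mass at least (1 -
  e)^3 and vanishing moment. Averaging logarithms compares this mass with (1 + e)^3 \<rho>, and e
  tends to 0.\<close>

lemma spectral_gap_contradiction:
  assumes am: "amenable m" and F: "F \<in> borel_measurable borel" and f: "f = B F" and super: "\<And>s. B F s \<le> F s"
    and FW: "\<And>s. indicator W s \<le> F s" and \<rho>: "0 < \<rho>" "\<rho> < 1" and Bf: "\<And>s. B f s \<le> ennreal \<rho> * f s"
    and fin: "\<And>Q. compact Q \<Longrightarrow> (\<integral>\<^sup>+s. indicator Q s * f s \<partial>m) < \<infinity>"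
  shows False
proof -
  have fm[measurable]: "f \<in> borel_measurable borel" by (rule f_measurable[OF F f super])
  have hf: "harnack f" by (rule harnack_f[OF F f super])
  have ffin: "f s < \<infinity>" for s by (rule f_finite[OF F f super fin])
  have f0: "0 < f 0" by (rule f_0_pos[OF F f super FW])
  define fr where "fr s = enn2real (f s)" for s
  have fr: "f s = ennreal (fr s)" "0 \<le> fr s" for s using ffin[of s] by (auto simp: fr_def)
  define R where "R y \<longleftrightarrow> (\<exists>C>0. \<forall>s. f (y + s) \<le> ennreal C * f s)" for y
  have R_add: "R (x + y)" if "R x" "R y" for x y
  proof -
    obtain C where C: "0 < C" "\<And>s. f (x + s) \<le> ennreal C * f s" using \<open>R x\<close> unfolding R_def by blast
    obtain D where D: "0 < D" "\<And>s. f (y + s) \<le> ennreal D * f s" using \<open>R y\<close> unfolding R_def by blast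
    have "f (x + y + s) \<le> ennreal (C * D) * f s" for s
    proof -
      have "f (x + (y + s)) \<le> ennreal C * f (y + s)" by (rule C)
      also have "\<dots> \<le> ennreal C * (ennreal D * f s)" by (intro mult_left_mono D) simp
      finally show ?thesis using C D by (simp add: ennreal_mult mult.assoc add.assoc)
    qed
    then show ?thesis unfolding R_def using C D by (intro exI[of _ "C * D"]) auto
  qed
  \<comment> \<open>Asking for y and -y makes H a group and bounds the ratio f (y + s) / f s from
    both sides. It contains U0 and is therefore open.\<close>
  define H where "H = {y. R y \<and> R (- y)}"
  have RU: "R y" if "y \<in> U0" for y unfolding R_def by (rule f_translate_bound[OF F f super that])
  have U0H: "U0 \<subseteq> H" using RU U0_uminus by (auto simp: H_def)
  have H_add: "x + y \<in> H" if "x \<in> H" "y \<in> H" for x y using that R_add R_add[of "- y" "- x"] by (simp add: H_def minus_add)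
  have H: "open_subgroup H" unfolding open_subgroup_def
  proof (intro conjI ballI)
    show "open H"
    proof (subst open_subopen, intro ballI)
      fix x assume x: "x \<in> H"
      have "z \<in> H" if "z \<in> {z. - x + z \<in> U0}" for z
        using H_add[OF x, of "- x + z"] that U0H by auto
      then show "\<exists>T. open T \<and> x \<in> T \<and> T \<subseteq> H"
        using open_translate(2)[OF open_U0, of x] zero_U0 by (intro exI[of _ "{z. - x + z \<in> U0}"]) auto
    qed
    show "0 \<in> H" using U0H zero_U0 by auto
    show "\<And>x y. x \<in> H \<Longrightarrow> y \<in> H \<Longrightarrow> x + y \<in> H" by (rule H_add)
    show "\<And>x. x \<in> H \<Longrightarrow> - x \<in> H" by (auto simp: H_def)
  qed
  note hminus = open_subgroup_uminus[OF H] and hzero = open_subgroup_zero[OF H]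
  \<comment> \<open>Closure points of U0 are included: the neighbourhood w + U0 of w meets U0, so w
    is a difference of two members of H.\<close>
  have WH: "W \<subseteq> H"
  proof
    fix w assume w: "w \<in> W"
    have "open {u. - w + u \<in> U0}" "w \<in> {u. - w + u \<in> U0}" using open_translate(2)[OF open_U0, of w] zero_U0 by auto
    then have "{u. - w + u \<in> U0} \<inter> U0 \<noteq> {}" using w unfolding W_def closure_iff_nhds_not_empty by blast
    then obtain u where u: "- w + u \<in> U0" "u \<in> U0" by blast
    have "u + - (- w + u) \<in> H" using u U0H H_add hminus by blast
    then show "w \<in> H" by (simp add: minus_add add.assoc[symmetric])
  qed
  \<comment> \<open>Positivity at 0 spreads over H, because f 0 is at most a constant times f s by
    the bound for -s.\<close>
  have fr_pos: "0 < fr s" if s: "s \<in> H" for s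
  proof -
    obtain C where C: "\<And>t. f (- s + t) \<le> ennreal C * f t" using s by (auto simp: H_def R_def)
    have "f s \<noteq> 0" using C[of s] f0 by auto
    then show ?thesis using fr[of s] by (cases "fr s = 0") auto
  qed
  define L where "L s = ln (fr s)" for s
  have L_le: "L t - L s \<le> ln C" if "s \<in> H" "t \<in> H" "0 < C" "f t \<le> ennreal C * f s" for s t C
  proof -
    have "ennreal (fr t) \<le> ennreal (C * fr s)" using that fr by (simp add: ennreal_mult)
    then have "fr t \<le> C * fr s" using that fr by (simp add: ennreal_le_iff)
    then have "ln (fr t) \<le> ln (C * fr s)" using fr_pos[OF that(2)] by simp
    then show ?thesis using fr_pos[OF that(1)] that by (simp add: L_def ln_mult)
  qed
  have L_cont: "continuous_on H L"
    unfolding continuous_on_def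
  proof (intro ballI tendstoI)
    fix s e assume s: "s \<in> H" and e: "0 < (e :: real)"
    obtain V where V: "open V" "0 \<in> V" "\<And>v t. v \<in> V \<Longrightarrow> f t \<le> ennreal (1 + e / 2) * f (v + t)" using harnackD[OF hf, of "e / 2"] e by auto
    define Z where "Z = {t. t + - s \<in> V} \<inter> {t. s + - t \<in> V}"
    have "open Z" "s \<in> Z" unfolding Z_def
      using open_translate(5)[OF V(1), of "- s"] open_translate(5)[OF open_translate(7)[OF V(1)], of "- s"] V(2) by (auto simp: minus_add)
    moreover have "dist (L t) (L s) < e" if t: "t \<in> Z" "t \<in> H" for t
    proof -
      have "f s \<le> ennreal (1 + e / 2) * f t" using V(3)[of "t + - s" s] t by (simp add: Z_def add.assoc)
      then have "L s - L t \<le> ln (1 + e / 2)" using L_le[OF t(2) s] e by simp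
      moreover have "f t \<le> ennreal (1 + e / 2) * f s" using V(3)[of "s + - t" t] t by (simp add: Z_def add.assoc)
      then have "L t - L s \<le> ln (1 + e / 2)" using L_le[OF s t(2)] e by simp
      moreover have "ln (1 + e / 2) \<le> e / 2" using e by (intro ln_add_one_self_le_self) simp
      ultimately show ?thesis using e by (simp add: dist_real_def abs_if)
    qed
    ultimately show "eventually (\<lambda>t. dist (L t) (L s) < e) (at s within H)"
      unfolding eventually_at_topological by blast
  qed
  \<comment> \<open>A bounded cocycle: u (x + y) is the translate of u x by y plus u y, so an
    invariant mean turns it into a homomorphism.\<close>
  define u where "u y s = L (y + s) - L s" for y s
  have u_bcont: "u y \<in> bcont H" if y: "y \<in> H" for y
  proof -
    have "continuous_on H (u y)" unfolding u_def[abs_def]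
      by (intro continuous_on_diff L_cont continuous_on_compose2[OF L_cont] continuous_on_add continuous_on_const continuous_on_id)
        (use H_add[OF y] in auto)
    moreover obtain C where C: "0 < C" "\<And>s. f (y + s) \<le> ennreal C * f s" using y by (auto simp: H_def R_def)
    moreover obtain D where D: "0 < D" "\<And>s. f (- y + s) \<le> ennreal D * f s" using y by (auto simp: H_def R_def)
    have "\<bar>u y s\<bar> \<le> \<bar>ln C\<bar> + \<bar>ln D\<bar>" if s: "s \<in> H" for s
    proof -
      have "L (y + s) - L s \<le> ln C" by (rule L_le[OF s H_add[OF y s] C])
      moreover have "f s \<le> ennreal D * f (y + s)" using D(2)[of "y + s"] by simp
      then have "L s - L (y + s) \<le> ln D" by (rule L_le[OF H_add[OF y s] s D(1)])
      ultimately show ?thesis unfolding u_def by linarith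
    qed
    ultimately show ?thesis unfolding bcont_def by blast
  qed
  obtain N where N_add: "\<And>\<phi> \<psi>. \<phi> \<in> bcont H \<Longrightarrow> \<psi> \<in> bcont H \<Longrightarrow> N (\<lambda>s. \<phi> s + \<psi> s) = N \<phi> + N \<psi>"
    and N_cmult: "\<And>\<phi> c. \<phi> \<in> bcont H \<Longrightarrow> N (\<lambda>s. c * \<phi> s) = c * N \<phi>"
    and N_le: "\<And>\<phi> a. \<phi> \<in> bcont H \<Longrightarrow> (\<And>s. s \<in> H \<Longrightarrow> \<phi> s \<le> a) \<Longrightarrow> N \<phi> \<le> a"
    and N_translate: "\<And>y \<phi>. y \<in> H \<Longrightarrow> \<phi> \<in> bcont H \<Longrightarrow> N (\<lambda>s. \<phi> (y + s)) = N \<phi>"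
  proof -
    from mean_on_open_subgroup[OF am H] obtain N where "(\<forall>\<phi>\<in>bcont H. \<forall>\<psi>\<in>bcont H. N (\<lambda>s. \<phi> s + \<psi> s) = N \<phi> + N \<psi>) \<and>
      (\<forall>c. \<forall>\<phi>\<in>bcont H. N (\<lambda>s. c * \<phi> s) = c * N \<phi>) \<and> (\<forall>\<phi>\<in>bcont H. \<forall>a. (\<forall>s\<in>H. \<phi> s \<le> a) \<longrightarrow> N \<phi> \<le> a) \<and>
      (\<forall>y\<in>H. \<forall>\<phi>\<in>bcont H. N (\<lambda>s. \<phi> (y + s)) = N \<phi>)" by (rule exE)
    then show thesis by (intro that[of N]) simp_all
  qed
  define \<xi> where "\<xi> y = N (u y)" for y
  have \<xi>_add: "\<xi> (x + y) = \<xi> x + \<xi> y" if x: "x \<in> H" and y: "y \<in> H" for x y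
  proof -
    have "u (x + y) = (\<lambda>s. u x (y + s) + u y s)" by (simp add: u_def fun_eq_iff add.assoc)
    moreover have "(\<lambda>s. u x (y + s)) \<in> bcont H"
    proof -
      obtain C where "\<And>s. s \<in> H \<Longrightarrow> \<bar>u x s\<bar> \<le> C" using u_bcont[OF x] unfolding bcont_def by blast
      then have "\<bar>u x (y + s)\<bar> \<le> C" if "s \<in> H" for s using H_add[OF y \<open>s \<in> H\<close>] by blast
      moreover have "continuous_on H (u x)" using u_bcont[OF x] unfolding bcont_def by blast
      then have "continuous_on H (\<lambda>s. u x (y + s))"
        by (rule continuous_on_compose2) (use H_add[OF y] in \<open>auto intro: continuous_on_add\<close>)
      ultimately show ?thesis unfolding bcont_def by blast
    qed
    ultimately show ?thesis unfolding \<xi>_def using N_add[OF _ u_bcont[OF y]] N_translate[OF y u_bcont[OF x]] by simp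
  qed
  have \<xi>_0: "\<xi> 0 = 0" using \<xi>_add[OF hzero hzero] by simp
  have \<xi>_uminus: "\<xi> (- x) = - \<xi> x" if "x \<in> H" for x using \<xi>_add[OF hminus[OF that] that] \<xi>_0 by simp
  define tm where "tm = translate_minorant f H \<xi>"
  have \<xi>_all: "\<forall>x\<in>H. \<forall>y\<in>H. \<xi> (x + y) = \<xi> x + \<xi> y" using \<xi>_add by blast
  note tm_rules = tm_self[where f = f, OF H \<xi>_all, folded tm_def] tm_mono[where f = f, OF H \<xi>_all, folded tm_def]
    tm_add[where f = f, OF H \<xi>_all, folded tm_def] tm_cmult[where f = f, OF H \<xi>_all, folded tm_def]
    tm_translate[where f = f, OF H \<xi>_all, folded tm_def] tm_sum[where f = f, OF H \<xi>_all, folded tm_def]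
  note tm_self = tm_rules(1) and tm_mono = tm_rules(2) and tm_add = tm_rules(3) and tm_cmult = tm_rules(4)
    and tm_translate = tm_rules(5) and tm_sum = tm_rules(6)
  \<comment> \<open>Divide by \<open>f s\<close>, use \<open>exp u \<ge> 1 + u\<close> and average over \<open>s\<close>.\<close>
  have bound: "w + c \<le> C" if tm: "tm h w c" and h: "\<And>s. s \<in> H \<Longrightarrow> h s \<le> ennreal C * f s" and C: "0 \<le> C" for h w c C
  proof -
    obtain xs where xs: "\<forall>p\<in>set xs. 0 \<le> fst p \<and> snd p \<in> H" "w = (\<Sum>p\<leftarrow>xs. fst p)" "c = (\<Sum>p\<leftarrow>xs. fst p * \<xi> (snd p))"
      "\<And>t. (\<Sum>p\<leftarrow>xs. ennreal (fst p) * f (snd p + t)) \<le> h t" using tm unfolding tm_def translate_minorant_def by blast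
    have mean: "(\<lambda>s. \<Sum>p\<leftarrow>ys. fst p * u (snd p) s) \<in> bcont H \<and> N (\<lambda>s. \<Sum>p\<leftarrow>ys. fst p * u (snd p) s) = (\<Sum>p\<leftarrow>ys. fst p * \<xi> (snd p))"
      if "\<forall>p\<in>set ys. 0 \<le> fst p \<and> snd p \<in> H" for ys
      using that
    proof (induction ys)
      case Nil
      show ?case using N_cmult[OF bcont_const, of 0 0] bcont_const[of 0] by simp
    next
      case (Cons p ys)
      have p: "u (snd p) \<in> bcont H" using Cons.prems by (intro u_bcont) auto
      have IH: "(\<lambda>s. \<Sum>p\<leftarrow>ys. fst p * u (snd p) s) \<in> bcont H" "N (\<lambda>s. \<Sum>p\<leftarrow>ys. fst p * u (snd p) s) = (\<Sum>p\<leftarrow>ys. fst p * \<xi> (snd p))"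
        using Cons by auto
      show ?case
        using bcont_add[OF bcont_cmult[OF p, of "fst p"] IH(1)] N_add[OF bcont_cmult[OF p, of "fst p"] IH(1)] N_cmult[OF p, of "fst p"] IH(2)
        by (simp add: \<xi>_def)
    qed
    have le: "ennreal ((\<Sum>p\<leftarrow>ys. fst p + fst p * u (snd p) s) * fr s) \<le> (\<Sum>p\<leftarrow>ys. ennreal (fst p) * f (snd p + s))"
      if "\<forall>p\<in>set ys. 0 \<le> fst p \<and> snd p \<in> H" and s: "s \<in> H" for ys s
      using that(1)
    proof (induction ys)
      case (Cons p ys)
      have p: "0 \<le> fst p" "snd p \<in> H" using Cons.prems by auto
      have "(1 + u (snd p) s) * fr s \<le> exp (u (snd p) s) * fr s" by (intro mult_right_mono exp_ge_add_one_self fr)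
      also have "\<dots> = fr (snd p + s)"
        using fr_pos[OF s] fr_pos[OF H_add[OF p(2) s]] by (simp add: u_def L_def exp_diff)
      finally have "fst p * ((1 + u (snd p) s) * fr s) \<le> fst p * fr (snd p + s)" using p by (intro mult_left_mono)
      then have "ennreal ((fst p + fst p * u (snd p) s) * fr s) \<le> ennreal (fst p) * f (snd p + s)"
        using p fr[of "snd p + s"] by (simp add: ennreal_mult[symmetric] algebra_simps)
      \<comment> \<open>The factors 1 + u may be negative, where \<open>ennreal\<close> truncates to
        0; subadditivity is what remains.\<close>
      moreover have "ennreal ((\<Sum>p\<leftarrow>p # ys. fst p + fst p * u (snd p) s) * fr s) \<le>
          ennreal ((fst p + fst p * u (snd p) s) * fr s) + ennreal ((\<Sum>p\<leftarrow>ys. fst p + fst p * u (snd p) s) * fr s)"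
        using ennreal_add_le by (simp add: distrib_right)
      ultimately show ?case using Cons by (auto intro: order_trans add_mono)
    qed simp
    have "(\<Sum>p\<leftarrow>xs. fst p * u (snd p) s) \<le> C - w" if s: "s \<in> H" for s
    proof -
      have "ennreal ((\<Sum>p\<leftarrow>xs. fst p + fst p * u (snd p) s) * fr s) \<le> ennreal C * f s"
        using le[OF xs(1) s] xs(4)[of s] h[OF s] by (meson order_trans)
      also have "\<dots> = ennreal (C * fr s)" using fr[of s] C by (simp add: ennreal_mult)
      finally have "(\<Sum>p\<leftarrow>xs. fst p + fst p * u (snd p) s) * fr s \<le> C * fr s" using C fr_pos[OF s] by (simp add: ennreal_le_iff)
      then have "(\<Sum>p\<leftarrow>xs. fst p + fst p * u (snd p) s) \<le> C" using fr_pos[OF s] by simp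
      then show ?thesis by (simp add: sum_list_addf xs(2))
    qed
    then have "N (\<lambda>s. \<Sum>p\<leftarrow>xs. fst p * u (snd p) s) \<le> C - w" using mean[OF xs(1)] by (intro N_le) auto
    then show ?thesis using mean[OF xs(1)] xs(3) by simp
  qed
  have \<kappa>H: "emeasure \<kappa> (- H) = 0"
    by (rule emeasure_subset_null[OF fin_radon_sets[OF \<kappa>] \<kappa>_W borel_compact[OF compact_W] WH])
  have \<tau>H: "emeasure \<tau> (- H) = 0"
    by (rule emeasure_subset_null[OF fin_radon_sets[OF \<tau>(1)] \<Omega>(2) borel_compact[OF \<Omega>(1)]]) (use \<Omega>_U0 U0H in blast)
  define p where "p = K' f"
  define q where "q = S p"
  have pm[measurable]: "p \<in> borel_measurable borel" unfolding p_def by (rule kernel_op_measurable[OF kernel_op_K' fm])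
  have qm[measurable]: "q \<in> borel_measurable borel" unfolding q_def by (rule kernel_op_measurable[OF kernel_op_S pm])
  have hp: "harnack p" unfolding p_def K'_def by (rule harnack_nnconv_reflect[OF \<kappa> compact_W \<kappa>_W hf fm])
  have hq: "harnack q" unfolding q_def S_def[abs_def]
    by (intro harnack_cmult harnack_add hp harnack_nnconv[OF \<tau>(1) \<Omega>(1,2) hp pm] harnack_nnconv_reflect[OF \<tau>(1) \<Omega>(1,2) hp pm])
  have Bf_eq: "B f = K q" by (simp add: B_def p_def q_def)
  have key: "(1 - e) ^ 3 \<le> (1 + e) ^ 3 * \<rho>" if e: "0 < e" "e < 1" for e
  proof -
    define l where "l = ennreal (1 + e)"
    have l1: "1 \<le> l" using e ennreal_leI[of 1 "1 + e"] by (simp add: l_def)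
    from nnconv_discretize[OF \<kappa> \<kappa>_1 H \<kappa>H hq hf qm fm e(1), folded K_def K'_def p_def l_def] obtain n and a :: "nat \<Rightarrow> 'a" and ea
      where "(\<forall>i. a i \<in> H) \<and> (\<forall>i. 0 \<le> ea i) \<and> 1 - e \<le> (\<Sum>i<n. ea i) \<and>
        (\<forall>s. (\<Sum>i<n. ennreal (ea i) * q (- a i + s)) \<le> l * K q s) \<and> (\<forall>s. (\<Sum>i<n. ennreal (ea i) * f (a i + s)) \<le> l * p s)"
      by (elim exE) (rule that)
    then have a: "\<And>i. a i \<in> H" and ea: "\<And>i. 0 \<le> ea i" "1 - e \<le> (\<Sum>i<n. ea i)"
      and A1: "\<And>s. (\<Sum>i<n. ennreal (ea i) * q (- a i + s)) \<le> l * K q s"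
      and A2: "\<And>s. (\<Sum>i<n. ennreal (ea i) * f (a i + s)) \<le> l * p s" by simp_all
    from nnconv_discretize[OF \<tau> H \<tau>H hp hp pm pm e(1), folded l_def] obtain k and x :: "nat \<Rightarrow> 'a" and d
      where "(\<forall>i. x i \<in> H) \<and> (\<forall>i. 0 \<le> d i) \<and> 1 - e \<le> (\<Sum>i<k. d i) \<and>
        (\<forall>s. (\<Sum>i<k. ennreal (d i) * p (- x i + s)) \<le> l * nnconv \<tau> p s) \<and>
        (\<forall>s. (\<Sum>i<k. ennreal (d i) * p (x i + s)) \<le> l * nnconv (reflect \<tau>) p s)"
      by (elim exE) (rule that)
    then have x: "\<And>i. x i \<in> H" and d: "\<And>i. 0 \<le> d i" "1 - e \<le> (\<Sum>i<k. d i)"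
      and T1: "\<And>s. (\<Sum>i<k. ennreal (d i) * p (- x i + s)) \<le> l * nnconv \<tau> p s"
      and T2: "\<And>s. (\<Sum>i<k. ennreal (d i) * p (x i + s)) \<le> l * nnconv (reflect \<tau>) p s" by simp_all
    define w X v where "w = (\<Sum>i<n. ea i)" and "X = (\<Sum>i<n. ea i * \<xi> (a i))" and "v = (\<Sum>i<k. d i)"
    have P: "tm (\<lambda>t. l * p t) w X"
    proof -
      have "tm (\<lambda>t. \<Sum>i<n. ennreal (ea i) * f (a i + t)) (\<Sum>i<n. ea i * 1) (\<Sum>i<n. ea i * (0 + 1 * \<xi> (a i)))"
        by (rule tm_sum, rule tm_cmult[OF tm_translate[OF tm_self a] ea(1)])
      then have "tm (\<lambda>t. \<Sum>i<n. ennreal (ea i) * f (a i + t)) w X" by (simp add: w_def X_def)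
      from tm_mono[OF this A2] show ?thesis .
    qed
    \<comment> \<open>The identity contributes w and X. The translates by -x j and x j together
      contribute 2 v w and 2 v X, since the values of \<open>\<xi>\<close> there cancel.\<close>
    define w' X' where "w' = (1 / 3) * (w + (v * w + v * w))" and "X' = (1 / 3) * ((1 + 2 * v) * X)"
    have Q: "tm (\<lambda>t. l * (l * q t)) w' X'"
    proof -
      have 1: "tm (\<lambda>t. \<Sum>j<k. ennreal (d j) * (l * p (- x j + t))) (\<Sum>j<k. d j * w) (\<Sum>j<k. d j * (X + w * \<xi> (- x j)))"
        by (rule tm_sum, rule tm_cmult[OF tm_translate[OF P hminus[OF x]] d(1)])
      have 2: "tm (\<lambda>t. \<Sum>j<k. ennreal (d j) * (l * p (x j + t))) (\<Sum>j<k. d j * w) (\<Sum>j<k. d j * (X + w * \<xi> (x j)))"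
        by (rule tm_sum, rule tm_cmult[OF tm_translate[OF P x] d(1)])
      define g where "g t = l * p t + ((\<Sum>j<k. ennreal (d j) * (l * p (- x j + t))) + (\<Sum>j<k. ennreal (d j) * (l * p (x j + t))))" for t
      have "tm (\<lambda>t. ennreal (1 / 3) * g t) ((1 / 3) * (w + ((\<Sum>j<k. d j * w) + (\<Sum>j<k. d j * w))))
          ((1 / 3) * (X + ((\<Sum>j<k. d j * (X + w * \<xi> (- x j))) + (\<Sum>j<k. d j * (X + w * \<xi> (x j))))))"
        unfolding g_def by (rule tm_cmult[OF tm_add[OF P tm_add[OF 1 2]]]) simp
      moreover have "(1 / 3) * (w + ((\<Sum>j<k. d j * w) + (\<Sum>j<k. d j * w))) = w'" by (simp add: w'_def v_def sum_distrib_right)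
      moreover have "(\<Sum>j<k. d j * (X + w * \<xi> (- x j))) + (\<Sum>j<k. d j * (X + w * \<xi> (x j))) = 2 * v * X"
        using \<xi>_uminus[OF x] by (simp add: v_def sum.distrib[symmetric] sum_distrib_left sum_distrib_right algebra_simps)
      then have "(1 / 3) * (X + ((\<Sum>j<k. d j * (X + w * \<xi> (- x j))) + (\<Sum>j<k. d j * (X + w * \<xi> (x j))))) = X'"
        by (simp only:) (simp add: X'_def algebra_simps)
      ultimately have G: "tm (\<lambda>t. ennreal (1 / 3) * g t) w' X'" by (simp only:)
      have "ennreal (1 / 3) * g t \<le> l * (l * q t)" for t
      proof -
        \<comment> \<open>The identity part of S is not discretized; it is padded with one factor l
          \<ge> 1 to match the other parts.\<close>
        have "l * p t \<le> l * (l * p t)" using mult_right_mono[OF l1, of "l * p t"] by simp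
        moreover have "(\<Sum>j<k. ennreal (d j) * (l * p (- x j + t))) \<le> l * (l * nnconv \<tau> p t)"
          using mult_left_mono[OF T1[of t] zero_le, of l] by (simp only: sum_distrib_left mult.left_commute)
        moreover have "(\<Sum>j<k. ennreal (d j) * (l * p (x j + t))) \<le> l * (l * nnconv (reflect \<tau>) p t)"
          using mult_left_mono[OF T2[of t] zero_le, of l] by (simp only: sum_distrib_left mult.left_commute)
        ultimately have "g t \<le> l * (l * p t) + (l * (l * nnconv \<tau> p t) + l * (l * nnconv (reflect \<tau>) p t))"
          unfolding g_def by (intro add_mono)
        then have "ennreal (1 / 3) * g t \<le> ennreal (1 / 3) * (l * (l * p t) + (l * (l * nnconv \<tau> p t) + l * (l * nnconv (reflect \<tau>) p t)))"
          by (rule mult_left_mono) simp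
        also have "\<dots> = l * (l * q t)" unfolding q_def S_def by (simp only: distrib_left mult.left_commute)
        finally show ?thesis .
      qed
      from tm_mono[OF G this] show ?thesis .
    qed
    have "tm (\<lambda>t. \<Sum>i<n. ennreal (ea i) * (l * (l * q (- a i + t)))) (\<Sum>i<n. ea i * w') (\<Sum>i<n. ea i * (X' + w' * \<xi> (- a i)))"
      by (rule tm_sum, rule tm_cmult[OF tm_translate[OF Q hminus[OF a]] ea(1)])
    moreover have "(\<Sum>i<n. ea i * w') = w * w'" by (simp add: w_def sum_distrib_right)
    moreover have "(\<Sum>i<n. ea i * (X' + w' * \<xi> (- a i))) = w * X' - w' * X"
      using \<xi>_uminus[OF a] by (simp add: w_def X_def sum_subtractf sum_distrib_left sum_distrib_right algebra_simps)
    \<comment> \<open>The outer kernel uses the points -a i with the weights that the inner kernel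
      gives to a i, and the symmetric middle factor scales mass and moment alike. So the total
      moment vanishes.\<close>
    moreover have "w * X' - w' * X = 0" by (simp add: w'_def X'_def algebra_simps)
    ultimately have "tm (\<lambda>t. \<Sum>i<n. ennreal (ea i) * (l * (l * q (- a i + t)))) (w * w') 0" by simp
    then have "w * w' + 0 \<le> (1 + e) ^ 3 * \<rho>"
    proof (rule bound)
      fix s
      have "(\<Sum>i<n. ennreal (ea i) * (l * (l * q (- a i + s)))) = l * (l * (\<Sum>i<n. ennreal (ea i) * q (- a i + s)))"
        by (simp only: sum_distrib_left mult.left_commute)
      also have "\<dots> \<le> l * (l * (l * K q s))" by (intro mult_left_mono A1) auto
      also have "\<dots> \<le> l * (l * (l * (ennreal \<rho> * f s)))" using Bf[of s] by (intro mult_left_mono) (auto simp: Bf_eq)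
      also have "\<dots> = (l * (l * (l * ennreal \<rho>))) * f s" by (simp only: mult.assoc)
      also have "l * (l * (l * ennreal \<rho>)) = ennreal ((1 + e) ^ 3 * \<rho>)"
        using e \<rho> by (simp add: l_def ennreal_mult power3_eq_cube mult.assoc)
      finally show "(\<Sum>i<n. ennreal (ea i) * (l * (l * q (- a i + s)))) \<le> ennreal ((1 + e) ^ 3 * \<rho>) * f s" .
    qed (use e \<rho> in auto)
    moreover have "(1 - e) ^ 3 \<le> w * w'"
    proof -
      have wv: "1 - e \<le> w" "1 - e \<le> v" using ea(2) d(2) by (auto simp: w_def v_def)
      have "(1 - e) * (1 - e) \<le> w * w" using e wv by (intro mult_mono) auto
      moreover have "1 - e \<le> (1 + 2 * v) / 3" using wv e by simp
      ultimately have "((1 - e) * (1 - e)) * (1 - e) \<le> (w * w) * ((1 + 2 * v) / 3)" by (rule mult_mono) (use e in auto)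
      also have "\<dots> = w * w'" by (simp add: w'_def algebra_simps)
      finally show ?thesis by (simp add: power3_eq_cube)
    qed
    ultimately show ?thesis by simp
  qed
  \<comment> \<open>The shift by 2 keeps e = 1 / (n + 2) strictly below 1, as \<open>key\<close>
    requires.\<close>
  have "(\<lambda>n. (1 - 1 / real (n + 2)) ^ 3) \<longlonglongrightarrow> (1 - 0) ^ 3"
    by (intro tendsto_power tendsto_diff tendsto_const LIMSEQ_ignore_initial_segment[OF lim_1_over_n])
  moreover have "(\<lambda>n. (1 + 1 / real (n + 2)) ^ 3 * \<rho>) \<longlonglongrightarrow> (1 + 0) ^ 3 * \<rho>"
    by (intro tendsto_mult tendsto_power tendsto_add tendsto_const LIMSEQ_ignore_initial_segment[OF lim_1_over_n])
  moreover have "(1 - 1 / real (n + 2)) ^ 3 \<le> (1 + 1 / real (n + 2)) ^ 3 * \<rho>" for n by (rule key) auto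
  ultimately have "(1 - 0) ^ 3 \<le> (1 + 0) ^ 3 * \<rho>" by (intro LIMSEQ_le) auto
  then show False using \<rho> by simp
qed

end

section \<open>From extended kernels to complex functions in L^p\<close>

text \<open>Infinite values would be sent to 0; the bridge between the two settings is therefore
  used for functions bounded by 1.\<close>

definition cplx :: "('a \<Rightarrow> ennreal) \<Rightarrow> 'a \<Rightarrow> complex" where
  "cplx h = (\<lambda>s. complex_of_real (enn2real (h s)))"

lemma cplx_measurable: "h \<in> borel_measurable M \<Longrightarrow> cplx h \<in> borel_measurable M"
  unfolding cplx_def by measurable

lemma norm_cplx: "h s \<le> 1 \<Longrightarrow> ennreal (norm (cplx h s)) = h s"
proof -
  assume "h s \<le> 1"
  then have "h s < \<infinity>" by (rule order.strict_trans1) simp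
  then show ?thesis by (simp add: cplx_def)
qed

lemma convolve_cplx:
  fixes \<nu> :: "'a::{topological_group_add, t2_space} measure"
  assumes \<nu>: "fin_radon \<nu>" and h: "h \<in> borel_measurable borel" "\<And>s. h s \<le> 1"
  shows "convolve \<nu> (cplx h) = cplx (nnconv \<nu> h)"
proof
  fix s
  have "h t < \<infinity>" for t using h(2)[of t] by (rule order.strict_trans1) simp
  then have e: "ennreal (enn2real (h t)) = h t" for t by simp
  have [measurable]: "(\<lambda>x. h (- x + s)) \<in> borel_measurable \<nu>" by (rule measurable_slice_fun[OF \<nu> h(1)])
  have "(LINT x|\<nu>. enn2real (h (- x + s))) = enn2real (\<integral>\<^sup>+x. ennreal (enn2real (h (- x + s))) \<partial>\<nu>)"
    by (rule integral_eq_nn_integral) auto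
  then show "convolve \<nu> (cplx h) s = cplx (nnconv \<nu> h) s"
    unfolding convolve_def cplx_def nnconv_def e integral_complex_of_real by simp
qed

lemma nnconv_le_1:
  fixes \<nu> :: "'a::{topological_group_add, t2_space} measure"
  assumes \<nu>: "fin_radon \<nu>" "emeasure \<nu> UNIV = 1" and h: "\<And>s. h s \<le> 1"
  shows "nnconv \<nu> h s \<le> 1"
proof -
  have "nnconv \<nu> h s \<le> (\<integral>\<^sup>+x. 1 \<partial>\<nu>)" unfolding nnconv_def by (intro nn_integral_mono h)
  then show ?thesis using \<nu>(2) fin_radon_space[OF \<nu>(1)] by simp
qed

lemma convolve_cmult: "convolve \<nu> (\<lambda>x. c * f x) = (\<lambda>s. c * convolve \<nu> f s)"
  by (simp add: convolve_def fun_eq_iff)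

lemma convolve_iterate_cmult: "(convolve \<nu> ^^ n) (\<lambda>x. c * f x) = (\<lambda>s. c * (convolve \<nu> ^^ n) f s)"
  by (induction n) (simp_all add: convolve_cmult)

lemma suminf_Suc_le:
  fixes a :: "nat \<Rightarrow> ennreal"
  shows "(\<Sum>n. a (Suc n)) \<le> (\<Sum>n. a n)"
proof (rule suminf_le_const[OF summableI])
  fix N
  have "(\<Sum>n<N. a (Suc n)) \<le> (\<Sum>n<Suc N. a n)" by (simp add: sum.lessThan_Suc_shift del: sum.lessThan_Suc)
  also have "\<dots> \<le> (\<Sum>n. a n)" by (rule sum_le_suminf) auto
  finally show "(\<Sum>n<N. a (Suc n)) \<le> (\<Sum>n. a n)" .
qed

lemma (in lc_group) Lp_norm_convolve_contraction:
  assumes \<nu>: "fin_radon (\<nu> :: 'a measure)" "emeasure \<nu> UNIV \<le> 1" and p: "1 \<le> p" and f: "f \<in> Lp m p"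
  shows "Lp_norm m p (convolve \<nu> f) \<le> Lp_norm m p f"
proof -
  have "measure \<nu> UNIV \<le> 1" using \<nu>(2) by (simp add: fin_radon_emeasure[OF \<nu>(1)])
  then have "measure \<nu> UNIV * Lp_norm m p f \<le> 1 * Lp_norm m p f" by (rule mult_right_mono) simp
  then show ?thesis using Lp_norm_convolve_le[OF \<nu>(1) p f] by simp
qed

context smoothing
begin

lemma reflect_\<kappa>_1: "emeasure (reflect \<kappa>) UNIV = 1" and reflect_\<tau>_1: "emeasure (reflect \<tau>) UNIV = 1"
  using \<kappa>_1 \<tau>(2) by (simp_all add: emeasure_reflect \<kappa> \<tau>(1))

definition Sc :: "('a \<Rightarrow> complex) \<Rightarrow> 'a \<Rightarrow> complex" where
  "Sc f s = (f s + (convolve \<tau> f s + convolve (reflect \<tau>) f s)) / 3"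

lemma S_le_1:
  assumes h: "\<And>s. h s \<le> 1" shows "S h s \<le> 1"
proof -
  have "S h s \<le> ennreal (1 / 3) * (1 + (1 + 1))"
    unfolding S_def by (intro mult_left_mono add_mono h nnconv_le_1[OF \<tau>, of h, OF h] nnconv_le_1[OF reflect_\<tau> reflect_\<tau>_1, of h, OF h]) simp
  also have "\<dots> = 1" using ennreal_mult[of "1/3" 3] by simp
  finally show ?thesis .
qed

lemma cplx_S:
  assumes h: "h \<in> borel_measurable borel" "\<And>s. h s \<le> 1"
  shows "cplx (S h) = Sc (cplx h)"
proof
  fix s
  have "h s < \<infinity>" "nnconv \<tau> h s < \<infinity>" "nnconv (reflect \<tau>) h s < \<infinity>"
    using h(2)[of s] nnconv_le_1[OF \<tau>, of h s, OF h(2)] nnconv_le_1[OF reflect_\<tau> reflect_\<tau>_1, of h s, OF h(2)]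
    by (auto intro: order.strict_trans1)
  then have *: "enn2real (S h s) = (1 / 3) * (enn2real (h s) + (enn2real (nnconv \<tau> h s) + enn2real (nnconv (reflect \<tau>) h s)))"
    by (simp add: S_def enn2real_mult enn2real_plus)
  show "cplx (S h) s = Sc (cplx h) s"
    unfolding Sc_def convolve_cplx[OF \<tau>(1) h] convolve_cplx[OF reflect_\<tau> h] unfolding cplx_def * by simp
qed

lemma
  assumes h: "h \<in> borel_measurable borel" "\<And>s. h s \<le> 1"
  shows cplx_B: "cplx (B h) = convolve \<kappa> (Sc (convolve (reflect \<kappa>) (cplx h)))" and B_le_1: "B h s \<le> 1"
proof -
  have m: "K' h \<in> borel_measurable borel" "S (K' h) \<in> borel_measurable borel"
    by (intro kernel_op_measurable[OF kernel_op_S] kernel_op_measurable[OF kernel_op_K'] h)+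
  have K1: "K' h t \<le> 1" for t unfolding K'_def by (rule nnconv_le_1[OF reflect_\<kappa> reflect_\<kappa>_1, of h, OF h(2)])
  have S1: "S (K' h) t \<le> 1" for t by (rule S_le_1[of "K' h", OF K1])
  show "B h s \<le> 1" unfolding B_def K_def by (rule nnconv_le_1[OF \<kappa> \<kappa>_1, of "S (K' h)", OF S1])
  have "cplx (B h) = convolve \<kappa> (cplx (S (K' h)))"
    using convolve_cplx[OF \<kappa> m(2) S1] by (simp add: B_def[abs_def] K_def)
  also have "cplx (S (K' h)) = Sc (cplx (K' h))" by (rule cplx_S[OF m(1) K1])
  also have "cplx (K' h) = convolve (reflect \<kappa>) (cplx h)" using convolve_cplx[OF reflect_\<kappa> h] by (simp add: K'_def)
  finally show "cplx (B h) = convolve \<kappa> (Sc (convolve (reflect \<kappa>) (cplx h)))" .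
qed

text \<open>Sc f is 2/3 of the midpoint of f and its convolution with \<open>\<tau>\<close>, plus
  1/3 of the reflected convolution. As the latter is contractive, a nearly maximal norm of Sc f
  forces a nearly maximal norm of the midpoint.\<close>

lemma
  assumes p: "1 \<le> p" and f: "f \<in> Lp m p"
  shows Sc_Lp: "Sc f \<in> Lp m p"
    and Lp_norm_Sc: "Lp_norm m p (Sc f) \<le> (2 / 3) * Lp_norm m p (\<lambda>s. (f s + convolve \<tau> f s) / 2) + (1 / 3) * Lp_norm m p f"
    and Lp_norm_Sc_le: "Lp_norm m p (Sc f) \<le> Lp_norm m p f"
proof -
  have p0: "0 < p" using p by simp
  note T = convolve_Lp[OF \<tau>(1) p f] and T' = convolve_Lp[OF reflect_\<tau> p f]
  have Tn: "Lp_norm m p (convolve \<tau> f) \<le> Lp_norm m p f" "Lp_norm m p (convolve (reflect \<tau>) f) \<le> Lp_norm m p f"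
    by (intro Lp_norm_convolve_contraction p f \<tau> reflect_\<tau>; simp add: \<tau> reflect_\<tau>_1)+
  define g where "g s = (1 / 2) * (f s + convolve \<tau> f s)" for s
  have g: "g \<in> Lp m p" unfolding g_def[abs_def] by (intro Lp_cmult Lp_add p f T)
  have S: "Sc f = (\<lambda>s. (2 / 3) * g s + (1 / 3) * convolve (reflect \<tau>) f s)"
    by (simp add: Sc_def g_def fun_eq_iff field_simps)
  show "Sc f \<in> Lp m p" unfolding S by (intro Lp_add Lp_cmult p g T')
  have "Lp_norm m p (Sc f) \<le> Lp_norm m p (\<lambda>s. (2 / 3) * g s) + Lp_norm m p (\<lambda>s. (1 / 3) * convolve (reflect \<tau>) f s)"
    unfolding S by (intro Lp_norm_triangle Lp_cmult p g T')
  also have "\<dots> = (2 / 3) * Lp_norm m p g + (1 / 3) * Lp_norm m p (convolve (reflect \<tau>) f)"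
    using Lp_norm_cmult[OF p0, of m "2 / 3" g] Lp_norm_cmult[OF p0, of m "1 / 3" "convolve (reflect \<tau>) f"] by simp
  also have "\<dots> \<le> (2 / 3) * Lp_norm m p g + (1 / 3) * Lp_norm m p f" using Tn by simp
  finally have le: "Lp_norm m p (Sc f) \<le> (2 / 3) * Lp_norm m p g + (1 / 3) * Lp_norm m p f" .
  then show "Lp_norm m p (Sc f) \<le> (2 / 3) * Lp_norm m p (\<lambda>s. (f s + convolve \<tau> f s) / 2) + (1 / 3) * Lp_norm m p f"
    by (simp add: g_def[abs_def])
  have "Lp_norm m p g = (1 / 2) * Lp_norm m p (\<lambda>s. f s + convolve \<tau> f s)"
    using Lp_norm_cmult[OF p0, of m "1 / 2" "\<lambda>s. f s + convolve \<tau> f s"] by (simp add: g_def[abs_def])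
  also have "Lp_norm m p (\<lambda>s. f s + convolve \<tau> f s) \<le> Lp_norm m p f + Lp_norm m p (convolve \<tau> f)" by (rule Lp_norm_triangle[OF p f T])
  finally have "Lp_norm m p g \<le> Lp_norm m p f" using Tn(1) by simp
  then show "Lp_norm m p (Sc f) \<le> Lp_norm m p f" using le by simp
qed

lemma
  assumes p: "1 \<le> p" and h: "h \<in> borel_measurable borel" "\<And>s. h s \<le> 1" and L: "cplx h \<in> Lp m p"
  shows cplx_B_Lp: "cplx (B h) \<in> Lp m p"
    and Lp_norm_cplx_B: "Lp_norm m p (cplx (B h)) \<le> Lp_norm m p (Sc (convolve (reflect \<kappa>) (cplx h)))"
proof -
  have "Sc (convolve (reflect \<kappa>) (cplx h)) \<in> Lp m p" by (intro Sc_Lp convolve_Lp reflect_\<kappa> p L)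
  then show "cplx (B h) \<in> Lp m p" "Lp_norm m p (cplx (B h)) \<le> Lp_norm m p (Sc (convolve (reflect \<kappa>) (cplx h)))"
    unfolding cplx_B[OF h] by (intro convolve_Lp \<kappa> p Lp_norm_convolve_contraction; simp add: \<kappa>_1)+
qed

text \<open>
  If \<open>B\<close> contracted the \<open>L\<^sup>p\<close> norm of its iterates on an indicator function by a factor below \<open>1\<close>, the series
  \<open>F = \<Sum>r\<^sup>n B\<^sup>n 1\<^sub>W\<close> would be locally integrable for some \<open>r > 1\<close>; local integrability of the terms follows from
  \<open>x \<le> \<delta> + \<delta>\<^bsup>1-p\<^esup> x\<^sup>p\<close> with \<open>\<delta> = t\<^sup>n\<close>.
\<close>

lemma no_spectral_gap:
  assumes am: "amenable m" and p: "1 \<le> p" and t: "0 < t" "t < 1"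
  shows "\<exists>h\<in>borel_measurable borel. (\<forall>s. h s \<le> 1) \<and> cplx h \<in> Lp m p \<and> t * Lp_norm m p (cplx h) < Lp_norm m p (cplx (B h))"
proof (rule ccontr)
  assume "\<not> ?thesis"
  then have gap: "Lp_norm m p (cplx (B h)) \<le> t * Lp_norm m p (cplx h)"
    if "h \<in> borel_measurable borel" "\<And>s. h s \<le> 1" "cplx h \<in> Lp m p" for h
    using that by (meson not_le)
  have p0: "0 < p" using p by simp
  define h where "h n = (B ^^ n) (indicator W)" for n
  have hS: "h (Suc n) = B (h n)" for n by (simp add: h_def)
  have Wb: "W \<in> sets borel" by (rule borel_compact[OF compact_W])
  define C where "C = Lp_norm m p (cplx (h 0))"
  have C: "0 \<le> C" by (simp add: C_def)
  have hn: "h n \<in> borel_measurable borel \<and> (\<forall>s. h n s \<le> 1) \<and> cplx (h n) \<in> Lp m p \<and> Lp_norm m p (cplx (h n)) \<le> t ^ n * C" for n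
  proof (induction n)
    case 0
    have "cplx (h 0) = indicator W" by (auto simp: h_def cplx_def indicator_def)
    moreover have "indicator W \<in> Lp m p"
    proof (rule Lp_indicator(1)[OF p0 Wb])
      show "emeasure m W \<le> ennreal (enn2real (emeasure m W))" using m_compact[OF compact_W] by simp
    qed simp
    moreover have "indicator W s \<le> (1 :: ennreal)" for s by (simp add: indicator_def)
    moreover have "h 0 = indicator W" by (simp add: h_def)
    moreover have "indicator W \<in> borel_measurable (borel :: 'a measure)" using Wb by (rule borel_measurable_indicator)
    ultimately show ?case unfolding C_def power_0 mult_1 by (intro conjI allI) (simp_all only: order_refl)
  next
    case (Suc n)
    then have m: "h n \<in> borel_measurable borel" and le: "\<And>s. h n s \<le> 1" and L: "cplx (h n) \<in> Lp m p"
      and N: "Lp_norm m p (cplx (h n)) \<le> t ^ n * C" by blast+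
    have "Lp_norm m p (cplx (B (h n))) \<le> t * (t ^ n * C)"
      using order_trans[OF gap[OF m le L] mult_left_mono[OF N]] t by simp
    moreover have "B (h n) s \<le> 1" for s by (rule B_le_1[OF m le])
    ultimately show ?case unfolding hS power_Suc mult.assoc using kernel_op_measurable[OF kernel_op_B m] cplx_B_Lp[OF p m le L] by blast
  qed
  then have hm[measurable]: "h n \<in> borel_measurable borel" and h1: "h n s \<le> 1" and hL: "cplx (h n) \<in> Lp m p"
    and hN: "Lp_norm m p (cplx (h n)) \<le> t ^ n * C" for n s by blast+
  \<comment> \<open>Halfway between t and 1: then r = 1 / \<rho> exceeds 1 while r t stays below 1,
    so the weighted series converges and still gains a factor r at each step.\<close>
  define \<rho> where "\<rho> = (1 + t) / 2"
  define r where "r = 1 / \<rho>"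
  have \<rho>: "0 < \<rho>" "\<rho> < 1" "t < \<rho>" using t by (auto simp: \<rho>_def)
  have r: "1 \<le> r" "r * t < 1" "\<rho> * r = 1" using \<rho> by (simp_all add: r_def pos_le_divide_eq pos_divide_less_eq)
  define F where "F s = (\<Sum>n. ennreal (r ^ n) * h n s)" for s
  define f where "f = B F"
  have Fm[measurable]: "F \<in> borel_measurable borel" unfolding F_def[abs_def]
    by (intro borel_measurable_suminf_order borel_measurable_times_ennreal borel_measurable_const hm)
  have f_eq: "f s = (\<Sum>n. ennreal (r ^ n) * h (Suc n) s)" for s
  proof -
    have "f = (\<lambda>s. \<Sum>n. B (\<lambda>s. ennreal (r ^ n) * h n s) s)" unfolding f_def F_def[abs_def]
      by (rule kernel_op_suminf[OF kernel_op_B]) (intro borel_measurable_times_ennreal borel_measurable_const hm)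
    also have "\<dots> = (\<lambda>s. \<Sum>n. ennreal (r ^ n) * h (Suc n) s)" unfolding kernel_op_cmult[OF kernel_op_B hm] hS ..
    finally show ?thesis by (rule fun_cong)
  qed
  have fm[measurable]: "f \<in> borel_measurable borel" unfolding f_def by (rule kernel_op_measurable[OF kernel_op_B Fm])
  \<comment> \<open>Applying B shifts the series by one index, so r f is F without its initial
    term.\<close>
  have rf: "ennreal r * f s \<le> F s" for s
  proof -
    have "ennreal r * f s = (\<Sum>n. ennreal (r ^ Suc n) * h (Suc n) s)"
      unfolding f_eq ennreal_suminf_cmult[symmetric] using r by (simp add: ennreal_mult mult.assoc)
    also have "\<dots> \<le> F s" unfolding F_def by (rule suminf_Suc_le[of "\<lambda>n. ennreal (r ^ n) * h n s"])
    finally show ?thesis .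
  qed
  have super: "B F s \<le> F s" for s
  proof -
    have "1 * f s \<le> ennreal r * f s" using r ennreal_leI[of 1 r] by (intro mult_right_mono) auto
    then show ?thesis using rf[of s] by (simp add: f_def)
  qed
  have FW: "indicator W s \<le> F s" for s
  proof -
    have "(\<Sum>n\<in>{0}. ennreal (r ^ n) * h n s) \<le> F s" unfolding F_def by (rule sum_le_suminf) auto
    then show ?thesis by (simp add: h_def)
  qed
  have Bf: "B f s \<le> ennreal \<rho> * f s" for s
  proof -
    have "B (\<lambda>s. ennreal r * f s) s \<le> B F s" by (intro kernel_op_mono[OF kernel_op_B] rf)
    then have "ennreal r * B f s \<le> f s" unfolding kernel_op_cmult[OF kernel_op_B fm] f_def[symmetric] .
    then have "ennreal \<rho> * (ennreal r * B f s) \<le> ennreal \<rho> * f s" by (rule mult_left_mono) simp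
    then have "(ennreal \<rho> * ennreal r) * B f s \<le> ennreal \<rho> * f s" by (simp only: mult.assoc)
    moreover have "ennreal \<rho> * ennreal r = 1" using ennreal_mult[of \<rho> r] r \<rho> by simp
    ultimately show ?thesis by (simp only: mult_1)
  qed
  have fin: "(\<integral>\<^sup>+s. indicator Q s * f s \<partial>m) < \<infinity>" if Q: "compact Q" for Q
  proof -
    have Qb[measurable]: "Q \<in> sets borel" by (rule borel_compact[OF Q])
    define D where "D = measure m Q + C powr p"
    have D: "0 \<le> D" by (simp add: D_def)
    have mQ: "emeasure m Q = ennreal (measure m Q)" using m_compact[OF Q] by (simp add: emeasure_eq_ennreal_measure less_top)
    have int: "(\<integral>\<^sup>+s. indicator Q s * h n s \<partial>m) \<le> ennreal (t ^ n * D)" for n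
    proof -
      define \<delta> where "\<delta> = t ^ n"
      have \<delta>: "0 < \<delta>" using t by (simp add: \<delta>_def)
      have pw: "x \<le> \<delta> + \<delta> powr (1 - p) * x powr p" if x: "0 \<le> x" for x
      proof (cases "x \<le> \<delta>")
        case True
        then show ?thesis by (simp add: add_increasing2)
      next
        case False
        then have "x = x powr (1 - p) * x powr p" using \<delta> by (simp add: powr_add[symmetric])
        also have "\<dots> \<le> \<delta> powr (1 - p) * x powr p" using False \<delta> p by (intro mult_right_mono powr_mono2') auto
        finally show ?thesis using \<delta> by simp
      qed
      have "indicator Q s * h n s \<le> ennreal \<delta> * indicator Q s + ennreal (\<delta> powr (1 - p)) * ennreal (norm (cplx (h n) s) powr p)" for s
      proof -
        have "ennreal (norm (cplx (h n) s)) \<le> ennreal (\<delta> + \<delta> powr (1 - p) * norm (cplx (h n) s) powr p)"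
          by (intro ennreal_leI pw) simp
        then have "h n s \<le> ennreal \<delta> + ennreal (\<delta> powr (1 - p)) * ennreal (norm (cplx (h n) s) powr p)"
          using \<delta> by (simp add: norm_cplx[of "h n", OF h1] ennreal_mult)
        then show ?thesis by (auto simp: indicator_def)
      qed
      then have "(\<integral>\<^sup>+s. indicator Q s * h n s \<partial>m) \<le>
          (\<integral>\<^sup>+s. ennreal \<delta> * indicator Q s + ennreal (\<delta> powr (1 - p)) * ennreal (norm (cplx (h n) s) powr p) \<partial>m)"
        by (rule nn_integral_mono)
      also have "\<dots> = (\<integral>\<^sup>+s. ennreal \<delta> * indicator Q s \<partial>m) + (\<integral>\<^sup>+s. ennreal (\<delta> powr (1 - p)) * ennreal (norm (cplx (h n) s) powr p) \<partial>m)"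
      proof (rule nn_integral_add)
        have [measurable]: "cplx (h n) \<in> borel_measurable borel" by (rule cplx_measurable[OF hm])
        show "(\<lambda>s. ennreal \<delta> * indicator Q s) \<in> borel_measurable m" by (rule measurable_m) measurable
        show "(\<lambda>s. ennreal (\<delta> powr (1 - p)) * ennreal (norm (cplx (h n) s) powr p)) \<in> borel_measurable m" by (rule measurable_m) measurable
      qed
      also have "(\<integral>\<^sup>+s. ennreal \<delta> * indicator Q s \<partial>m) = ennreal (\<delta> * measure m Q)"
        using \<delta> by (subst nn_integral_cmult_indicator) (auto simp: sets_m mQ ennreal_mult)
      also have "(\<integral>\<^sup>+s. ennreal (\<delta> powr (1 - p)) * ennreal (norm (cplx (h n) s) powr p) \<partial>m) =
          ennreal (\<delta> powr (1 - p)) * (\<integral>\<^sup>+s. ennreal (norm (cplx (h n) s) powr p) \<partial>m)"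
      proof (rule nn_integral_cmult)
        have [measurable]: "cplx (h n) \<in> borel_measurable borel" by (rule cplx_measurable[OF hm])
        show "(\<lambda>s. ennreal (norm (cplx (h n) s) powr p)) \<in> borel_measurable m" by (rule measurable_m) measurable
      qed
      also have "(\<integral>\<^sup>+s. ennreal (norm (cplx (h n) s) powr p) \<partial>m) = ennreal (Lp_norm m p (cplx (h n)) powr p)"
        by (rule nn_integral_Lp[OF p0 hL])
      also have "ennreal (\<delta> powr (1 - p)) * ennreal (Lp_norm m p (cplx (h n)) powr p) \<le> ennreal (\<delta> powr (1 - p)) * ennreal ((\<delta> * C) powr p)"
        unfolding \<delta>_def using p0 hN by (intro mult_left_mono ennreal_leI powr_mono2) auto
      also have "ennreal (\<delta> * measure m Q) + ennreal (\<delta> powr (1 - p)) * ennreal ((\<delta> * C) powr p) = ennreal (\<delta> * D)"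
      proof -
        have "\<delta> powr (1 - p) * (\<delta> * C) powr p = \<delta> powr (1 - p) * \<delta> powr p * C powr p" using \<delta> C by (simp add: powr_mult)
        also have "\<delta> powr (1 - p) * \<delta> powr p = \<delta>" using \<delta> by (simp add: powr_add[symmetric])
        finally have "\<delta> * measure m Q + \<delta> powr (1 - p) * (\<delta> * C) powr p = \<delta> * D" by (simp add: D_def distrib_left)
        moreover have "ennreal (\<delta> * measure m Q + \<delta> powr (1 - p) * (\<delta> * C) powr p) =
            ennreal (\<delta> * measure m Q) + ennreal (\<delta> powr (1 - p)) * ennreal ((\<delta> * C) powr p)"
          using \<delta> by (subst ennreal_plus) (auto simp: ennreal_mult)
        ultimately show ?thesis by simp
      qed
      finally show ?thesis by (simp only: \<delta>_def add_left_mono)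
    qed
    have meas: "(\<lambda>s. indicator Q s * h n s) \<in> borel_measurable m" for n
      by (intro measurable_m borel_measurable_times_ennreal borel_measurable_indicator Qb hm)
    have "(\<integral>\<^sup>+s. indicator Q s * f s \<partial>m) = (\<integral>\<^sup>+s. (\<Sum>n. ennreal (r ^ n) * (indicator Q s * h (Suc n) s)) \<partial>m)"
      unfolding f_eq ennreal_suminf_cmult[symmetric] by (simp only: mult.left_commute)
    also have "\<dots> = (\<Sum>n. \<integral>\<^sup>+s. ennreal (r ^ n) * (indicator Q s * h (Suc n) s) \<partial>m)"
      by (rule nn_integral_suminf) (intro borel_measurable_times_ennreal[OF borel_measurable_const meas])
    also have "\<dots> = (\<Sum>n. ennreal (r ^ n) * (\<integral>\<^sup>+s. indicator Q s * h (Suc n) s \<partial>m))"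
      unfolding nn_integral_cmult[OF meas] ..
    also have "\<dots> \<le> (\<Sum>n. ennreal (r ^ n) * ennreal (t ^ Suc n * D))"
      by (intro suminf_le mult_left_mono int summableI) auto
    also have "\<dots> = (\<Sum>n. ennreal ((r * t) ^ n * (t * D)))"
    proof (intro suminf_cong)
      fix n
      have "(r * t) ^ n * (t * D) = r ^ n * (t ^ Suc n * D)" by (simp add: power_mult_distrib)
      then show "ennreal (r ^ n) * ennreal (t ^ Suc n * D) = ennreal ((r * t) ^ n * (t * D))"
        using r t D by (simp only:) (rule ennreal_mult[symmetric]; simp)
    qed
    also have "\<dots> = ennreal (\<Sum>n. (r * t) ^ n * (t * D))"
      using r t D by (intro suminf_ennreal2 summable_mult2 summable_geometric) auto
    also have "\<dots> < \<infinity>" by simp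
    finally show ?thesis .
  qed
  show False
    by (rule spectral_gap_contradiction[OF am Fm f_def super FW \<rho>(1,2) Bf fin])
qed

end

context smoothing
begin

text \<open>Absence of a gap gives h on which B loses almost no norm. The outer kernel is
  contractive, so the loss of Sc at K' h is also small, and uniform convexity makes this function
  nearly invariant under \<open>\<tau>\<close>.\<close>

lemma approximate_fixed_point:
  assumes am: "amenable m" and p: "1 < p" and e: "0 < e"
  shows "\<exists>k. (\<lambda>s. complex_of_real (k s)) \<in> Lp m p \<and> (\<forall>s. 0 \<le> k s) \<and> Lp_norm m p (\<lambda>s. complex_of_real (k s)) \<le> 1 \<and>
    3 / 4 \<le> Lp_norm m p (\<lambda>s. complex_of_real (k s)) \<and>
    Lp_norm m p (\<lambda>s. complex_of_real (k s) - convolve \<tau> (\<lambda>s. complex_of_real (k s)) s) \<le> e"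
proof -
  have p1: "1 \<le> p" and p0: "0 < p" using p by auto
  have "\<exists>d>0. \<forall>f\<in>Lp m p. \<forall>g\<in>Lp m p. Lp_norm m p f \<le> 1 + d \<longrightarrow> Lp_norm m p g \<le> 1 + d \<longrightarrow>
     1 - d \<le> Lp_norm m p (\<lambda>x. (f x + g x) / 2) \<longrightarrow> Lp_norm m p (\<lambda>x. f x - g x) \<le> e"
    by (rule Lp_uniform_convexity[OF p e]) simp
  then obtain d where d: "0 < d" and uc: "\<forall>f\<in>Lp m p. \<forall>g\<in>Lp m p. Lp_norm m p f \<le> 1 + d \<longrightarrow> Lp_norm m p g \<le> 1 + d \<longrightarrow>
     1 - d \<le> Lp_norm m p (\<lambda>x. (f x + g x) / 2) \<longrightarrow> Lp_norm m p (\<lambda>x. f x - g x) \<le> e" by (elim exE conjE)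
  \<comment> \<open>The value 3/4 is the required lower norm bound. From t \<le> (2/3) mid + 1/3 the
    midpoint norm is at least (3 t - 1) / 2, which the second entry makes at least 1 - d.\<close>
  define t where "t = max (3 / 4) (1 - 2 * d / 3)"
  have t: "0 < t" "t < 1" "3 / 4 \<le> t" "1 - 2 * d / 3 \<le> t" using d by (auto simp: t_def)
  obtain h where h: "h \<in> borel_measurable borel" "\<And>s. h s \<le> 1" "cplx h \<in> Lp m p" "t * Lp_norm m p (cplx h) < Lp_norm m p (cplx (B h))"
    using no_spectral_gap[OF am p1 t(1,2)] by blast
  define N where "N = Lp_norm m p (cplx h)"
  define g where "g = convolve (reflect \<kappa>) (cplx h)"
  have g_eq: "g = cplx (K' h)" unfolding g_def K'_def by (rule convolve_cplx[OF reflect_\<kappa> h(1,2)])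
  have gL: "g \<in> Lp m p" unfolding g_def by (rule convolve_Lp[OF reflect_\<kappa> p1 h(3)])
  have gN: "Lp_norm m p g \<le> N" unfolding g_def N_def by (rule Lp_norm_convolve_contraction[OF reflect_\<kappa> _ p1 h(3)]) (simp add: reflect_\<kappa>_1)
  have tN: "t * N < Lp_norm m p (Sc g)"
    using h(4) Lp_norm_cplx_B[OF p1 h(1-3)] by (simp add: g_def N_def)
  have "N \<noteq> 0" using tN gN Lp_norm_Sc_le[OF p1 gL] by auto
  moreover have "0 \<le> N" unfolding N_def by (rule Lp_norm_nonneg)
  ultimately have N: "0 < N" by linarith
  \<comment> \<open>Division by the norm of h rather than by that of K' h keeps both the upper bound
    1 for the norm and the lower bound t after applying Sc.\<close>
  define k where "k s = enn2real (K' h s) / N" for s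
  define w where "w s = complex_of_real (k s)" for s
  have w: "w = (\<lambda>s. of_real (1 / N) * g s)" by (simp add: w_def k_def g_eq cplx_def fun_eq_iff)
  have wL: "w \<in> Lp m p" unfolding w by (rule Lp_cmult[OF gL])
  have scale: "Lp_norm m p (\<lambda>s. of_real (1 / N) * f s) = Lp_norm m p f / N" for f
    using Lp_norm_cmult[OF p0, of m "of_real (1 / N)" f] N by (simp add: norm_divide)
  have w1: "Lp_norm m p w \<le> 1" unfolding w scale using gN N by simp
  have Sw: "Sc w = (\<lambda>s. of_real (1 / N) * Sc g s)"
    unfolding w Sc_def[abs_def] convolve_cmult by (simp add: fun_eq_iff add_divide_distrib distrib_left)
  have Scw: "t < Lp_norm m p (Sc w)" unfolding Sw scale using tN N by (simp add: pos_less_divide_eq)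
  have "t \<le> Lp_norm m p w" using Scw Lp_norm_Sc_le[OF p1 wL] by linarith
  moreover have "Lp_norm m p (\<lambda>s. w s - convolve \<tau> w s) \<le> e"
  proof (rule uc[rule_format, OF wL convolve_Lp[OF \<tau>(1) p1 wL]])
    show "Lp_norm m p w \<le> 1 + d" using w1 d by simp
    show "Lp_norm m p (convolve \<tau> w) \<le> 1 + d"
      using Lp_norm_convolve_contraction[OF \<tau>(1) _ p1 wL] \<tau>(2) w1 d by simp
    show "1 - d \<le> Lp_norm m p (\<lambda>s. (w s + convolve \<tau> w s) / 2)"
      using Lp_norm_Sc[OF p1 wL] Scw w1 t(4) by linarith
  qed
  ultimately show ?thesis using wL w1 t(3) N unfolding w_def[abs_def] by (intro exI[of _ k]) (auto simp: k_def)
qed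

text \<open>By contractivity each further application of \<open>\<tau>\<close> loses at most e in
  norm, so n steps starting from 3/4 lose at most 1/4 in total.\<close>

lemma approximate_fixed_point_iterate:
  assumes am: "amenable m" and p: "1 < p"
  shows "\<exists>k. (\<lambda>s. complex_of_real (k s)) \<in> Lp m p \<and> (\<forall>s. 0 \<le> k s) \<and> Lp_norm m p (\<lambda>s. complex_of_real (k s)) \<le> 1 \<and>
    1 / 2 \<le> Lp_norm m p ((convolve \<tau> ^^ n) (\<lambda>s. complex_of_real (k s)))"
proof -
  have p1: "1 \<le> p" using p by simp
  define e where "e = 1 / (4 * (real n + 1))"
  have e: "0 < e" "real n * e \<le> 1 / 4" by (auto simp: e_def field_simps)
  obtain k where k: "(\<lambda>s. complex_of_real (k s)) \<in> Lp m p" "\<forall>s. 0 \<le> k s" "Lp_norm m p (\<lambda>s. complex_of_real (k s)) \<le> 1"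
    "3 / 4 \<le> Lp_norm m p (\<lambda>s. complex_of_real (k s))"
    "Lp_norm m p (\<lambda>s. complex_of_real (k s) - convolve \<tau> (\<lambda>s. complex_of_real (k s)) s) \<le> e"
    using approximate_fixed_point[OF am p e(1)] by blast
  define w where "w s = complex_of_real (k s)" for s
  have w: "w \<in> Lp m p" "3 / 4 \<le> Lp_norm m p w" "Lp_norm m p (\<lambda>s. w s - convolve \<tau> w s) \<le> e" using k by (auto simp: w_def[abs_def])
  have bd: "bounded_Lp_operator m p (convolve \<tau>)" by (rule bounded_convolve[OF \<tau>(1) p1])
  have contr: "Lp_contraction m p (convolve \<tau>)"
    unfolding Lp_contraction_def using bd Lp_norm_convolve_contraction[OF \<tau>(1) _ p1] \<tau>(2) by simp
  have "Lp_norm m p w - real j * e \<le> Lp_norm m p ((convolve \<tau> ^^ j) w)" for j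
  proof (induction j)
    case (Suc j)
    note it = bounded_Lp_iterate[OF p1 bd]
    have Tw: "convolve \<tau> w \<in> Lp m p" by (rule convolve_Lp[OF \<tau>(1) p1 w(1)])
    have neg: "(\<lambda>y. - 1 * convolve \<tau> w y) \<in> Lp m p" by (rule Lp_cmult[OF Tw])
    have "AE x in m. (convolve \<tau> ^^ j) (\<lambda>y. w y + - 1 * convolve \<tau> w y) x = (convolve \<tau> ^^ j) w x - (convolve \<tau> ^^ Suc j) w x"
      using it(3)[OF w(1) neg, of j] it(4)[OF Tw, of j "- 1"] by eventually_elim (simp add: funpow_swap1)
    then have "Lp_norm m p (\<lambda>x. (convolve \<tau> ^^ j) w x - (convolve \<tau> ^^ Suc j) w x) = Lp_norm m p ((convolve \<tau> ^^ j) (\<lambda>y. w y + - 1 * convolve \<tau> w y))"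
      by (intro Lp_norm_cong_AE[symmetric] Lp_measurable[of _ m p] it(1) Lp_add Lp_diff p1 w neg)
    also have "\<dots> \<le> Lp_norm m p (\<lambda>y. w y + - 1 * convolve \<tau> w y)"
      by (intro Lp_contraction_iterate[OF p1 contr] Lp_add p1 w neg)
    also have "\<dots> \<le> e" using w(3) by simp
    finally have "Lp_norm m p ((convolve \<tau> ^^ j) w) \<le> Lp_norm m p ((convolve \<tau> ^^ Suc j) w) + e"
      using Lp_norm_diff_ineq[OF p1 it(1)[OF w(1), of j] it(1)[OF w(1), of "Suc j"]] by simp
    then show ?case using Suc by (simp add: algebra_simps)
  qed simp
  from this[of n] have "1 / 2 \<le> Lp_norm m p ((convolve \<tau> ^^ n) w)" using w(2) e(2) by linarith
  then show ?thesis using k unfolding w_def[abs_def] by blast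
qed

end

section \<open>Mass above 1 forces exponential growth\<close>

lemma exponential_not_sublinear:
  assumes q: "1 < q" and b: "0 < b" and a: "\<And>n. b * q ^ n \<le> a n" and lim: "(\<lambda>n. a n / real n) \<longlonglongrightarrow> 0"
  shows False
proof -
  have "b * (q - 1) \<le> a n / real n" if n: "1 \<le> n" for n
  proof -
    have "real n * (q - 1) \<le> q ^ n" using Bernoulli_inequality[of "q - 1" n] q by simp
    then have "b * (real n * (q - 1)) \<le> b * q ^ n" using b by (intro mult_left_mono) auto
    then have "b * (real n * (q - 1)) \<le> a n" using a[of n] by linarith
    then show ?thesis using n by (simp add: pos_le_divide_eq mult.commute mult.left_commute)
  qed
  then have "b * (q - 1) \<le> 0" by (intro LIMSEQ_le_const[OF lim]) auto
  moreover have "0 < b * (q - 1)" using b q by simp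
  ultimately show False by simp
qed

context lc_group
begin

lemma convolve_contraction:
  assumes \<nu>: "fin_radon (\<nu> :: 'a measure)" "emeasure \<nu> UNIV \<le> 1" and p: "1 \<le> p"
  shows "Lp_contraction m p (convolve \<nu>)"
  unfolding Lp_contraction_def using bounded_convolve[OF \<nu>(1) p] Lp_norm_convolve_contraction[OF \<nu> p] by blast

text \<open>The measure c \<tau> is the restriction of \<open>\<nu>\<close> to C, so a majorant of f
  gives a majorant of the convolution. This is what one step of the comparison of orbits
  uses.\<close>

lemma convolve_dominated:
  assumes \<nu>: "fin_radon (\<nu> :: 'a measure)" and C: "C \<in> sets borel" and c: "0 < c"
    and \<tau>: "\<tau> = density \<nu> (\<lambda>y. ennreal (indicator C y / c))" "fin_radon \<tau>"
    and p: "1 \<le> p" and f: "f \<in> Lp m p" and g: "g \<in> Lp m p" and fg: "AE x in m. norm (f x) \<le> Re (g x)"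
  shows "AE s in m. norm (of_real c * convolve \<tau> f s) \<le> Re (convolve \<nu> g s)"
proof -
  have p0: "0 < p" using p by simp
  note fm = Lp_measurable[OF f] and gm = Lp_measurable[OF g]
  \<comment> \<open>Both functions are set to 0 where the majorization fails, which makes it hold
    everywhere without changing the classes; in particular Re g' is nonnegative.\<close>
  define f' where "f' x = (if norm (f x) \<le> Re (g x) then f x else 0)" for x
  define g' where "g' x = (if norm (f x) \<le> Re (g x) then g x else 0)" for x
  have [measurable]: "f \<in> borel_measurable m" "g \<in> borel_measurable m" by (rule fm, rule gm)
  have f'm: "f' \<in> borel_measurable m" and g'm: "g' \<in> borel_measurable m"
    unfolding f'_def[abs_def] g'_def[abs_def] by measurable
  have ff: "AE x in m. f x = f' x" and gg: "AE x in m. g x = g' x"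
    using fg by (eventually_elim, simp add: f'_def g'_def)+
  have f': "f' \<in> Lp m p" by (rule Lp_cong_AE[OF p0 f f'm ff])
  have g': "g' \<in> Lp m p" by (rule Lp_cong_AE[OF p0 g g'm gg])
  have le: "norm (f' x) \<le> Re (g' x)" for x by (simp add: f'_def g'_def)
  have nn: "0 \<le> Re (g' x)" for x by (rule order_trans[OF norm_ge_zero le])
  have "norm (of_real c * convolve \<tau> f' s) \<le> Re (convolve \<nu> g' s)" if int: "integrable \<nu> (\<lambda>x. g' (- x + s))" for s
  proof -
    have [measurable]: "(\<lambda>x. f' (- x + s)) \<in> borel_measurable \<nu>"
      by (rule measurable_slice_fun[OF \<nu> Lp_borel[OF f']])
    have [measurable]: "C \<in> sets \<nu>" using C by (simp add: fin_radon_sets[OF \<nu>])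
    have "convolve \<tau> f' s = (LINT x|\<nu>. (indicator C x / c) *\<^sub>R f' (- x + s))"
      unfolding convolve_def \<tau>(1) using c by (intro integral_density) auto
    then have "norm (of_real c * convolve \<tau> f' s) = c * norm (LINT x|\<nu>. (indicator C x / c) *\<^sub>R f' (- x + s))"
      using c by (simp add: norm_mult)
    also have "\<dots> \<le> c * (LINT x|\<nu>. norm ((indicator C x / c) *\<^sub>R f' (- x + s)))"
      using c by (intro mult_left_mono integral_norm_bound) simp
    also have "\<dots> = (LINT x|\<nu>. c * norm ((indicator C x / c) *\<^sub>R f' (- x + s)))" by simp
    also have "\<dots> \<le> (LINT x|\<nu>. Re (g' (- x + s)))"
    proof (rule integral_mono')
      show "integrable \<nu> (\<lambda>x. Re (g' (- x + s)))" using int by (rule integrable_Re)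
      show "c * norm ((indicator C x / c) *\<^sub>R f' (- x + s)) \<le> Re (g' (- x + s))" for x
        using le[of "- x + s"] nn[of "- x + s"] c by (simp add: indicator_def)
      show "0 \<le> Re (g' (- x + s))" for x by (rule nn)
    qed
    also have "\<dots> = Re (convolve \<nu> g' s)" unfolding convolve_def by (rule integral_Re[OF int])
    finally show ?thesis .
  qed
  then have "AE s in m. norm (of_real c * convolve \<tau> f' s) \<le> Re (convolve \<nu> g' s)"
    using convolve_integrable_AE[OF \<nu> p g'] by (auto elim: eventually_mono)
  moreover have "AE s in m. convolve \<tau> f s = convolve \<tau> f' s"
    by (rule bounded_Lp_cong[OF bounded_convolve[OF \<tau>(2) p] f f' ff])
  moreover have "AE s in m. convolve \<nu> g s = convolve \<nu> g' s"
    by (rule bounded_Lp_cong[OF bounded_convolve[OF \<nu> p] g g' gg])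
  ultimately show ?thesis by eventually_elim simp
qed

text \<open>
  A compact set of mass \<open>c > 1\<close> carries a probability measure \<open>\<tau>\<close> with \<open>c \<tau> \<le> \<nu>\<close>. Almost invariant positive functions
  for \<open>\<tau>\<close> are summed up to a single function on which the powers of \<open>\<nu>\<close> grow exponentially.
\<close>

lemma amenable_mass_le_1:
  assumes am: "amenable m" and \<nu>: "fin_radon (\<nu> :: 'a measure)" and p: "1 < p"
    and growth: "\<And>f. f \<in> Lp m p \<Longrightarrow> (\<lambda>n. Lp_norm m p ((convolve \<nu> ^^ n) f) / real n) \<longlonglongrightarrow> 0"
  shows "emeasure \<nu> UNIV \<le> 1"
proof (rule ccontr)
  assume "\<not> ?thesis"
  then have "1 < emeasure \<nu> UNIV" by simp
  then obtain C where C: "compact C" "1 < emeasure \<nu> C" by (rule fin_radon_inner[OF \<nu> open_UNIV])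
  have p1: "1 \<le> p" and p0: "0 < p" using p by auto
  have Cb[measurable]: "C \<in> sets borel" by (rule borel_compact[OF C(1)])
  have sets_\<nu>[measurable_cong]: "sets \<nu> = sets borel" by (rule fin_radon_sets[OF \<nu>])
  define c where "c = measure \<nu> C"
  have \<nu>C: "emeasure \<nu> C = ennreal c" unfolding c_def by (rule fin_radon_emeasure[OF \<nu>])
  have c: "1 < c" using C(2) \<nu>C by simp
  define \<tau> where "\<tau> = density \<nu> (\<lambda>y. ennreal (indicator C y / c))"
  have \<tau>: "fin_radon \<tau>" unfolding \<tau>_def
    by (rule fin_radon_density[OF \<nu>, where b = "1 / c"]) (use c in \<open>auto intro!: ennreal_leI simp: indicator_def\<close>)
  have \<tau>_emeasure: "emeasure \<tau> A = (\<integral>\<^sup>+x. ennreal (1 / c) * indicator (C \<inter> A) x \<partial>\<nu>)" if "A \<in> sets borel" for A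
  proof -
    have m: "(\<lambda>y. ennreal (indicator C y / c)) \<in> borel_measurable \<nu>"
      by (intro measurable_compose[OF _ measurable_ennreal] borel_measurable_divide borel_measurable_indicator borel_measurable_const)
        (simp add: sets_\<nu> Cb)
    have "emeasure \<tau> A = (\<integral>\<^sup>+x. ennreal (indicator C x / c) * indicator A x \<partial>\<nu>)"
      unfolding \<tau>_def by (rule emeasure_density[OF m]) (simp add: sets_\<nu> that)
    also have "\<dots> = (\<integral>\<^sup>+x. ennreal (1 / c) * indicator (C \<inter> A) x \<partial>\<nu>)"
      by (intro nn_integral_cong) (auto simp: indicator_def)
    finally show ?thesis .
  qed
  have \<tau>1: "emeasure \<tau> UNIV = 1"
    using c by (subst \<tau>_emeasure) (auto simp: nn_integral_cmult_indicator \<nu>C ennreal_mult[symmetric])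
  have \<tau>0: "emeasure \<tau> (- C) = 0" by (subst \<tau>_emeasure) auto
  obtain \<theta> W0 where \<theta>: "continuous_on UNIV \<theta>" "\<And>x. 0 \<le> \<theta> x" "compact W0" "\<And>x. \<theta> x \<noteq> 0 \<Longrightarrow> x \<in> W0"
    "\<And>x. x \<in> C \<Longrightarrow> 0 < \<theta> x" "\<And>x. \<theta> (- x) = \<theta> x" "0 < \<theta> 0" "(\<integral>\<^sup>+x. ennreal (\<theta> x) \<partial>m) = 1"
    by (rule symmetric_kernel[OF C(1)]) (rule that)
  interpret smoothing m \<theta> W0 C \<tau> by unfold_locales (fact \<theta> \<tau> \<tau>1 \<tau>0 C(1))+
  define e where "e k = (\<lambda>s. complex_of_real (k s))" for k :: "'a \<Rightarrow> real"
  define Q where "Q n k \<longleftrightarrow> e k \<in> Lp m p \<and> (\<forall>s. 0 \<le> k s) \<and> Lp_norm m p (e k) \<le> 1 \<and> 1 / 2 \<le> Lp_norm m p ((convolve \<tau> ^^ n) (e k))" for n k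
  have "\<exists>k. Q n k" for n using approximate_fixed_point_iterate[OF am p, of n] unfolding Q_def e_def .
  then obtain k where "\<And>n. Q n (k n)" by metis
  then have kL: "e (k n) \<in> Lp m p" and k0: "0 \<le> k n s" and k1: "Lp_norm m p (e (k n)) \<le> 1"
    and kn: "1 / 2 \<le> Lp_norm m p ((convolve \<tau> ^^ n) (e (k n)))" for n s by (auto simp: Q_def)
  \<comment> \<open>Halfway between 1/c and 1: the weights r^n are summable, while (r c)^n
    grows.\<close>
  define r where "r = (1 + 1 / c) / 2"
  have r: "0 < r" "r < 1" "1 < r * c" using c by (auto simp: r_def field_simps)
  define v where "v n = (\<lambda>s. complex_of_real (r ^ n) * e (k n) s)" for n
  have v: "v n \<in> Lp m p" for n unfolding v_def by (rule Lp_cmult[OF kL])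
  have vN: "Lp_norm m p (v n) \<le> r ^ n" for n
    unfolding v_def Lp_norm_cmult[OF p0] using mult_left_mono[OF k1[of n], of "r ^ n"] r by (simp add: norm_power)
  define V where "V N = (\<lambda>s. \<Sum>n<N. v n s)" for N :: nat
  have V: "V N \<in> Lp m p" for N unfolding V_def by (rule Lp_sum[OF p1 v])
  define \<sigma> where "\<sigma> N = (\<Sum>n<N. r ^ n)" for N :: nat
  have diff: "Lp_norm m p (\<lambda>s. V i s - V j s) \<le> \<bar>\<sigma> i - \<sigma> j\<bar>" for i j
  proof -
    have *: "Lp_norm m p (\<lambda>s. V j s - V i s) \<le> \<bar>\<sigma> j - \<sigma> i\<bar>" if ij: "i \<le> j" for i j
    proof -
      have "V j s - V i s = (\<Sum>n\<in>{i..<j}. v n s)" for s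
        using sum.atLeastLessThan_concat[of 0 i j "\<lambda>n. v n s"] ij by (simp add: V_def lessThan_atLeast0 algebra_simps)
      then have "Lp_norm m p (\<lambda>s. V j s - V i s) \<le> (\<Sum>n\<in>{i..<j}. Lp_norm m p (v n))" using Lp_norm_sum[OF p1 v] by simp
      also have "\<dots> \<le> (\<Sum>n\<in>{i..<j}. r ^ n)" by (intro sum_mono vN)
      also have "\<dots> = \<sigma> j - \<sigma> i"
        using sum.atLeastLessThan_concat[of 0 i j "\<lambda>n. r ^ n"] ij by (simp add: \<sigma>_def lessThan_atLeast0 algebra_simps)
      finally show ?thesis by linarith
    qed
    show ?thesis using *[of i j] *[of j i] Lp_norm_diff_commute[of m p "V i" "V j"] by (cases "i \<le> j") auto
  qed
  have "Cauchy \<sigma>" using summable_geometric[of r] r unfolding \<sigma>_def[abs_def] by (intro LIMSEQ_imp_Cauchy[OF summable_LIMSEQ]) auto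
  have "\<exists>g\<in>Lp m p. (\<lambda>n. Lp_norm m p (\<lambda>x. V n x - g x)) \<longlonglongrightarrow> 0"
  proof (rule Lp_complete[OF p1 V])
    fix \<epsilon> :: real assume "0 < \<epsilon>"
    then obtain N where N: "\<And>i j. N \<le> i \<Longrightarrow> N \<le> j \<Longrightarrow> norm (\<sigma> i - \<sigma> j) < \<epsilon>" using CauchyD[OF \<open>Cauchy \<sigma>\<close>] by blast
    have "Lp_norm m p (\<lambda>x. V i x - V j x) \<le> \<epsilon>" if "N \<le> i" "N \<le> j" for i j using N[OF that] diff[of i j] by simp
    then show "\<exists>N. \<forall>i\<ge>N. \<forall>j\<ge>N. Lp_norm m p (\<lambda>x. V i x - V j x) \<le> \<epsilon>" by blast
  qed
  then obtain g where g: "g \<in> Lp m p" "(\<lambda>n. Lp_norm m p (\<lambda>x. V n x - g x)) \<longlonglongrightarrow> 0" by blast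
  \<comment> \<open>All terms are nonnegative, so V N dominates v n once N > n. The excess of |v n|
    over Re g is then at most |V N - g| pointwise, whose norm tends to 0.\<close>
  have vg: "AE x in m. norm (v n x) \<le> Re (g x)" for n
  proof -
    define d where "d x = complex_of_real (max 0 (norm (v n x) - Re (g x)))" for x
    have [measurable]: "v n \<in> borel_measurable m" "g \<in> borel_measurable m" using Lp_measurable[OF v] Lp_measurable[OF g(1)] by auto
    have dm: "d \<in> borel_measurable m" unfolding d_def[abs_def] by measurable
    have dV: "d \<in> Lp m p" "Lp_norm m p d \<le> Lp_norm m p (\<lambda>x. V N x - g x)" if N: "Suc n \<le> N" for N
    proof -
      have "norm (d x) \<le> norm (V N x - g x)" for x
      proof -
        have vr: "v i x = of_real (r ^ i * k i x)" "0 \<le> r ^ i * k i x" for i using k0 r by (simp_all add: v_def e_def)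
        have "norm (v n x) = r ^ n * k n x" unfolding vr(1)[of n] norm_of_real using vr(2)[of n] by simp
        also have "\<dots> \<le> (\<Sum>i<N. r ^ i * k i x)" using N vr(2) by (intro member_le_sum) auto
        also have "\<dots> = Re (V N x)" by (simp add: V_def vr(1))
        finally have "norm (v n x) - Re (g x) \<le> Re (V N x - g x)" by simp
        also have "\<dots> \<le> norm (V N x - g x)" by (rule complex_Re_le_cmod)
        finally show ?thesis by (simp add: d_def)
      qed
      then show "d \<in> Lp m p" "Lp_norm m p d \<le> Lp_norm m p (\<lambda>x. V N x - g x)"
        using Lp_norm_dominated[OF p0 Lp_diff[OF p1 V[of N] g(1)] dm] by auto
    qed
    have "Lp_norm m p d \<le> 0" using dV(2) by (intro LIMSEQ_le_const[OF g(2)]) blast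
    then have "Lp_norm m p d = 0" using Lp_norm_nonneg[of m p d] by simp
    then have "AE x in m. d x = 0" using Lp_norm_eq_0[OF p0 dV(1)[OF order_refl]] by simp
    then show ?thesis by eventually_elim (auto simp: d_def max_def split: if_splits)
  qed
  note it\<tau> = bounded_Lp_iterate(1)[OF p1 bounded_convolve[OF \<tau>(1) p1]] and it\<nu> = bounded_Lp_iterate(1)[OF p1 bounded_convolve[OF \<nu> p1]]
  \<comment> \<open>The index n of the summand and the number j of steps are kept independent for
    the induction; they are set equal afterwards.\<close>
  have dom: "AE x in m. norm (of_real (c ^ j) * (convolve \<tau> ^^ j) (v n) x) \<le> Re ((convolve \<nu> ^^ j) g x)" for j n
  proof (induction j)
    case 0
    show ?case using vg[of n] by simp
  next
    case (Suc j)
    have "AE s in m. norm (of_real c * convolve \<tau> (\<lambda>x. of_real (c ^ j) * (convolve \<tau> ^^ j) (v n) x) s) \<le> Re (convolve \<nu> ((convolve \<nu> ^^ j) g) s)"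
      using c by (intro convolve_dominated[OF \<nu> Cb _ \<tau>_def \<tau>(1) p1 Lp_cmult[OF it\<tau>[OF v]] it\<nu>[OF g(1)] Suc]) simp
    then show ?case by (simp add: convolve_cmult mult.assoc)
  qed
  have "(1 / 2) * (r * c) ^ n \<le> Lp_norm m p ((convolve \<nu> ^^ n) g)" for n
  proof -
    have "(1 / 2) * (r * c) ^ n \<le> (r * c) ^ n * Lp_norm m p ((convolve \<tau> ^^ n) (e (k n)))"
      using mult_left_mono[OF kn[of n], of "(r * c) ^ n"] r by (simp add: mult.commute)
    also have "\<dots> = Lp_norm m p (\<lambda>x. of_real (c ^ n) * (convolve \<tau> ^^ n) (v n) x)"
    proof -
      have "(\<lambda>x. of_real (c ^ n) * (convolve \<tau> ^^ n) (v n) x) = (\<lambda>x. of_real ((r * c) ^ n) * (convolve \<tau> ^^ n) (e (k n)) x)"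
        unfolding v_def convolve_iterate_cmult by (simp add: power_mult_distrib fun_eq_iff)
      moreover have "norm (complex_of_real ((r * c) ^ n)) = (r * c) ^ n" using r by (simp only: norm_of_real) simp
      ultimately show ?thesis by (simp only: Lp_norm_cmult[OF p0])
    qed
    also have "\<dots> \<le> Lp_norm m p ((convolve \<nu> ^^ n) g)"
    proof (rule Lp_norm_dominated(2)[OF p0 it\<nu>[OF g(1)]])
      show "(\<lambda>x. of_real (c ^ n) * (convolve \<tau> ^^ n) (v n) x) \<in> borel_measurable m"
        by (rule Lp_measurable[OF Lp_cmult[OF it\<tau>[OF v]]])
      show "AE x in m. norm (of_real (c ^ n) * (convolve \<tau> ^^ n) (v n) x) \<le> norm ((convolve \<nu> ^^ n) g x)"
        using dom[of n n] by eventually_elim (rule order_trans[OF _ complex_Re_le_cmod])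
    qed
    finally show ?thesis .
  qed
  from exponential_not_sublinear[OF r(3) _ this growth[OF g(1)]] show False by simp
qed

lemma compact_mass_le_1:
  assumes comp: "compact (UNIV :: 'a set)" and \<nu>: "fin_radon (\<nu> :: 'a measure)"
    and growth: "\<And>f. f \<in> Lp m 1 \<Longrightarrow> (\<lambda>n. Lp_norm m 1 ((convolve \<nu> ^^ n) f) / real n) \<longlonglongrightarrow> 0"
  shows "emeasure \<nu> UNIV \<le> 1"
proof (rule ccontr)
  assume gt: "\<not> ?thesis"
  define c where "c = measure \<nu> UNIV"
  have c: "1 < c" using gt by (simp add: c_def fin_radon_emeasure[OF \<nu>] not_le)
  have fin: "emeasure m UNIV < \<infinity>" by (rule m_compact[OF comp])
  have "finite_measure m" using fin by (intro finite_measureI) simp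
  then have one: "(\<lambda>x. 1) \<in> Lp m 1" by (simp add: Lp_def finite_measure.integrable_const)
  have pos: "0 < measure m UNIV" using fin m_UNIV by (simp add: measure_def enn2real_positive_iff zero_less_iff_neq_zero)
  have T: "(convolve \<nu> ^^ n) (\<lambda>x. 1) = (\<lambda>x. complex_of_real (c ^ n))" for n
  proof (induction n)
    case (Suc n)
    then show ?case by (simp add: convolve_def c_def fin_radon_space[OF \<nu>] fun_eq_iff scaleR_conv_of_real)
  qed simp
  have "measure m UNIV * c ^ n \<le> Lp_norm m 1 ((convolve \<nu> ^^ n) (\<lambda>x. 1))" for n
    unfolding T using c by (simp add: Lp_norm_def norm_power)
  from exponential_not_sublinear[OF c pos this growth[OF one]] show False .
qed

end

theorem theoremA:
  fixes m :: "'a::{topological_group_add, t2_space} measure"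
    and \<mu> :: "'a set \<Rightarrow> complex"
    and p :: real
  assumes "locally_compact_space (euclidean :: 'a topology)"
    and "left_haar_measure m"
    and "regular_complex_measure \<mu>"
    and "1 \<le> p"
  shows
    "((\<forall>x y :: 'a. x + y = y + x) \<and> p = 2 \<longrightarrow>
        (mean_ergodic m p (convolution_operator \<mu>) \<longleftrightarrow> power_bounded m p (convolution_operator \<mu>))) \<and>
     (amenable m \<and> positive_complex_measure \<mu> \<and> 1 < p \<longrightarrow>
        (mean_ergodic m p (convolution_operator \<mu>) \<longleftrightarrow> power_bounded m p (convolution_operator \<mu>)) \<and>
        (power_bounded m p (convolution_operator \<mu>) \<longleftrightarrow> measure_norm \<mu> \<le> 1)) \<and>
     (compact (UNIV :: 'a set) \<and> positive_complex_measure \<mu> \<and> p = 1 \<longrightarrow>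
        (mean_ergodic m p (convolution_operator \<mu>) \<longleftrightarrow> power_bounded m p (convolution_operator \<mu>)) \<and>
        (power_bounded m p (convolution_operator \<mu>) \<longleftrightarrow> measure_norm \<mu> \<le> 1))"
proof -
  interpret lc_group m using assms(1,2) by unfold_locales
  define T where "T = convolution_operator \<mu>"
  note \<mu> = assms(3) and p = assms(4)
  have bd: "bounded_Lp_operator m p T" unfolding T_def by (rule bounded_convolution_operator[OF \<mu> p])
  have growth: "(\<lambda>n. Lp_norm m p ((T ^^ n) f) / real n) \<longlonglongrightarrow> 0" if "mean_ergodic m p T \<or> power_bounded m p T" "f \<in> Lp m p" for f
    using that(1) mean_ergodic_growth[OF p bd _ that(2)] power_bounded_growth[OF p bd _ that(2)] by (elim disjE)
  have "mean_ergodic m p T \<longleftrightarrow> power_bounded m p T" if comm: "\<forall>x y :: 'a. x + y = y + x" and p2: "p = 2"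
  proof -
    have "Lp_contraction m 2 T" if me: "mean_ergodic m p T \<or> power_bounded m p T"
    proof (rule normal_contraction)
      show "bounded_Lp_operator m 2 T" using bd p2 by simp
      have T2: "translation_limit 2 T" unfolding T_def by (rule translation_limit_convolution_operator[OF \<mu>]) simp
      show "Lp_norm m 2 (T f) ^ 2 \<le> Lp_norm m 2 (T (T f)) * Lp_norm m 2 f" if "f \<in> Lp m 2" for f
        using comm bounded_Lp_closed[OF bd] p2 by (intro translation_limit_normal[OF _ T2 _ that]) auto
      show "(\<lambda>n. Lp_norm m 2 ((T ^^ n) f) / real n) \<longlonglongrightarrow> 0" if "f \<in> Lp m 2" for f using growth[OF me, of f] that p2 by simp
    qed
    then show ?thesis using Lp_contraction_mean_ergodic[of 2 m T] Lp_contraction_power_bounded[of 2 m T] unfolding p2 by (metis one_less_numeral_iff semiring_norm(76) one_le_numeral)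
  qed
  \<comment> \<open>The amenable and the compact case run in parallel: they differ only in what
    bounds the mass and in the reason why contractions are mean ergodic.\<close>
  moreover have "(mean_ergodic m p T \<longleftrightarrow> power_bounded m p T) \<and> (power_bounded m p T \<longleftrightarrow> measure_norm \<mu> \<le> 1)"
    if pos: "positive_complex_measure \<mu>" and case_assm: "(amenable m \<and> 1 < p) \<or> (compact (UNIV :: 'a set) \<and> p = 1)"
  proof -
    obtain \<nu> where \<nu>: "fin_radon \<nu>" "convolution_operator \<mu> = convolve \<nu>" "measure_norm \<mu> = emeasure \<nu> UNIV"
      by (rule positive_complex_measure_convolve[OF \<mu> pos])
    have T: "T = convolve \<nu>" using \<nu>(2) by (simp add: T_def)
    have "emeasure \<nu> UNIV \<le> 1" if me: "mean_ergodic m p T \<or> power_bounded m p T"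
      using case_assm
    proof
      assume "amenable m \<and> 1 < p"
      then show ?thesis using amenable_mass_le_1[OF _ \<nu>(1), of p] growth[OF me] T by blast
    next
      assume "compact (UNIV :: 'a set) \<and> p = 1"
      then show ?thesis using compact_mass_le_1[OF _ \<nu>(1)] growth[OF me] T by blast
    qed
    moreover have "mean_ergodic m p T \<and> power_bounded m p T" if le: "emeasure \<nu> UNIV \<le> 1"
    proof
      note contr = convolve_contraction[OF \<nu>(1) le, folded T]
      show "power_bounded m p T" by (rule Lp_contraction_power_bounded[OF p contr[OF p]])
      show "mean_ergodic m p T" using case_assm
      proof
        assume "amenable m \<and> 1 < p"
        then show ?thesis using Lp_contraction_mean_ergodic[OF _ contr[OF p]] by blast
      next
        assume *: "compact (UNIV :: 'a set) \<and> p = 1"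
        have "finite_measure m" using m_compact * by (intro finite_measureI) (auto simp: less_top)
        then show ?thesis using L1_contraction_mean_ergodic[OF _ contr contr] * by simp
      qed
    qed
    ultimately show ?thesis unfolding \<nu>(3) by blast
  qed
  ultimately show ?thesis unfolding T_def by blast
qed

end
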